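(* Let $d\ge1$, $s>1+\frac d2$, and let $(u_0,\gamma_0)$ be an $\mathbb H^s(\mathbb T^d)$-valued $\mathcal F_0$-measurable random variable in $L^2(\Omega;\mathbb H^s(\mathbb T^d))$. Let $\varrho>0$ be the constant described in the context, and assume that the real parameters $\delta$ and $c$ satisfy one of the following two conditions: $$\delta>\tfrac12\ \text{ and }\ c\ne0,\qquad\text{or}\qquad \delta=\tfrac12\ \text{ and }\ |c|>\sqrt{\varrho}.$$ Then the local maximal strong pathwise solution $(u,\gamma,\mathbf t)$ of the system on $t\ge0$, $x\in\mathbb T^d$ $$\begin{cases}\mathrm du+\big(u\cdot\nabla u+\mathscr L_1(u)+\mathscr L_2(\gamma)\big)\mathrm dt=c\,(1+\|(u,\gamma)\|_{\mathbb W^{1,\infty}})^{\delta}\,u\,\mathrm dW,\\ \mathrm d\gamma+\big(u\cdot\nabla\gamma+\mathscr L_3(u,\gamma)\big)\mathrm dt=c\,(1+\|(u,\gamma)\|_{\mathbb W^{1,\infty}})^{\delta}\,\gamma\,\mathrm dW,\\ u(0,x)=u_0(x),\quad\gamma(0,x)=\gamma_0(x)\end{cases}$$ exists globally in time $\mathbb P$-almost surely, that is, $\mathbb P\{\mathbf t=\infty\}=1$.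
   Context: **Function spaces.** $\mathbb T^d=(\mathbb R/2\pi\mathbb Z)^d$. $\Lambda^{r}=(1-\Delta)^{r/2}$ and $(f,g)_{H^r}=(\Lambda^rf,\Lambda^rg)_{L^2}$. $\mathbb H^r(\mathbb T^d)=H^r(\mathbb T^d;\mathbb R^d)\times H^r(\mathbb T^d;\mathbb R)$, $\mathbb L^2=\mathbb H^0$, $\mathbb W^{1,\infty}(\mathbb T^d)=W^{1,\infty}(\mathbb T^d;\mathbb R^d)\times W^{1,\infty}(\mathbb T^d;\mathbb R)$, with product norms $\|(u,\gamma)\|^2=\|u\|^2+\|\gamma\|^2$. $W$ is a standard one-dimensional Brownian motion on a fixed complete filtered probability space $(\Omega,\mathcal F,\mathbb P,(\mathcal F_t)_{t\ge0})$. **Nonlinearities.** $u$ is $\mathbb R^d$-valued, $\gamma$ is scalar. Conventions: $(\nabla u)_{ij}=\partial_ju_i$, $\nabla\gamma$ is a row vector, the divergence of a matrix is row-wise, $(u\cdot(\nabla u)^T)_i=\sum_ju_j\partial_iu_j$, $(\nabla\gamma\nabla u)_k=\sum_j\partial_j\gamma\,\partial_ku_j$, $((\nabla\gamma)\cdot\nabla u)_k=\sum_j\partial_j\gamma\,\partial_ju_k$. $I_d$ is the identity matrix. Set $$\mathscr L_1(u)=\Lambda^{-2}\mathrm{div}\big(\tfrac12|\nabla u|^2I_d+\nabla u\nabla u+\nabla u(\nabla u)^T-(\nabla u)^T\nabla u-(\mathrm{div}\,u)\nabla u\big)+\Lambda^{-2}\big((\mathrm{div}\,u)u+u\cdot(\nabla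 u)^T\big),$$ $$\mathscr L_2(\gamma)=\Lambda^{-2}\mathrm{div}\big(\tfrac12(\gamma^2+|\nabla\gamma|^2)I_d-(\nabla\gamma)^T\nabla\gamma\big),$$ $$\mathscr L_3(u,\gamma)=\Lambda^{-2}\mathrm{div}\big(\nabla\gamma\nabla u+(\nabla\gamma)\cdot\nabla u-(\mathrm{div}\,u)\nabla\gamma\big)+\Lambda^{-2}\big((\mathrm{div}\,u)\gamma\big).$$ For $\mathbf y=(u,\gamma)$: $B(\mathbf y,\mathbf y)=(u\cdot\nabla u,u\cdot\nabla\gamma)$, $F(\mathbf y)=(\mathscr L_1(u)+\mathscr L_2(\gamma),\mathscr L_3(u,\gamma))$. **The constant $\varrho$.** $\varrho>0$ is a constant, independent of $\epsilon$, such that for all $\epsilon\in(0,1)$ and $\mathbf y\in\mathbb H^s(\mathbb T^d)$ $$\big|2\big(\Lambda^sJ_\epsilon\mathbf y,\Lambda^s(J_\epsilon B(\mathbf y,\mathbf y)+J_\epsilon F(\mathbf y))\big)_{\mathbb L^2}\big|\le\varrho\,\|\mathbf y\|_{\mathbb W^{1,\infty}}\|\mathbf y\|_{\mathbb H^s}^2,$$ where $J_\epsilon$ is the standard Friedrichs mollifier on $\mathbb T^d$: the Fourier multiplier with symbol $\hat\jmath(\epsilon k)$, $k\in\mathbb Z^d$, where $\hat\jmath$ is a real even Schwartz function with $0\le\hat\jmath\le1$ and $\hat\jmath(\xi)=1$ for $|\xi|\le1$. **Solutions.** A *local strong pathwise solution* is a pair $(\mathbf y,\mathbf t)$, $\mathbf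 y=(u,\gamma)$, where $\mathbf t$ is a stopping time with $\mathbb P\{\mathbf t>0\}=1$ and $\mathbf y$ is an $\mathbb H^s$-valued $\mathcal F_t$-predictable process with $\mathbf y(\cdot\wedge\mathbf t)\in L^2(\Omega;\mathcal C([0,\infty);\mathbb H^s))$ which satisfies the time-integrated system on $[0,t\wedge\mathbf t]$ for all $t>0$, $\mathbb P$-a.s. The solution $(\mathbf y,\bar{\mathbf t})$ is *maximal* if $\mathbb P\{\bar{\mathbf t}>0\}=1$ and there are stopping times $\mathbf t_n$ increasing to $\bar{\mathbf t}$ such that each $(\mathbf y,\mathbf t_n)$ is a local strong pathwise solution and $\sup_{t\in[0,\mathbf t_n]}\|\mathbf y(t)\|_{\mathbb W^{1,\infty}}>n$ on $\{\bar{\mathbf t}<\infty\}$. *)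

theory Defs
  imports "HOL-Probability.Probability"
begin

section \<open>The Hilbert space of real square-integrable functions on the torus\<close>

text \<open>The torus is represented by a fundamental domain carrying Lebesgue measure; the boundary faces
  that a closed cell counts twice are null sets.  Periodicity enters only through the Fourier
  coefficients below, by which all derivatives are defined.\<close>

definition torus :: "(real ^ 'd::finite) measure" where
  "torus = restrict_space lborel (cbox 0 (\<chi> i. 2 * pi))"

definition sq_integrable :: "(real ^ 'd::finite \<Rightarrow> real) \<Rightarrow> bool" where
  "sq_integrable f \<longleftrightarrow> f \<in> borel_measurable torus \<and> integrable torus (\<lambda>x. (f x)\<^sup>2)"

lemma sq_integrable_prod:
  assumes "sq_integrable f" "sq_integrable g"
  shows "integrable torus (\<lambda>x. f x * g x)"
proof (rule Bochner_Integration.integrable_bound)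
  show "integrable torus (\<lambda>x. (f x)\<^sup>2 + (g x)\<^sup>2)"
    using assms by (simp add: sq_integrable_def)
  show "(\<lambda>x. f x * g x) \<in> borel_measurable torus"
    using assms by (auto simp: sq_integrable_def intro: borel_measurable_times)
  have "\<bar>a * b\<bar> \<le> a\<^sup>2 + b\<^sup>2" for a b :: real
  proof -
    have "2 * \<bar>a * b\<bar> \<le> a\<^sup>2 + b\<^sup>2"
      using sum_squares_bound[of "\<bar>a\<bar>" "\<bar>b\<bar>"] by (simp add: abs_mult)
    then show ?thesis using abs_ge_zero[of "a * b"] by linarith
  qed
  then show "AE x in torus. norm (f x * g x) \<le> norm ((f x)\<^sup>2 + (g x)\<^sup>2)"
    by (intro AE_I2) simp
qed

lemma sq_integrable_add:
  assumes "sq_integrable f" "sq_integrable g"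
  shows "sq_integrable (\<lambda>x. f x + g x)"
  using assms sq_integrable_prod[OF assms]
  by (auto simp: sq_integrable_def power2_sum mult.assoc intro: borel_measurable_add)

lemma sq_integrable_scale:
  assumes "sq_integrable f"
  shows "sq_integrable (\<lambda>x. r * f x)"
  using assms by (auto simp: sq_integrable_def power_mult_distrib intro: borel_measurable_times)

quotient_type 'd L2 = "real ^ 'd::finite \<Rightarrow> real" / partial:
    "\<lambda>f g. sq_integrable f \<and> sq_integrable g \<and> (AE x in torus. f x = g x)"
proof (rule part_equivpI)
  show "\<exists>f :: real ^ 'd \<Rightarrow> real.
      sq_integrable f \<and> sq_integrable f \<and> (AE x in torus. f x = f x)"
    by (rule exI[of _ "\<lambda>_. 0"]) (simp add: sq_integrable_def)
  show "symp (\<lambda>f g :: real ^ 'd \<Rightarrow> real.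
      sq_integrable f \<and> sq_integrable g \<and> (AE x in torus. f x = g x))"
    by (rule sympI) (auto elim: AE_mp)
  show "transp (\<lambda>f g :: real ^ 'd \<Rightarrow> real.
      sq_integrable f \<and> sq_integrable g \<and> (AE x in torus. f x = g x))"
    by (rule transpI) (auto elim: AE_mp)
qed

instantiation L2 :: (finite) real_vector
begin

lift_definition zero_L2 :: "'a L2" is "\<lambda>_. 0"
  by (simp add: sq_integrable_def)

lift_definition plus_L2 :: "'a L2 \<Rightarrow> 'a L2 \<Rightarrow> 'a L2" is "\<lambda>f g x. f x + g x"
  by (auto intro: sq_integrable_add)

lift_definition scaleR_L2 :: "real \<Rightarrow> 'a L2 \<Rightarrow> 'a L2" is "\<lambda>r f x. r * f x"
  by (auto intro: sq_integrable_scale)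

lift_definition uminus_L2 :: "'a L2 \<Rightarrow> 'a L2" is "\<lambda>f x. - f x"
  by (auto simp: sq_integrable_def)

definition minus_L2 :: "'a L2 \<Rightarrow> 'a L2 \<Rightarrow> 'a L2" where
  "minus_L2 f g = f + - g"

instance
proof
  fix f g h :: "'a L2" and a b :: real
  show "f + g + h = f + (g + h)"
    by transfer (simp add: sq_integrable_add add.assoc)
  show "f + g = g + f"
    by transfer (simp add: sq_integrable_add add.commute)
  show "0 + f = f"
    by transfer simp
  show "- f + f = 0"
    by transfer (simp add: sq_integrable_def)
  show "f - g = f + - g"
    by (rule minus_L2_def)
  show "a *\<^sub>R (f + g) = a *\<^sub>R f + a *\<^sub>R g"
    by transfer (simp add: sq_integrable_add sq_integrable_scale distrib_left)
  show "(a + b) *\<^sub>R f = a *\<^sub>R f + b *\<^sub>R f"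
    by transfer (simp add: sq_integrable_add sq_integrable_scale distrib_right[symmetric])
  show "a *\<^sub>R b *\<^sub>R f = (a * b) *\<^sub>R f"
    by transfer (simp add: sq_integrable_scale mult.assoc)
  show "1 *\<^sub>R f = f"
    by transfer simp
qed

end

instantiation L2 :: (finite) real_inner
begin

lift_definition inner_L2 :: "'a L2 \<Rightarrow> 'a L2 \<Rightarrow> real" is "\<lambda>f g. \<integral>x. f x * g x \<partial>torus"
proof (clarify, rule integral_cong_AE)
  fix f f' g g' :: "real ^ 'a \<Rightarrow> real"
  assume "sq_integrable f" "sq_integrable f'" "sq_integrable g" "sq_integrable g'"
  then show "(\<lambda>x. f x * g x) \<in> borel_measurable torus"
      and "(\<lambda>x. f' x * g' x) \<in> borel_measurable torus"
    by (auto simp: sq_integrable_def intro: borel_measurable_times)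
  assume "AE x in torus. f x = f' x" "AE x in torus. g x = g' x"
  then show "AE x in torus. f x * g x = f' x * g' x"
    by eventually_elim simp
qed

definition norm_L2 :: "'a L2 \<Rightarrow> real" where
  "norm_L2 f = sqrt (inner f f)"

definition sgn_L2 :: "'a L2 \<Rightarrow> 'a L2" where
  "sgn_L2 f = f /\<^sub>R norm f"

definition dist_L2 :: "'a L2 \<Rightarrow> 'a L2 \<Rightarrow> real" where
  "dist_L2 f g = norm (f - g)"

definition uniformity_L2 :: "('a L2 \<times> 'a L2) filter" where
  "uniformity_L2 = (INF e\<in>{0 <..}. principal {(f, g). dist f g < e})"

definition open_L2 :: "'a L2 set \<Rightarrow> bool" where
  "open_L2 U = (\<forall>f\<in>U. eventually (\<lambda>(f', g). f' = f \<longrightarrow> g \<in> U) uniformity)"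

instance
proof
  fix f g h :: "'a L2" and r :: real
  show "inner f g = inner g f"
    by transfer (simp add: mult.commute)
  show "inner (f + g) h = inner f h + inner g h"
    by transfer (simp add: distrib_right sq_integrable_prod)
  show "inner (r *\<^sub>R f) g = r * inner f g"
    by transfer (simp add: mult.assoc)
  show "0 \<le> inner f f"
    by transfer simp
  show "inner f f = 0 \<longleftrightarrow> f = 0"
  proof transfer
    fix f :: "real ^ 'a \<Rightarrow> real"
    assume "sq_integrable f \<and> sq_integrable f \<and> (AE x in torus. f x = f x)"
    then have f: "sq_integrable f" by simp
    then have "(\<integral>x. f x * f x \<partial>torus) = 0 \<longleftrightarrow> (AE x in torus. f x * f x = 0)"
      by (intro integral_nonneg_eq_0_iff_AE sq_integrable_prod) simp_all
    then show "(\<integral>x. f x * f x \<partial>torus) = 0 \<longleftrightarrow>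
        sq_integrable f \<and> sq_integrable (\<lambda>_. 0 :: real) \<and> (AE x in torus. f x = 0)"
      using f by (simp add: sq_integrable_def)
  qed
qed (simp_all add: norm_L2_def sgn_L2_def dist_L2_def uniformity_L2_def open_L2_def)

end

text \<open>Pointwise product of two classes.  It is meaningful only if the product of representatives is
  again square-integrable, e.g. if one factor is bounded; this is so wherever it is applied below to
  \<open>Hs s\<close> with \<open>s > 1 + d/2\<close>.\<close>

definition L2_mult :: "'d::finite L2 \<Rightarrow> 'd L2 \<Rightarrow> 'd L2" (infixl \<open>\<odot>\<close> 70) where
  "f \<odot> g = abs_L2 (\<lambda>x. rep_L2 f x * rep_L2 g x)"


section \<open>Fourier multipliers and Sobolev spaces\<close>

definition freq :: "int ^ 'd::finite \<Rightarrow> real ^ 'd" where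
  "freq k = (\<chi> i. real_of_int (k $ i))"

definition fourier_coeff :: "'d::finite L2 \<Rightarrow> int ^ 'd \<Rightarrow> complex" where
  "fourier_coeff f k =
    (\<integral>x. complex_of_real (rep_L2 f x) * cis (- (freq k \<bullet> x)) \<partial>torus) / (2 * pi) ^ CARD('d)"

text \<open>The \<open>THE\<close> is justified by completeness of the trigonometric system and the Riesz-Fischer
  theorem, provided the symbol \<open>m\<close> is Hermitian and \<open>f\<close> lies in the domain of the operator.\<close>

definition fourier_mult :: "(int ^ 'd::finite \<Rightarrow> complex) \<Rightarrow> 'd L2 \<Rightarrow> 'd L2" where
  "fourier_mult m f = (THE g. \<forall>k. fourier_coeff g k = m k * fourier_coeff f k)"

definition bessel_symbol :: "real \<Rightarrow> int ^ 'd::finite \<Rightarrow> complex" where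
  "bessel_symbol r k = complex_of_real ((1 + (norm (freq k))\<^sup>2) powr (r / 2))"

definition deriv_symbol :: "'d::finite \<Rightarrow> int ^ 'd \<Rightarrow> complex" where
  "deriv_symbol j k = \<i> * of_int (k $ j)"

definition \<Lambda>\<^sub>0 :: "real \<Rightarrow> 'd::finite L2 \<Rightarrow> 'd L2" where
  "\<Lambda>\<^sub>0 r = fourier_mult (bessel_symbol r)"

definition dx :: "'d::finite \<Rightarrow> 'd L2 \<Rightarrow> 'd L2" where
  "dx j = fourier_mult (deriv_symbol j)"

text \<open>\<open>\<Lambda>\<^sup>-\<^sup>2 \<partial>\<^sub>j\<close> as one operator of order \<open>-1\<close>: \<open>\<partial>\<^sub>j\<close> alone would lead out of \<open>L\<^sup>2\<close> when
  \<open>s < 2\<close>, which is possible for \<open>d = 1\<close>.\<close>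

definition \<Lambda>m2_dx :: "'d::finite \<Rightarrow> 'd L2 \<Rightarrow> 'd L2" where
  "\<Lambda>m2_dx j = fourier_mult (\<lambda>k. bessel_symbol (- 2) k * deriv_symbol j k)"

text \<open>Pairs \<open>(u, \<gamma>)\<close>.  The inner products that the library puts on \<open>vec\<close> and on products make this
  type the space \<open>L\<^sup>2\<close> with its product norm.\<close>

type_synonym 'd state = "(('d L2) ^ 'd) \<times> 'd L2"

definition state_mult :: "(int ^ 'd::finite \<Rightarrow> complex) \<Rightarrow> 'd state \<Rightarrow> 'd state" where
  "state_mult m y = ((\<chi> i. fourier_mult m (fst y $ i)), fourier_mult m (snd y))"

definition \<Lambda> :: "real \<Rightarrow> 'd::finite state \<Rightarrow> 'd state" where
  "\<Lambda> r = state_mult (bessel_symbol r)"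

definition sobolev_scalar :: "real \<Rightarrow> 'd::finite L2 set" where
  "sobolev_scalar r =
    {f. (\<lambda>k. (1 + (norm (freq k))\<^sup>2) powr r * (norm (fourier_coeff f k))\<^sup>2) summable_on UNIV}"

text \<open>For \<open>r \<ge> 0\<close>, \<open>Hs r\<close> is carried by a subset of \<open>L\<^sup>2\<close>, and \<open>\<Lambda> r\<close> maps it isometrically onto \<open>L\<^sup>2\<close>.
  Hence a function \<open>Y\<close> into \<open>Hs r\<close> is continuous (Borel measurable) for the topology of \<open>Hs r\<close> iff
  \<open>\<Lambda> r \<circ> Y\<close> is continuous (Borel measurable) into \<open>L\<^sup>2\<close>.\<close>

definition Hs :: "real \<Rightarrow> 'd::finite state set" where
  "Hs r = {y. (\<forall>i. fst y $ i \<in> sobolev_scalar r) \<and> snd y \<in> sobolev_scalar r}"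

definition Hs_norm :: "real \<Rightarrow> 'd::finite state \<Rightarrow> real" where
  "Hs_norm r y = norm (\<Lambda> r y)"

definition Hs_continuous_on :: "real \<Rightarrow> real set \<Rightarrow> (real \<Rightarrow> 'd::finite state) \<Rightarrow> bool" where
  "Hs_continuous_on r T Y \<longleftrightarrow> (\<forall>t\<in>T. Y t \<in> Hs r) \<and> continuous_on T (\<lambda>t. \<Lambda> r (Y t))"

definition Hs_measurable :: "real \<Rightarrow> 'a measure \<Rightarrow> ('a \<Rightarrow> 'd::finite state) \<Rightarrow> bool" where
  "Hs_measurable r N Y \<longleftrightarrow>
    (\<forall>a\<in>space N. Y a \<in> Hs r) \<and> (\<lambda>a. \<Lambda> r (Y a)) \<in> borel_measurable N"

definition sup_norm :: "(real ^ 'd::finite \<Rightarrow> 'e::real_normed_vector) \<Rightarrow> real" where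
  "sup_norm f = real_of_ereal (esssup torus (\<lambda>x. ereal (norm (f x))))"

text \<open>Euclidean and Frobenius norms are used for the values of \<open>u\<close> and \<open>\<nabla>u\<close>.\<close>

definition W1inf_vector :: "('d::finite L2) ^ 'd \<Rightarrow> real" where
  "W1inf_vector u = sup_norm (\<lambda>x. (\<chi> i. rep_L2 (u $ i) x) :: real ^ 'd)
    + sup_norm (\<lambda>x. (\<chi> i j. rep_L2 (dx j (u $ i)) x) :: real ^ 'd ^ 'd)"

definition W1inf_scalar :: "'d::finite L2 \<Rightarrow> real" where
  "W1inf_scalar g = sup_norm (rep_L2 g) + sup_norm (\<lambda>x. (\<chi> j. rep_L2 (dx j g) x) :: real ^ 'd)"

definition W1inf_norm :: "'d::finite state \<Rightarrow> real" where
  "W1inf_norm y = sqrt ((W1inf_vector (fst y))\<^sup>2 + (W1inf_scalar (snd y))\<^sup>2)"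


section \<open>The nonlinearities\<close>

text \<open>Matrices are given by their entries, with \<open>(\<nabla>u)\<^sub>i\<^sub>j = \<partial>\<^sub>j u\<^sub>i\<close>; multiples of
  \<open>I\<^sub>d\<close> appear as conditionals on \<open>i = j\<close>, and \<open>|\<nabla>u|\<close> is the Frobenius norm.\<close>

definition grad :: "('d::finite L2) ^ 'd \<Rightarrow> 'd \<Rightarrow> 'd \<Rightarrow> 'd L2" where
  "grad u i j = dx j (u $ i)"

definition divergence :: "('d::finite L2) ^ 'd \<Rightarrow> 'd L2" where
  "divergence u = (\<Sum>j\<in>UNIV. dx j (u $ j))"

definition \<Lambda>m2_div :: "('d::finite \<Rightarrow> 'd L2) \<Rightarrow> 'd L2" where
  "\<Lambda>m2_div v = (\<Sum>j\<in>UNIV. \<Lambda>m2_dx j (v j))"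

definition \<L>\<^sub>1 :: "('d::finite L2) ^ 'd \<Rightarrow> ('d L2) ^ 'd" where
  "\<L>\<^sub>1 u = (\<chi> i.
    \<Lambda>m2_div (\<lambda>j.
      (if i = j then (1 / 2) *\<^sub>R (\<Sum>k\<in>UNIV. \<Sum>l\<in>UNIV. grad u k l \<odot> grad u k l) else 0)
      + (\<Sum>k\<in>UNIV. grad u i k \<odot> grad u k j)
      + (\<Sum>k\<in>UNIV. grad u i k \<odot> grad u j k)
      - (\<Sum>k\<in>UNIV. grad u k i \<odot> grad u k j)
      - divergence u \<odot> grad u i j)
    + \<Lambda>\<^sub>0 (- 2) (divergence u \<odot> u $ i + (\<Sum>j\<in>UNIV. u $ j \<odot> dx i (u $ j))))"

definition \<L>\<^sub>2 :: "'d::finite L2 \<Rightarrow> ('d L2) ^ 'd" where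
  "\<L>\<^sub>2 g = (\<chi> i. \<Lambda>m2_div (\<lambda>j.
      (if i = j then (1 / 2) *\<^sub>R (g \<odot> g + (\<Sum>k\<in>UNIV. dx k g \<odot> dx k g)) else 0)
      - dx i g \<odot> dx j g))"

definition \<L>\<^sub>3 :: "('d::finite L2) ^ 'd \<Rightarrow> 'd L2 \<Rightarrow> 'd L2" where
  "\<L>\<^sub>3 u g =
    \<Lambda>m2_div (\<lambda>k.
      (\<Sum>j\<in>UNIV. dx j g \<odot> dx k (u $ j))
      + (\<Sum>j\<in>UNIV. dx j g \<odot> dx j (u $ k))
      - divergence u \<odot> dx k g)
    + \<Lambda>\<^sub>0 (- 2) (divergence u \<odot> g)"

definition nonlin_B :: "'d::finite state \<Rightarrow> 'd state \<Rightarrow> 'd state" where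
  "nonlin_B y z =
    ((\<chi> i. \<Sum>j\<in>UNIV. fst y $ j \<odot> dx j (fst z $ i)), (\<Sum>j\<in>UNIV. fst y $ j \<odot> dx j (snd z)))"

definition nonlin_F :: "'d::finite state \<Rightarrow> 'd state" where
  "nonlin_F y = (\<L>\<^sub>1 (fst y) + \<L>\<^sub>2 (snd y), \<L>\<^sub>3 (fst y) (snd y))"


section \<open>Friedrichs mollifier and the constant of the mollified energy estimate\<close>

text \<open>\<open>D [i\<^sub>1, \<dots>, i\<^sub>n]\<close> plays the role of \<open>\<partial>\<^sub>i\<^sub>1 \<dots> \<partial>\<^sub>i\<^sub>n f\<close>.\<close>

definition schwartz :: "(real ^ 'd::finite \<Rightarrow> real) \<Rightarrow> bool" where
  "schwartz f \<longleftrightarrow> (\<exists>D :: 'd list \<Rightarrow> real ^ 'd \<Rightarrow> real. D [] = f \<and>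
    (\<forall>l x. (D l has_derivative (\<lambda>h. \<Sum>i\<in>UNIV. h $ i * D (i # l) x)) (at x)) \<and>
    (\<forall>l n. \<exists>C. \<forall>x. (1 + norm x) ^ n * \<bar>D l x\<bar> \<le> C))"

definition friedrichs_symbol :: "(real ^ 'd::finite \<Rightarrow> real) \<Rightarrow> bool" where
  "friedrichs_symbol jhat \<longleftrightarrow> schwartz jhat \<and> (\<forall>\<xi>. jhat (- \<xi>) = jhat \<xi>) \<and>
    (\<forall>\<xi>. 0 \<le> jhat \<xi> \<and> jhat \<xi> \<le> 1) \<and> (\<forall>\<xi>. norm \<xi> \<le> 1 \<longrightarrow> jhat \<xi> = 1)"

definition mollifier :: "(real ^ 'd::finite \<Rightarrow> real) \<Rightarrow> real \<Rightarrow> 'd state \<Rightarrow> 'd state" where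
  "mollifier jhat \<epsilon> = state_mult (\<lambda>k. complex_of_real (jhat (\<epsilon> *\<^sub>R freq k)))"

definition energy_constant :: "real \<Rightarrow> (real ^ 'd::finite \<Rightarrow> real) \<Rightarrow> real \<Rightarrow> bool" where
  "energy_constant s jhat \<rho> \<longleftrightarrow> 0 < \<rho> \<and>
    (\<forall>\<epsilon>\<in>{0<..<1}. \<forall>y\<in>Hs s.
      \<bar>2 * (\<Lambda> s (mollifier jhat \<epsilon> y) \<bullet>
        \<Lambda> s (mollifier jhat \<epsilon> (nonlin_B y y) + mollifier jhat \<epsilon> (nonlin_F y)))\<bar>
      \<le> \<rho> * W1inf_norm y * (Hs_norm s y)\<^sup>2)"


section \<open>Brownian motion and the Ito integral\<close>

text \<open>The filtration is indexed by \<open>ennreal\<close> so that the library's stopping times may take the value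
  \<open>\<infinity>\<close>; \<open>F \<infinity>\<close> is any sub-\<open>\<sigma>\<close>-algebra containing all \<open>F t\<close> and restricts nothing.  Completeness means
  that the underlying measure is complete and \<open>F 0\<close> contains all null sets; right-continuity is not
  assumed.\<close>

locale brownian_basis = prob_space M + complete_measure M + filtration "space M" F
  for M :: "'w measure" and F :: "ennreal \<Rightarrow> 'w measure" +
  fixes W :: "real \<Rightarrow> 'w \<Rightarrow> real"
  assumes filtration_subalgebra: "\<And>t. subalgebra M (F t)"
    and null_sets_F0: "null_sets M \<subseteq> sets (F 0)"
    and W_adapted: "\<And>t. 0 \<le> t \<Longrightarrow> W t \<in> borel_measurable (F (ennreal t))"
    and W_0: "AE \<omega> in M. W 0 \<omega> = 0"
    and W_gaussian: "\<And>r t. 0 \<le> r \<Longrightarrow> r < t \<Longrightarrow>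
      distributed M lborel (\<lambda>\<omega>. W t \<omega> - W r \<omega>) (normal_density 0 (sqrt (t - r)))"
    and W_indep: "\<And>r t. 0 \<le> r \<Longrightarrow> r < t \<Longrightarrow>
      indep_set (sets (F (ennreal r)))
        {(\<lambda>\<omega>. W t \<omega> - W r \<omega>) -` B \<inter> space M | B. B \<in> sets borel}"
    and W_continuous: "AE \<omega> in M. continuous_on {0..} (\<lambda>t. W t \<omega>)"

definition predictable_sigma :: "(ennreal \<Rightarrow> 'w measure) \<Rightarrow> (real \<times> 'w) measure" where
  "predictable_sigma F = sigma ({0..} \<times> space (F 0))
    ({{0} \<times> A | A. A \<in> sets (F 0)} \<union>
     {{a<..b} \<times> A | a b A. 0 \<le> a \<and> a \<le> b \<and> A \<in> sets (F (ennreal a))})"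

text \<open>Elementary processes: \<open>p 0 \<le> \<dots> \<le> p n\<close> is the time grid and \<open>X i\<close> the finitely-valued random
  variable on \<open>]p i, p (i + 1)]\<close>, known at time \<open>p i\<close>.\<close>

definition elementary ::
  "(ennreal \<Rightarrow> 'w measure) \<Rightarrow> nat \<Rightarrow> (nat \<Rightarrow> real) \<Rightarrow> (nat \<Rightarrow> 'w \<Rightarrow> 'h) \<Rightarrow> bool" where
  "elementary F n p X \<longleftrightarrow> 0 \<le> p 0 \<and>
    (\<forall>i<n. p i \<le> p (Suc i) \<and> simple_function (F (ennreal (p i))) (X i))"

definition elementary_process ::
  "nat \<Rightarrow> (nat \<Rightarrow> real) \<Rightarrow> (nat \<Rightarrow> 'w \<Rightarrow> 'h::real_vector) \<Rightarrow> real \<Rightarrow> 'w \<Rightarrow> 'h" where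
  "elementary_process n p X t \<omega> = (\<Sum>i<n. indicator {p i<..p (Suc i)} t *\<^sub>R X i \<omega>)"

definition elementary_integral ::
  "(real \<Rightarrow> 'w \<Rightarrow> real) \<Rightarrow> nat \<Rightarrow> (nat \<Rightarrow> real) \<Rightarrow> (nat \<Rightarrow> 'w \<Rightarrow> 'h::real_vector)
    \<Rightarrow> real \<Rightarrow> 'w \<Rightarrow> 'h" where
  "elementary_integral W n p X t \<omega> =
    (\<Sum>i<n. (W (min t (p (Suc i))) \<omega> - W (min t (p i)) \<omega>) *\<^sub>R X i \<omega>)"

text \<open>\<open>I\<close> is (a version of) \<open>t \<mapsto> \<integral>\<^sub>0\<^sup>t H dW\<close> for a predictable Hilbert-space valued \<open>H\<close> with almost surely
  locally square-integrable paths.  The usual approximation by elementary integrals, locally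
  uniformly in time in probability, is stated with almost sure convergence; this is no
  restriction, as one may pass to a subsequence.\<close>

definition ito_integral ::
  "'w measure \<Rightarrow> (ennreal \<Rightarrow> 'w measure) \<Rightarrow> (real \<Rightarrow> 'w \<Rightarrow> real)
    \<Rightarrow> (real \<Rightarrow> 'w \<Rightarrow> 'h::real_inner) \<Rightarrow> (real \<Rightarrow> 'w \<Rightarrow> 'h) \<Rightarrow> bool" where
  "ito_integral M F W H I \<longleftrightarrow>
    (\<lambda>(t, \<omega>). H t \<omega>) \<in> borel_measurable (predictable_sigma F) \<and>
    (\<exists>n p X. (\<forall>m. elementary F (n m) (p m) (X m)) \<and>
      (AE \<omega> in M. \<forall>T\<ge>0.
        (\<lambda>m. \<integral>\<^sup>+t\<in>{0..T}.
          ennreal ((norm (elementary_process (n m) (p m) (X m) t \<omega> - H t \<omega>))\<^sup>2) \<partial>lborel)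
            \<longlonglongrightarrow> 0 \<and>
        uniform_limit {0..T} (\<lambda>m t. elementary_integral W (n m) (p m) (X m) t \<omega>)
          (\<lambda>t. I t \<omega>) sequentially))"


section \<open>Strong pathwise solutions\<close>

definition stopped :: "('w \<Rightarrow> ennreal) \<Rightarrow> real \<Rightarrow> 'w \<Rightarrow> real" where
  "stopped \<tau> t \<omega> = enn2real (min (ennreal t) (\<tau> \<omega>))"

definition noise_coeff :: "real \<Rightarrow> real \<Rightarrow> 'd::finite state \<Rightarrow> 'd state" where
  "noise_coeff c \<delta> y = (c * (1 + W1inf_norm y) powr \<delta>) *\<^sub>R y"

text \<open>The time-integrated system on \<open>[0, t \<and> \<tau>]\<close>, as an identity in \<open>L\<^sup>2\<close>.  The integral up to
  \<open>t \<and> \<tau>\<close> against \<open>W\<close> is the one of the integrand cut off after \<open>\<tau>\<close>.  The drift is a continuous function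
  of time along the solutions below, so that \<^const>\<open>integral\<close> agrees with the Bochner integral.\<close>

definition satisfies_system ::
  "'w measure \<Rightarrow> (ennreal \<Rightarrow> 'w measure) \<Rightarrow> (real \<Rightarrow> 'w \<Rightarrow> real) \<Rightarrow> real \<Rightarrow> real
    \<Rightarrow> ('w \<Rightarrow> 'd::finite state) \<Rightarrow> (real \<Rightarrow> 'w \<Rightarrow> 'd state) \<Rightarrow> ('w \<Rightarrow> ennreal) \<Rightarrow> bool" where
  "satisfies_system M F W c \<delta> y0 y \<tau> \<longleftrightarrow>
    (\<exists>I. ito_integral M F W
        (\<lambda>t \<omega>. if ennreal t \<le> \<tau> \<omega> then noise_coeff c \<delta> (y t \<omega>) else 0) I \<and>
      (AE \<omega> in M. \<forall>t\<ge>0. let t' = stopped \<tau> t \<omega> in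
        (\<lambda>r. nonlin_B (y r \<omega>) (y r \<omega>) + nonlin_F (y r \<omega>)) integrable_on {0..t'} \<and>
        y t' \<omega> + integral {0..t'} (\<lambda>r. nonlin_B (y r \<omega>) (y r \<omega>) + nonlin_F (y r \<omega>))
          = y0 \<omega> + I t \<omega>))"

text \<open>The values of \<open>y\<close> after \<open>\<tau>\<close> are irrelevant apart from predictability.  Membership in
  \<open>L\<^sup>2(\<Omega>; C([0,\<infinity>); Hs s))\<close> is square integrability of each of the seminorms \<open>sup\<^bsub>[0,T]\<^esub> \<parallel>\<cdot>\<parallel>\<close> defining the
  topology of \<open>C([0,\<infinity>); Hs s)\<close>.\<close>

definition local_strong_solution ::
  "'w measure \<Rightarrow> (ennreal \<Rightarrow> 'w measure) \<Rightarrow> (real \<Rightarrow> 'w \<Rightarrow> real) \<Rightarrow> real \<Rightarrow> real \<Rightarrow> real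
    \<Rightarrow> ('w \<Rightarrow> 'd::finite state) \<Rightarrow> (real \<Rightarrow> 'w \<Rightarrow> 'd state) \<Rightarrow> ('w \<Rightarrow> ennreal) \<Rightarrow> bool" where
  "local_strong_solution M F W s c \<delta> y0 y \<tau> \<longleftrightarrow>
    stopping_time F \<tau> \<and> \<P>(\<omega> in M. 0 < \<tau> \<omega>) = 1 \<and>
    Hs_measurable s (predictable_sigma F) (\<lambda>(t, \<omega>). y t \<omega>) \<and>
    (AE \<omega> in M. Hs_continuous_on s {0..} (\<lambda>t. y (stopped \<tau> t \<omega>) \<omega>)) \<and>
    (\<forall>T\<ge>0. (\<integral>\<^sup>+\<omega>. (\<Squnion>t\<in>{0..T}. ennreal ((Hs_norm s (y (stopped \<tau> t \<omega>) \<omega>))\<^sup>2)) \<partial>M) < \<infinity>) \<and>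
    satisfies_system M F W c \<delta> y0 y \<tau>"

definition maximal_strong_solution ::
  "'w measure \<Rightarrow> (ennreal \<Rightarrow> 'w measure) \<Rightarrow> (real \<Rightarrow> 'w \<Rightarrow> real) \<Rightarrow> real \<Rightarrow> real \<Rightarrow> real
    \<Rightarrow> ('w \<Rightarrow> 'd::finite state) \<Rightarrow> (real \<Rightarrow> 'w \<Rightarrow> 'd state) \<Rightarrow> ('w \<Rightarrow> ennreal) \<Rightarrow> bool" where
  "maximal_strong_solution M F W s c \<delta> y0 y \<tau> \<longleftrightarrow>
    stopping_time F \<tau> \<and> \<P>(\<omega> in M. 0 < \<tau> \<omega>) = 1 \<and>
    (\<exists>\<tau>n. (\<forall>n. local_strong_solution M F W s c \<delta> y0 y (\<tau>n n)) \<and>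
      (AE \<omega> in M. incseq (\<lambda>n. \<tau>n n \<omega>) \<and> (\<lambda>n. \<tau>n n \<omega>) \<longlonglongrightarrow> \<tau> \<omega>) \<and>
      (\<forall>n. AE \<omega> in M. \<tau> \<omega> < \<infinity> \<longrightarrow>
        (\<Squnion>t\<in>{t. 0 \<le> t \<and> ennreal t \<le> \<tau>n n \<omega>}. ennreal (W1inf_norm (y t \<omega>))) > of_nat n))"

end

theory Submission
  imports Defs
begin

text \<open>Put \<open>v = \<Lambda>\<^sup>s y\<close> and let \<open>w\<close> be the \<open>W\<^sup>1\<^sup>,\<^sup>\<infinity>\<close> norm of \<open>y\<close>, so that \<open>w \<le> K |v|\<close> by Sobolev
  embedding.  For the mollified quantity \<open>X = |J v|\<^sup>2\<close> and \<open>g = c (1 + w)\<^sup>\<delta>\<close>, Ito's formula gives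
  \<open>ln (1 + X)\<close> a drift of at most \<open>\<rho> |v|\<^sup>2 w / (1 + X) + g\<^sup>2 x - 2 g\<^sup>2 x\<^sup>2\<close> with \<open>x = X / (1 + X)\<close>, and a martingale
  part with bracket \<open>4 g\<^sup>2 x\<^sup>2 dt\<close>.  The hypothesis on \<open>\<delta>\<close> and \<open>c\<close> says that the noise beats the transport term
  for large \<open>w\<close> even after a small fraction \<open>\<eta>\<close> of the bracket is set aside.  That fraction compensates
  \<open>\<eta>\<close> times the martingale, so the exponential supermartingale bounds the probability that \<open>|v|\<close> exceeds \<open>R\<close>
  before time \<open>T\<close> by a constant times \<open>R\<close> to the power \<open>- 2 \<eta>\<close>.  As \<open>w\<close> exceeds \<open>n\<close> before \<open>\<tau>\<^sub>n\<close> whenever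
  \<open>\<tau>\<close> is finite, \<open>n \<rightarrow> \<infinity>\<close> excludes \<open>\<tau> < T\<close>.  Ito's formula itself is replaced by a second order expansion of
  \<open>ln (1 + X)\<close> along time grids whose error terms vanish in probability.\<close>

section \<open>Increments of Brownian motion\<close>

text \<open>The drift contains first derivatives of the solution, one too many for
  \<open>\<Lambda>\<^sup>s\<close>, so the equation for v holds only after mollification, while the
  energy estimate for |J v|^2 has |v|^2 on its right-hand side. The gap closes along a single path:
  its range up to a finite time is compact, the mollifiers converge uniformly there, and |v|^2 \<le>
  |J v|^2 + 1 once the mollifier is fine enough, how fine depending on the path. Probability
  therefore enters only through bad sets, one for each mollifier and grid: a path that exceeds R
  lies in them for all fine mollifiers and grids, and Fatou's lemma for sets bounds the probability
  of such paths without any uniformity. The stochastic integral is given only as an almost sure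
  limit of elementary integrals; its increments are compared with g J v dW by the isometry for
  adapted sums, after a truncation that supplies the missing moments. Independence of an increment
  from the past is used directly in place of conditional expectations, and an adapted 0-1 factor
  that turns off all steps after |v| has been seen above R takes the place of an exit time.\<close>

context brownian_basis
begin

lemma space_F_eq [simp]: "space (F t) = space M"
  by (rule space_F)

lemma sets_F_subset: "sets (F t) \<subseteq> sets M"
  using filtration_subalgebra[of t] by (simp add: subalgebra_def)

lemma measurable_F_mono:
  assumes "f \<in> measurable (F a) N" "a \<le> b"
  shows "f \<in> measurable (F b) N"
  using assms sets_F_mono[of a b] measurable_mono[of N N "F a" "F b"]
  by (simp add: subset_eq)

lemma measurable_F_real_mono:
  "f \<in> measurable (F (ennreal a)) N \<Longrightarrow> a \<le> b \<Longrightarrow> f \<in> measurable (F (ennreal b)) N"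
  by (erule measurable_F_mono) (rule ennreal_leI)

lemma measurable_F_M: "f \<in> measurable (F a) N \<Longrightarrow> f \<in> measurable M N"
  using sets_F_subset measurable_mono[of N N "F a" M] by auto

definition dW :: "real \<Rightarrow> real \<Rightarrow> 'w \<Rightarrow> real" where
  "dW a b \<omega> = W b \<omega> - W a \<omega>"

lemma dW_measurable_F: "0 \<le> a \<Longrightarrow> a \<le> b \<Longrightarrow> dW a b \<in> borel_measurable (F (ennreal b))"
  unfolding dW_def[abs_def]
  by (intro borel_measurable_diff W_adapted measurable_F_real_mono[of "W a" a]) auto

lemma dW_measurable: "0 \<le> a \<Longrightarrow> a \<le> b \<Longrightarrow> dW a b \<in> borel_measurable M"
  by (blast intro: dW_measurable_F measurable_F_M)

lemma dW_distributed:
  "0 \<le> a \<Longrightarrow> a < b \<Longrightarrow> distributed M lborel (dW a b) (normal_density 0 (sqrt (b - a)))"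
  unfolding dW_def[abs_def] by (rule W_gaussian)

lemma dW_indep:
  assumes "0 \<le> a" "a < b" and K: "K \<in> measurable (F (ennreal a)) N"
  shows "indep_var N K borel (dW a b)"
  unfolding indep_var_eq
proof (intro conjI)
  show "K \<in> measurable M N" using K by (rule measurable_F_M)
  show "dW a b \<in> borel_measurable M" using assms by (intro dW_measurable) auto
  let ?S = "{dW a b -` B \<inter> space M | B. B \<in> sets borel}"
  have "indep_set (sets (F (ennreal a))) ?S"
    using W_indep[OF assms(1,2)] by (simp add: dW_def[abs_def])
  moreover have "sigma_sets (space M) {K -` A \<inter> space M | A. A \<in> sets N} \<subseteq> sets (F (ennreal a))"
    using measurable_sets[OF K] sets.sigma_sets_subset[of "{K -` A \<inter> space M | A. A \<in> sets N}" "F (ennreal a)"]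
    by auto
  \<comment> \<open>Preimages of the Borel sets already form a \<sigma>-algebra, so generating one
    from them adds no set.\<close>
  moreover have "sigma_sets (space M) ?S \<subseteq> ?S"
  proof -
    have "?S = sets (vimage_algebra (space M) (dW a b) borel)"
      by (subst sets_vimage_algebra2) auto
    then show ?thesis
      using sets.sigma_sets_eq[of "vimage_algebra (space M) (dW a b) borel"] by simp
  qed
  ultimately show "indep_set (sigma_sets (space M) {K -` A \<inter> space M | A. A \<in> sets N}) (sigma_sets (space M) ?S)"
    unfolding indep_set_def by (elim indep_sets_mono_sets) (auto split: bool.split)
qed

lemma dW_integrable_power: "0 \<le> a \<Longrightarrow> a < b \<Longrightarrow> integrable M (\<lambda>\<omega>. dW a b \<omega> ^ n)"
  using integrable_normal_moment[of "sqrt (b - a)" 0 n] dW_distributed[of a b]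
  by (subst distributed_integrable[OF dW_distributed, symmetric]) auto

lemma dW_moments:
  assumes "0 \<le> a" "a < b"
  shows "(\<integral>\<omega>. dW a b \<omega> \<partial>M) = 0"
    and "(\<integral>\<omega>. (dW a b \<omega>)\<^sup>2 \<partial>M) = b - a"
    and "(\<integral>\<omega>. (dW a b \<omega>) ^ 4 \<partial>M) = 3 * (b - a)\<^sup>2"
proof -
  have p: "0 < sqrt (b - a)" using assms by simp
  have I: "(\<integral>\<omega>. g (dW a b \<omega>) \<partial>M) = (\<integral>x. normal_density 0 (sqrt (b - a)) x * g x \<partial>lborel)"
    if "g \<in> borel_measurable borel" for g :: "real \<Rightarrow> real"
    using distributed_integral[OF dW_distributed[OF assms], of g] that by simp
  show "(\<integral>\<omega>. dW a b \<omega> \<partial>M) = 0"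
    using I[of "\<lambda>x. x"] integral_normal_moment_odd[OF p, of 0 0] by simp
  show "(\<integral>\<omega>. (dW a b \<omega>)\<^sup>2 \<partial>M) = b - a"
    using I[of "\<lambda>x. x\<^sup>2"] integral_normal_moment_even[OF p, of 0 1] assms by simp
  show "(\<integral>\<omega>. (dW a b \<omega>) ^ 4 \<partial>M) = 3 * (b - a)\<^sup>2"
    using I[of "\<lambda>x. x ^ 4"] integral_normal_moment_even[OF p, of 0 2] assms
    by (simp add: fact_numeral power2_eq_square)
qed

text \<open>Isometry for sums over disjoint time intervals. In a mixed term the increment over the
  later interval is independent of all other factors and has mean 0, so only the diagonal survives.
  The function \<open>f x\<close> lets one computation serve both the increments and their centred
  squares.\<close>

lemma integrable_norm_sum_increments:
  fixes K :: "'i \<Rightarrow> 'w \<Rightarrow> 'h::{real_inner, second_countable_topology}"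
    and f :: "'i \<Rightarrow> real \<Rightarrow> real"
  assumes fin: "finite A"
    and sr: "\<And>x. x \<in> A \<Longrightarrow> 0 \<le> s x \<and> s x < r x"
    and disj: "\<And>x y. x \<in> A \<Longrightarrow> y \<in> A \<Longrightarrow> x \<noteq> y \<Longrightarrow> r x \<le> s y \<or> r y \<le> s x"
    and K: "\<And>x. x \<in> A \<Longrightarrow> K x \<in> borel_measurable (F (ennreal (s x)))"
    and bd: "\<And>x \<omega>. x \<in> A \<Longrightarrow> \<omega> \<in> space M \<Longrightarrow> norm (K x \<omega>) \<le> C x"
    and f: "\<And>x. x \<in> A \<Longrightarrow> f x \<in> borel_measurable borel"
    and int: "\<And>x. x \<in> A \<Longrightarrow> integrable M (\<lambda>\<omega>. (f x (dW (s x) (r x) \<omega>))\<^sup>2)"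
    and mean: "\<And>x. x \<in> A \<Longrightarrow> (\<integral>\<omega>. f x (dW (s x) (r x) \<omega>) \<partial>M) = 0"
  shows "integrable M (\<lambda>\<omega>. (norm (\<Sum>x\<in>A. f x (dW (s x) (r x) \<omega>) *\<^sub>R K x \<omega>))\<^sup>2)" (is ?thesis1)
    and "(\<integral>\<omega>. (norm (\<Sum>x\<in>A. f x (dW (s x) (r x) \<omega>) *\<^sub>R K x \<omega>))\<^sup>2 \<partial>M)
      = (\<Sum>x\<in>A. (\<integral>\<omega>. (norm (K x \<omega>))\<^sup>2 \<partial>M) * (\<integral>\<omega>. (f x (dW (s x) (r x) \<omega>))\<^sup>2 \<partial>M))" (is ?thesis2)
proof -
  define Y where "Y x \<omega> = f x (dW (s x) (r x) \<omega>)" for x \<omega>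
  have YF: "Y x \<in> borel_measurable (F (ennreal (r x)))" if "x \<in> A" for x
    unfolding Y_def[abs_def] using f[OF that] dW_measurable_F[of "s x" "r x"] sr[OF that]
    by (intro measurable_compose[OF _ f[OF that]]) auto
  have YM: "Y x \<in> borel_measurable M" if "x \<in> A" for x
    using YF[OF that] by (rule measurable_F_M)
  have KM: "K x \<in> borel_measurable M" if "x \<in> A" for x
    using K[OF that] by (rule measurable_F_M)
  have Y2: "integrable M (\<lambda>\<omega>. (Y x \<omega>)\<^sup>2)" if "x \<in> A" for x using int[OF that] by (simp add: Y_def)
  have Yi: "integrable M (Y x)" if "x \<in> A" for x
    using square_integrable_imp_integrable[OF YM[OF that] Y2[OF that]] .
  have indep: "indep_var borel Z borel (Y x)"
    if "x \<in> A" "Z \<in> borel_measurable (F (ennreal (s x)))" for x and Z :: "'w \<Rightarrow> real"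
  proof -
    have "indep_var borel Z borel (dW (s x) (r x))" using dW_indep sr that by auto
    from indep_var_compose[OF this, of "\<lambda>z. z" borel "f x" borel] f[OF that(1)]
    show ?thesis by (simp add: Y_def[abs_def] comp_def)
  qed
  have Kint: "integrable M (\<lambda>\<omega>. K x \<omega> \<bullet> K y \<omega>)" if "x \<in> A" "y \<in> A" for x y
  proof (rule integrable_const_bound[where B="C x * C y"])
    show "AE \<omega> in M. norm (K x \<omega> \<bullet> K y \<omega>) \<le> C x * C y"
    proof (rule AE_I2)
      fix \<omega> assume w: "\<omega> \<in> space M"
      have "norm (K x \<omega> \<bullet> K y \<omega>) \<le> norm (K x \<omega>) * norm (K y \<omega>)" using Cauchy_Schwarz_ineq2 by auto
      also have "\<dots> \<le> C x * C y"
        using bd[OF that(1) w] bd[OF that(2) w] by (intro mult_mono) (auto intro: order_trans[OF norm_ge_zero])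
      finally show "norm (K x \<omega> \<bullet> K y \<omega>) \<le> C x * C y" .
    qed
    show "(\<lambda>\<omega>. K x \<omega> \<bullet> K y \<omega>) \<in> borel_measurable M" using KM that by auto
  qed
  have diag: "integrable M (\<lambda>\<omega>. (K x \<omega> \<bullet> K x \<omega>) * (Y x \<omega> * Y x \<omega>))"
     "(\<integral>\<omega>. (K x \<omega> \<bullet> K x \<omega>) * (Y x \<omega> * Y x \<omega>) \<partial>M) = (\<integral>\<omega>. K x \<omega> \<bullet> K x \<omega> \<partial>M) * (\<integral>\<omega>. Y x \<omega> * Y x \<omega> \<partial>M)"
    if x: "x \<in> A" for x
  proof -
    have Km: "(\<lambda>\<omega>. K x \<omega> \<bullet> K x \<omega>) \<in> borel_measurable (F (ennreal (s x)))" using K[OF x] by auto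
    have "indep_var borel (\<lambda>\<omega>. K x \<omega> \<bullet> K x \<omega>) borel (Y x)"
      by (rule indep[OF x Km])
    from indep_var_compose[OF this, of "\<lambda>z. z" borel "\<lambda>z. z * z" borel]
    have *: "indep_var borel (\<lambda>\<omega>. K x \<omega> \<bullet> K x \<omega>) borel (\<lambda>\<omega>. Y x \<omega> * Y x \<omega>)" by (simp add: comp_def)
    show "integrable M (\<lambda>\<omega>. (K x \<omega> \<bullet> K x \<omega>) * (Y x \<omega> * Y x \<omega>))"
      using * Kint[OF x x] Y2[OF x] unfolding power2_eq_square by (rule indep_var_integrable)
    show "(\<integral>\<omega>. (K x \<omega> \<bullet> K x \<omega>) * (Y x \<omega> * Y x \<omega>) \<partial>M) = (\<integral>\<omega>. K x \<omega> \<bullet> K x \<omega> \<partial>M) * (\<integral>\<omega>. Y x \<omega> * Y x \<omega> \<partial>M)"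
      using * Kint[OF x x] Y2[OF x] unfolding power2_eq_square by (rule indep_var_lebesgue_integral)
  qed
  have off: "integrable M (\<lambda>\<omega>. (K x \<omega> \<bullet> K y \<omega>) * (Y x \<omega> * Y y \<omega>)) \<and>
     (\<integral>\<omega>. (K x \<omega> \<bullet> K y \<omega>) * (Y x \<omega> * Y y \<omega>) \<partial>M) = 0"
    if x: "x \<in> A" and y: "y \<in> A" and le: "r x \<le> s y" for x y
  proof -
    \<comment> \<open>Everything except the later increment, gathered into one variable known at
      time \<open>s y\<close>.\<close>
    let ?Z = "\<lambda>\<omega>. (K x \<omega> \<bullet> K y \<omega>) * Y x \<omega>"
    have Kx: "K x \<in> borel_measurable (F (ennreal (s y)))"
      using K[OF x] by (rule measurable_F_real_mono) (use sr[OF x] le in auto)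
    have Yx: "Y x \<in> borel_measurable (F (ennreal (s y)))"
      using YF[OF x] by (rule measurable_F_real_mono) (use le in auto)
    have Zm: "?Z \<in> borel_measurable (F (ennreal (s y)))"
      using Kx K[OF y] Yx by auto
    have Zi: "integrable M ?Z"
    proof (rule Bochner_Integration.integrable_bound[where f="\<lambda>\<omega>. C x * C y * Y x \<omega>"])
      show "integrable M (\<lambda>\<omega>. C x * C y * Y x \<omega>)" using Yi[OF x] by simp
      show "?Z \<in> borel_measurable M" using Zm by (rule measurable_F_M)
      show "AE \<omega> in M. norm (?Z \<omega>) \<le> norm (C x * C y * Y x \<omega>)"
      proof (rule AE_I2)
        fix \<omega> assume w: "\<omega> \<in> space M"
        have "\<bar>K x \<omega> \<bullet> K y \<omega>\<bar> \<le> norm (K x \<omega>) * norm (K y \<omega>)" by (rule Cauchy_Schwarz_ineq2)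
        also have "\<dots> \<le> C x * C y"
          using bd[OF x w] bd[OF y w] by (intro mult_mono) (auto intro: order_trans[OF norm_ge_zero])
        also have "\<dots> \<le> \<bar>C x * C y\<bar>" by simp
        finally show "norm (?Z \<omega>) \<le> norm (C x * C y * Y x \<omega>)"
          unfolding real_norm_def abs_mult[of _ "Y x \<omega>"] by (rule mult_right_mono) simp
      qed
    qed
    have ind: "indep_var borel ?Z borel (Y y)" by (rule indep[OF y Zm])
    have "integrable M (\<lambda>\<omega>. ?Z \<omega> * Y y \<omega>)"
      using ind Zi Yi[OF y] by (rule indep_var_integrable)
    moreover have "(\<integral>\<omega>. ?Z \<omega> * Y y \<omega> \<partial>M) = (\<integral>\<omega>. ?Z \<omega> \<partial>M) * (\<integral>\<omega>. Y y \<omega> \<partial>M)"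
      using ind Zi Yi[OF y] by (rule indep_var_lebesgue_integral)
    ultimately show ?thesis using mean[OF y] by (simp add: Y_def mult.assoc)
  qed
  have off': "integrable M (\<lambda>\<omega>. (K x \<omega> \<bullet> K y \<omega>) * (Y x \<omega> * Y y \<omega>)) \<and>
     (\<integral>\<omega>. (K x \<omega> \<bullet> K y \<omega>) * (Y x \<omega> * Y y \<omega>) \<partial>M) = 0"
    if x: "x \<in> A" and y: "y \<in> A" and ne: "x \<noteq> y" for x y
  proof -
    have "(\<lambda>\<omega>. (K x \<omega> \<bullet> K y \<omega>) * (Y x \<omega> * Y y \<omega>)) = (\<lambda>\<omega>. (K y \<omega> \<bullet> K x \<omega>) * (Y y \<omega> * Y x \<omega>))"
      by (intro ext) (metis inner_commute mult.commute)
    with disj[OF x y ne] off[OF x y] off[OF y x] show ?thesis by auto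
  qed
  have eq: "(norm (\<Sum>x\<in>A. f x (dW (s x) (r x) \<omega>) *\<^sub>R K x \<omega>))\<^sup>2
      = (\<Sum>x\<in>A. \<Sum>y\<in>A. (K x \<omega> \<bullet> K y \<omega>) * (Y x \<omega> * Y y \<omega>))" for \<omega>
    unfolding power2_norm_eq_inner inner_sum_left inner_sum_right Y_def[symmetric]
    by (intro sum.cong refl) (simp add: inner_commute mult.assoc mult.left_commute)
  have all: "integrable M (\<lambda>\<omega>. (K x \<omega> \<bullet> K y \<omega>) * (Y x \<omega> * Y y \<omega>))" if "x \<in> A" "y \<in> A" for x y
    using diag(1) off' that by (cases "x = y") auto
  show ?thesis1 unfolding eq by (intro Bochner_Integration.integrable_sum all)
  have "(\<integral>\<omega>. (\<Sum>x\<in>A. \<Sum>y\<in>A. (K x \<omega> \<bullet> K y \<omega>) * (Y x \<omega> * Y y \<omega>)) \<partial>M)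
      = (\<Sum>x\<in>A. \<Sum>y\<in>A. (\<integral>\<omega>. (K x \<omega> \<bullet> K y \<omega>) * (Y x \<omega> * Y y \<omega>) \<partial>M))"
    by (simp add: Bochner_Integration.integral_sum all)
  also have "\<dots> = (\<Sum>x\<in>A. \<Sum>y\<in>A. if y = x then (\<integral>\<omega>. K x \<omega> \<bullet> K x \<omega> \<partial>M) * (\<integral>\<omega>. Y x \<omega> * Y x \<omega> \<partial>M) else 0)"
    using diag(2) off' by (intro sum.cong refl) auto
  also have "\<dots> = (\<Sum>x\<in>A. (\<integral>\<omega>. K x \<omega> \<bullet> K x \<omega> \<partial>M) * (\<integral>\<omega>. Y x \<omega> * Y x \<omega> \<partial>M))"
    using fin by simp
  finally show ?thesis2
    unfolding eq unfolding Y_def power2_norm_eq_inner power2_eq_square[of "f _ _"] .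
qed

end

section \<open>Probability bounds for adapted sums of increments\<close>

context brownian_basis
begin

text \<open>The coefficients come without moments, so the isometry is applied to a truncation that
  agrees with them whenever the total quadratic sum is at most \<open>b\<close>; Markov's inequality
  then costs \<open>b / a\<close>. The map \<open>blk\<close> groups terms before squares are taken:
  a single block gives the square of the whole sum, singleton blocks give the sum of the
  squares.\<close>

lemma truncated_increments_bad_set:
  fixes K :: "'i \<Rightarrow> 'w \<Rightarrow> 'h::{real_inner, second_countable_topology}"
    and blk :: "'i \<Rightarrow> 'j"
  assumes fin: "finite A"
    and sr: "\<And>x. x \<in> A \<Longrightarrow> 0 \<le> s x \<and> s x < r x"
    and disj: "\<And>x y. x \<in> A \<Longrightarrow> y \<in> A \<Longrightarrow> x \<noteq> y \<Longrightarrow> r x \<le> s y \<or> r y \<le> s x"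
    and K: "\<And>x. x \<in> A \<Longrightarrow> K x \<in> borel_measurable (F (ennreal (s x)))"
    and a: "0 < a" and b: "0 < b"
  shows "\<exists>Z\<in>events. prob Z \<le> b / a \<and> (\<forall>\<omega>\<in>space M - Z.
    (\<Sum>x\<in>A. (norm (K x \<omega>))\<^sup>2 * (r x - s x)) \<le> b \<longrightarrow>
    (\<Sum>i\<in>blk ` A. (norm (\<Sum>x\<in>{x\<in>A. blk x = i}. dW (s x) (r x) \<omega> *\<^sub>R K x \<omega>))\<^sup>2) < a)"
proof -
  \<comment> \<open>The running quadratic sum includes the interval of \<open>x\<close> itself. This
    is legitimate because \<open>K x\<close> is known at the left end, so \<open>L x\<close> is
    adapted and vanishes as soon as the bound \<open>b\<close> would be exceeded.\<close>
  define Q where "Q x \<omega> = (\<Sum>y\<in>{y\<in>A. s y \<le> s x}. (norm (K y \<omega>))\<^sup>2 * (r y - s y))" for x \<omega>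
  define L where "L x \<omega> = (if Q x \<omega> \<le> b then K x \<omega> else 0)" for x \<omega>
  have [measurable]: "K x \<in> borel_measurable M" if "x \<in> A" for x
    using K[OF that] by (rule measurable_F_M)
  have [measurable]: "dW (s x) (r x) \<in> borel_measurable M" if "x \<in> A" for x
    using sr[OF that] by (intro dW_measurable) auto
  have QF: "Q x \<in> borel_measurable (F (ennreal (s x)))" if "x \<in> A" for x
    unfolding Q_def[abs_def]
  proof (intro borel_measurable_sum)
    fix y assume "y \<in> {y \<in> A. s y \<le> s x}"
    then have "K y \<in> borel_measurable (F (ennreal (s x)))"
      using K measurable_F_real_mono[of "K y" "s y" borel "s x"] by auto
    then show "(\<lambda>\<omega>. (norm (K y \<omega>))\<^sup>2 * (r y - s y)) \<in> borel_measurable (F (ennreal (s x)))"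
      by auto
  qed
  have LF: "L x \<in> borel_measurable (F (ennreal (s x)))" if "x \<in> A" for x
  proof -
    note [measurable] = QF[OF that] K[OF that]
    show ?thesis unfolding L_def[abs_def] by measurable
  qed
  have [measurable]: "L x \<in> borel_measurable M" if "x \<in> A" for x
    using LF[OF that] by (rule measurable_F_M)
  have nn: "0 \<le> (norm (K y \<omega>))\<^sup>2 * (r y - s y)" if "y \<in> A" for y \<omega>
    using sr[OF that] by auto
  have Lsum: "(\<Sum>x\<in>A. (norm (L x \<omega>))\<^sup>2 * (r x - s x)) \<le> b" for \<omega>
  proof (cases "{x\<in>A. Q x \<omega> \<le> b} = {}")
    case True
    then have "(\<Sum>x\<in>A. (norm (L x \<omega>))\<^sup>2 * (r x - s x)) = 0"
      by (intro sum.neutral) (auto simp: L_def)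
    then show ?thesis using b by simp
  next
    case False
    \<comment> \<open>The latest interval that survives the truncation has a running sum containing
      all other survivors.\<close>
    define B where "B = {x\<in>A. Q x \<omega> \<le> b}"
    have finB: "finite B" "B \<noteq> {}" using fin False by (auto simp: B_def)
    have "Max (s ` B) \<in> s ` B" using finB by (intro Max_in) auto
    then obtain z where z: "z \<in> B" "s z = Max (s ` B)" by auto
    have "(\<Sum>x\<in>A. (norm (L x \<omega>))\<^sup>2 * (r x - s x)) = (\<Sum>x\<in>B. (norm (K x \<omega>))\<^sup>2 * (r x - s x))"
      by (rule sum.mono_neutral_cong_right) (auto simp: fin B_def L_def)
    also have "\<dots> \<le> Q z \<omega>"
      unfolding Q_def using finB z(2) fin nn
      by (intro sum_mono2) (auto simp: B_def)
    also have "\<dots> \<le> b" using z by (simp add: B_def)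
    finally show ?thesis .
  qed
  have Lterm: "(norm (L x \<omega>))\<^sup>2 * (r x - s x) \<le> b" if "x \<in> A" for x \<omega>
    by (rule order_trans[OF _ Lsum[of \<omega>]], rule member_le_sum) (use that fin sr in \<open>auto simp: less_imp_le\<close>)
  have Lbd: "norm (L x \<omega>) \<le> sqrt (b / (r x - s x))" if "x \<in> A" for x \<omega>
    using Lterm[OF that, of \<omega>] sr[OF that] by (intro real_le_rsqrt) (simp add: field_simps)
  have m1: "(\<integral>\<omega>. dW (s x) (r x) \<omega> \<partial>M) = 0" "(\<integral>\<omega>. (dW (s x) (r x) \<omega>)\<^sup>2 \<partial>M) = r x - s x"
    "integrable M (\<lambda>\<omega>. (dW (s x) (r x) \<omega>)\<^sup>2)" if "x \<in> A" for x
    using dW_moments[of "s x" "r x"] dW_integrable_power[of "s x" "r x" 2] sr[OF that] by auto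
  let ?S = "\<lambda>i \<omega>. (norm (\<Sum>x\<in>{x\<in>A. blk x = i}. dW (s x) (r x) \<omega> *\<^sub>R L x \<omega>))\<^sup>2"
  have blk: "integrable M (?S i)"
      "(\<integral>\<omega>. ?S i \<omega> \<partial>M) = (\<Sum>x\<in>{x\<in>A. blk x = i}. (\<integral>\<omega>. (norm (L x \<omega>))\<^sup>2 \<partial>M) * (r x - s x))" for i
  proof -
    let ?B = "{x\<in>A. blk x = i}"
    note * = integrable_norm_sum_increments[of ?B s r L "\<lambda>x. sqrt (b / (r x - s x))" "\<lambda>_ z. z"]
    show "integrable M (?S i)"
      by (rule *(1)) (use fin sr disj LF Lbd m1 in auto)
    have "(\<integral>\<omega>. ?S i \<omega> \<partial>M) = (\<Sum>x\<in>?B. (\<integral>\<omega>. (norm (L x \<omega>))\<^sup>2 \<partial>M) * (\<integral>\<omega>. (dW (s x) (r x) \<omega>)\<^sup>2 \<partial>M))"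
      by (rule *(2)) (use fin sr disj LF Lbd m1 in auto)
    also have "\<dots> = (\<Sum>x\<in>?B. (\<integral>\<omega>. (norm (L x \<omega>))\<^sup>2 \<partial>M) * (r x - s x))"
      by (intro sum.cong refl) (simp add: m1)
    finally show "(\<integral>\<omega>. ?S i \<omega> \<partial>M) = (\<Sum>x\<in>?B. (\<integral>\<omega>. (norm (L x \<omega>))\<^sup>2 \<partial>M) * (r x - s x))" .
  qed
  let ?T = "\<lambda>\<omega>. \<Sum>i\<in>blk ` A. ?S i \<omega>"
  have Tint: "integrable M ?T" by (intro Bochner_Integration.integrable_sum blk)
  have Li: "integrable M (\<lambda>\<omega>. (norm (L x \<omega>))\<^sup>2)" if "x \<in> A" for x
  proof (rule integrable_const_bound[where B="b / (r x - s x)"])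
    show "AE \<omega> in M. norm ((norm (L x \<omega>))\<^sup>2) \<le> b / (r x - s x)"
      using Lterm[OF that] sr[OF that] by (intro AE_I2) (auto simp: field_simps)
  qed (use that in measurable)
  have "(\<integral>\<omega>. ?T \<omega> \<partial>M) = (\<Sum>i\<in>blk ` A. \<Sum>x\<in>{x\<in>A. blk x = i}. (\<integral>\<omega>. (norm (L x \<omega>))\<^sup>2 \<partial>M) * (r x - s x))"
    by (subst Bochner_Integration.integral_sum) (simp_all add: blk)
  also have "\<dots> = (\<Sum>x\<in>A. (\<integral>\<omega>. (norm (L x \<omega>))\<^sup>2 \<partial>M) * (r x - s x))"
    using fin by (rule sum.image_gen[symmetric])
  also have "\<dots> = (\<integral>\<omega>. (\<Sum>x\<in>A. (norm (L x \<omega>))\<^sup>2 * (r x - s x)) \<partial>M)"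
    using Li by (subst Bochner_Integration.integral_sum) auto
  also have "\<dots> \<le> b"
    using Lsum by (intro integral_le_const Bochner_Integration.integrable_sum integrable_mult_left Li) auto
  finally have ET: "(\<integral>\<omega>. ?T \<omega> \<partial>M) \<le> b" .
  have markov: "prob {\<omega> \<in> space M. a \<le> ?T \<omega>} \<le> b / a"
  proof -
    have "prob {\<omega> \<in> space M. a \<le> ?T \<omega>} \<le> (\<integral>\<omega>. ?T \<omega> \<partial>M) / a"
      by (rule integral_Markov_inequality_measure[where A="space M", OF Tint]) (auto simp: a intro!: sum_nonneg)
    also have "\<dots> \<le> b / a" using ET a by (intro divide_right_mono) auto
    finally show ?thesis .
  qed
  let ?U = "\<lambda>\<omega>. \<Sum>i\<in>blk ` A. (norm (\<Sum>x\<in>{x\<in>A. blk x = i}. dW (s x) (r x) \<omega> *\<^sub>R K x \<omega>))\<^sup>2"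
  have same: "?T \<omega> = ?U \<omega>" if "\<not> b < (\<Sum>x\<in>A. (norm (K x \<omega>))\<^sup>2 * (r x - s x))" for \<omega>
  proof -
    have "Q x \<omega> \<le> b" for x
    proof -
      have "Q x \<omega> \<le> (\<Sum>x\<in>A. (norm (K x \<omega>))\<^sup>2 * (r x - s x))"
        unfolding Q_def using fin nn by (intro sum_mono2) auto
      then show ?thesis using that by simp
    qed
    then show ?thesis by (simp add: L_def)
  qed
  show ?thesis
  proof (intro bexI conjI ballI impI)
    fix \<omega> assume w: "\<omega> \<in> space M - {\<omega> \<in> space M. a \<le> ?T \<omega>}"
      and "(\<Sum>x\<in>A. (norm (K x \<omega>))\<^sup>2 * (r x - s x)) \<le> b"
    then have "?T \<omega> = ?U \<omega>" by (intro same) simp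
    then show "?U \<omega> < a" using w by (simp add: not_le)
  qed (use markov in auto)
qed

text \<open>Quadratic variation along a grid: by the fourth Gaussian moment the centred square of an
  increment has variance twice the squared step, so over a fixed time span the sum is small with the
  mesh, and Chebyshev's inequality applies.\<close>

lemma prob_squared_increments:
  fixes \<theta> :: "nat \<Rightarrow> 'w \<Rightarrow> real" and t :: "nat \<Rightarrow> real"
  assumes t0: "0 \<le> t 0" and t: "\<And>i. t i < t (Suc i)"
    and th: "\<And>i. i < n \<Longrightarrow> \<theta> i \<in> borel_measurable (F (ennreal (t i)))"
    and bd: "\<And>i \<omega>. i < n \<Longrightarrow> \<omega> \<in> space M \<Longrightarrow> \<bar>\<theta> i \<omega>\<bar> \<le> B"
    and a: "0 < a"
  shows "prob {\<omega> \<in> space M. a \<le> \<bar>\<Sum>i<n. \<theta> i \<omega> * ((dW (t i) (t (Suc i)) \<omega>)\<^sup>2 - (t (Suc i) - t i))\<bar>}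
    \<le> (\<Sum>i<n. B\<^sup>2 * (2 * (t (Suc i) - t i)\<^sup>2)) / a\<^sup>2"
proof -
  have mono: "t i \<le> t j" if "i \<le> j" for i j
    by (rule lift_Suc_mono_le[of t]) (simp_all add: t that less_imp_le)
  have tpos: "0 \<le> t i" for i using mono[of 0 i] t0 by simp
  let ?Y = "\<lambda>i \<omega>. (dW (t i) (t (Suc i)) \<omega>)\<^sup>2 - (t (Suc i) - t i)"
  have [measurable]: "dW (t i) (t (Suc i)) \<in> borel_measurable M" for i
    using t[of i] tpos[of i] by (intro dW_measurable) auto
  have [measurable]: "\<theta> i \<in> borel_measurable M" if "i < n" for i
    using th[OF that] by (rule measurable_F_M)
  have I2: "integrable M (\<lambda>\<omega>. (dW (t i) (t (Suc i)) \<omega>)\<^sup>2)" and I4: "integrable M (\<lambda>\<omega>. (dW (t i) (t (Suc i)) \<omega>) ^ 4)" for i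
    using dW_integrable_power[of "t i" "t (Suc i)"] t[of i] tpos[of i] by auto
  have Y2: "(?Y i \<omega>)\<^sup>2 = (dW (t i) (t (Suc i)) \<omega>) ^ 4 - (2 * (t (Suc i) - t i)) * (dW (t i) (t (Suc i)) \<omega>)\<^sup>2 + (t (Suc i) - t i)\<^sup>2" for i \<omega>
    by (simp add: power2_eq_square algebra_simps power4_eq_xxxx)
  have Yi: "integrable M (\<lambda>\<omega>. (?Y i \<omega>)\<^sup>2)" for i
    unfolding Y2 using I2 I4 by simp
  have EY: "(\<integral>\<omega>. ?Y i \<omega> \<partial>M) = 0" and EY2: "(\<integral>\<omega>. (?Y i \<omega>)\<^sup>2 \<partial>M) = 2 * (t (Suc i) - t i)\<^sup>2" for i
  proof -
    note m = dW_moments[OF tpos[of i] t[of i]]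
    show "(\<integral>\<omega>. ?Y i \<omega> \<partial>M) = 0" using I2 m by (simp add: prob_space)
    have "(\<integral>\<omega>. (?Y i \<omega>)\<^sup>2 \<partial>M) = 3 * (t (Suc i) - t i)\<^sup>2 - (2 * (t (Suc i) - t i)) * (t (Suc i) - t i) + (t (Suc i) - t i)\<^sup>2"
      unfolding Y2 using I2 I4 m by (simp add: prob_space)
    then show "(\<integral>\<omega>. (?Y i \<omega>)\<^sup>2 \<partial>M) = 2 * (t (Suc i) - t i)\<^sup>2"
      by (simp add: power2_eq_square algebra_simps)
  qed
  let ?S = "\<lambda>\<omega>. \<Sum>i<n. \<theta> i \<omega> * ?Y i \<omega>"
  have disj: "t (Suc x) \<le> t y \<or> t (Suc y) \<le> t x" if "x \<noteq> y" for x y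
    using that mono[of "Suc x" y] mono[of "Suc y" x] by linarith
  note * = integrable_norm_sum_increments[of "{..<n}" t "\<lambda>i. t (Suc i)" \<theta> "\<lambda>_. B" "\<lambda>i z. z\<^sup>2 - (t (Suc i) - t i)"]
  have int: "integrable M (\<lambda>\<omega>. (?S \<omega>)\<^sup>2)"
  proof -
    have "integrable M (\<lambda>\<omega>. (norm (\<Sum>i<n. ?Y i \<omega> *\<^sub>R \<theta> i \<omega>))\<^sup>2)"
      by (rule *(1)) (use tpos t disj th bd Yi EY in auto)
    then show ?thesis by (simp add: mult.commute)
  qed
  have "(\<integral>\<omega>. (norm (\<Sum>i<n. ?Y i \<omega> *\<^sub>R \<theta> i \<omega>))\<^sup>2 \<partial>M) = (\<Sum>i<n. (\<integral>\<omega>. (norm (\<theta> i \<omega>))\<^sup>2 \<partial>M) * (\<integral>\<omega>. (?Y i \<omega>)\<^sup>2 \<partial>M))"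
    by (rule *(2)) (use tpos t disj th bd Yi EY in auto)
  then have "(\<integral>\<omega>. (?S \<omega>)\<^sup>2 \<partial>M) = (\<Sum>i<n. (\<integral>\<omega>. (\<theta> i \<omega>)\<^sup>2 \<partial>M) * (2 * (t (Suc i) - t i)\<^sup>2))"
    using EY2 by (simp add: mult.commute)
  also have "\<dots> \<le> (\<Sum>i<n. B\<^sup>2 * (2 * (t (Suc i) - t i)\<^sup>2))"
  proof (intro sum_mono mult_right_mono)
    fix i assume i: "i \<in> {..<n}"
    have sq: "(\<theta> i \<omega>)\<^sup>2 \<le> B\<^sup>2" if "\<omega> \<in> space M" for \<omega>
      using bd[of i \<omega>] i that power_mono[of "\<bar>\<theta> i \<omega>\<bar>" B 2] by auto
    have "integrable M (\<lambda>\<omega>. (\<theta> i \<omega>)\<^sup>2)"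
      by (rule integrable_const_bound[where B="B\<^sup>2"]) (use i sq in auto)
    then show "(\<integral>\<omega>. (\<theta> i \<omega>)\<^sup>2 \<partial>M) \<le> B\<^sup>2" using sq by (intro integral_le_const) auto
  qed auto
  finally have E: "(\<integral>\<omega>. (?S \<omega>)\<^sup>2 \<partial>M) \<le> (\<Sum>i<n. B\<^sup>2 * (2 * (t (Suc i) - t i)\<^sup>2))" .
  have "{\<omega> \<in> space M. a \<le> \<bar>?S \<omega>\<bar>} = {\<omega> \<in> space M. a\<^sup>2 \<le> (?S \<omega>)\<^sup>2}"
    using a abs_le_square_iff[of a] by auto
  moreover have "prob {\<omega> \<in> space M. a\<^sup>2 \<le> (?S \<omega>)\<^sup>2} \<le> (\<integral>\<omega>. (?S \<omega>)\<^sup>2 \<partial>M) / a\<^sup>2"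
    using a by (intro integral_Markov_inequality_measure[where A="space M", OF int]) auto
  ultimately show ?thesis using divide_right_mono[OF E, of "a\<^sup>2"] by simp
qed

text \<open>Freezing lemma: the joint law of \<open>K\<close> and the increment is a product, so the
  increment can be integrated out against its Gaussian density with \<open>K\<close> held fixed. It
  takes the place of a conditional expectation given the past.\<close>

lemma nn_integral_dW_indep:
  assumes ab: "0 \<le> a" "a < b" and K: "K \<in> measurable (F (ennreal a)) N"
    and [measurable]: "\<phi> \<in> borel_measurable (N \<Otimes>\<^sub>M borel)"
  shows "(\<integral>\<^sup>+\<omega>. \<phi> (K \<omega>, dW a b \<omega>) \<partial>M)
    = (\<integral>\<^sup>+\<omega>. (\<integral>\<^sup>+x. ennreal (normal_density 0 (sqrt (b - a)) x) * \<phi> (K \<omega>, x) \<partial>lborel) \<partial>M)"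
proof -
  have K'[measurable]: "K \<in> measurable M N" using K by (rule measurable_F_M)
  have D[measurable]: "dW a b \<in> borel_measurable M" using ab by (intro dW_measurable) auto
  have eq: "distr M (N \<Otimes>\<^sub>M borel) (\<lambda>\<omega>. (K \<omega>, dW a b \<omega>)) = distr M N K \<Otimes>\<^sub>M distr M borel (dW a b)"
  proof -
    interpret P1: prob_space "distr M N K" by (rule prob_space_distr) (rule K')
    interpret P2: prob_space "distr M borel (dW a b)" by (rule prob_space_distr) (rule D)
    have "distr M N K \<Otimes>\<^sub>M distr M borel (dW a b) = distr M (N \<Otimes>\<^sub>M borel) (\<lambda>\<omega>. (K \<omega>, dW a b \<omega>))"
    proof (rule pair_measure_eqI)
      fix A B assume A: "A \<in> sets (distr M N K)" and B: "B \<in> sets (distr M borel (dW a b))"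
      have KA: "K -` A \<inter> space M \<in> sets (F (ennreal a))"
        using measurable_sets[OF K, of A] A by simp
      have "prob ((K -` A \<inter> space M) \<inter> (dW a b -` B \<inter> space M))
          = prob (K -` A \<inter> space M) * prob (dW a b -` B \<inter> space M)"
      proof -
        have "dW a b -` B \<inter> space M \<in> {(\<lambda>\<omega>. W b \<omega> - W a \<omega>) -` B \<inter> space M | B. B \<in> sets borel}"
          using B by (auto simp: dW_def[abs_def])
        with KA show ?thesis
          using W_indep[OF ab, unfolded indep_sets2_eq] by blast
      qed
      moreover have "(\<lambda>\<omega>. (K \<omega>, dW a b \<omega>)) -` (A \<times> B) \<inter> space M = (K -` A \<inter> space M) \<inter> (dW a b -` B \<inter> space M)"
        by auto
      ultimately show "emeasure (distr M N K) A * emeasure (distr M borel (dW a b)) B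
          = emeasure (distr M (N \<Otimes>\<^sub>M borel) (\<lambda>\<omega>. (K \<omega>, dW a b \<omega>))) (A \<times> B)"
        using A B by (simp add: emeasure_distr emeasure_eq_measure ennreal_mult)
    qed (auto intro: P1.sigma_finite_measure_axioms P2.sigma_finite_measure_axioms)
    then show ?thesis ..
  qed
  interpret D: prob_space "distr M borel (dW a b)" by (rule prob_space_distr) (rule D)
  have "(\<integral>\<^sup>+\<omega>. \<phi> (K \<omega>, dW a b \<omega>) \<partial>M) = (\<integral>\<^sup>+z. \<phi> z \<partial>distr M (N \<Otimes>\<^sub>M borel) (\<lambda>\<omega>. (K \<omega>, dW a b \<omega>)))"
    by (subst nn_integral_distr) auto
  also have "\<dots> = (\<integral>\<^sup>+z. \<phi> z \<partial>(distr M N K \<Otimes>\<^sub>M distr M borel (dW a b)))" by (simp only: eq)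
  also have "\<dots> = (\<integral>\<^sup>+k. (\<integral>\<^sup>+x. \<phi> (k, x) \<partial>distr M borel (dW a b)) \<partial>distr M N K)"
    by (rule D.nn_integral_fst[symmetric]) measurable
  also have "\<dots> = (\<integral>\<^sup>+\<omega>. (\<integral>\<^sup>+x. \<phi> (K \<omega>, x) \<partial>distr M borel (dW a b)) \<partial>M)"
    by (subst nn_integral_distr) auto
  also have "\<dots> = (\<integral>\<^sup>+\<omega>. (\<integral>\<^sup>+x. ennreal (normal_density 0 (sqrt (b - a)) x) * \<phi> (K \<omega>, x) \<partial>lborel) \<partial>M)"
  proof (intro nn_integral_cong)
    fix \<omega> assume w: "\<omega> \<in> space M"
    have Kw: "K \<omega> \<in> space N" using w K' by (auto simp: measurable_def)
    have m[measurable]: "(\<lambda>x. \<phi> (K \<omega>, x)) \<in> borel_measurable borel"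
      using Kw by measurable
    have "(\<integral>\<^sup>+x. \<phi> (K \<omega>, x) \<partial>distr M borel (dW a b)) = (\<integral>\<^sup>+\<omega>'. \<phi> (K \<omega>, dW a b \<omega>') \<partial>M)"
      by (subst nn_integral_distr) auto
    also have "\<dots> = (\<integral>\<^sup>+x. ennreal (normal_density 0 (sqrt (b - a)) x) * \<phi> (K \<omega>, x) \<partial>lborel)"
      using distributed_nn_integral[OF dW_distributed[OF ab], of "\<lambda>x. \<phi> (K \<omega>, x)"] by simp
    finally show "(\<integral>\<^sup>+x. \<phi> (K \<omega>, x) \<partial>distr M borel (dW a b)) = \<dots>" .
  qed
  finally show ?thesis .
qed

text \<open>Completing the square: the exponential tilt by \<open>c\<close> moves a centred Gaussian
  to mean \<open>c * D\<close>, and the compensator is exactly its normalisation.\<close>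

lemma exp_normal_density:
  assumes "0 < D"
  shows "normal_density 0 (sqrt D) x * exp (c * x - c\<^sup>2 * D / 2) = normal_density (c * D) (sqrt D) x"
proof -
  have "- (x\<^sup>2) / (2 * D) + (c * x - c\<^sup>2 * D / 2) = - ((x - c * D)\<^sup>2) / (2 * D)"
    using assms by (simp add: field_simps power2_eq_square)
  then have "exp (- (x\<^sup>2) / (2 * D)) * exp (c * x - c\<^sup>2 * D / 2) = exp (- ((x - c * D)\<^sup>2) / (2 * D))"
    by (simp only: exp_add[symmetric])
  then show ?thesis using assms unfolding normal_density_def by simp
qed

text \<open>Induction removes the last increment: with the past frozen, its factor turns the centred
  Gaussian density into a shifted one, still of mass 1. As only nonnegative integrals occur, the
  identity holds for every adapted \<open>c\<close>.\<close>

lemma nn_integral_exponential_increments: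
  fixes c :: "nat \<Rightarrow> 'w \<Rightarrow> real" and t :: "nat \<Rightarrow> real"
  assumes t0: "0 \<le> t 0" and t: "\<And>i. t i < t (Suc i)"
    and c: "\<And>i. i < n \<Longrightarrow> c i \<in> borel_measurable (F (ennreal (t i)))"
  shows "(\<integral>\<^sup>+\<omega>. ennreal (exp (\<Sum>i<n. c i \<omega> * dW (t i) (t (Suc i)) \<omega> - (c i \<omega>)\<^sup>2 * (t (Suc i) - t i) / 2)) \<partial>M) = 1"
  using c
proof (induction n)
  case 0
  then show ?case by (simp add: emeasure_space_1)
next
  case (Suc n)
  have mono: "t i \<le> t j" if "i \<le> j" for i j
    by (rule lift_Suc_mono_le[of t]) (simp_all add: t that less_imp_le)
  have tpos: "0 \<le> t i" for i using mono[of 0 i] t0 by simp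
  let ?D = "t (Suc n) - t n"
  let ?L = "\<lambda>\<omega>. \<Sum>i<n. c i \<omega> * dW (t i) (t (Suc i)) \<omega> - (c i \<omega>)\<^sup>2 * (t (Suc i) - t i) / 2"
  have L: "?L \<in> borel_measurable (F (ennreal (t n)))"
  proof (intro borel_measurable_sum)
    fix i assume i: "i \<in> {..<n}"
    then have "c i \<in> borel_measurable (F (ennreal (t n)))"
      using Suc.prems[of i] measurable_F_real_mono[OF _ mono[of i n]] by auto
    moreover have "dW (t i) (t (Suc i)) \<in> borel_measurable (F (ennreal (t n)))"
      using i measurable_F_real_mono[OF dW_measurable_F mono[of "Suc i" n]] tpos[of i] t[of i] by auto
    ultimately show "(\<lambda>\<omega>. c i \<omega> * dW (t i) (t (Suc i)) \<omega> - (c i \<omega>)\<^sup>2 * (t (Suc i) - t i) / 2)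
        \<in> borel_measurable (F (ennreal (t n)))" by auto
  qed
  define \<phi> :: "(real \<times> real) \<times> real \<Rightarrow> ennreal"
    where "\<phi> z = ennreal (exp (fst (fst z))) * ennreal (exp (snd (fst z) * snd z - (snd (fst z))\<^sup>2 * ?D / 2))" for z
  have [measurable]: "\<phi> \<in> borel_measurable ((borel \<Otimes>\<^sub>M borel) \<Otimes>\<^sub>M borel)"
    unfolding \<phi>_def[abs_def] by measurable
  have K: "(\<lambda>\<omega>. (?L \<omega>, c n \<omega>)) \<in> measurable (F (ennreal (t n))) (borel \<Otimes>\<^sub>M borel)"
    using L Suc.prems[of n] by auto
  have "(\<integral>\<^sup>+\<omega>. ennreal (exp (\<Sum>i<Suc n. c i \<omega> * dW (t i) (t (Suc i)) \<omega> - (c i \<omega>)\<^sup>2 * (t (Suc i) - t i) / 2)) \<partial>M)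
      = (\<integral>\<^sup>+\<omega>. \<phi> ((?L \<omega>, c n \<omega>), dW (t n) (t (Suc n)) \<omega>) \<partial>M)"
    by (intro nn_integral_cong) (simp add: \<phi>_def ennreal_mult[symmetric] exp_add[symmetric])
  also have "\<dots> = (\<integral>\<^sup>+\<omega>. (\<integral>\<^sup>+x. ennreal (normal_density 0 (sqrt ?D) x) * \<phi> ((?L \<omega>, c n \<omega>), x) \<partial>lborel) \<partial>M)"
    using K tpos t by (intro nn_integral_dW_indep) auto
  also have "\<dots> = (\<integral>\<^sup>+\<omega>. ennreal (exp (?L \<omega>)) \<partial>M)"
  proof (intro nn_integral_cong)
    fix \<omega>
    have "ennreal (normal_density 0 (sqrt ?D) x) * \<phi> ((?L \<omega>, c n \<omega>), x)
        = ennreal (exp (?L \<omega>)) * ennreal (normal_density (c n \<omega> * ?D) (sqrt ?D) x)" for x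
      using exp_normal_density[of ?D x "c n \<omega>"] t[of n]
      by (simp add: \<phi>_def ennreal_mult[symmetric] mult.left_commute normal_density_nonneg)
    moreover have "(\<integral>\<^sup>+x. ennreal (normal_density (c n \<omega> * ?D) (sqrt ?D) x) \<partial>lborel) = 1"
      using t[of n] nn_integral_eq_integral[of lborel "normal_density (c n \<omega> * ?D) (sqrt ?D)"]
      by (simp add: normal_density_nonneg)
    ultimately show "(\<integral>\<^sup>+x. ennreal (normal_density 0 (sqrt ?D) x) * \<phi> ((?L \<omega>, c n \<omega>), x) \<partial>lborel) = ennreal (exp (?L \<omega>))"
      by (simp add: nn_integral_cmult)
  qed
  also have "\<dots> = 1" using Suc by simp
  finally show ?case .
qed

text \<open>Markov's inequality for the exponential, whose mean is 1.\<close>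

lemma prob_exponential_increments:
  fixes c :: "nat \<Rightarrow> 'w \<Rightarrow> real" and t :: "nat \<Rightarrow> real"
  assumes t0: "0 \<le> t 0" and t: "\<And>i. t i < t (Suc i)"
    and c: "\<And>i. i < n \<Longrightarrow> c i \<in> borel_measurable (F (ennreal (t i)))"
  shows "prob {\<omega> \<in> space M. L \<le> (\<Sum>i<n. c i \<omega> * dW (t i) (t (Suc i)) \<omega> - (c i \<omega>)\<^sup>2 * (t (Suc i) - t i) / 2)} \<le> exp (- L)"
proof -
  let ?S = "\<lambda>\<omega>. \<Sum>i<n. c i \<omega> * dW (t i) (t (Suc i)) \<omega> - (c i \<omega>)\<^sup>2 * (t (Suc i) - t i) / 2"
  have mono: "t i \<le> t j" if "i \<le> j" for i j
    by (rule lift_Suc_mono_le[of t]) (simp_all add: t that less_imp_le)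
  have tpos: "0 \<le> t i" for i using mono[of 0 i] t0 by simp
  have [measurable]: "c i \<in> borel_measurable M" if "i < n" for i using c[OF that] by (rule measurable_F_M)
  have [measurable]: "dW (t i) (t (Suc i)) \<in> borel_measurable M" for i
    using t[of i] tpos[of i] by (intro dW_measurable) auto
  have "emeasure M ({\<omega> \<in> space M. 1 \<le> ennreal (exp (- L)) * ennreal (exp (?S \<omega>))})
      \<le> ennreal (exp (- L)) * (\<integral>\<^sup>+\<omega>. ennreal (exp (?S \<omega>)) * indicator (space M) \<omega> \<partial>M)"
    by (rule nn_integral_Markov_inequality) measurable
  also have "(\<integral>\<^sup>+\<omega>. ennreal (exp (?S \<omega>)) * indicator (space M) \<omega> \<partial>M) = (\<integral>\<^sup>+\<omega>. ennreal (exp (?S \<omega>)) \<partial>M)"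
    by (intro nn_integral_cong) auto
  also have "\<dots> = 1" by (rule nn_integral_exponential_increments[where c=c and t=t and n=n, OF t0 t c])
  also have "{\<omega> \<in> space M. 1 \<le> ennreal (exp (- L)) * ennreal (exp (?S \<omega>))} = {\<omega> \<in> space M. L \<le> ?S \<omega>}"
    by (auto simp: ennreal_mult[symmetric] exp_add[symmetric])
  finally show ?thesis by (simp add: emeasure_eq_measure)
qed

end

section \<open>Ito integrals along time grids\<close>

text \<open>Fatou's lemma for sets: the tail intersections increase to the event, and each is
  contained in every later \<open>Z l\<close>. It performs all probabilistic limits of the proof,
  over approximating elementary processes, over grids and over mollifiers, with no rate that would
  have to be uniform in \<omega>.\<close>

lemma (in prob_space) prob_eventually_le:
  assumes Z: "\<And>l. Z l \<in> events" and v: "\<And>l. prob (Z l) \<le> v l" and lim: "v \<longlonglongrightarrow> c"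
  shows "{\<omega> \<in> space M. \<forall>\<^sub>F l in sequentially. \<omega> \<in> Z l} \<in> events" (is "?S \<in> _")
    and "prob {\<omega> \<in> space M. \<forall>\<^sub>F l in sequentially. \<omega> \<in> Z l} \<le> c"
proof -
  define D where "D n = (\<Inter>l\<in>{n..}. Z l)" for n :: nat
  have D: "D n \<in> events" for n unfolding D_def using Z by (intro sets.countable_INT) auto
  have eq: "?S = (\<Union>n. D n)"
    using sets.sets_into_space[OF Z] by (auto simp: D_def eventually_sequentially)
  show "?S \<in> events" unfolding eq using D by auto
  have "prob (D n) \<le> c" for n
  proof (rule LIMSEQ_le_const[OF lim], intro exI allI impI)
    fix l assume "n \<le> l"
    then have "prob (D n) \<le> prob (Z l)" by (intro finite_measure_mono Z) (auto simp: D_def)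
    then show "prob (D n) \<le> v l" using v[of l] by simp
  qed
  moreover have "(\<lambda>n. prob (D n)) \<longlonglongrightarrow> prob (\<Union>n. D n)"
    by (rule finite_Lim_measure_incseq) (use D in \<open>auto simp: incseq_def D_def\<close>)
  ultimately show "prob ?S \<le> c" unfolding eq by (intro LIMSEQ_le_const2) auto
qed

context brownian_basis
begin

text \<open>Checked on the generating rectangles: their slice at time \<open>t\<close> is empty or
  belongs to some \<open>F (ennreal a)\<close> with \<open>a \<le> t\<close>. This is how
  predictable integrands become adapted at grid times.\<close>

lemma predictable_section_omega:
  assumes "0 \<le> t"
  shows "(\<lambda>\<omega>. (t, \<omega>)) \<in> measurable (F (ennreal t)) (predictable_sigma F)"
  unfolding predictable_sigma_def
proof (rule measurable_measure_of)
  show "{{0} \<times> A |A. A \<in> sets (F 0)} \<union> {{a<..b} \<times> A |a b A. 0 \<le> a \<and> a \<le> b \<and> A \<in> sets (F (ennreal a))}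
    \<subseteq> Pow ({0..} \<times> space (F 0))"
    using sets.sets_into_space by fastforce
  show "(\<lambda>\<omega>. (t, \<omega>)) \<in> space (F (ennreal t)) \<rightarrow> {0..} \<times> space (F 0)" using assms by auto
  fix B assume "B \<in> {{0} \<times> A |A. A \<in> sets (F 0)} \<union> {{a<..b} \<times> A |a b A. 0 \<le> a \<and> a \<le> b \<and> A \<in> sets (F (ennreal a))}"
  then show "(\<lambda>\<omega>. (t, \<omega>)) -` B \<inter> space (F (ennreal t)) \<in> sets (F (ennreal t))"
  proof
    assume "B \<in> {{0} \<times> A |A. A \<in> sets (F 0)}"
    then obtain A where A: "B = {0} \<times> A" "A \<in> sets (F 0)" by auto
    then have "A \<in> sets (F (ennreal t))" using sets_F_mono[of 0 "ennreal t"] by auto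
    then have "A \<inter> space (F (ennreal t)) \<in> sets (F (ennreal t))" by (intro sets.Int sets.top)
    then show ?thesis using A by (cases "t = 0") (auto simp: Int_def vimage_def)
  next
    assume "B \<in> {{a<..b} \<times> A |a b A. 0 \<le> a \<and> a \<le> b \<and> A \<in> sets (F (ennreal a))}"
    then obtain a b A where A: "B = {a<..b} \<times> A" "A \<in> sets (F (ennreal a))" by auto
    show ?thesis
    proof (cases "t \<in> {a<..b}")
      case True
      then have "A \<in> sets (F (ennreal t))" using A(2) sets_F_mono[of "ennreal a" "ennreal t"] ennreal_leI[of a t] by auto
      then have "A \<inter> space (F (ennreal t)) \<in> sets (F (ennreal t))" by (intro sets.Int sets.top)
      then show ?thesis using A True by (auto simp: Int_def vimage_def)
    next
      case False
      then have "(\<lambda>\<omega>. (t, \<omega>)) -` B \<inter> space (F (ennreal t)) = {}" using A by auto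
      then show ?thesis by simp
    qed
  qed
qed

lemma predictable_section_time:
  assumes "\<omega> \<in> space M"
  shows "(\<lambda>t. (t, \<omega>)) \<in> measurable (restrict_space borel {0..}) (predictable_sigma F)"
  unfolding predictable_sigma_def
proof (rule measurable_measure_of)
  show "{{0} \<times> A |A. A \<in> sets (F 0)} \<union> {{a<..b} \<times> A |a b A. 0 \<le> a \<and> a \<le> b \<and> A \<in> sets (F (ennreal a))}
    \<subseteq> Pow ({0..} \<times> space (F 0))"
    using sets.sets_into_space by fastforce
  show "(\<lambda>t. (t, \<omega>)) \<in> space (restrict_space borel {0..}) \<rightarrow> {0..} \<times> space (F 0)"
    using assms by (auto simp: space_restrict_space)
  fix B assume "B \<in> {{0} \<times> A |A. A \<in> sets (F 0)} \<union> {{a<..b} \<times> A |a b A. 0 \<le> a \<and> a \<le> b \<and> A \<in> sets (F (ennreal a))}"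
  then obtain C A where C: "B = C \<times> A" "C \<in> sets borel" "C \<subseteq> {0..}"
  proof
    assume "B \<in> {{0} \<times> A |A. A \<in> sets (F 0)}"
    then show thesis using that[of "{0}"] by auto
  next
    assume "B \<in> {{a<..b} \<times> A |a b A. 0 \<le> a \<and> a \<le> b \<and> A \<in> sets (F (ennreal a))}"
    then obtain a b A where "B = {a<..b} \<times> A" "0 \<le> a" by auto
    moreover from this have "{a<..b} \<subseteq> {0..}" by (auto intro: order_trans less_imp_le)
    ultimately show thesis using that[of "{a<..b}" A] by auto
  qed
  have "(\<lambda>t. (t, \<omega>)) -` B \<inter> space (restrict_space borel {0..}) = (if \<omega> \<in> A then C else {})"
    using C by (auto simp: space_restrict_space)
  then show "(\<lambda>t. (t, \<omega>)) -` B \<inter> space (restrict_space borel {0..}) \<in> sets (restrict_space borel {0..})"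
    using C by (auto simp: sets_restrict_space_iff)
qed

lemma predictable_adapted:
  assumes "(\<lambda>(t, \<omega>). H t \<omega>) \<in> measurable (predictable_sigma F) N" "0 \<le> t"
  shows "H t \<in> measurable (F (ennreal t)) N"
  using measurable_compose[OF predictable_section_omega[OF assms(2)] assms(1)] by simp

lemma predictable_path_measurable:
  assumes "(\<lambda>(t, \<omega>). H t \<omega>) \<in> measurable (predictable_sigma F) N" "\<omega> \<in> space M"
  shows "(\<lambda>t. H t \<omega>) \<in> measurable (restrict_space borel {0..}) N"
  using measurable_compose[OF predictable_section_time[OF assms(2)] assms(1)] by simp

text \<open>Only the part of an elementary cell inside \<open>{t..t'}\<close> contributes; clamping
  both endpoints to this interval isolates it, and cells outside collapse to a point.\<close>

lemma elementary_integral_increment: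
  assumes t: "t \<le> t'" and p: "\<And>j. j < n \<Longrightarrow> p j \<le> p (Suc j)"
  shows "elementary_integral W n p X t' \<omega> - elementary_integral W n p X t \<omega>
    = (\<Sum>j<n. dW (max t (min t' (p j))) (max t (min t' (p (Suc j)))) \<omega> *\<^sub>R X j \<omega>)"
proof -
  have clamp: "W (min t' q) \<omega> - W (min t q) \<omega> = W (max t (min t' q)) \<omega> - W t \<omega>" for q
    using t by (cases "q \<le> t"; cases "q \<le> t'") (auto simp: min_def max_def)
  have "(W (min t' (p (Suc j))) \<omega> - W (min t' (p j)) \<omega>) *\<^sub>R X j \<omega> - (W (min t (p (Suc j))) \<omega> - W (min t (p j)) \<omega>) *\<^sub>R X j \<omega>
      = dW (max t (min t' (p j))) (max t (min t' (p (Suc j)))) \<omega> *\<^sub>R X j \<omega>" for j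
    using clamp[of "p (Suc j)"] clamp[of "p j"] unfolding dW_def scaleR_left_diff_distrib[symmetric]
    by (intro arg_cong[where f="\<lambda>z. z *\<^sub>R X j \<omega>"]) linarith
  then show ?thesis
    unfolding elementary_integral_def sum_subtractf[symmetric] by (intro sum.cong) auto
qed

lemma elementary_process_path_measurable [measurable]:
  fixes X :: "nat \<Rightarrow> 'w \<Rightarrow> 'h::{real_inner, second_countable_topology}"
  shows "(\<lambda>x. elementary_process n p X x \<omega>) \<in> borel_measurable borel"
  unfolding elementary_process_def by measurable

lemma elementary_grid_bad_set:
  fixes X :: "nat \<Rightarrow> 'w \<Rightarrow> 'h::{real_inner, second_countable_topology}"
    and \<Psi> :: "nat \<Rightarrow> 'w \<Rightarrow> 'h \<Rightarrow> 'k::{real_inner, second_countable_topology}"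
    and blk :: "nat \<Rightarrow> 'j"
  assumes el: "elementary F n p X" and p0: "p 0 = 0" and pn: "t N \<le> p n"
    and t0: "t 0 = 0" and t: "\<And>i. t i < t (Suc i)"
    and G: "\<And>i. i < N \<Longrightarrow> G i \<in> borel_measurable (F (ennreal (t i)))"
    and \<Psi>lin: "\<And>i \<omega>. i < N \<Longrightarrow> linear (\<Psi> i \<omega>)"
    and \<Psi>bd: "\<And>i \<omega> x. i < N \<Longrightarrow> norm (\<Psi> i \<omega> x) \<le> \<xi> i \<omega> * norm x"
    and \<Psi>meas: "\<And>i u Z. i < N \<Longrightarrow> t i \<le> u \<Longrightarrow> Z \<in> borel_measurable (F (ennreal u)) \<Longrightarrow>
        (\<lambda>\<omega>. \<Psi> i \<omega> (Z \<omega>)) \<in> borel_measurable (F (ennreal u))"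
    and \<xi>: "\<And>i \<omega>. i < N \<Longrightarrow> \<xi> i \<omega> = 0 \<or> \<xi> i \<omega> = 1"
    and a: "0 < a" and b: "0 < b"
  shows "\<exists>Z\<in>events. prob Z \<le> b / a \<and> (\<forall>\<omega>\<in>space M - Z.
    (\<Sum>i<N. ennreal (\<xi> i \<omega>) * (\<integral>\<^sup>+r\<in>{t i<..t (Suc i)}. ennreal ((norm (elementary_process n p X r \<omega> - G i \<omega>))\<^sup>2) \<partial>lborel)) \<le> ennreal b
    \<longrightarrow> (\<Sum>k\<in>blk ` {..<N}. (norm (\<Sum>i\<in>{i\<in>{..<N}. blk i = k}. \<Psi> i \<omega> (elementary_integral W n p X (t (Suc i)) \<omega> - elementary_integral W n p X (t i) \<omega>
         - dW (t i) (t (Suc i)) \<omega> *\<^sub>R G i \<omega>)))\<^sup>2) < a)"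
proof -
  define s r where "s z = max (t (fst z)) (min (t (Suc (fst z))) (p (snd z)))"
    and "r z = max (t (fst z)) (min (t (Suc (fst z))) (p (Suc (snd z))))" for z :: "nat \<times> nat"
  \<comment> \<open>Degenerate cells are dropped, as the isometry asks for intervals of positive
    length.\<close>
  define A where "A = {z \<in> {..<N} \<times> {..<n}. s z < r z}"
  define K where "K z \<omega> = \<Psi> (fst z) \<omega> (X (snd z) \<omega> - G (fst z) \<omega>)" for z \<omega>
  have tmono: "t i \<le> t j" if "i \<le> j" for i j
    by (rule lift_Suc_mono_le[of t]) (simp_all add: t that less_imp_le)
  have pstep: "p j \<le> p (Suc j)" if "j < n" for j using el that by (auto simp: elementary_def)
  have pmono: "p i \<le> p j" if "i \<le> j" "j \<le> n" for i j
    using that(1) that(2)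
  proof (induction j rule: dec_induct)
    case (step k)
    then show ?case using pstep[of k] by simp
  qed simp
  have tpos: "0 \<le> t i" for i using tmono[of 0 i] t0 by simp
  have fin: "finite A" by (simp add: A_def)
  have sr: "0 \<le> s z \<and> s z < r z" if "z \<in> A" for z
    using that tpos[of "fst z"] by (auto simp: A_def s_def max_def)
  have disj: "r x \<le> s y \<or> r y \<le> s x" if x: "x \<in> A" and y: "y \<in> A" and ne: "x \<noteq> y" for x y
  proof -
    obtain i j i' j' where xy: "x = (i, j)" "y = (i', j')" by (metis surj_pair)
    have b: "i < N" "j < n" "i' < N" "j' < n" using x y xy by (auto simp: A_def)
    consider "i < i'" | "i' < i" | "i = i'" "j < j'" | "i = i'" "j' < j"
      using ne xy by (metis linorder_neqE_nat)
    then show ?thesis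
    proof cases
      case 1
      then show ?thesis using tmono[of "Suc i" i'] t[of i] unfolding s_def r_def xy by auto
    next
      case 2
      then show ?thesis using tmono[of "Suc i'" i] t[of i'] unfolding s_def r_def xy by auto
    next
      case 3
      then show ?thesis using pmono[of "Suc j" j'] b unfolding s_def r_def xy by auto
    next
      case 4
      then show ?thesis using pmono[of "Suc j'" j] b unfolding s_def r_def xy by auto
    qed
  qed
  have XF: "X j \<in> borel_measurable (F (ennreal (p j)))" if "j < n" for j
    using el that by (auto simp: elementary_def intro: borel_measurable_simple_function)
  have KF: "K z \<in> borel_measurable (F (ennreal (s z)))" if z: "z \<in> A" for z
  proof -
    have b: "fst z < N" "snd z < n" "s z < r z" using z by (auto simp: A_def)
    \<comment> \<open>A cell of positive length starts no earlier than either grid point, so both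
      values are known at its left end.\<close>
    have le: "p (snd z) \<le> s z" "t (fst z) \<le> s z"
      using b(3) pstep[OF b(2)] unfolding s_def r_def by auto
    have "X (snd z) \<in> borel_measurable (F (ennreal (s z)))"
      by (rule measurable_F_real_mono[OF XF[OF b(2)] le(1)])
    moreover have "G (fst z) \<in> borel_measurable (F (ennreal (s z)))"
      by (rule measurable_F_real_mono[OF G[OF b(1)] le(2)])
    ultimately show ?thesis
      unfolding K_def[abs_def] using b(1) le(2) by (intro \<Psi>meas) auto
  qed
  obtain Z where Z: "Z \<in> events" "prob Z \<le> b / a"
    and Zb: "\<And>\<omega>. \<omega> \<in> space M - Z \<Longrightarrow> (\<Sum>x\<in>A. (norm (K x \<omega>))\<^sup>2 * (r x - s x)) \<le> b \<Longrightarrow>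
      (\<Sum>k\<in>(\<lambda>z. blk (fst z)) ` A. (norm (\<Sum>x\<in>{x\<in>A. blk (fst x) = k}. dW (s x) (r x) \<omega> *\<^sub>R K x \<omega>))\<^sup>2) < a"
    using truncated_increments_bad_set[of A s r K a b "\<lambda>z. blk (fst z)", OF fin sr disj KF a b] by blast
  show ?thesis
  proof (intro bexI conjI ballI impI)
    fix \<omega> assume w: "\<omega> \<in> space M - Z"
    let ?D = "\<lambda>i. elementary_integral W n p X (t (Suc i)) \<omega> - elementary_integral W n p X (t i) \<omega> - dW (t i) (t (Suc i)) \<omega> *\<^sub>R G i \<omega>"
    let ?f = "\<lambda>i x. ennreal ((norm (elementary_process n p X x \<omega> - G i \<omega>))\<^sup>2)"
    assume hyp: "(\<Sum>i<N. ennreal (\<xi> i \<omega>) * (\<integral>\<^sup>+x\<in>{t i<..t (Suc i)}. ?f i x \<partial>lborel)) \<le> ennreal b"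
    have cells: "{x \<in> A. fst x = i} = Pair i ` {j\<in>{..<n}. s (i, j) < r (i, j)}" if "i < N" for i
      using that by (auto simp: A_def)
    have D: "(\<Sum>x\<in>{x\<in>A. fst x = i}. dW (s x) (r x) \<omega> *\<^sub>R K x \<omega>) = \<Psi> i \<omega> (?D i)" if i: "i < N" for i
    proof -
      have "t (Suc i) \<le> p n" using tmono[of "Suc i" N] i pn by simp
      \<comment> \<open>The telescoping sum recovers the whole step because the elementary grid
        starts at 0 and reaches \<open>t N\<close>.\<close>
      have tel: "dW (t i) (t (Suc i)) \<omega> = (\<Sum>j<n. dW (s (i, j)) (r (i, j)) \<omega>)"
      proof -
        have "(\<Sum>j<n. dW (s (i, j)) (r (i, j)) \<omega>) = (\<Sum>j<n. W (max (t i) (min (t (Suc i)) (p (Suc j)))) \<omega> - W (max (t i) (min (t (Suc i)) (p j))) \<omega>)"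
          by (simp add: dW_def s_def r_def)
        also have "\<dots> = W (max (t i) (min (t (Suc i)) (p n))) \<omega> - W (max (t i) (min (t (Suc i)) (p 0))) \<omega>"
          by (rule sum_lessThan_telescope)
        also have "\<dots> = dW (t i) (t (Suc i)) \<omega>"
          using \<open>t (Suc i) \<le> p n\<close> p0 tpos[of i] t[of i] by (simp add: dW_def min_def max_def)
        finally show ?thesis ..
      qed
      have "?D i = (\<Sum>j<n. dW (s (i, j)) (r (i, j)) \<omega> *\<^sub>R X j \<omega>) - (\<Sum>j<n. dW (s (i, j)) (r (i, j)) \<omega>) *\<^sub>R G i \<omega>"
        using elementary_integral_increment[of "t i" "t (Suc i)" n p X \<omega>] t[of i] pstep tel
        by (simp add: s_def r_def less_imp_le)
      also have "\<dots> = (\<Sum>j<n. dW (s (i, j)) (r (i, j)) \<omega> *\<^sub>R (X j \<omega> - G i \<omega>))"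
        by (simp add: scaleR_sum_left scaleR_diff_right sum_subtractf)
      finally have "\<Psi> i \<omega> (?D i) = \<Psi> i \<omega> (\<Sum>j<n. dW (s (i, j)) (r (i, j)) \<omega> *\<^sub>R (X j \<omega> - G i \<omega>))"
        by (rule arg_cong)
      also have "\<dots> = (\<Sum>j<n. dW (s (i, j)) (r (i, j)) \<omega> *\<^sub>R K (i, j) \<omega>)"
        by (simp only: linear_sum[OF \<Psi>lin[OF i]] linear_scale[OF \<Psi>lin[OF i]] K_def fst_conv snd_conv)
      also have "\<dots> = (\<Sum>j\<in>{j\<in>{..<n}. s (i, j) < r (i, j)}. dW (s (i, j)) (r (i, j)) \<omega> *\<^sub>R K (i, j) \<omega>)"
      proof (rule sum.mono_neutral_right)
        show "\<forall>j\<in>{..<n} - {j \<in> {..<n}. s (i, j) < r (i, j)}. dW (s (i, j)) (r (i, j)) \<omega> *\<^sub>R K (i, j) \<omega> = 0"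
        proof
          fix j assume "j \<in> {..<n} - {j \<in> {..<n}. s (i, j) < r (i, j)}"
          then have "s (i, j) = r (i, j)" using pstep[of j] by (auto simp: s_def r_def min_def max_def split: if_splits)
          then show "dW (s (i, j)) (r (i, j)) \<omega> *\<^sub>R K (i, j) \<omega> = 0" by (simp add: dW_def)
        qed
      qed auto
      finally show ?thesis unfolding cells[OF i] by (subst sum.reindex) (auto simp: inj_on_def)
    qed
    \<comment> \<open>The elementary process equals \<open>X j\<close> on the cell
      \<open>(i, j)\<close>, and the cells of a step are disjoint, so the quadratic sum is the exact
      integral over a part of that step.\<close>
    have Q: "ennreal (\<Sum>x\<in>{x\<in>A. fst x = i}. (norm (K x \<omega>))\<^sup>2 * (r x - s x))
        \<le> ennreal (\<xi> i \<omega>) * (\<integral>\<^sup>+x\<in>{t i<..t (Suc i)}. ?f i x \<partial>lborel)" if i: "i < N" for i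
    proof -
      let ?J = "{j\<in>{..<n}. s (i, j) < r (i, j)}"
      have "ennreal (\<Sum>x\<in>{x\<in>A. fst x = i}. (norm (K x \<omega>))\<^sup>2 * (r x - s x))
          = ennreal (\<Sum>j\<in>?J. (norm (K (i, j) \<omega>))\<^sup>2 * (r (i, j) - s (i, j)))"
        unfolding cells[OF i] by (subst sum.reindex) (auto simp: inj_on_def)
      also have "\<dots> \<le> ennreal (\<Sum>j\<in>?J. \<xi> i \<omega> * ((norm (X j \<omega> - G i \<omega>))\<^sup>2 * (r (i, j) - s (i, j))))"
      proof (intro ennreal_leI sum_mono)
        fix j assume j: "j \<in> ?J"
        have "(norm (K (i, j) \<omega>))\<^sup>2 \<le> (\<xi> i \<omega> * norm (X j \<omega> - G i \<omega>))\<^sup>2"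
          using \<Psi>bd[OF i] by (intro power_mono) (auto simp: K_def)
        also have "\<dots> = \<xi> i \<omega> * (norm (X j \<omega> - G i \<omega>))\<^sup>2" using \<xi>[OF i, of \<omega>] by auto
        finally have "(norm (K (i, j) \<omega>))\<^sup>2 * (r (i, j) - s (i, j)) \<le> \<xi> i \<omega> * (norm (X j \<omega> - G i \<omega>))\<^sup>2 * (r (i, j) - s (i, j))"
          using j by (intro mult_right_mono) auto
        then show "(norm (K (i, j) \<omega>))\<^sup>2 * (r (i, j) - s (i, j)) \<le> \<xi> i \<omega> * ((norm (X j \<omega> - G i \<omega>))\<^sup>2 * (r (i, j) - s (i, j)))"
          by (simp add: mult.assoc)
      qed
      also have "\<dots> = ennreal (\<xi> i \<omega>) * (\<Sum>j\<in>?J. ennreal ((norm (X j \<omega> - G i \<omega>))\<^sup>2 * (r (i, j) - s (i, j))))"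
        using \<xi>[OF i, of \<omega>] by (auto simp: sum_distrib_left[symmetric] intro!: sum_ennreal[symmetric])
      also have "(\<Sum>j\<in>?J. ennreal ((norm (X j \<omega> - G i \<omega>))\<^sup>2 * (r (i, j) - s (i, j))))
          = (\<Sum>j\<in>?J. (\<integral>\<^sup>+x. ?f i x * indicator {s (i, j)<..r (i, j)} x \<partial>lborel))"
      proof (intro sum.cong refl)
        fix j assume j: "j \<in> ?J"
        have val: "elementary_process n p X x \<omega> = X j \<omega>" if x: "x \<in> {s (i, j)<..r (i, j)}" for x
        proof -
          have xj: "x \<in> {p j<..p (Suc j)}" using x j by (auto simp: s_def r_def min_def max_def split: if_splits)
          have "x \<notin> {p k<..p (Suc k)}" if "k < n" "k \<noteq> j" for k
            using that xj j pmono[of "Suc k" j] pmono[of "Suc j" k] by (cases "k < j") auto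
          then have "elementary_process n p X x \<omega> = (\<Sum>k<n. if k = j then X j \<omega> else 0)"
            unfolding elementary_process_def using xj by (intro sum.cong) (auto simp: indicator_def)
          then show ?thesis using j by simp
        qed
        have "(\<integral>\<^sup>+x. ?f i x * indicator {s (i, j)<..r (i, j)} x \<partial>lborel)
            = (\<integral>\<^sup>+x. ennreal ((norm (X j \<omega> - G i \<omega>))\<^sup>2) * indicator {s (i, j)<..r (i, j)} x \<partial>lborel)"
          using val by (intro nn_integral_cong) (auto simp: indicator_def)
        also have "\<dots> = ennreal ((norm (X j \<omega> - G i \<omega>))\<^sup>2 * (r (i, j) - s (i, j)))"
          using j by (simp add: nn_integral_cmult_indicator ennreal_mult)
        finally show "ennreal ((norm (X j \<omega> - G i \<omega>))\<^sup>2 * (r (i, j) - s (i, j))) = (\<integral>\<^sup>+x. ?f i x * indicator {s (i, j)<..r (i, j)} x \<partial>lborel)" ..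
      qed
      also have "(\<Sum>j\<in>?J. (\<integral>\<^sup>+x. ?f i x * indicator {s (i, j)<..r (i, j)} x \<partial>lborel))
          = (\<integral>\<^sup>+x. (\<Sum>j\<in>?J. ?f i x * indicator {s (i, j)<..r (i, j)} x) \<partial>lborel)"
        by (rule nn_integral_sum[symmetric]) measurable
      also have "\<dots> \<le> (\<integral>\<^sup>+x\<in>{t i<..t (Suc i)}. ?f i x \<partial>lborel)"
      proof (intro nn_integral_mono)
        fix x
        have disj': "disjoint_family_on (\<lambda>j. {s (i, j)<..r (i, j)}) ?J"
          unfolding disjoint_family_on_def
        proof (intro ballI impI)
          fix j k assume "j \<in> ?J" "k \<in> ?J" "j \<noteq> k"
          then have "r (i, j) \<le> s (i, k) \<or> r (i, k) \<le> s (i, j)" using i by (intro disj) (auto simp: A_def)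
          then show "{s (i, j)<..r (i, j)} \<inter> {s (i, k)<..r (i, k)} = {}" by auto
        qed
        have "(\<Sum>j\<in>?J. ?f i x * indicator {s (i, j)<..r (i, j)} x) = ?f i x * (\<Sum>j\<in>?J. indicator {s (i, j)<..r (i, j)} x)"
          by (simp add: sum_distrib_left)
        also have "(\<Sum>j\<in>?J. indicator {s (i, j)<..r (i, j)} x) = (indicator (\<Union>j\<in>?J. {s (i, j)<..r (i, j)}) x :: ennreal)"
          using disj' by (intro indicator_UN_disjoint[symmetric]) auto
        also have "\<dots> \<le> indicator {t i<..t (Suc i)} x"
          using t[of i] by (intro indicator_leI) (auto simp: s_def r_def)
        finally show "(\<Sum>j\<in>?J. ?f i x * indicator {s (i, j)<..r (i, j)} x) \<le> ?f i x * indicator {t i<..t (Suc i)} x"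
          by (simp add: mult_left_mono)
      qed
      finally show ?thesis by (simp add: mult_left_mono)
    qed
    have split: "(\<Sum>x\<in>A. h x) = (\<Sum>i<N. \<Sum>x\<in>{x\<in>A. fst x = i}. h x)" for h :: "nat \<times> nat \<Rightarrow> real"
      using fin by (intro sum.group[symmetric]) (auto simp: A_def)
    have "ennreal (\<Sum>x\<in>A. (norm (K x \<omega>))\<^sup>2 * (r x - s x))
        = (\<Sum>i<N. ennreal (\<Sum>x\<in>{x\<in>A. fst x = i}. (norm (K x \<omega>))\<^sup>2 * (r x - s x)))"
      unfolding split using sr by (intro sum_ennreal[symmetric] sum_nonneg) (auto simp: less_imp_le)
    also have "\<dots> \<le> ennreal b" using Q by (intro order_trans[OF sum_mono hyp]) auto
    finally have "(\<Sum>x\<in>A. (norm (K x \<omega>))\<^sup>2 * (r x - s x)) \<le> b" using b by simp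
    from Zb[OF w this]
    have lt: "(\<Sum>k\<in>(\<lambda>z. blk (fst z)) ` A. (norm (\<Sum>x\<in>{x\<in>A. blk (fst x) = k}. dW (s x) (r x) \<omega> *\<^sub>R K x \<omega>))\<^sup>2) < a" .
    have inner: "(\<Sum>i\<in>{i\<in>{..<N}. blk i = k}. \<Psi> i \<omega> (?D i)) = (\<Sum>x\<in>{x\<in>A. blk (fst x) = k}. dW (s x) (r x) \<omega> *\<^sub>R K x \<omega>)" for k
    proof -
      have "(\<Sum>i\<in>{i\<in>{..<N}. blk i = k}. \<Psi> i \<omega> (?D i)) = (\<Sum>i\<in>{i\<in>{..<N}. blk i = k}. \<Sum>x\<in>{x\<in>{x\<in>A. blk (fst x) = k}. fst x = i}. dW (s x) (r x) \<omega> *\<^sub>R K x \<omega>)"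
      proof (intro sum.cong refl)
        fix i assume i: "i \<in> {i\<in>{..<N}. blk i = k}"
        then have "{x\<in>{x\<in>A. blk (fst x) = k}. fst x = i} = {x \<in> A. fst x = i}" by auto
        then show "\<Psi> i \<omega> (?D i) = (\<Sum>x\<in>{x\<in>{x\<in>A. blk (fst x) = k}. fst x = i}. dW (s x) (r x) \<omega> *\<^sub>R K x \<omega>)"
          using D[of i] i by simp
      qed
      also have "\<dots> = (\<Sum>x\<in>{x\<in>A. blk (fst x) = k}. dW (s x) (r x) \<omega> *\<^sub>R K x \<omega>)"
        using fin by (intro sum.group) (auto simp: A_def)
      finally show ?thesis .
    qed
    have "(\<Sum>k\<in>blk ` {..<N}. (norm (\<Sum>i\<in>{i\<in>{..<N}. blk i = k}. \<Psi> i \<omega> (?D i)))\<^sup>2)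
        = (\<Sum>k\<in>(\<lambda>z. blk (fst z)) ` A. (norm (\<Sum>x\<in>{x\<in>A. blk (fst x) = k}. dW (s x) (r x) \<omega> *\<^sub>R K x \<omega>))\<^sup>2)"
      unfolding inner
    proof (rule sum.mono_neutral_right)
      show "(\<lambda>z. blk (fst z)) ` A \<subseteq> blk ` {..<N}" by (auto simp: A_def)
      show "\<forall>k\<in>blk ` {..<N} - (\<lambda>z. blk (fst z)) ` A. (norm (\<Sum>x\<in>{x\<in>A. blk (fst x) = k}. dW (s x) (r x) \<omega> *\<^sub>R K x \<omega>))\<^sup>2 = 0"
      proof
        fix k assume "k \<in> blk ` {..<N} - (\<lambda>z. blk (fst z)) ` A"
        then have "\<And>x. x \<in> A \<Longrightarrow> blk (fst x) \<noteq> k" by blast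
        then have "{x\<in>A. blk (fst x) = k} = {}" by blast
        then show "(norm (\<Sum>x\<in>{x\<in>A. blk (fst x) = k}. dW (s x) (r x) \<omega> *\<^sub>R K x \<omega>))\<^sup>2 = 0" by (simp only: sum.empty) simp
      qed
    qed simp
    with lt show "(\<Sum>k\<in>blk ` {..<N}. (norm (\<Sum>i\<in>{i\<in>{..<N}. blk i = k}. \<Psi> i \<omega> (?D i)))\<^sup>2) < a" by simp
  qed (use Z in auto)
qed

end

context brownian_basis
begin

text \<open>A cell of value 0 is added at either end, so that the grid starts at 0 and reaches
  \<open>T\<close> as \<open>elementary_grid_bad_set\<close> demands; process and integral stay the
  same.\<close>

lemma elementary_extend:
  assumes el: "elementary F n p X"
  obtains n' p' X' where "elementary F n' p' X'" "p' 0 = 0" "T \<le> p' n'"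
    "elementary_process n' p' X' = elementary_process n p X"
    "elementary_integral W n' p' X' = elementary_integral W n p X"
proof -
  define p' where "p' j = (case j of 0 \<Rightarrow> 0 | Suc j \<Rightarrow> if j \<le> n then p j else max (p n) T)" for j
  define X' where "X' j = (case j of 0 \<Rightarrow> (\<lambda>_. 0) | Suc j \<Rightarrow> if j < n then X j else (\<lambda>_. 0))" for j
  have p0: "0 \<le> p 0" and st: "\<And>i. i < n \<Longrightarrow> p i \<le> p (Suc i) \<and> simple_function (F (ennreal (p i))) (X i)"
    using el by (auto simp: elementary_def)
  have "elementary F (Suc (Suc n)) p' X'"
    unfolding elementary_def
  proof (intro conjI allI impI)
    fix i assume "i < Suc (Suc n)"
    then consider "i = 0" | j where "i = Suc j" "j < n" | "i = Suc n" by (cases i) (auto simp: less_Suc_eq)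
    then have "p' i \<le> p' (Suc i) \<and> simple_function (F (ennreal (p' i))) (X' i)"
      using p0 st by cases (auto simp: p'_def X'_def)
    then show "p' i \<le> p' (Suc i)" "simple_function (F (ennreal (p' i))) (X' i)" by auto
  qed (simp add: p'_def)
  moreover have "elementary_process (Suc (Suc n)) p' X' = elementary_process n p X"
    unfolding elementary_process_def sum.lessThan_Suc_shift[where n="Suc n"]
    by (intro ext) (simp add: p'_def X'_def)
  moreover have "elementary_integral W (Suc (Suc n)) p' X' = elementary_integral W n p X"
    unfolding elementary_integral_def sum.lessThan_Suc_shift[where n="Suc n"]
    by (intro ext) (simp add: p'_def X'_def)
  ultimately show ?thesis using that[of "Suc (Suc n)" p' X'] by (simp add: p'_def)
qed

text \<open>The estimate for elementary integrals passes to their almost sure limit. If the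
  integrand oscillates little on the active steps, the approximations eventually stay within the
  quadratic budget \<open>b\<close>. A path outside the limiting bad set escapes \<open>Z m\<close>
  for infinitely many \<open>m\<close>, and this suffices because the estimated quantity
  converges.\<close>

lemma ito_grid_bad_set:
  fixes H I :: "real \<Rightarrow> 'w \<Rightarrow> 'h::{real_inner, second_countable_topology}"
    and \<Psi> :: "nat \<Rightarrow> 'w \<Rightarrow> 'h \<Rightarrow> 'k::{real_inner, second_countable_topology}"
    and blk :: "nat \<Rightarrow> 'j"
  assumes ito: "ito_integral M F W H I"
    and t0: "t 0 = 0" and t: "\<And>i. t i < t (Suc i)" and N: "0 < N"
    and \<Psi>lin: "\<And>i \<omega>. i < N \<Longrightarrow> linear (\<Psi> i \<omega>)"
    and \<Psi>bd: "\<And>i \<omega> x. i < N \<Longrightarrow> norm (\<Psi> i \<omega> x) \<le> \<xi> i \<omega> * norm x"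
    and \<Psi>meas: "\<And>i u Z. i < N \<Longrightarrow> t i \<le> u \<Longrightarrow> Z \<in> borel_measurable (F (ennreal u)) \<Longrightarrow>
        (\<lambda>\<omega>. \<Psi> i \<omega> (Z \<omega>)) \<in> borel_measurable (F (ennreal u))"
    and \<xi>: "\<And>i \<omega>. i < N \<Longrightarrow> \<xi> i \<omega> = 0 \<or> \<xi> i \<omega> = 1"
    and a: "0 < a" and b: "0 < b"
  shows "\<exists>Z\<in>events. prob Z \<le> b / a \<and> (AE \<omega> in M. \<omega> \<notin> Z \<longrightarrow>
    (\<forall>i<N. \<xi> i \<omega> = 1 \<longrightarrow> (\<forall>r\<in>{t i<..t (Suc i)}. (norm (H r \<omega> - H (t i) \<omega>))\<^sup>2 * (4 * t N) \<le> b)) \<longrightarrow>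
    (\<Sum>k\<in>blk ` {..<N}. (norm (\<Sum>i\<in>{i\<in>{..<N}. blk i = k}. \<Psi> i \<omega> (I (t (Suc i)) \<omega> - I (t i) \<omega>
         - dW (t i) (t (Suc i)) \<omega> *\<^sub>R H (t i) \<omega>)))\<^sup>2) \<le> a)"
proof -
  have tmono: "t i \<le> t j" if "i \<le> j" for i j
    by (rule lift_Suc_mono_le[of t]) (simp_all add: t that less_imp_le)
  have tpos: "0 \<le> t i" for i using tmono[of 0 i] t0 by simp
  have T: "0 < t N" using tmono[of 1 N] t[of 0] t0 N by simp
  from ito obtain n p X where Hm: "(\<lambda>(t, \<omega>). H t \<omega>) \<in> borel_measurable (predictable_sigma F)"
    and el: "\<And>m. elementary F (n m) (p m) (X m)"
    and conv: "AE \<omega> in M. \<forall>T\<ge>0. (\<lambda>m. \<integral>\<^sup>+t\<in>{0..T}. ennreal ((norm (elementary_process (n m) (p m) (X m) t \<omega> - H t \<omega>))\<^sup>2) \<partial>lborel)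
            \<longlonglongrightarrow> 0 \<and> uniform_limit {0..T} (\<lambda>m t. elementary_integral W (n m) (p m) (X m) t \<omega>) (\<lambda>t. I t \<omega>) sequentially"
    unfolding ito_integral_def by blast
  let ?E = "\<lambda>m. elementary_process (n m) (p m) (X m)" and ?J = "\<lambda>m. elementary_integral W (n m) (p m) (X m)"
  have HF: "H (t i) \<in> borel_measurable (F (ennreal (t i)))" for i
    using predictable_adapted[OF Hm tpos] .
  let ?U = "\<lambda>\<omega> J. (\<Sum>k\<in>blk ` {..<N}. (norm (\<Sum>i\<in>{i\<in>{..<N}. blk i = k}. \<Psi> i \<omega> (J (t (Suc i)) \<omega> - J (t i) \<omega>
         - dW (t i) (t (Suc i)) \<omega> *\<^sub>R H (t i) \<omega>)))\<^sup>2)"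
  let ?Q = "\<lambda>\<omega> m. (\<Sum>i<N. ennreal (\<xi> i \<omega>) * (\<integral>\<^sup>+r\<in>{t i<..t (Suc i)}. ennreal ((norm (?E m r \<omega> - H (t i) \<omega>))\<^sup>2) \<partial>lborel))"
  define P where "P m Z \<longleftrightarrow> Z \<in> events \<and> prob Z \<le> b / a \<and>
    (\<forall>\<omega>\<in>space M - Z. ?Q \<omega> m \<le> ennreal b \<longrightarrow> ?U \<omega> (?J m) < a)" for m Z
  have "\<exists>Z. P m Z" for m
  proof -
    have "\<exists>Z\<in>events. prob Z \<le> b / a \<and> (\<forall>\<omega>\<in>space M - Z. ?Q \<omega> m \<le> ennreal b \<longrightarrow> ?U \<omega> (?J m) < a)"
    proof -
    obtain n' p' X' where e: "elementary F n' p' X'" "p' 0 = 0" "t N \<le> p' n'"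
      and eq: "elementary_process n' p' X' = ?E m" "elementary_integral W n' p' X' = ?J m"
      by (rule elementary_extend[OF el[of m]])
    show ?thesis
      unfolding eq[symmetric]
    proof (rule elementary_grid_bad_set[where t=t and N=N and G="\<lambda>i. H (t i)" and \<Psi>=\<Psi> and \<xi>=\<xi> and a=a and b=b and blk=blk
          and n=n' and p=p' and X=X'])
      show "elementary F n' p' X'" "p' 0 = 0" "t N \<le> p' n'" by (fact e)+
      show "t 0 = 0" "0 < a" "0 < b" by (fact t0 a b)+
      fix i show "t i < t (Suc i)" by (rule t)
      assume i: "i < N"
      show "H (t i) \<in> borel_measurable (F (ennreal (t i)))" by (rule HF)
      fix \<omega> x
      show "linear (\<Psi> i \<omega>)" by (rule \<Psi>lin[OF i])
      show "norm (\<Psi> i \<omega> x) \<le> \<xi> i \<omega> * norm x" by (rule \<Psi>bd[OF i])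
      show "\<xi> i \<omega> = 0 \<or> \<xi> i \<omega> = 1" by (rule \<xi>[OF i])
    next
      fix i u and Z :: "'w \<Rightarrow> 'h" assume "i < N" "t i \<le> u" "Z \<in> borel_measurable (F (ennreal u))"
      then show "(\<lambda>\<omega>. \<Psi> i \<omega> (Z \<omega>)) \<in> borel_measurable (F (ennreal u))" by (rule \<Psi>meas)
    qed
  qed
    then show ?thesis unfolding P_def by blast
  qed
  then have "\<exists>Z. \<forall>m. P m (Z m)" by (intro choice allI)
  then obtain Z where "\<forall>m. P m (Z m)" by (elim exE)
  then have Z: "\<And>m. Z m \<in> events" "\<And>m. prob (Z m) \<le> b / a"
    and ZU: "\<And>m \<omega>. \<omega> \<in> space M - Z m \<Longrightarrow> ?Q \<omega> m \<le> ennreal b \<Longrightarrow> ?U \<omega> (?J m) < a"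
    by (simp_all add: P_def)
  let ?Z = "{\<omega> \<in> space M. \<forall>\<^sub>F m in sequentially. \<omega> \<in> Z m}"
  have Zi: "?Z \<in> events" "prob ?Z \<le> b / a"
    using prob_eventually_le[OF Z(1) Z(2) tendsto_const] by auto
  have "AE \<omega> in M. \<omega> \<notin> ?Z \<longrightarrow>
    (\<forall>i<N. \<xi> i \<omega> = 1 \<longrightarrow> (\<forall>r\<in>{t i<..t (Suc i)}. (norm (H r \<omega> - H (t i) \<omega>))\<^sup>2 * (4 * t N) \<le> b)) \<longrightarrow> ?U \<omega> I \<le> a"
    using conv AE_space
  proof eventually_elim
    case (elim \<omega>)
    show ?case
    proof (intro impI)
      assume nZ: "\<omega> \<notin> ?Z"
        and path: "\<forall>i<N. \<xi> i \<omega> = 1 \<longrightarrow> (\<forall>r\<in>{t i<..t (Suc i)}. (norm (H r \<omega> - H (t i) \<omega>))\<^sup>2 * (4 * t N) \<le> b)"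
      have c1: "(\<lambda>m. \<integral>\<^sup>+r\<in>{0..t N}. ennreal ((norm (?E m r \<omega> - H r \<omega>))\<^sup>2) \<partial>lborel) \<longlonglongrightarrow> 0"
        and c2: "uniform_limit {0..t N} (\<lambda>m t. ?J m t \<omega>) (\<lambda>t. I t \<omega>) sequentially"
        using elim(1) T by auto
      \<comment> \<open>Half of \<open>b\<close> is reserved for the oscillation of \<open>H\<close>
        within a step, the other half for the distance to the approximation. The factor 2 from
        squaring a sum turns this half into the \<open>4 * t N\<close> of the oscillation
        condition.\<close>
      have Qle: "?Q \<omega> m \<le> 2 * (\<integral>\<^sup>+r\<in>{0..t N}. ennreal ((norm (?E m r \<omega> - H r \<omega>))\<^sup>2) \<partial>lborel) + ennreal (b / 2)" for m
      proof -
        define h where "h r = ennreal ((norm (?E m r \<omega> - H r \<omega>))\<^sup>2) * indicator {0..t N} r" for r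
        have Hp: "(\<lambda>r. H r \<omega>) \<in> borel_measurable (restrict_space borel {0..})"
          by (rule predictable_path_measurable[OF Hm elim(2)])
        have Ep: "(\<lambda>r. ?E m r \<omega>) \<in> borel_measurable (restrict_space borel {0..})"
          by (rule measurable_restrict_space1) measurable
        have "(\<lambda>r. ennreal ((norm (?E m r \<omega> - H r \<omega>))\<^sup>2)) \<in> borel_measurable (restrict_space borel {0..})"
          using Hp Ep by measurable
        then have "(\<lambda>r. ennreal ((norm (?E m r \<omega> - H r \<omega>))\<^sup>2) * indicator {0..} r) \<in> borel_measurable borel"
          by (subst (asm) borel_measurable_restrict_space_iff_ennreal) auto
        then have "(\<lambda>r. (ennreal ((norm (?E m r \<omega> - H r \<omega>))\<^sup>2) * indicator {0..} r) * indicator {0..t N} r) \<in> borel_measurable borel"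
          by measurable
        also have "(\<lambda>r. (ennreal ((norm (?E m r \<omega> - H r \<omega>))\<^sup>2) * indicator {0..} r) * indicator {0..t N} r) = h"
          by (auto simp: h_def indicator_def)
        finally have [measurable]: "h \<in> borel_measurable borel" .
        have "?Q \<omega> m \<le> (\<Sum>i<N. (\<integral>\<^sup>+r. (2 * h r + ennreal (b / (2 * t N))) * indicator {t i<..t (Suc i)} r \<partial>lborel))"
        proof (rule sum_mono)
          fix i assume i: "i \<in> {..<N}"
          show "ennreal (\<xi> i \<omega>) * (\<integral>\<^sup>+r\<in>{t i<..t (Suc i)}. ennreal ((norm (?E m r \<omega> - H (t i) \<omega>))\<^sup>2) \<partial>lborel)
              \<le> (\<integral>\<^sup>+r. (2 * h r + ennreal (b / (2 * t N))) * indicator {t i<..t (Suc i)} r \<partial>lborel)"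
          proof (cases "\<xi> i \<omega> = 1")
            case True
            have "(\<integral>\<^sup>+r\<in>{t i<..t (Suc i)}. ennreal ((norm (?E m r \<omega> - H (t i) \<omega>))\<^sup>2) \<partial>lborel)
              \<le> (\<integral>\<^sup>+r. (2 * h r + ennreal (b / (2 * t N))) * indicator {t i<..t (Suc i)} r \<partial>lborel)"
            proof (intro nn_integral_mono)
              fix r
              show "ennreal ((norm (?E m r \<omega> - H (t i) \<omega>))\<^sup>2) * indicator {t i<..t (Suc i)} r
                  \<le> (2 * h r + ennreal (b / (2 * t N))) * indicator {t i<..t (Suc i)} r"
              proof (cases "r \<in> {t i<..t (Suc i)}")
                case r: True
                have rT: "r \<in> {0..t N}" using r tpos[of i] tmono[of "Suc i" N] i by auto
                have "(norm (H r \<omega> - H (t i) \<omega>))\<^sup>2 * (4 * t N) \<le> b" using path True i r by auto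
                then have p2: "2 * (norm (H r \<omega> - H (t i) \<omega>))\<^sup>2 \<le> b / (2 * t N)" using T by (simp add: field_simps)
                have "norm (?E m r \<omega> - H (t i) \<omega>) \<le> norm (?E m r \<omega> - H r \<omega>) + norm (H r \<omega> - H (t i) \<omega>)"
                  using norm_triangle_ineq[of "?E m r \<omega> - H r \<omega>" "H r \<omega> - H (t i) \<omega>"] by simp
                then have "(norm (?E m r \<omega> - H (t i) \<omega>))\<^sup>2 \<le> (norm (?E m r \<omega> - H r \<omega>) + norm (H r \<omega> - H (t i) \<omega>))\<^sup>2"
                  by (intro power_mono) auto
                also have "\<dots> \<le> 2 * (norm (?E m r \<omega> - H r \<omega>))\<^sup>2 + 2 * (norm (H r \<omega> - H (t i) \<omega>))\<^sup>2"
                  using sum_squares_bound[of "norm (?E m r \<omega> - H r \<omega>)" "norm (H r \<omega> - H (t i) \<omega>)"] by (simp add: power2_sum)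
                finally have "(norm (?E m r \<omega> - H (t i) \<omega>))\<^sup>2 \<le> 2 * (norm (?E m r \<omega> - H r \<omega>))\<^sup>2 + b / (2 * t N)"
                  using p2 by simp
                then have "ennreal ((norm (?E m r \<omega> - H (t i) \<omega>))\<^sup>2) \<le> ennreal (2 * (norm (?E m r \<omega> - H r \<omega>))\<^sup>2 + b / (2 * t N))"
                  by (rule ennreal_leI)
                also have "\<dots> = 2 * h r + ennreal (b / (2 * t N))"
                  using rT T b by (simp add: h_def ennreal_mult)
                finally show ?thesis using r by simp
              qed simp
            qed
            then show ?thesis using True by simp
          next
            case False
            then show ?thesis using \<xi>[of i \<omega>] i by auto
          qed
        qed
        also have "\<dots> = (\<integral>\<^sup>+r. (\<Sum>i<N. (2 * h r + ennreal (b / (2 * t N))) * indicator {t i<..t (Suc i)} r) \<partial>lborel)"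
          by (rule nn_integral_sum[symmetric]) measurable
        also have "\<dots> \<le> (\<integral>\<^sup>+r. 2 * h r + ennreal (b / (2 * t N)) * indicator {0..t N} r \<partial>lborel)"
        proof (intro nn_integral_mono)
          fix r
          have "disjoint_family_on (\<lambda>i. {t i<..t (Suc i)}) {..<N}"
            unfolding disjoint_family_on_def
          proof (intro ballI impI)
            fix i j :: nat assume "i \<noteq> j"
            then show "{t i<..t (Suc i)} \<inter> {t j<..t (Suc j)} = {}"
              using tmono[of "Suc i" j] tmono[of "Suc j" i] by (cases "i < j") auto
          qed
          then have "(\<Sum>i<N. indicator {t i<..t (Suc i)} r) = (indicator (\<Union>i<N. {t i<..t (Suc i)}) r :: ennreal)"
            by (intro indicator_UN_disjoint[symmetric]) auto
          also have "\<dots> \<le> indicator {0..t N} r"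
          proof (rule indicator_leI)
            assume "r \<in> (\<Union>i<N. {t i<..t (Suc i)})"
            then obtain i where "i < N" "r \<in> {t i<..t (Suc i)}" by auto
            then show "r \<in> {0..t N}" using tpos[of i] tmono[of "Suc i" N] by auto
          qed
          finally have le: "(\<Sum>i<N. indicator {t i<..t (Suc i)} r) \<le> (indicator {0..t N} r :: ennreal)" .
          have "(\<Sum>i<N. (2 * h r + ennreal (b / (2 * t N))) * indicator {t i<..t (Suc i)} r)
              = (2 * h r + ennreal (b / (2 * t N))) * (\<Sum>i<N. indicator {t i<..t (Suc i)} r)"
            by (simp only: sum_distrib_left)
          also have "\<dots> \<le> (2 * h r + ennreal (b / (2 * t N))) * indicator {0..t N} r"
            by (intro mult_left_mono le) auto
          also have "\<dots> = 2 * h r + ennreal (b / (2 * t N)) * indicator {0..t N} r"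
            by (auto simp: h_def indicator_def)
          finally show "(\<Sum>i<N. (2 * h r + ennreal (b / (2 * t N))) * indicator {t i<..t (Suc i)} r)
            \<le> 2 * h r + ennreal (b / (2 * t N)) * indicator {0..t N} r" .
        qed
        also have "\<dots> = 2 * (\<integral>\<^sup>+r. h r \<partial>lborel) + ennreal (b / (2 * t N)) * ennreal (t N)"
          using T by (simp add: nn_integral_add nn_integral_cmult nn_integral_cmult_indicator)
        also have "ennreal (b / (2 * t N)) * ennreal (t N) = ennreal (b / 2)"
          using T b by (simp add: ennreal_mult[symmetric])
        finally show ?thesis unfolding h_def .
      qed
      have "\<forall>\<^sub>F m in sequentially. (\<integral>\<^sup>+r\<in>{0..t N}. ennreal ((norm (?E m r \<omega> - H r \<omega>))\<^sup>2) \<partial>lborel) < ennreal (b / 4)"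
        using b by (intro order_tendstoD(2)[OF c1]) simp
      then have Qev: "\<forall>\<^sub>F m in sequentially. ?Q \<omega> m \<le> ennreal b"
      proof eventually_elim
        case (elim m)
        have "?Q \<omega> m \<le> 2 * ennreal (b / 4) + ennreal (b / 2)"
          using elim by (intro order_trans[OF Qle] add_right_mono mult_left_mono less_imp_le) auto
        also have "2 * ennreal (b / 4) = ennreal (b / 2)" using b ennreal_mult[of 2 "b / 4"] by simp
        also have "ennreal (b / 2) + ennreal (b / 2) = ennreal b"
          using b by (subst ennreal_plus[symmetric]) auto
        finally show ?case .
      qed
      have Jlim: "(\<lambda>m. ?J m (t i) \<omega>) \<longlonglongrightarrow> I (t i) \<omega>" if "i \<le> N" for i
        by (rule tendsto_uniform_limitI[OF c2]) (use tpos tmono[OF that] in auto)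
      have bl: "bounded_linear (\<Psi> i \<omega>)" if "i < N" for i
      proof -
        have "norm (\<Psi> i \<omega> x) \<le> norm x * \<xi> i \<omega>" for x using \<Psi>bd[OF that, of \<omega> x] by (simp add: mult.commute)
        then show ?thesis using \<Psi>lin[OF that, of \<omega>]
          by (intro bounded_linear_intro[where K="\<xi> i \<omega>"]) (auto simp: linear_add linear_scale)
      qed
      have Ulim: "(\<lambda>m. ?U \<omega> (?J m)) \<longlonglongrightarrow> ?U \<omega> I"
        by (intro tendsto_sum tendsto_power tendsto_norm bounded_linear.tendsto[OF bl] tendsto_diff tendsto_const Jlim) auto
      show "?U \<omega> I \<le> a"
      proof (rule ccontr)
        assume "\<not> ?U \<omega> I \<le> a"
        then have "\<forall>\<^sub>F m in sequentially. a < ?U \<omega> (?J m)"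
          by (intro order_tendstoD(1)[OF Ulim]) simp
        then have "\<forall>\<^sub>F m in sequentially. \<omega> \<in> Z m"
          using Qev
        proof eventually_elim
          case (elim m)
          then show ?case using ZU[of \<omega> m] \<open>\<omega> \<in> space M\<close> by fastforce
        qed
        then show False using nZ \<open>\<omega> \<in> space M\<close> by simp
      qed
    qed
  qed
  then show ?thesis using Zi by blast
qed

end

section \<open>The logarithmic Lyapunov function\<close>

text \<open>The difference of the two sides has derivative \<open>x ^ 3 / (1 + x)\<close>, which has
  the sign of \<open>x\<close>, so its minimum is at 0. A one-sided bound with a cubic error is all
  that the expansion of the logarithm asks for.\<close>

lemma ln_one_plus_le_cubic:
  fixes u :: real
  assumes "-1 < u"
  shows "ln (1 + u) \<le> u - u\<^sup>2 / 2 + u ^ 3 / 3"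
proof -
  define f where "f u = u - u\<^sup>2 / 2 + u ^ 3 / 3 - ln (1 + u)" for u :: real
  have der: "(f has_real_derivative x ^ 3 / (1 + x)) (at x)" if "-1 < x" for x
  proof -
    have "(f has_real_derivative 1 - x + x\<^sup>2 - 1 / (1 + x)) (at x)"
      unfolding f_def[abs_def] using that
      by (auto intro!: derivative_eq_intros simp: power2_eq_square field_simps)
    moreover have "1 - x + x\<^sup>2 - 1 / (1 + x) = x ^ 3 / (1 + x)"
      using that by (simp add: field_simps power2_eq_square power3_eq_cube)
    ultimately show ?thesis by simp
  qed
  have "f 0 \<le> f u"
  proof (cases "0 \<le> u")
    case True
    show ?thesis
    proof (rule DERIV_nonneg_imp_nondecreasing[of 0 u f, OF True])
      fix x assume "0 \<le> x" "x \<le> u"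
      then have "0 \<le> x ^ 3 / (1 + x)" by simp
      then show "\<exists>y. (f has_real_derivative y) (at x) \<and> 0 \<le> y"
        using der[of x] \<open>0 \<le> x\<close> by (intro exI[of _ "x ^ 3 / (1 + x)"]) simp
    qed
  next
    case False
    show ?thesis
    proof (rule DERIV_nonpos_imp_nonincreasing[of u 0 f])
      fix x assume x: "u \<le> x" "x \<le> 0"
      then have "x ^ 3 / (1 + x) \<le> 0"
        using assms by (intro divide_nonpos_pos) (auto simp: power3_eq_cube mult_nonneg_nonpos zero_le_mult_iff mult_le_0_iff)
      then show "\<exists>y. (f has_real_derivative y) (at x) \<and> y \<le> 0" using der[of x] x assms by fastforce
    qed (use False in simp)
  qed
  then show ?thesis by (simp add: f_def)
qed

lemma norm_le_half_one_plus_square: "2 * norm z \<le> 1 + (norm z)\<^sup>2"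
  using sum_squares_bound[of 1 "norm z"] by simp

text \<open>One step of the discrete Ito formula: \<open>\<alpha>\<close> is the drift,
  \<open>w\<close> the Brownian increment and \<open>e\<close> the error of freezing the integrand.
  The two error terms differ in kind. The noise part carries the small factor
  \<open>\<theta>\<close>, because squared increments add up to about the elapsed time; the rest may
  carry \<open>1 / \<theta>\<close>, because its squares add up to something negligible.\<close>

lemma log_energy_increment:
  fixes z \<alpha> e :: "'h::real_inner" and g w \<theta> \<mu> :: real
  defines "X \<equiv> (norm z)\<^sup>2"
  defines "\<kappa> \<equiv> 1 / (1 + X)"
  defines "b \<equiv> 2 * \<kappa> * g * X"
  defines "h \<equiv> - \<alpha> + w *\<^sub>R g *\<^sub>R z + e"
  assumes \<theta>: "0 < \<theta>" "\<theta> \<le> 1" and \<mu>: "norm h \<le> \<mu>" "\<mu> \<le> \<theta>"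
  shows "ln (1 + (norm (z + h))\<^sup>2) - ln (1 + X) \<le>
    - (2 * \<kappa> * (z \<bullet> \<alpha>)) + 2 * \<kappa> * (z \<bullet> e) + b * w + (\<kappa> * g\<^sup>2 * X - b\<^sup>2 / 2) * w\<^sup>2
    + 10 * \<theta> * w\<^sup>2 * (norm (g *\<^sub>R z))\<^sup>2 + 20 / \<theta> * ((norm e)\<^sup>2 + (norm \<alpha>)\<^sup>2)"
proof -
  define H where "H = g *\<^sub>R z"
  define q where "q = e - \<alpha>"
  define A where "A = \<bar>w\<bar> * norm H"
  \<comment> \<open>\<open>1 + (norm (z + h))\<^sup>2\<close> equals
    \<open>(1 + X) * (1 + u)\<close>; \<open>a1\<close> is the part of \<open>u\<close> linear in
    the noise, \<open>b1\<close> the remainder.\<close>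
  define a1 where "a1 = b * w"
  define b1 where "b1 = 2 * \<kappa> * (z \<bullet> q) + \<kappa> * (norm h)\<^sup>2"
  define u where "u = \<kappa> * (2 * (z \<bullet> h) + (norm h)\<^sup>2)"
  have hH: "h = w *\<^sub>R H + q" by (simp add: h_def H_def q_def)
  have X0: "0 \<le> X" by (simp add: X_def)
  have k0: "0 < \<kappa>" "\<kappa> \<le> 1" using X0 by (auto simp: \<kappa>_def)
  \<comment> \<open>Because \<open>2 * norm z \<le> 1 + X\<close>, every first order term is bounded
    by the norm of its increment, however large \<open>z\<close> is.\<close>
  have kz: "2 * \<kappa> * norm z \<le> 1"
  proof -
    have "2 * \<kappa> * norm z = (2 * norm z) / (1 + X)" by (simp add: \<kappa>_def)
    also have "\<dots> \<le> 1"
      using norm_le_half_one_plus_square[of z] X0 by (subst pos_divide_le_eq) (auto simp: X_def add_pos_nonneg)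
    finally show ?thesis .
  qed
  have kz': "\<bar>2 * \<kappa> * (z \<bullet> x)\<bar> \<le> norm x" for x
  proof -
    have "\<bar>2 * \<kappa> * (z \<bullet> x)\<bar> = 2 * \<kappa> * \<bar>z \<bullet> x\<bar>" using k0 by (simp add: abs_mult)
    also have "\<dots> \<le> 2 * \<kappa> * (norm z * norm x)" using k0 Cauchy_Schwarz_ineq2[of z x] by (intro mult_left_mono) auto
    also have "\<dots> \<le> 1 * norm x" using mult_right_mono[OF kz, of "norm x"] by (simp add: mult.assoc)
    finally show ?thesis by simp
  qed
  have a1eq: "a1 = 2 * \<kappa> * (z \<bullet> (w *\<^sub>R H))"
    by (simp add: a1_def b_def H_def X_def power2_norm_eq_inner)
  have ueq: "u = a1 + b1"
    by (simp add: u_def a1eq b1_def hH inner_add_right algebra_simps)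
  have A0: "0 \<le> A" by (simp add: A_def)
  have a1A: "\<bar>a1\<bar> \<le> A" using kz'[of "w *\<^sub>R H"] by (simp add: a1eq A_def)
  have mu0: "0 \<le> \<mu>" using \<mu>(1) norm_ge_zero[of h] by linarith
  have h1: "norm h \<le> 1" using \<mu> \<theta> by simp
  have sq_h: "(norm h)\<^sup>2 = A\<^sup>2 + 2 * ((w *\<^sub>R H) \<bullet> q) + (norm q)\<^sup>2"
    unfolding hH A_def by (simp add: power2_norm_eq_inner inner_add_left inner_add_right inner_commute power_mult_distrib)
      (simp add: power2_eq_square)
  have cs: "\<bar>(w *\<^sub>R H) \<bullet> q\<bar> \<le> A * norm q" using Cauchy_Schwarz_ineq2[of "w *\<^sub>R H" q] by (simp add: A_def)
  have ubd: "\<bar>u\<bar> \<le> norm h + (norm h)\<^sup>2"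
  proof -
    have "\<bar>u\<bar> \<le> \<bar>2 * \<kappa> * (z \<bullet> h)\<bar> + \<kappa> * (norm h)\<^sup>2"
      using abs_triangle_ineq[of "2 * \<kappa> * (z \<bullet> h)" "\<kappa> * (norm h)\<^sup>2"] k0 by (simp add: u_def algebra_simps abs_mult)
    also have "\<dots> \<le> norm h + 1 * (norm h)\<^sup>2" using k0 by (intro add_mono kz' mult_right_mono) auto
    finally show ?thesis by simp
  qed
  have u2: "\<bar>u\<bar> \<le> 2 * norm h"
    using ubd mult_left_mono[OF h1, of "norm h"] by (simp add: power2_eq_square)
  have u3: "u ^ 3 \<le> 8 * \<mu> * (norm h)\<^sup>2"
  proof -
    have "u ^ 3 \<le> \<bar>u\<bar> ^ 3" using abs_ge_self[of "u ^ 3"] by (simp add: power_abs)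
    also have "\<dots> \<le> (2 * norm h) ^ 3" by (intro power_mono u2) auto
    also have "\<dots> = 8 * norm h * (norm h)\<^sup>2" by (simp add: power2_eq_square power3_eq_cube)
    also have "\<dots> \<le> 8 * \<mu> * (norm h)\<^sup>2" using \<mu> by (intro mult_right_mono) auto
    finally show ?thesis .
  qed
  have hsum: "(norm h)\<^sup>2 \<le> 2 * A\<^sup>2 + 2 * (norm q)\<^sup>2"
    using sq_h cs sum_squares_bound[of A "norm q"] by (simp add: abs_le_iff)
  have b1bd: "\<bar>b1\<bar> \<le> norm q + (norm h)\<^sup>2"
  proof -
    have "\<bar>b1\<bar> \<le> \<bar>2 * \<kappa> * (z \<bullet> q)\<bar> + \<kappa> * (norm h)\<^sup>2"
      using abs_triangle_ineq[of "2 * \<kappa> * (z \<bullet> q)" "\<kappa> * (norm h)\<^sup>2"] k0 by (simp add: b1_def abs_mult)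
    also have "\<dots> \<le> norm q + 1 * (norm h)\<^sup>2" using k0 by (intro add_mono kz' mult_right_mono) auto
    finally show ?thesis by simp
  qed
  have "1 + (norm (z + h))\<^sup>2 = (1 + X) * (1 + u)"
  proof -
    have "(1 + X) * \<kappa> = 1" using X0 by (simp add: \<kappa>_def)
    then have "(1 + X) * (1 + u) = 1 + X + (2 * (z \<bullet> h) + (norm h)\<^sup>2)"
      unfolding u_def distrib_left mult.assoc[symmetric] by simp
    also have "\<dots> = 1 + (norm (z + h))\<^sup>2"
      by (simp add: X_def power2_norm_eq_inner inner_add_left inner_add_right inner_commute)
    finally show ?thesis ..
  qed
  moreover from this have u1: "0 < 1 + u"
    using X0 by (metis add_pos_nonneg zero_le_power2 zero_less_mult_pos zero_less_one)
  ultimately have "ln (1 + (norm (z + h))\<^sup>2) - ln (1 + X) = ln (1 + u)"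
    using X0 by (simp add: ln_mult)
  also have "\<dots> \<le> u - u\<^sup>2 / 2 + u ^ 3 / 3" using u1 by (intro ln_one_plus_le_cubic) simp
  \<comment> \<open>From the square of \<open>u\<close> only the square of the noise part and a
    bounded mixed term are kept; the cubic term is absorbed by
    \<open>norm h \<le> \<mu>\<close>.\<close>
  also have "\<dots> \<le> u - (a1\<^sup>2 / 2 - A * (norm q + (norm h)\<^sup>2)) + 3 * \<mu> * (norm h)\<^sup>2"
  proof -
    have "\<bar>a1 * b1\<bar> \<le> A * (norm q + (norm h)\<^sup>2)"
      unfolding abs_mult using a1A b1bd A0 by (intro mult_mono) auto
    moreover have "u\<^sup>2 = a1\<^sup>2 + 2 * (a1 * b1) + b1\<^sup>2" by (simp add: ueq power2_sum)
    ultimately have "a1\<^sup>2 / 2 - A * (norm q + (norm h)\<^sup>2) \<le> u\<^sup>2 / 2"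
      using zero_le_power2[of b1] abs_ge_minus_self[of "a1 * b1"] by argo
    moreover have "u ^ 3 / 3 \<le> 3 * \<mu> * (norm h)\<^sup>2"
    proof -
      have "0 \<le> \<mu> * (norm h)\<^sup>2" using mu0 by simp
      then show ?thesis using u3 by simp
    qed
    ultimately show ?thesis by linarith
  qed
  also have "u = 2 * \<kappa> * (z \<bullet> q) + b * w + \<kappa> * (norm h)\<^sup>2"
    by (simp add: ueq a1_def b1_def)
  \<comment> \<open>The square of the noise is the Ito correction and is kept exactly; the mixed
    terms with \<open>q\<close> go into the error.\<close>
  also have "\<kappa> * (norm h)\<^sup>2 \<le> \<kappa> * g\<^sup>2 * X * w\<^sup>2 + 2 * (A * norm q) + (norm q)\<^sup>2"
  proof -
    have "\<kappa> * (norm h)\<^sup>2 = \<kappa> * A\<^sup>2 + \<kappa> * (2 * ((w *\<^sub>R H) \<bullet> q) + (norm q)\<^sup>2)"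
      by (simp add: sq_h algebra_simps)
    also have "\<kappa> * A\<^sup>2 = \<kappa> * g\<^sup>2 * X * w\<^sup>2" by (simp add: A_def H_def X_def power_mult_distrib)
    also have "\<kappa> * (2 * ((w *\<^sub>R H) \<bullet> q) + (norm q)\<^sup>2) \<le> 1 * (2 * (A * norm q) + (norm q)\<^sup>2)"
    proof -
      have "\<kappa> * (2 * ((w *\<^sub>R H) \<bullet> q) + (norm q)\<^sup>2) \<le> \<kappa> * (2 * (A * norm q) + (norm q)\<^sup>2)"
        using cs k0 by (intro mult_left_mono) auto
      also have "\<dots> \<le> 1 * (2 * (A * norm q) + (norm q)\<^sup>2)"
        using k0 A0 by (intro mult_right_mono) auto
      finally show ?thesis .
    qed
    finally show ?thesis by simp
  qed
  finally have main: "ln (1 + (norm (z + h))\<^sup>2) - ln (1 + X) \<le>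
     2 * \<kappa> * (z \<bullet> q) + b * w + (\<kappa> * g\<^sup>2 * X - b\<^sup>2 / 2) * w\<^sup>2
     + (3 * (A * norm q) + (norm q)\<^sup>2 + A * (norm h)\<^sup>2 + 3 * \<mu> * (norm h)\<^sup>2)"
    by (simp add: a1_def power_mult_distrib algebra_simps)
  \<comment> \<open>Young's inequality with weight \<open>\<theta>\<close> distributes the mixed
    term over noise and remainder.\<close>
  have e1: "3 * (A * norm q) \<le> 3 / 2 * \<theta> * A\<^sup>2 + 3 / 2 / \<theta> * (norm q)\<^sup>2"
  proof -
    have "0 \<le> (\<theta> * A - norm q)\<^sup>2 / \<theta>" using \<theta> by simp
    also have "\<dots> = \<theta> * A\<^sup>2 - 2 * (A * norm q) + (norm q)\<^sup>2 / \<theta>"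
      using \<theta> by (simp add: power2_eq_square field_simps)
    finally show ?thesis by (simp add: field_simps)
  qed
  have e2: "A * (norm h)\<^sup>2 \<le> \<mu> / 2 * (A\<^sup>2 + (norm h)\<^sup>2)"
  proof -
    have "A * (norm h)\<^sup>2 = norm h * (A * norm h)" by (simp add: power2_eq_square)
    also have "\<dots> \<le> \<mu> * ((A\<^sup>2 + (norm h)\<^sup>2) / 2)"
      using sum_squares_bound[of A "norm h"] \<mu> mu0 A0 by (intro mult_mono) auto
    finally show ?thesis by simp
  qed
  have "3 * (A * norm q) + (norm q)\<^sup>2 + A * (norm h)\<^sup>2 + 3 * \<mu> * (norm h)\<^sup>2
      \<le> 3 / 2 * \<theta> * A\<^sup>2 + 3 / 2 / \<theta> * (norm q)\<^sup>2 + (norm q)\<^sup>2 + \<mu> / 2 * A\<^sup>2 + 7 / 2 * \<mu> * (norm h)\<^sup>2"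
    using e1 e2 by (simp add: algebra_simps)
  also have "7 / 2 * \<mu> * (norm h)\<^sup>2 \<le> 7 / 2 * \<mu> * (2 * A\<^sup>2 + 2 * (norm q)\<^sup>2)"
    using hsum mu0 by (intro mult_left_mono) auto
  also have "3 / 2 * \<theta> * A\<^sup>2 + 3 / 2 / \<theta> * (norm q)\<^sup>2 + (norm q)\<^sup>2 + \<mu> / 2 * A\<^sup>2 + 7 / 2 * \<mu> * (2 * A\<^sup>2 + 2 * (norm q)\<^sup>2)
      = (3 / 2 * \<theta> + 15 / 2 * \<mu>) * A\<^sup>2 + (3 / 2 / \<theta> + 1 + 7 * \<mu>) * (norm q)\<^sup>2"
    by (simp add: algebra_simps)
  also have "\<dots> \<le> (10 * \<theta>) * A\<^sup>2 + (10 / \<theta>) * (norm q)\<^sup>2"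
  proof (intro add_mono mult_right_mono)
    show "3 / 2 * \<theta> + 15 / 2 * \<mu> \<le> 10 * \<theta>" using \<mu> \<theta> by simp
    have "1 \<le> 1 / \<theta>" using \<theta> by simp
    moreover have "3 / 2 / \<theta> = 3 / 2 * (1 / \<theta>)" "10 / \<theta> = 10 * (1 / \<theta>)" by simp_all
    ultimately show "3 / 2 / \<theta> + 1 + 7 * \<mu> \<le> 10 / \<theta>" using \<mu> \<theta> by linarith
  qed auto
  also have "(norm q)\<^sup>2 \<le> 2 * ((norm e)\<^sup>2 + (norm \<alpha>)\<^sup>2)"
  proof -
    have "(norm q)\<^sup>2 \<le> (norm e + norm \<alpha>)\<^sup>2" unfolding q_def by (intro power_mono norm_triangle_ineq4) auto
    also have "\<dots> \<le> 2 * ((norm e)\<^sup>2 + (norm \<alpha>)\<^sup>2)"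
      using sum_squares_bound[of "norm e" "norm \<alpha>"] by (simp add: power2_sum)
    finally show ?thesis .
  qed
  finally have err: "3 * (A * norm q) + (norm q)\<^sup>2 + A * (norm h)\<^sup>2 + 3 * \<mu> * (norm h)\<^sup>2
      \<le> 10 * \<theta> * A\<^sup>2 + 20 / \<theta> * ((norm e)\<^sup>2 + (norm \<alpha>)\<^sup>2)"
    using \<theta> by (simp add: divide_right_mono mult_left_mono)
  have "A\<^sup>2 = w\<^sup>2 * (norm (g *\<^sub>R z))\<^sup>2" by (simp add: A_def H_def power_mult_distrib)
  moreover have "2 * \<kappa> * (z \<bullet> q) = - (2 * \<kappa> * (z \<bullet> \<alpha>)) + 2 * \<kappa> * (z \<bullet> e)"
    by (simp add: q_def inner_diff_right algebra_simps)
  ultimately show ?thesis using main err by (simp add: mult.assoc)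
qed

text \<open>Here \<open>w\<close> stands for the \<open>W1inf_norm\<close>, \<open>n\<close> for |v|
  and \<open>X\<close> for |J v|^2. Since \<open>w \<le> K * n\<close>, a large \<open>w\<close>
  forces \<open>x = X / (1 + X)\<close> close to 1, where the noise terms approach
  \<open>- (1 - 2 * \<eta>)\<close> times the squared coefficient and outweigh
  \<open>\<rho> * w\<close>. For bounded \<open>w\<close> all terms are bounded.\<close>

lemma lyapunov_scalar_bound:
  fixes \<rho> c \<delta> K :: real
  assumes "0 < \<rho>" "(\<delta> > 1 / 2 \<and> c \<noteq> 0) \<or> (\<delta> = 1 / 2 \<and> \<bar>c\<bar> > sqrt \<rho>)" "0 \<le> K"
  obtains \<eta> C where "0 < \<eta>" "0 \<le> C"
    "\<And>w n X. 0 \<le> w \<Longrightarrow> 0 \<le> X \<Longrightarrow> 0 \<le> n \<Longrightarrow> w \<le> K * n \<Longrightarrow> n\<^sup>2 \<le> X + 1 \<Longrightarrow>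
      \<rho> * w + (c * (1 + w) powr \<delta>)\<^sup>2 * (X / (1 + X))
      - 2 * (1 - \<eta>) * (c * (1 + w) powr \<delta>)\<^sup>2 * (X / (1 + X))\<^sup>2 \<le> C"
proof -
  text \<open>The point of the strict inequalities: some fraction \<open>\<lambda> < 1\<close> of the noise already beats the
    drift for large \<open>w\<close>.\<close>
  have "\<exists>l w0. 0 < l \<and> l < 1 \<and> 0 \<le> w0 \<and> (\<forall>w\<ge>w0. \<rho> * w \<le> l * (c * (1 + w) powr \<delta>)\<^sup>2)"
  proof -
    have sq: "(c * (1 + w) powr \<delta>)\<^sup>2 = c\<^sup>2 * (1 + w) powr (2 * \<delta>)" if "0 \<le> w" for w
      using that by (simp add: power_mult_distrib power2_eq_square powr_add[symmetric])
    show ?thesis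
    proof (cases "\<delta> = 1 / 2")
      case True
      then have "sqrt \<rho> < \<bar>c\<bar>" using assms by auto
      then have "(sqrt \<rho>)\<^sup>2 < \<bar>c\<bar>\<^sup>2" using assms(1) by (intro power_strict_mono) auto
      then have c: "\<rho> < c\<^sup>2" using assms(1) by simp
      have "\<rho> * w \<le> (\<rho> / c\<^sup>2) * (c * (1 + w) powr \<delta>)\<^sup>2" if "0 \<le> w" for w
      proof -
        have "(c * (1 + w) powr \<delta>)\<^sup>2 = c\<^sup>2 * (1 + w)" using sq[OF that] that unfolding True by simp
        then have "(\<rho> / c\<^sup>2) * (c * (1 + w) powr \<delta>)\<^sup>2 = \<rho> * (1 + w)" using c assms(1) by (cases "c = 0") auto
        then show ?thesis using assms(1) by simp
      qed
      moreover have "0 < \<rho> / c\<^sup>2" "\<rho> / c\<^sup>2 < 1" using c assms(1) by (auto simp: divide_simps)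
      ultimately show ?thesis by (intro exI[of _ "\<rho> / c\<^sup>2"] exI[of _ 0]) auto
    next
      case False
      then have d: "1 / 2 < \<delta>" "c \<noteq> 0" using assms by auto
      \<comment> \<open>Beyond this point \<open>(1 + w) powr (2 * \<delta> - 1)\<close> exceeds
        \<open>2 * \<rho> / c\<^sup>2\<close>, so half of the noise dominates the drift.\<close>
      define w1 where "w1 = (2 * \<rho> / c\<^sup>2) powr (1 / (2 * \<delta> - 1))"
      have w1: "2 * \<rho> / c\<^sup>2 \<le> (1 + w) powr (2 * \<delta> - 1)" if "w1 \<le> w" for w
      proof -
        have "2 * \<rho> / c\<^sup>2 = w1 powr (2 * \<delta> - 1)"
          using d assms(1) by (simp add: w1_def powr_powr)
        also have "\<dots> \<le> (1 + w) powr (2 * \<delta> - 1)"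
          using d that by (intro powr_mono2) (auto simp: w1_def)
        finally show ?thesis .
      qed
      have "\<rho> * w \<le> 1 / 2 * (c * (1 + w) powr \<delta>)\<^sup>2" if w: "max 0 w1 \<le> w" for w
      proof -
        have "2 * \<rho> / c\<^sup>2 * w \<le> (1 + w) powr (2 * \<delta> - 1) * (1 + w)"
          using w1[of w] w assms(1) d by (intro mult_mono) auto
        also have "\<dots> = (1 + w) powr (2 * \<delta>)" using w by (simp add: powr_mult_base[symmetric] powr_diff)
        finally show ?thesis using d w sq[of w] by (simp add: field_simps)
      qed
      then show ?thesis by (intro exI[of _ "1 / 2"] exI[of _ "max 0 w1"]) auto
    qed
  qed
  then obtain l w0 where l: "0 < l" "l < 1" "0 \<le> w0" and dom: "\<And>w. w0 \<le> w \<Longrightarrow> \<rho> * w \<le> l * (c * (1 + w) powr \<delta>)\<^sup>2"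
    by auto
  \<comment> \<open>The slack \<open>1 - l\<close> is shared out: \<open>\<eta>\<close> takes one
    eighth of it, and \<open>w > w2\<close> makes \<open>1 - x\<close> at most another eighth.
    Together they still leave \<open>2 * (1 - \<eta>) * x\<^sup>2 \<ge> 1 + l\<close>.\<close>
  define \<eta> where "\<eta> = (1 - l) / 8"
  define w2 where "w2 = max w0 (K * sqrt (8 / (1 - l)) + 1)"
  have eta: "0 < \<eta>" "\<eta> < 1" using l by (auto simp: \<eta>_def)
  have w2: "0 \<le> w2" "w0 \<le> w2" using l by (auto simp: w2_def)
  define G where "G w = (c * (1 + w) powr \<delta>)\<^sup>2" for w
  define C where "C = \<rho> * w2 + G w2"
  have d0: "0 \<le> \<delta>" using assms(2) by auto
  show ?thesis
  proof (rule that[of \<eta> C])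
    show "0 < \<eta>" by fact
    show "0 \<le> C" using assms w2 by (simp add: C_def G_def)
    fix w n X :: real
    assume w: "0 \<le> w" and X: "0 \<le> X" and n: "0 \<le> n" "w \<le> K * n" "n\<^sup>2 \<le> X + 1"
    define x where "x = X / (1 + X)"
    have x: "0 \<le> x" "x < 1" using X by (auto simp: x_def)
    have G0: "0 \<le> G w" by (simp add: G_def)
    have "\<rho> * w + G w * x - 2 * (1 - \<eta>) * G w * x\<^sup>2 \<le> C"
    proof (cases "w \<le> w2")
      case True
      have "G w \<le> G w2"
        using True w d0 by (auto simp: G_def power_mult_distrib intro!: mult_left_mono power_mono powr_mono2)
      moreover have "G w * x \<le> G w * 1" using x G0 by (intro mult_left_mono) auto
      moreover have "\<rho> * w \<le> \<rho> * w2" using True assms by simp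
      moreover have "0 \<le> 2 * (1 - \<eta>) * G w * x\<^sup>2" using eta G0 by simp
      ultimately show ?thesis by (simp add: C_def)
    next
      case False
      then have Kn: "K * sqrt (8 / (1 - l)) < K * n" using n w2 unfolding w2_def by linarith
      then have "sqrt (8 / (1 - l)) < n" using assms(3) by (simp add: mult_less_cancel_left split: if_splits)
      then have "(sqrt (8 / (1 - l)))\<^sup>2 < n\<^sup>2" using l by (intro power_strict_mono) auto
      then have "8 / (1 - l) < 1 + X" using n(3) l by simp
      then have x1: "1 - x \<le> (1 - l) / 8" using X l by (simp add: x_def field_simps)
      have "x - 2 * (1 - \<eta>) * x\<^sup>2 \<le> - l"
      proof -
        have "x\<^sup>2 \<ge> 1 - 2 * (1 - x)" using zero_le_power2[of "1 - x"] by (simp add: power2_eq_square algebra_simps)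
        then have "x\<^sup>2 \<ge> 1 - (1 - l) / 4" using x1 by argo
        then have "2 * (1 - \<eta>) * x\<^sup>2 \<ge> 2 * (1 - \<eta>) * (1 - (1 - l) / 4)" using eta by (intro mult_left_mono) auto
        moreover have "2 * (1 - \<eta>) * (1 - (1 - l) / 4) \<ge> 1 + l"
        proof -
          have "0 \<le> (1 - l) * (5 - l)" using l by (intro mult_nonneg_nonneg) auto
          then show ?thesis unfolding \<eta>_def by (simp add: field_simps)
        qed
        ultimately show ?thesis using x by simp
      qed
      then have "G w * (x - 2 * (1 - \<eta>) * x\<^sup>2) \<le> G w * (- l)" using G0 by (rule mult_left_mono)
      moreover have "\<rho> * w \<le> l * G w" using dom[of w] False w2 by (simp add: G_def)
      ultimately have "\<rho> * w + G w * x - 2 * (1 - \<eta>) * G w * x\<^sup>2 \<le> 0" by (simp add: algebra_simps)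
      also have "0 \<le> C" using assms w2 by (simp add: C_def G_def)
      finally show ?thesis .
    qed
    then show "\<rho> * w + (c * (1 + w) powr \<delta>)\<^sup>2 * (X / (1 + X))
      - 2 * (1 - \<eta>) * (c * (1 + w) powr \<delta>)\<^sup>2 * (X / (1 + X))\<^sup>2 \<le> C" unfolding G_def x_def .
  qed
qed

text \<open>Each squared increment is split into \<open>\<Delta>\<close> and a centred part. The
  terms with \<open>\<Delta>\<close>, including the compensator
  \<open>\<eta> * (b i)\<^sup>2 * \<Delta> / 2\<close> that is added and subtracted, are bounded
  through \<open>C0\<close>; what remains is the compensated martingale sum and the error
  terms.\<close>

lemma discrete_log_energy_bound:
  fixes z \<alpha> e :: "nat \<Rightarrow> 'h::real_inner" and g w p :: "nat \<Rightarrow> real"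
  assumes step: "\<And>i. i < k \<Longrightarrow> z (Suc i) = z i + (- \<alpha> i + w i *\<^sub>R g i *\<^sub>R z i + e i)"
    and small: "\<And>i. i < k \<Longrightarrow> norm (z (Suc i) - z i) \<le> \<theta>"
    and \<theta>: "0 < \<theta>" "\<theta> \<le> 1" and \<Delta>: "0 \<le> \<Delta>"
    and \<kappa>: "\<And>i. \<kappa> i = 1 / (1 + (norm (z i))\<^sup>2)"
    and b: "\<And>i. b i = 2 * \<kappa> i * g i * (norm (z i))\<^sup>2"
    and \<psi>: "\<And>i. \<psi> i = \<kappa> i * (g i)\<^sup>2 * (norm (z i))\<^sup>2 - (b i)\<^sup>2 / 2"
    and drift: "\<And>i. i < k \<Longrightarrow> - (2 * \<kappa> i * (z i \<bullet> \<alpha> i)) \<le> \<Delta> * p i"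
    and \<alpha>: "\<And>i. i < k \<Longrightarrow> norm (\<alpha> i) \<le> C * \<Delta>"
    and bd: "\<And>i. i < k \<Longrightarrow> p i + \<psi> i + \<eta> * (b i)\<^sup>2 / 2 \<le> C0"
    and G: "\<And>i. i < k \<Longrightarrow> norm (g i *\<^sub>R z i) \<le> G"
  shows "ln (1 + (norm (z k))\<^sup>2) - ln (1 + (norm (z 0))\<^sup>2) \<le>
    (\<Sum>i<k. b i * w i - \<eta> * (b i)\<^sup>2 * \<Delta> / 2) + k * \<Delta> * C0 + (\<Sum>i<k. 2 * \<kappa> i * (z i \<bullet> e i))
    + (\<Sum>i<k. \<psi> i * ((w i)\<^sup>2 - \<Delta>)) + 10 * \<theta> * G\<^sup>2 * (\<Sum>i<k. (w i)\<^sup>2)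
    + 20 / \<theta> * ((\<Sum>i<k. (norm (e i))\<^sup>2) + k * (C * \<Delta>)\<^sup>2)"
proof -
  have "ln (1 + (norm (z k))\<^sup>2) - ln (1 + (norm (z 0))\<^sup>2) = (\<Sum>i<k. ln (1 + (norm (z (Suc i)))\<^sup>2) - ln (1 + (norm (z i))\<^sup>2))"
    by (rule sum_lessThan_telescope[symmetric])
  also have "\<dots> \<le> (\<Sum>i<k. (b i * w i - \<eta> * (b i)\<^sup>2 * \<Delta> / 2) + \<Delta> * C0 + 2 * \<kappa> i * (z i \<bullet> e i)
      + \<psi> i * ((w i)\<^sup>2 - \<Delta>) + 10 * \<theta> * G\<^sup>2 * (w i)\<^sup>2 + 20 / \<theta> * ((norm (e i))\<^sup>2 + (C * \<Delta>)\<^sup>2))"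
  proof (rule sum_mono)
    fix i assume "i \<in> {..<k}"
    then have i: "i < k" by simp
    have "norm (- \<alpha> i + w i *\<^sub>R g i *\<^sub>R z i + e i) \<le> \<theta>" using small[OF i] step[OF i] by simp
    from log_energy_increment[OF \<theta> this order_refl]
    have "ln (1 + (norm (z (Suc i)))\<^sup>2) - ln (1 + (norm (z i))\<^sup>2) \<le> - (2 * \<kappa> i * (z i \<bullet> \<alpha> i)) + 2 * \<kappa> i * (z i \<bullet> e i)
      + b i * w i + \<psi> i * (w i)\<^sup>2 + 10 * \<theta> * (w i)\<^sup>2 * (norm (g i *\<^sub>R z i))\<^sup>2 + 20 / \<theta> * ((norm (e i))\<^sup>2 + (norm (\<alpha> i))\<^sup>2)"
      by (simp only: step[OF i] \<psi> b \<kappa>)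
    moreover have "10 * \<theta> * (w i)\<^sup>2 * (norm (g i *\<^sub>R z i))\<^sup>2 \<le> 10 * \<theta> * (w i)\<^sup>2 * G\<^sup>2"
      using \<theta> by (intro mult_left_mono power_mono G i) auto
    moreover have "20 / \<theta> * ((norm (e i))\<^sup>2 + (norm (\<alpha> i))\<^sup>2) \<le> 20 / \<theta> * ((norm (e i))\<^sup>2 + (C * \<Delta>)\<^sup>2)"
      using \<theta> by (intro mult_left_mono add_left_mono power_mono \<alpha> i) auto
    moreover have "\<Delta> * p i + \<psi> i * \<Delta> + \<eta> * (b i)\<^sup>2 * \<Delta> / 2 \<le> \<Delta> * C0"
      using mult_left_mono[OF bd[OF i] \<Delta>] by (simp add: algebra_simps)
    ultimately show "ln (1 + (norm (z (Suc i)))\<^sup>2) - ln (1 + (norm (z i))\<^sup>2) \<le>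
        (b i * w i - \<eta> * (b i)\<^sup>2 * \<Delta> / 2) + \<Delta> * C0 + 2 * \<kappa> i * (z i \<bullet> e i)
      + \<psi> i * ((w i)\<^sup>2 - \<Delta>) + 10 * \<theta> * G\<^sup>2 * (w i)\<^sup>2 + 20 / \<theta> * ((norm (e i))\<^sup>2 + (C * \<Delta>)\<^sup>2)"
      using drift[OF i] by (simp add: algebra_simps)
  qed
  also have "\<dots> = (\<Sum>i<k. b i * w i - \<eta> * (b i)\<^sup>2 * \<Delta> / 2) + k * \<Delta> * C0 + (\<Sum>i<k. 2 * \<kappa> i * (z i \<bullet> e i))
    + (\<Sum>i<k. \<psi> i * ((w i)\<^sup>2 - \<Delta>)) + 10 * \<theta> * G\<^sup>2 * (\<Sum>i<k. (w i)\<^sup>2)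
    + 20 / \<theta> * ((\<Sum>i<k. (norm (e i))\<^sup>2) + k * (C * \<Delta>)\<^sup>2)"
    by (simp only: sum.distrib sum_distrib_left[symmetric] sum_constant card_lessThan distrib_left) simp
  finally show ?thesis .
qed

section \<open>Time grids along a continuous path\<close>

lemma eventually_uniform_on_grid:
  fixes f :: "real \<Rightarrow> 'e::metric_space"
  assumes f: "continuous_on {0..D} f" and T: "0 < T" and \<eta>: "0 < \<eta>"
  shows "\<forall>\<^sub>F m in sequentially. \<forall>r\<in>{0..D}. \<forall>r'\<in>{0..D}. \<bar>r - r'\<bar> \<le> T / real (Suc m) \<longrightarrow> dist (f r) (f r') \<le> \<eta>"
proof -
  have "uniformly_continuous_on {0..D} f" using f by (intro compact_uniformly_continuous) auto
  then obtain d where d: "0 < d" "\<And>r r'. r \<in> {0..D} \<Longrightarrow> r' \<in> {0..D} \<Longrightarrow> dist r' r < d \<Longrightarrow> dist (f r') (f r) < \<eta>"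
    using \<eta> unfolding uniformly_continuous_on_def by blast
  have "(\<lambda>m. T / real (Suc m)) \<longlonglongrightarrow> 0"
    using LIMSEQ_Suc[OF lim_const_over_n[of T]] .
  then have "\<forall>\<^sub>F m in sequentially. T / real (Suc m) < d" using d(1) by (rule order_tendstoD(2))
  then show ?thesis
  proof eventually_elim
    case (elim m)
    show ?case
    proof (intro ballI impI)
      fix r r' assume "r \<in> {0..D}" "r' \<in> {0..D}" "\<bar>r - r'\<bar> \<le> T / real (Suc m)"
      then show "dist (f r) (f r') \<le> \<eta>"
        using d(2)[of r' r] elim by (simp add: dist_real_def)
    qed
  qed
qed

text \<open>With \<open>m + 1\<close> steps every index gives a genuine grid, and the step length
  never divides by 0.\<close>

definition grid :: "real \<Rightarrow> nat \<Rightarrow> nat \<Rightarrow> real" where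
  "grid T m i = real i * (T / real (Suc m))"

lemma grid_0 [simp]: "grid T m 0 = 0" by (simp add: grid_def)

lemma grid_Suc: "grid T m (Suc i) = grid T m i + T / real (Suc m)"
  unfolding grid_def of_nat_Suc[of i] by (simp only: distrib_right mult_1 add.commute)

lemma grid_less: "0 < T \<Longrightarrow> grid T m i < grid T m (Suc i)"
  by (simp add: grid_Suc)

lemma grid_mono: "0 < T \<Longrightarrow> i \<le> j \<Longrightarrow> grid T m i \<le> grid T m j"
  unfolding grid_def by (intro mult_right_mono) auto

lemma grid_nonneg: "0 < T \<Longrightarrow> 0 \<le> grid T m i"
  by (simp add: grid_def)

lemma grid_end [simp]: "grid T m (Suc m) = T"
  by (simp add: grid_def del: of_nat_Suc)

text \<open>Pairing with a fixed vector reduces both claims to monotonicity of real integrals; for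
  the norm bound that vector is the increment of the integral itself.\<close>

lemma integral_increment_bounds:
  fixes f :: "real \<Rightarrow> 'h::real_inner"
  assumes st: "0 \<le> s" "s \<le> t" and int: "f integrable_on {0..s}" "f integrable_on {0..t}"
    and bd: "\<And>r. r \<in> {s..t} \<Longrightarrow> norm (f r) \<le> C"
    and low: "\<And>r. r \<in> {s..t} \<Longrightarrow> - (x \<bullet> f r) \<le> p"
  shows "norm (integral {0..t} f - integral {0..s} f) \<le> C * (t - s)"
    and "- (x \<bullet> (integral {0..t} f - integral {0..s} f)) \<le> p * (t - s)"
proof -
  have bl: "bounded_linear (\<lambda>y. - (x \<bullet> y))" for x :: 'h
    by (intro bounded_linear_minus bounded_linear_inner_right)
  have eq: "(\<lambda>r. - (x \<bullet> f r)) integrable_on {s..t} \<and>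
      integral {s..t} (\<lambda>r. - (x \<bullet> f r)) = - (x \<bullet> (integral {0..t} f - integral {0..s} f))" for x
  proof -
    have h: "((\<lambda>r. - (x \<bullet> f r)) has_integral - (x \<bullet> integral {0..u} f)) {0..u}" if "f integrable_on {0..u}" for u
      using has_integral_linear[OF integrable_integral[OF that] bl[of x]] by (simp add: comp_def)
    have i: "(\<lambda>r. - (x \<bullet> f r)) integrable_on {s..t}"
      by (rule integrable_subinterval_real[OF has_integral_integrable[OF h[OF int(2)]]]) (use st in auto)
    have "integral {0..s} (\<lambda>r. - (x \<bullet> f r)) + integral {s..t} (\<lambda>r. - (x \<bullet> f r)) = integral {0..t} (\<lambda>r. - (x \<bullet> f r))"
      by (rule Henstock_Kurzweil_Integration.integral_combine[OF st has_integral_integrable[OF h[OF int(2)]]])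
    then show ?thesis using i integral_unique[OF h[OF int(1)]] integral_unique[OF h[OF int(2)]]
      by (simp add: inner_diff_right)
  qed
  have le: "- (x \<bullet> (integral {0..t} f - integral {0..s} f)) \<le> p * (t - s)"
    if "\<And>r. r \<in> {s..t} \<Longrightarrow> - (x \<bullet> f r) \<le> p" for x p
  proof -
    have "integral {s..t} (\<lambda>r. - (x \<bullet> f r)) \<le> integral {s..t} (\<lambda>_. p)"
      using eq[of x] that by (intro integral_le) auto
    then show ?thesis using eq[of x] st by (simp add: mult.commute)
  qed
  show "- (x \<bullet> (integral {0..t} f - integral {0..s} f)) \<le> p * (t - s)" by (rule le[OF low])
  let ?y = "integral {0..t} f - integral {0..s} f"
  have "- (- ?y \<bullet> ?y) \<le> (norm ?y * C) * (t - s)"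
  proof (rule le)
    fix r assume r: "r \<in> {s..t}"
    have "- (- ?y \<bullet> f r) \<le> norm ?y * norm (f r)" using norm_cauchy_schwarz[of ?y "f r"] by (simp only: inner_minus_left minus_minus)
    also have "\<dots> \<le> norm ?y * C" by (intro mult_left_mono bd r) auto
    finally show "- (- ?y \<bullet> f r) \<le> norm ?y * C" .
  qed
  then have "norm ?y * norm ?y \<le> norm ?y * (C * (t - s))"
    by (simp only: inner_minus_left minus_minus power2_norm_eq_inner[symmetric] power2_eq_square mult.assoc)
  moreover have "0 \<le> C * (t - s)"
  proof -
    have "0 \<le> C" using bd[of s] st norm_ge_zero[of "f s"] by (meson atLeastAtMost_iff order_refl order_trans)
    then show ?thesis using st by simp
  qed
  ultimately show "norm ?y \<le> C * (t - s)" by (cases "norm ?y = 0") auto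
qed

text \<open>The exit time is replaced by the first grid point at which the path is above
  \<open>R\<close>. On fine grids it exists, because the path is above \<open>R\<close> at
  \<open>D\<close> and, by uniform continuity, also at the last grid point not after
  \<open>D\<close>. All steps before it lie in \<open>{0..D}\<close>, where every quantity of the
  expansion varies little.\<close>

lemma eventually_good_grid:
  fixes V :: "real \<Rightarrow> 'h::real_inner" and J A :: "'h \<Rightarrow> 'h" and wt :: "'h \<Rightarrow> real" and g :: "'h \<Rightarrow> real"
  defines "\<phi> x \<equiv> (2 * (1 / (1 + (norm (J x))\<^sup>2))) *\<^sub>R J x"
  assumes T: "0 < T" and D: "0 \<le> D" "D \<le> T"
    and V: "continuous_on {0..D} V" and VR: "R < norm (V D)"
    and J: "bounded_linear J" and wt: "continuous_on UNIV wt" and g: "continuous_on UNIV g"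
    and A: "\<And>B. \<exists>C. \<forall>x. norm x \<le> B \<longrightarrow> norm (A x) \<le> C"
    and int: "\<And>t. t \<in> {0..D} \<Longrightarrow> (\<lambda>r. A (V r)) integrable_on {0..t}"
    and energy: "\<And>t. t \<in> {0..D} \<Longrightarrow> - (\<phi> (V t) \<bullet> A (V t)) \<le> \<rho> * wt (V t)"
    and \<rho>: "0 < \<rho>" and \<theta>: "0 < \<theta>" and \<epsilon>: "0 < \<epsilon>" and \<zeta>: "0 < \<zeta>"
  obtains C where "\<forall>\<^sub>F m in sequentially. \<exists>k\<le>Suc m.
      (\<forall>i\<le>k. grid T m i \<le> D) \<and> (\<forall>i<k. norm (V (grid T m i)) \<le> R) \<and> R < norm (V (grid T m k)) \<and>
      (\<forall>i<k. \<forall>r\<in>{grid T m i..grid T m (Suc i)}.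
        norm (g (V r) *\<^sub>R J (V r) - g (V (grid T m i)) *\<^sub>R J (V (grid T m i))) \<le> \<epsilon>) \<and>
      (\<forall>i<k. norm (J (V (grid T m (Suc i))) - J (V (grid T m i))) \<le> \<theta>) \<and>
      (\<forall>i<k. norm (integral {0..grid T m (Suc i)} (\<lambda>r. A (V r)) - integral {0..grid T m i} (\<lambda>r. A (V r))) \<le> C * (T / real (Suc m))) \<and>
      (\<forall>i<k. - (\<phi> (V (grid T m i)) \<bullet> (integral {0..grid T m (Suc i)} (\<lambda>r. A (V r)) - integral {0..grid T m i} (\<lambda>r. A (V r))))
        \<le> (T / real (Suc m)) * (\<rho> * wt (V (grid T m i)) + \<zeta>))"
proof -
  have "bounded (V ` {0..D})" using V by (intro compact_imp_bounded compact_continuous_image) auto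
  then obtain B where "\<forall>x\<in>V ` {0..D}. norm x \<le> B" by (auto simp: bounded_iff)
  then have B: "\<And>t. t \<in> {0..D} \<Longrightarrow> norm (V t) \<le> B" by blast
  from A[of B] obtain C where C: "\<And>x. norm x \<le> B \<Longrightarrow> norm (A x) \<le> C" by blast
  have C0: "0 \<le> C" using C[OF B[of 0]] D norm_ge_zero[of "A (V 0)"] by (meson atLeastAtMost_iff order_refl order_trans)
  have JV: "continuous_on {0..D} (\<lambda>t. J (V t))" by (rule bounded_linear.continuous_on[OF J V])
  have gV: "continuous_on {0..D} (\<lambda>t. g (V t))" using continuous_on_compose2[OF g V] by auto
  have wV: "continuous_on {0..D} (\<lambda>t. wt (V t))" using continuous_on_compose2[OF wt V] by auto
  have nz: "1 + (norm x)\<^sup>2 \<noteq> 0" for x :: 'h using zero_le_power2[of "norm x"] by linarith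
  have \<phi>V: "continuous_on {0..D} (\<lambda>t. \<phi> (V t))"
    unfolding \<phi>_def by (intro continuous_intros JV) (use nz in auto)
  have HV: "continuous_on {0..D} (\<lambda>t. g (V t) *\<^sub>R J (V t))" by (intro continuous_intros JV gV)
  \<comment> \<open>The tolerance \<open>\<zeta>\<close> is split equally between the variation of
    \<open>\<phi> (V r)\<close>, paired with a vector of norm at most \<open>C\<close>, and the
    variation of \<open>\<rho> * wt (V r)\<close>.\<close>
  let ?\<zeta>1 = "\<zeta> / (2 * (C + 1))" and ?\<zeta>2 = "\<zeta> / (2 * \<rho>)"
  have z: "0 < ?\<zeta>1" "0 < ?\<zeta>2" "0 < (norm (V D) - R) / 2" using \<zeta> \<rho> C0 VR by auto
  show ?thesis
  proof (rule that)
    show "\<forall>\<^sub>F m in sequentially. \<exists>k\<le>Suc m.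
      (\<forall>i\<le>k. grid T m i \<le> D) \<and> (\<forall>i<k. norm (V (grid T m i)) \<le> R) \<and> R < norm (V (grid T m k)) \<and>
      (\<forall>i<k. \<forall>r\<in>{grid T m i..grid T m (Suc i)}.
        norm (g (V r) *\<^sub>R J (V r) - g (V (grid T m i)) *\<^sub>R J (V (grid T m i))) \<le> \<epsilon>) \<and>
      (\<forall>i<k. norm (J (V (grid T m (Suc i))) - J (V (grid T m i))) \<le> \<theta>) \<and>
      (\<forall>i<k. norm (integral {0..grid T m (Suc i)} (\<lambda>r. A (V r)) - integral {0..grid T m i} (\<lambda>r. A (V r))) \<le> C * (T / real (Suc m))) \<and>
      (\<forall>i<k. - (\<phi> (V (grid T m i)) \<bullet> (integral {0..grid T m (Suc i)} (\<lambda>r. A (V r)) - integral {0..grid T m i} (\<lambda>r. A (V r))))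
        \<le> (T / real (Suc m)) * (\<rho> * wt (V (grid T m i)) + \<zeta>))"
      using eventually_uniform_on_grid[OF V T z(3)] eventually_uniform_on_grid[OF HV T \<epsilon>]
        eventually_uniform_on_grid[OF JV T \<theta>] eventually_uniform_on_grid[OF \<phi>V T z(1)] eventually_uniform_on_grid[OF wV T z(2)]
    proof eventually_elim
      case (elim m)
      let ?t = "grid T m" and ?\<Delta> = "T / real (Suc m)"
      have \<Delta>: "0 < ?\<Delta>" using T by simp
      \<comment> \<open>The last grid index whose time is not after \<open>D\<close>; since
        \<open>D \<le> T\<close>, it is at most \<open>Suc m\<close>.\<close>
      define j0 where "j0 = nat \<lfloor>D / ?\<Delta>\<rfloor>"
      have j0: "real j0 \<le> D / ?\<Delta>" "D / ?\<Delta> < real j0 + 1"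
        using D T unfolding j0_def by (auto simp: of_nat_nat le_floor_iff)
      have tj0: "?t j0 \<le> D" "D \<le> ?t j0 + ?\<Delta>"
        using j0 unfolding grid_def pos_le_divide_eq[OF \<Delta>] pos_divide_less_eq[OF \<Delta>] distrib_right mult_1
        by (blast intro: less_imp_le)+
      have "D / ?\<Delta> \<le> real (Suc m)" using D \<Delta> T mult_right_mono[of D T "real (Suc m)"] by (simp add: field_simps)
      then have j0m: "j0 \<le> Suc m" using j0 by linarith
      have "dist (V D) (V (?t j0)) \<le> (norm (V D) - R) / 2"
        using elim(1) D tj0 grid_nonneg[OF T, of m j0] by auto
      then have "R < norm (V (?t j0))"
        using VR norm_triangle_ineq2[of "V D" "V (?t j0)"] by (simp add: dist_norm field_simps)
      then have ex: "\<exists>k. R < norm (V (?t k))" by blast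
      define k where "k = (LEAST k. R < norm (V (?t k)))"
      have k: "R < norm (V (?t k))" unfolding k_def by (rule LeastI_ex[OF ex])
      have kmin: "norm (V (?t i)) \<le> R" if "i < k" for i using not_less_Least[of i "\<lambda>k. R < norm (V (?t k))"] that
        by (auto simp: k_def)
      have kj: "k \<le> j0" unfolding k_def by (rule Least_le) fact
      have tD: "?t i \<le> D" if "i \<le> k" for i using grid_mono[OF T, of i j0 m] that kj tj0 by linarith
      have t0: "0 \<le> ?t i" for i by (rule grid_nonneg[OF T])
      have rng: "r \<in> {0..D} \<and> ?t i \<in> {0..D} \<and> ?t (Suc i) \<in> {0..D} \<and> \<bar>r - ?t i\<bar> \<le> ?\<Delta>"
        if "i < k" "r \<in> {?t i..?t (Suc i)}" for i r
        using that tD[of i] tD[of "Suc i"] t0[of i] by (auto simp: grid_Suc)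
      have est: "norm (integral {0..?t (Suc i)} (\<lambda>r. A (V r)) - integral {0..?t i} (\<lambda>r. A (V r))) \<le> C * ?\<Delta> \<and>
         - (\<phi> (V (?t i)) \<bullet> (integral {0..?t (Suc i)} (\<lambda>r. A (V r)) - integral {0..?t i} (\<lambda>r. A (V r))))
        \<le> ?\<Delta> * (\<rho> * wt (V (?t i)) + \<zeta>)" if i: "i < k" for i
      proof -
        have le: "?t i \<le> ?t (Suc i)" using \<Delta> by (simp add: grid_Suc)
        have rt: "?t i \<in> {0..D}" "?t (Suc i) \<in> {0..D}" using rng[OF i, of "?t i"] le by auto
        have low: "- (\<phi> (V (?t i)) \<bullet> A (V r)) \<le> \<rho> * wt (V (?t i)) + \<zeta>" if r: "r \<in> {?t i..?t (Suc i)}" for r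
        proof -
          note rr = rng[OF i r]
          have "norm (\<phi> (V r) - \<phi> (V (?t i))) \<le> ?\<zeta>1" using elim(4) rr by (auto simp: dist_norm)
          then have "(\<phi> (V r) - \<phi> (V (?t i))) \<bullet> A (V r) \<le> ?\<zeta>1 * C"
            using norm_cauchy_schwarz[of "\<phi> (V r) - \<phi> (V (?t i))" "A (V r)"] C[OF B, of r] rr z
            by (intro order_trans[OF _ mult_mono[of _ ?\<zeta>1 "norm (A (V r))" C]]) auto
          also have "\<dots> \<le> \<zeta> / 2" using C0 \<zeta> by (simp add: field_simps)
          finally have 1: "(\<phi> (V r) - \<phi> (V (?t i))) \<bullet> A (V r) \<le> \<zeta> / 2" .
          have "\<bar>wt (V r) - wt (V (?t i))\<bar> \<le> ?\<zeta>2" using elim(5) rr by (auto simp: dist_real_def)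
          then have "\<rho> * (wt (V r) - wt (V (?t i))) \<le> \<rho> * ?\<zeta>2" using \<rho> by (intro mult_left_mono) auto
          then have 2: "\<rho> * wt (V r) - \<rho> * wt (V (?t i)) \<le> \<zeta> / 2" using \<rho> by (simp add: algebra_simps)
          show ?thesis using 1 2 energy[of r] rr by (simp add: inner_diff_left)
        qed
        have bd: "norm (A (V r)) \<le> C" if "r \<in> {?t i..?t (Suc i)}" for r using C B rng[OF i that] by auto
        show ?thesis
          using integral_increment_bounds[OF t0 le int[OF rt(1)] int[OF rt(2)] bd low]
          by (simp add: grid_Suc mult.commute)
      qed
      show ?case
      proof (intro exI[of _ k] conjI allI impI ballI)
        show "k \<le> Suc m" using kj j0m by simp
        show "norm (g (V r) *\<^sub>R J (V r) - g (V (?t i)) *\<^sub>R J (V (?t i))) \<le> \<epsilon>" if "i < k" "r \<in> {?t i..?t (Suc i)}" for i r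
          using elim(2) rng[OF that] by (auto simp: dist_norm)
        show "norm (J (V (?t (Suc i))) - J (V (?t i))) \<le> \<theta>" if "i < k" for i
          using elim(3) rng[OF that, of "?t (Suc i)"] \<Delta> by (auto simp: dist_norm grid_Suc)
      qed (use tD kmin k est in auto)
    qed
  qed
qed

section \<open>Exit probabilities\<close>

text \<open>In the application \<open>v\<close> is \<open>\<Lambda>\<^sup>s y\<close>, \<open>J q\<close> a mollifier and \<open>A q\<close> the mollified nonlinearity lifted by
  \<open>\<Lambda>\<^sup>s\<close>; only the mollified equation makes sense in \<open>L\<^sup>2\<close>.\<close>

locale multiplicative_evolution = brownian_basis M F W
  for M :: "'w measure" and F :: "ennreal \<Rightarrow> 'w measure" and W :: "real \<Rightarrow> 'w \<Rightarrow> real" +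
  fixes v :: "real \<Rightarrow> 'w \<Rightarrow> 'h::{real_inner, second_countable_topology}"
    and \<sigma> :: "'w \<Rightarrow> ennreal"
    and wt :: "'h \<Rightarrow> real"
    and J A :: "nat \<Rightarrow> 'h \<Rightarrow> 'h"
    and I :: "nat \<Rightarrow> real \<Rightarrow> 'w \<Rightarrow> 'h"
    and \<rho> c \<delta> K :: real
  assumes \<sigma>: "stopping_time F \<sigma>"
    and v_adapted: "\<And>t. 0 \<le> t \<Longrightarrow> v t \<in> borel_measurable (F (ennreal t))"
    and v_continuous: "AE \<omega> in M. \<forall>D\<ge>0. ennreal D \<le> \<sigma> \<omega> \<longrightarrow> continuous_on {0..D} (\<lambda>t. v t \<omega>)"
    and wt_continuous: "continuous_on UNIV wt"
    and wt_nonneg: "\<And>x. 0 \<le> wt x"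
    and wt_le: "\<And>x. wt x \<le> K * norm x"
    and J: "\<And>q. bounded_linear (J q)"
    and J_le: "\<And>q x. norm (J q x) \<le> norm x"
    and J_tendsto: "\<And>x. (\<lambda>q. J q x) \<longlonglongrightarrow> x"
    and A_bounded: "\<And>q B. \<exists>C. \<forall>x. norm x \<le> B \<longrightarrow> norm (A q x) \<le> C"
    and energy: "\<And>q x. - (2 * (J q x \<bullet> A q x)) \<le> \<rho> * wt x * (norm x)\<^sup>2"
    and ito: "\<And>q. ito_integral M F W
      (\<lambda>t \<omega>. if ennreal t \<le> \<sigma> \<omega> then (c * (1 + wt (v t \<omega>)) powr \<delta>) *\<^sub>R J q (v t \<omega>) else 0) (I q)"
    and equation: "\<And>q. AE \<omega> in M. \<forall>t\<ge>0. ennreal t \<le> \<sigma> \<omega> \<longrightarrow>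
      (\<lambda>r. A q (v r \<omega>)) integrable_on {0..t} \<and>
      J q (v t \<omega>) + integral {0..t} (\<lambda>r. A q (v r \<omega>)) = J q (v 0 \<omega>) + I q t \<omega>"
    and \<rho>: "0 < \<rho>" and K: "0 \<le> K" and \<delta>: "0 \<le> \<delta>"
begin

definition g :: "'h \<Rightarrow> real" where "g x = c * (1 + wt x) powr \<delta>"

definition H :: "nat \<Rightarrow> real \<Rightarrow> 'w \<Rightarrow> 'h" where
  "H q t \<omega> = (if ennreal t \<le> \<sigma> \<omega> then g (v t \<omega>) *\<^sub>R J q (v t \<omega>) else 0)"

text \<open>Derivative of \<open>ln (1 + X)\<close> at X = |J x|^2. With it, \<open>b\<close> is the
  coefficient of the noise in the logarithm and \<open>\<psi>\<close> its Ito correction.\<close>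

definition \<kappa> :: "nat \<Rightarrow> 'h \<Rightarrow> real" where "\<kappa> q x = 1 / (1 + (norm (J q x))\<^sup>2)"

definition b :: "nat \<Rightarrow> 'h \<Rightarrow> real" where "b q x = 2 * \<kappa> q x * g x * (norm (J q x))\<^sup>2"

definition \<psi> :: "nat \<Rightarrow> 'h \<Rightarrow> real" where
  "\<psi> q x = \<kappa> q x * (g x)\<^sup>2 * (norm (J q x))\<^sup>2 - (b q x)\<^sup>2 / 2"

text \<open>Adapted substitute for stopping at an exit time: it is known at the grid time
  \<open>i\<close>, and once 0 it remains 0.\<close>

definition act :: "real \<Rightarrow> real \<Rightarrow> nat \<Rightarrow> nat \<Rightarrow> 'w \<Rightarrow> real" where
  "act T R m i \<omega> = (if ennreal (grid T m i) \<le> \<sigma> \<omega> \<and> (\<forall>j\<le>i. norm (v (grid T m j) \<omega>) \<le> R) then 1 else 0)"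

definition increment :: "real \<Rightarrow> nat \<Rightarrow> nat \<Rightarrow> 'w \<Rightarrow> real" where
  "increment T m i = dW (grid T m i) (grid T m (Suc i))"

text \<open>Error of the left-point approximation of the Ito integral on one grid step.\<close>

definition defect :: "real \<Rightarrow> nat \<Rightarrow> nat \<Rightarrow> nat \<Rightarrow> 'w \<Rightarrow> 'h" where
  "defect T q m i \<omega> = I q (grid T m (Suc i)) \<omega> - I q (grid T m i) \<omega> - increment T m i \<omega> *\<^sub>R H q (grid T m i) \<omega>"

text \<open>The path condition of \<open>ito_grid_bad_set\<close>, with the budget
  \<open>\<beta>\<close> and the switch \<open>act\<close>.\<close>

definition oscillation_le :: "real \<Rightarrow> real \<Rightarrow> nat \<Rightarrow> nat \<Rightarrow> 'w \<Rightarrow> real \<Rightarrow> bool" where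
  "oscillation_le T R q m \<omega> \<beta> \<longleftrightarrow> (\<forall>i<Suc m. act T R m i \<omega> = 1 \<longrightarrow>
    (\<forall>r\<in>{grid T m i<..grid T m (Suc i)}. (norm (H q r \<omega> - H q (grid T m i) \<omega>))\<^sup>2 * (4 * T) \<le> \<beta>))"

lemma g_continuous: "continuous_on UNIV g"
proof -
  have "1 + wt x \<noteq> 0" for x using wt_nonneg[of x] by linarith
  then show ?thesis
    unfolding g_def[abs_def] by (intro continuous_intros wt_continuous) auto
qed

lemma nz: "1 + (norm (x :: 'h))\<^sup>2 \<noteq> 0"
  using zero_le_power2[of "norm x"] by linarith

lemma \<kappa>_bounds: "0 < \<kappa> q x" "\<kappa> q x \<le> 1" "2 * \<kappa> q x * norm (J q x) \<le> 1"
proof -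
  have p: "0 < 1 + (norm (J q x))\<^sup>2" by (simp add: add_pos_nonneg)
  then show "0 < \<kappa> q x" "\<kappa> q x \<le> 1" by (simp_all add: \<kappa>_def)
  have "2 * \<kappa> q x * norm (J q x) = (2 * norm (J q x)) / (1 + (norm (J q x))\<^sup>2)" by (simp add: \<kappa>_def)
  also have "\<dots> \<le> 1" using p norm_le_half_one_plus_square by (subst pos_divide_le_eq) auto
  finally show "2 * \<kappa> q x * norm (J q x) \<le> 1" .
qed

lemma continuous_coefficients:
  "continuous_on UNIV (J q)" "continuous_on UNIV (\<kappa> q)" "continuous_on UNIV (b q)" "continuous_on UNIV (\<psi> q)"
proof -
  show J': "continuous_on UNIV (J q)" by (rule bounded_linear.continuous_on[OF J]) (rule continuous_on_id)
  show k: "continuous_on UNIV (\<kappa> q)" unfolding \<kappa>_def[abs_def] by (intro continuous_intros J') (use nz in auto)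
  show bb: "continuous_on UNIV (b q)" unfolding b_def[abs_def] by (intro continuous_intros J' k g_continuous)
  show "continuous_on UNIV (\<psi> q)" unfolding \<psi>_def[abs_def] by (intro continuous_intros J' k bb g_continuous) auto
qed

lemma adapted_continuous:
  fixes f :: "'h \<Rightarrow> 'k::topological_space"
  assumes "continuous_on UNIV f" "0 \<le> t"
  shows "(\<lambda>\<omega>. f (v t \<omega>)) \<in> borel_measurable (F (ennreal t))"
  using measurable_compose[OF v_adapted[OF assms(2)] borel_measurable_continuous_onI[OF assms(1)]] .

lemma act_adapted:
  assumes "0 < T"
  shows "act T R m i \<in> borel_measurable (F (ennreal (grid T m i)))"
proof -
  let ?F = "F (ennreal (grid T m i))"
  have s: "Measurable.pred ?F (\<lambda>\<omega>. ennreal (grid T m i) \<le> \<sigma> \<omega>)"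
  proof -
    \<comment> \<open>That \<sigma> has not been passed at the grid time is the complement of
      \<sigma> being smaller, an event that a stopping time places in the \<sigma>-algebra of that
      time.\<close>
    note [measurable] = stopping_time_less_const[OF \<sigma>, of "ennreal (grid T m i)"]
    have "Measurable.pred ?F (\<lambda>\<omega>. \<not> \<sigma> \<omega> < ennreal (grid T m i))" by measurable
    then show ?thesis by (simp add: not_less)
  qed
  have n: "Measurable.pred ?F (\<lambda>\<omega>. norm (v (grid T m j) \<omega>) \<le> R)" if "j \<le> i" for j
  proof -
    have [measurable]: "v (grid T m j) \<in> borel_measurable ?F"
      by (rule measurable_F_real_mono[OF v_adapted grid_mono[OF assms that]]) (rule grid_nonneg[OF assms])
    show ?thesis by measurable
  qed
  have "Measurable.pred ?F (\<lambda>\<omega>. j \<le> i \<longrightarrow> norm (v (grid T m j) \<omega>) \<le> R)" for j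
    using n[of j] by (cases "j \<le> i") simp_all
  then have n': "Measurable.pred ?F (\<lambda>\<omega>. \<forall>j\<le>i. norm (v (grid T m j) \<omega>) \<le> R)"
    by (rule pred_intros_countable)
  have "Measurable.pred ?F (\<lambda>\<omega>. ennreal (grid T m i) \<le> \<sigma> \<omega> \<and> (\<forall>j\<le>i. norm (v (grid T m j) \<omega>) \<le> R))"
    by (rule pred_intros_logic(3)[OF s n'])
  then show ?thesis unfolding act_def[abs_def]
    by (intro measurable_If measurable_const predE) auto
qed

lemma act_cases: "act T R m i \<omega> = 0 \<or> act T R m i \<omega> = 1"
  by (simp add: act_def)

lemma bounded_coefficients:
  assumes "norm x \<le> R"
  defines "G \<equiv> \<bar>c\<bar> * (1 + K * R) powr \<delta> * R"
  shows "norm (g x *\<^sub>R J q x) \<le> G" "\<bar>b q x\<bar> \<le> G" "\<bar>\<psi> q x\<bar> \<le> 2 * G\<^sup>2"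
proof -
  have R: "0 \<le> R" using assms(1) norm_ge_zero order_trans by blast
  have "wt x \<le> K * R" using wt_le[of x] mult_left_mono[OF assms(1) K] by linarith
  then have "(1 + wt x) powr \<delta> \<le> (1 + K * R) powr \<delta>"
    using \<delta> wt_nonneg[of x] by (intro powr_mono2) auto
  then have "\<bar>g x\<bar> \<le> \<bar>c\<bar> * (1 + K * R) powr \<delta>" by (simp add: g_def abs_mult mult_left_mono)
  moreover have "norm (J q x) \<le> R" using J_le[of q x] assms(1) by simp
  ultimately show G: "norm (g x *\<^sub>R J q x) \<le> G" unfolding G_def norm_scaleR by (intro mult_mono) auto
  have "\<bar>b q x\<bar> = (2 * \<kappa> q x * norm (J q x)) * norm (g x *\<^sub>R J q x)"
    using \<kappa>_bounds(1)[of q x] by (simp add: b_def abs_mult power2_eq_square)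
  also have "\<dots> \<le> 1 * G" using \<kappa>_bounds[of q x] G by (intro mult_mono) auto
  finally show bG: "\<bar>b q x\<bar> \<le> G" by simp
  have "\<kappa> q x * (g x)\<^sup>2 * (norm (J q x))\<^sup>2 = \<kappa> q x * (norm (g x *\<^sub>R J q x))\<^sup>2" by (simp add: power_mult_distrib)
  also have "\<dots> \<le> 1 * G\<^sup>2" using \<kappa>_bounds[of q x] G by (intro mult_mono power_mono) auto
  finally have 1: "\<kappa> q x * (g x)\<^sup>2 * (norm (J q x))\<^sup>2 \<le> G\<^sup>2" by simp
  have 2: "0 \<le> \<kappa> q x * (g x)\<^sup>2 * (norm (J q x))\<^sup>2" using \<kappa>_bounds(1)[of q x] by simp
  have "(b q x)\<^sup>2 \<le> G\<^sup>2" using power_mono[OF bG, of 2] by simp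
  then show "\<bar>\<psi> q x\<bar> \<le> 2 * G\<^sup>2" using 1 2 zero_le_power2[of "b q x"] unfolding \<psi>_def by arith
qed

lemma ito_H: "ito_integral M F W (H q) (I q)"
  using ito[of q] unfolding H_def[abs_def] g_def .

text \<open>All steps form one block, which keeps the cancellation between the defects that a sum of
  absolute values would lose. The defects are tested against the gradient of
  \<open>ln (1 + (norm z)\<^sup>2)\<close>, a vector of norm at most 1.\<close>

lemma linear_defect_bad_set:
  assumes T: "0 < T" and a: "0 < a" and \<beta>: "0 < \<beta>"
  shows "\<exists>Z\<in>events. prob Z \<le> \<beta> / a \<and> (AE \<omega> in M. \<omega> \<notin> Z \<longrightarrow> oscillation_le T R q m \<omega> \<beta> \<longrightarrow>
    (\<Sum>i<Suc m. act T R m i \<omega> * (2 * \<kappa> q (v (grid T m i) \<omega>) * (J q (v (grid T m i) \<omega>) \<bullet> defect T q m i \<omega>)))\<^sup>2 \<le> a)"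
proof -
  let ?\<Psi> = "\<lambda>i \<omega> x. act T R m i \<omega> * (2 * \<kappa> q (v (grid T m i) \<omega>) * (J q (v (grid T m i) \<omega>) \<bullet> x))"
  have T4: "4 * T = 4 * grid T m (Suc m)" by simp
  have bad: "\<exists>Z\<in>events. prob Z \<le> \<beta> / a \<and> (AE \<omega> in M. \<omega> \<notin> Z \<longrightarrow>
    oscillation_le T R q m \<omega> \<beta> \<longrightarrow>
    (\<Sum>k\<in>(\<lambda>_. ()) ` {..<Suc m}. (norm (\<Sum>i\<in>{i\<in>{..<Suc m}. () = k}. ?\<Psi> i \<omega> (defect T q m i \<omega>)))\<^sup>2) \<le> a)"
    unfolding oscillation_le_def defect_def increment_def T4
  proof (rule ito_grid_bad_set[where \<xi>="\<lambda>i. act T R m i" and \<Psi>="?\<Psi>", OF ito_H grid_0 grid_less[OF T]])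
    fix i \<omega> and x :: 'h
    show "linear (?\<Psi> i \<omega>)"
      by (rule linearI) (simp_all add: inner_add_right algebra_simps)
    have "\<bar>2 * \<kappa> q (v (grid T m i) \<omega>) * (J q (v (grid T m i) \<omega>) \<bullet> x)\<bar>
        \<le> 2 * \<kappa> q (v (grid T m i) \<omega>) * (norm (J q (v (grid T m i) \<omega>)) * norm x)"
      using \<kappa>_bounds(1)[of q "v (grid T m i) \<omega>"] Cauchy_Schwarz_ineq2 by (simp add: abs_mult)
    also have "\<dots> \<le> 1 * norm x"
      using mult_right_mono[OF \<kappa>_bounds(3) norm_ge_zero] by (simp only: mult.assoc)
    finally show "norm (?\<Psi> i \<omega> x) \<le> act T R m i \<omega> * norm x"
      using act_cases[of T R m i \<omega>] by auto
    show "act T R m i \<omega> = 0 \<or> act T R m i \<omega> = 1" by (rule act_cases)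
  next
    fix i u and Z :: "'w \<Rightarrow> 'h" assume u: "grid T m i \<le> u" and Z[measurable]: "Z \<in> borel_measurable (F (ennreal u))"
    have t0: "0 \<le> grid T m i" by (rule grid_nonneg[OF T])
    note [measurable] = measurable_F_real_mono[OF act_adapted[OF T] u]
      measurable_F_real_mono[OF adapted_continuous[OF continuous_coefficients(1) t0] u]
      measurable_F_real_mono[OF adapted_continuous[OF continuous_coefficients(2) t0] u]
    show "(\<lambda>\<omega>. ?\<Psi> i \<omega> (Z \<omega>)) \<in> borel_measurable (F (ennreal u))" by measurable
  qed (use a \<beta> in auto)
  have "(\<Sum>k\<in>(\<lambda>_. ()) ` {..<Suc m}. (norm (\<Sum>i\<in>{i\<in>{..<Suc m}. () = k}. f i))\<^sup>2) = (\<Sum>i<Suc m. f i)\<^sup>2"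
    for f :: "nat \<Rightarrow> real"
  proof -
    have "(\<lambda>_. ()) ` {..<Suc m} = {()}" "{i\<in>{..<Suc m}. () = ()} = {..<Suc m}" by auto
    then show ?thesis by (simp only: sum.insert sum.empty finite.emptyI empty_iff not_False_eq_True add_0_right real_norm_def power2_abs)
  qed
  with bad show ?thesis by (simp only:)
qed

text \<open>Every step is its own block, so the squares of the defects are added instead of the
  defects.\<close>

lemma square_defect_bad_set:
  assumes T: "0 < T" and a: "0 < a" and \<beta>: "0 < \<beta>"
  shows "\<exists>Z\<in>events. prob Z \<le> \<beta> / a \<and> (AE \<omega> in M. \<omega> \<notin> Z \<longrightarrow> oscillation_le T R q m \<omega> \<beta> \<longrightarrow>
    (\<Sum>i<Suc m. act T R m i \<omega> * (norm (defect T q m i \<omega>))\<^sup>2) \<le> a)"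
proof -
  let ?\<Psi> = "\<lambda>i \<omega> x. act T R m i \<omega> *\<^sub>R x"
  have T4: "4 * T = 4 * grid T m (Suc m)" by simp
  have bad: "\<exists>Z\<in>events. prob Z \<le> \<beta> / a \<and> (AE \<omega> in M. \<omega> \<notin> Z \<longrightarrow>
    oscillation_le T R q m \<omega> \<beta> \<longrightarrow>
    (\<Sum>k\<in>(\<lambda>i. i) ` {..<Suc m}. (norm (\<Sum>i\<in>{i\<in>{..<Suc m}. i = k}. ?\<Psi> i \<omega> (defect T q m i \<omega>)))\<^sup>2) \<le> a)"
    unfolding oscillation_le_def defect_def increment_def T4
  proof (rule ito_grid_bad_set[where \<xi>="\<lambda>i. act T R m i" and \<Psi>="?\<Psi>", OF ito_H grid_0 grid_less[OF T]])
    fix i \<omega> and x :: 'h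
    show "linear (?\<Psi> i \<omega>)" by (rule linearI) (simp_all add: scaleR_add_right)
    show "norm (?\<Psi> i \<omega> x) \<le> act T R m i \<omega> * norm x"
      using act_cases[of T R m i \<omega>] by auto
    show "act T R m i \<omega> = 0 \<or> act T R m i \<omega> = 1" by (rule act_cases)
  next
    fix i u and Z :: "'w \<Rightarrow> 'h" assume u: "grid T m i \<le> u" and Z[measurable]: "Z \<in> borel_measurable (F (ennreal u))"
    note [measurable] = measurable_F_real_mono[OF act_adapted[OF T] u]
    show "(\<lambda>\<omega>. ?\<Psi> i \<omega> (Z \<omega>)) \<in> borel_measurable (F (ennreal u))" by measurable
  qed (use a \<beta> in auto)
  have "(\<Sum>k\<in>(\<lambda>i. i) ` {..<Suc m}. (norm (\<Sum>i\<in>{i\<in>{..<Suc m}. i = k}. ?\<Psi> i \<omega> (f i)))\<^sup>2)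
      = (\<Sum>i<Suc m. act T R m i \<omega> * (norm (f i))\<^sup>2)" for \<omega> and f :: "nat \<Rightarrow> 'h"
  proof (simp only: image_ident, intro sum.cong refl)
    fix k assume "k \<in> {..<Suc m}"
    then have eq: "{i\<in>{..<Suc m}. i = k} = {k}" by auto
    show "(norm (\<Sum>i\<in>{i\<in>{..<Suc m}. i = k}. ?\<Psi> i \<omega> (f i)))\<^sup>2 = act T R m k \<omega> * (norm (f k))\<^sup>2"
      unfolding eq using act_cases[of T R m k \<omega>] by auto
  qed
  with bad show ?thesis by (simp only:)
qed

end

section \<open>Growth of the logarithm along a single path\<close>

context multiplicative_evolution
begin

text \<open>A statement about one path: if it exceeds \<open>R\<close> before \<open>T\<close> and
  satisfies the four error bounds, the growth of the logarithm must come from the compensated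
  martingale. The subtracted 1 covers all errors: 1/8 each from the linear defect, the centred
  squares, the noise remainder and the drift tolerance, and 1/4 from the squared defects and
  drifts.\<close>

lemma path_exponent_bound:
  fixes R R0 D T \<theta> \<beta> \<eta> C0 :: real
  defines "G \<equiv> \<bar>c\<bar> * (1 + K * R) powr \<delta> * R"
  assumes T: "0 < T" and R: "0 < R" and D: "0 \<le> D" "D \<le> T" and D\<sigma>: "ennreal D \<le> \<sigma> \<omega>"
    and cont: "continuous_on {0..D} (\<lambda>t. v t \<omega>)"
    and VR: "R < norm (v D \<omega>)" and V0: "norm (v 0 \<omega>) \<le> R0"
    and near: "\<And>t. t \<in> {0..D} \<Longrightarrow> (norm (v t \<omega>))\<^sup>2 \<le> (norm (J q (v t \<omega>)))\<^sup>2 + 1"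
    and eq: "\<forall>t\<ge>0. ennreal t \<le> \<sigma> \<omega> \<longrightarrow> (\<lambda>r. A q (v r \<omega>)) integrable_on {0..t} \<and>
      J q (v t \<omega>) + integral {0..t} (\<lambda>r. A q (v r \<omega>)) = J q (v 0 \<omega>) + I q t \<omega>"
    and \<theta>: "0 < \<theta>" "\<theta> \<le> 1" and \<beta>: "0 < \<beta>" and \<theta>G: "10 * \<theta> * G\<^sup>2 * (T + 1) \<le> 1 / 8"
    and \<eta>: "0 < \<eta>" and C0: "0 \<le> C0"
    and scalar: "\<And>w n X. 0 \<le> w \<Longrightarrow> 0 \<le> X \<Longrightarrow> 0 \<le> n \<Longrightarrow> w \<le> K * n \<Longrightarrow> n\<^sup>2 \<le> X + 1 \<Longrightarrow>
      \<rho> * w + (c * (1 + w) powr \<delta>)\<^sup>2 * (X / (1 + X))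
      - 2 * (1 - \<eta>) * (c * (1 + w) powr \<delta>)\<^sup>2 * (X / (1 + X))\<^sup>2 \<le> C0"
  shows "\<forall>\<^sub>F m in sequentially.
    (oscillation_le T R q m \<omega> \<beta> \<longrightarrow>
      (\<Sum>i<Suc m. act T R m i \<omega> * (2 * \<kappa> q (v (grid T m i) \<omega>) * (J q (v (grid T m i) \<omega>) \<bullet> defect T q m i \<omega>)))\<^sup>2 \<le> 1 / 64 \<and>
      (\<Sum>i<Suc m. act T R m i \<omega> * (norm (defect T q m i \<omega>))\<^sup>2) \<le> \<theta> / 160) \<longrightarrow>
    \<bar>\<Sum>i<Suc m. act T R m i \<omega> * \<psi> q (v (grid T m i) \<omega>) * ((increment T m i \<omega>)\<^sup>2 - (grid T m (Suc i) - grid T m i))\<bar> < 1 / 8 \<longrightarrow>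
    \<bar>\<Sum>i<Suc m. 1 * ((increment T m i \<omega>)\<^sup>2 - (grid T m (Suc i) - grid T m i))\<bar> < 1 \<longrightarrow>
    \<eta> * (ln (R\<^sup>2) - ln (1 + R0\<^sup>2) - C0 * T - 1) \<le>
      (\<Sum>i<Suc m. (act T R m i \<omega> * \<eta> * b q (v (grid T m i) \<omega>)) * increment T m i \<omega>
        - (act T R m i \<omega> * \<eta> * b q (v (grid T m i) \<omega>))\<^sup>2 * (grid T m (Suc i) - grid T m i) / 2)"
proof -
  define V where "V t = v t \<omega>" for t
  \<comment> \<open>Over a time span of at most \<open>T\<close> this tolerance adds up to 1/8;
    \<open>\<epsilon>\<close> below is the largest oscillation that \<open>oscillation_le\<close>
    admits.\<close>
  define \<zeta> where "\<zeta> = 1 / (8 * T)"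
  define \<epsilon> where "\<epsilon> = sqrt (\<beta> / (4 * T))"
  have \<zeta>: "0 < \<zeta>" and \<epsilon>: "0 < \<epsilon>" using T \<beta> by (auto simp: \<zeta>_def \<epsilon>_def)
  have upto: "ennreal t \<le> \<sigma> \<omega>" if "t \<le> D" for t
    using ennreal_leI[OF that] D\<sigma> by (rule order_trans)
  have int: "(\<lambda>r. A q (V r)) integrable_on {0..t}" if "t \<in> {0..D}" for t
    using eq upto[of t] that unfolding V_def by auto
  \<comment> \<open>Here |v|^2 on the right of the energy estimate is absorbed: \<open>near\<close>
    gives \<open>\<kappa> q (V t) * (norm (V t))\<^sup>2 \<le> 1\<close>.\<close>
  have energyV: "- ((2 * (1 / (1 + (norm (J q (V t)))\<^sup>2))) *\<^sub>R J q (V t) \<bullet> A q (V t)) \<le> \<rho> * wt (V t)"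
    if t: "t \<in> {0..D}" for t
  proof -
    have k: "0 < \<kappa> q (V t)" by (rule \<kappa>_bounds)
    have "- ((2 * (1 / (1 + (norm (J q (V t)))\<^sup>2))) *\<^sub>R J q (V t) \<bullet> A q (V t)) = \<kappa> q (V t) * - (2 * (J q (V t) \<bullet> A q (V t)))"
      by (simp add: \<kappa>_def)
    also have "\<dots> \<le> \<kappa> q (V t) * (\<rho> * wt (V t) * (norm (V t))\<^sup>2)" using k by (intro mult_left_mono energy) auto
    also have "\<dots> = \<rho> * wt (V t) * (\<kappa> q (V t) * (norm (V t))\<^sup>2)" by simp
    also have "\<dots> \<le> \<rho> * wt (V t) * 1"
    proof (intro mult_left_mono)
      have "\<kappa> q (V t) * (norm (V t))\<^sup>2 \<le> \<kappa> q (V t) * ((norm (J q (V t)))\<^sup>2 + 1)"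
        using near[OF t] k by (intro mult_left_mono) (auto simp: V_def)
      also have "\<dots> = 1" using nz[of "J q (V t)"] by (simp add: \<kappa>_def add.commute)
      finally show "\<kappa> q (V t) * (norm (V t))\<^sup>2 \<le> 1" .
    qed (use \<rho> wt_nonneg in auto)
    finally show ?thesis by simp
  qed
  obtain C where good: "\<forall>\<^sub>F m in sequentially. \<exists>k\<le>Suc m.
      (\<forall>i\<le>k. grid T m i \<le> D) \<and> (\<forall>i<k. norm (V (grid T m i)) \<le> R) \<and> R < norm (V (grid T m k)) \<and>
      (\<forall>i<k. \<forall>r\<in>{grid T m i..grid T m (Suc i)}.
        norm (g (V r) *\<^sub>R J q (V r) - g (V (grid T m i)) *\<^sub>R J q (V (grid T m i))) \<le> \<epsilon>) \<and>
      (\<forall>i<k. norm (J q (V (grid T m (Suc i))) - J q (V (grid T m i))) \<le> \<theta>) \<and>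
      (\<forall>i<k. norm (integral {0..grid T m (Suc i)} (\<lambda>r. A q (V r)) - integral {0..grid T m i} (\<lambda>r. A q (V r))) \<le> C * (T / real (Suc m))) \<and>
      (\<forall>i<k. - ((2 * (1 / (1 + (norm (J q (V (grid T m i))))\<^sup>2))) *\<^sub>R J q (V (grid T m i)) \<bullet> (integral {0..grid T m (Suc i)} (\<lambda>r. A q (V r)) - integral {0..grid T m i} (\<lambda>r. A q (V r))))
        \<le> (T / real (Suc m)) * (\<rho> * wt (V (grid T m i)) + \<zeta>))"
    by (rule eventually_good_grid[where V=V and J="J q" and A="A q" and wt=wt and g=g and R=R and D=D and \<rho>=\<rho> and \<theta>=\<theta> and \<epsilon>=\<epsilon> and \<zeta>=\<zeta>,
      OF T D _ _ J wt_continuous g_continuous A_bounded int energyV \<rho> \<theta>(1) \<epsilon> \<zeta>])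
      (use cont VR in \<open>simp_all add: V_def[abs_def]\<close>)
  \<comment> \<open>Contribution of the squared drift increments, which vanishes with the
    mesh.\<close>
  have "(\<lambda>m. 20 / \<theta> * (T * C\<^sup>2) * (T / real (Suc m))) \<longlonglongrightarrow> 20 / \<theta> * (T * C\<^sup>2) * 0"
    by (intro tendsto_mult tendsto_const LIMSEQ_Suc[OF lim_const_over_n[of T]])
  then have "\<forall>\<^sub>F m in sequentially. 20 / \<theta> * (T * C\<^sup>2) * (T / real (Suc m)) < 1 / 8"
    by (intro order_tendstoD(2)) auto
  with good show ?thesis
  proof eventually_elim
    case (elim m)
    let ?t = "grid T m" and ?\<Delta> = "T / real (Suc m)"
    let ?P = "\<lambda>t. integral {0..t} (\<lambda>r. A q (V r))"
    from elim(1) obtain k where k: "k \<le> Suc m"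
      and tD': "\<forall>i\<le>k. ?t i \<le> D"
      and le': "\<forall>i<k. norm (V (?t i)) \<le> R" and gt: "R < norm (V (?t k))"
      and osc': "\<forall>i<k. \<forall>r\<in>{?t i..?t (Suc i)}. norm (g (V r) *\<^sub>R J q (V r) - g (V (?t i)) *\<^sub>R J q (V (?t i))) \<le> \<epsilon>"
      and small': "\<forall>i<k. norm (J q (V (?t (Suc i))) - J q (V (?t i))) \<le> \<theta>"
      and \<alpha>': "\<forall>i<k. norm (?P (?t (Suc i)) - ?P (?t i)) \<le> C * ?\<Delta>"
      and drift': "\<forall>i<k. - ((2 * (1 / (1 + (norm (J q (V (?t i))))\<^sup>2))) *\<^sub>R J q (V (?t i)) \<bullet> (?P (?t (Suc i)) - ?P (?t i)))
        \<le> ?\<Delta> * (\<rho> * wt (V (?t i)) + \<zeta>)"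
      by (elim exE conjE) (rule that)
    note tD = tD'[rule_format] and le = le'[rule_format] and osc = osc'[rule_format]
      and small = small'[rule_format] and \<alpha> = \<alpha>'[rule_format] and drift = drift'[rule_format]
    have \<Delta>: "0 < ?\<Delta>" using T by simp
    have t0: "0 \<le> ?t i" for i by (rule grid_nonneg[OF T])
    have H: "H q r \<omega> = g (V r) *\<^sub>R J q (V r)" if "r \<le> D" for r
      using upto[OF that] by (simp add: H_def V_def)
    have act1: "act T R m i \<omega> = 1" if "i < k" for i
      using that tD[of i] upto le by (auto simp: act_def V_def)
    have act0: "act T R m i \<omega> = 0" if "k \<le> i" for i
      using that gt by (auto simp: act_def V_def not_le intro!: exI[of _ k])
    \<comment> \<open>The switch is 1 before \<open>k\<close> and 0 from \<open>k\<close> on, so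
      switched sums over the whole grid end at the exit index.\<close>
    have actsum: "(\<Sum>i<Suc m. act T R m i \<omega> * f i) = (\<Sum>i<k. f i)" for f :: "nat \<Rightarrow> real"
    proof -
      have "(\<Sum>i<Suc m. act T R m i \<omega> * f i) = (\<Sum>i<k. act T R m i \<omega> * f i)"
        using k act0 by (intro sum.mono_neutral_right) auto
      also have "\<dots> = (\<Sum>i<k. f i)" using act1 by (intro sum.cong) auto
      finally show ?thesis .
    qed
    \<comment> \<open>This makes the conditional defect bounds available: the active steps are those
      before \<open>k\<close>, where the integrand moves by at most
      \<open>\<epsilon>\<close>.\<close>
    have oscle: "oscillation_le T R q m \<omega> \<beta>"
      unfolding oscillation_le_def
    proof (intro allI impI ballI)
      fix i r assume a: "act T R m i \<omega> = 1" and r: "r \<in> {?t i<..?t (Suc i)}"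
      have i: "i < k" using a act0[of i] by (cases "k \<le> i") auto
      have rD: "r \<le> D" "?t i \<le> D" using r tD[of "Suc i"] tD[of i] i by auto
      have "norm (H q r \<omega> - H q (?t i) \<omega>) \<le> \<epsilon>" unfolding H[OF rD(1)] H[OF rD(2)] using r by (intro osc i) auto
      then have "(norm (H q r \<omega> - H q (?t i) \<omega>))\<^sup>2 \<le> \<epsilon>\<^sup>2" by (intro power_mono) auto
      then show "(norm (H q r \<omega> - H q (?t i) \<omega>))\<^sup>2 * (4 * T) \<le> \<beta>" using T \<beta> by (simp add: \<epsilon>_def field_simps)
    qed
    let ?z = "\<lambda>i. J q (V (?t i))" and ?w = "\<lambda>i. increment T m i \<omega>" and ?e = "\<lambda>i. defect T q m i \<omega>"
    let ?b = "\<lambda>i. b q (V (?t i))" and ?\<psi> = "\<lambda>i. \<psi> q (V (?t i))" and ?\<kappa> = "\<lambda>i. \<kappa> q (V (?t i))"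
    have main: "ln (1 + (norm (?z k))\<^sup>2) - ln (1 + (norm (?z 0))\<^sup>2) \<le>
      (\<Sum>i<k. ?b i * ?w i - \<eta> * (?b i)\<^sup>2 * ?\<Delta> / 2) + k * ?\<Delta> * (C0 + \<zeta>) + (\<Sum>i<k. 2 * ?\<kappa> i * (?z i \<bullet> ?e i))
      + (\<Sum>i<k. ?\<psi> i * ((?w i)\<^sup>2 - ?\<Delta>)) + 10 * \<theta> * G\<^sup>2 * (\<Sum>i<k. (?w i)\<^sup>2)
      + 20 / \<theta> * ((\<Sum>i<k. (norm (?e i))\<^sup>2) + k * (C * ?\<Delta>)\<^sup>2)"
    proof (rule discrete_log_energy_bound[where \<alpha>="\<lambda>i. ?P (?t (Suc i)) - ?P (?t i)" and g="\<lambda>i. g (V (?t i))"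
          and p="\<lambda>i. \<rho> * wt (V (?t i)) + \<zeta>"])
      show "?\<kappa> i = 1 / (1 + (norm (?z i))\<^sup>2)" for i by (simp add: \<kappa>_def)
      show "?b i = 2 * ?\<kappa> i * g (V (?t i)) * (norm (?z i))\<^sup>2" for i by (simp add: b_def)
      show "?\<psi> i = ?\<kappa> i * (g (V (?t i)))\<^sup>2 * (norm (?z i))\<^sup>2 - (?b i)\<^sup>2 / 2" for i by (simp add: \<psi>_def)
      fix i assume i: "i < k"
      have e1: "?z i + ?P (?t i) = J q (v 0 \<omega>) + I q (?t i) \<omega>"
        using eq t0 upto[OF tD[of i]] i unfolding V_def by auto
      have e2: "?z (Suc i) + ?P (?t (Suc i)) = J q (v 0 \<omega>) + I q (?t (Suc i)) \<omega>"
        using eq t0 upto[OF tD[of "Suc i"]] i unfolding V_def by auto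
      have "?z (Suc i) = J q (v 0 \<omega>) + I q (?t (Suc i)) \<omega> - ?P (?t (Suc i))" using e2 by (simp add: eq_diff_eq)
      also have "J q (v 0 \<omega>) = ?z i + ?P (?t i) - I q (?t i) \<omega>" using e1 by (simp add: eq_diff_eq)
      finally have e3: "?z (Suc i) = ?z i + ?P (?t i) - I q (?t i) \<omega> + I q (?t (Suc i)) \<omega> - ?P (?t (Suc i))" .
      show "?z (Suc i) = ?z i + (- (?P (?t (Suc i)) - ?P (?t i)) + ?w i *\<^sub>R g (V (?t i)) *\<^sub>R ?z i + ?e i)"
        unfolding e3 defect_def H[OF tD[OF less_imp_le[OF i]]] by simp
      show "norm (?z (Suc i) - ?z i) \<le> \<theta>" by (rule small[OF i])
      show "- (2 * ?\<kappa> i * (?z i \<bullet> (?P (?t (Suc i)) - ?P (?t i)))) \<le> ?\<Delta> * (\<rho> * wt (V (?t i)) + \<zeta>)"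
        using drift[OF i] by (simp only: inner_scaleR_left \<kappa>_def)
      show "norm (?P (?t (Suc i)) - ?P (?t i)) \<le> C * ?\<Delta>" by (rule \<alpha>[OF i])
      show "norm (g (V (?t i)) *\<^sub>R ?z i) \<le> G" unfolding G_def by (rule bounded_coefficients(1)[OF le[OF i]])
      define X where "X = (norm (?z i))\<^sup>2"
      have X: "0 \<le> X" "?\<kappa> i * X = X / (1 + X)" by (simp_all add: X_def \<kappa>_def)
      have \<psi>eq: "?\<psi> i = (g (V (?t i)))\<^sup>2 * (X / (1 + X)) - (?b i)\<^sup>2 / 2"
        unfolding X(2)[symmetric] unfolding \<psi>_def X_def by simp
      have beq: "?b i = 2 * g (V (?t i)) * (X / (1 + X))"
        unfolding X(2)[symmetric] unfolding b_def X_def by simp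
      have "\<rho> * wt (V (?t i)) + (g (V (?t i)))\<^sup>2 * (X / (1 + X))
        - 2 * (1 - \<eta>) * (g (V (?t i)))\<^sup>2 * (X / (1 + X))\<^sup>2 \<le> C0"
        unfolding g_def
        by (rule scalar[OF wt_nonneg X(1) norm_ge_zero wt_le]) (use near[of "?t i"] t0 tD[of i] i in \<open>simp add: X_def V_def\<close>)
      \<comment> \<open>As \<open>?b i\<close> is twice the coefficient times
        \<open>X / (1 + X)\<close>, setting aside the fraction \<open>\<eta>\<close> of the bracket
        changes the factor 2 of the quadratic term into \<open>2 * (1 - \<eta>)\<close>.\<close>
      moreover have "?\<psi> i + \<eta> * (?b i)\<^sup>2 / 2 = (g (V (?t i)))\<^sup>2 * (X / (1 + X)) - 2 * (1 - \<eta>) * (g (V (?t i)))\<^sup>2 * (X / (1 + X))\<^sup>2"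
        unfolding \<psi>eq beq power_mult_distrib by (simp add: left_diff_distrib right_diff_distrib)
      ultimately show "\<rho> * wt (V (?t i)) + \<zeta> + ?\<psi> i + \<eta> * (?b i)\<^sup>2 / 2 \<le> C0 + \<zeta>" by linarith
    qed (use \<theta> \<Delta> in auto)
    show ?case
    proof (intro impI)
      assume E12: "oscillation_le T R q m \<omega> \<beta> \<longrightarrow>
        (\<Sum>i<Suc m. act T R m i \<omega> * (2 * \<kappa> q (v (grid T m i) \<omega>) * (J q (v (grid T m i) \<omega>) \<bullet> defect T q m i \<omega>)))\<^sup>2 \<le> 1 / 64 \<and>
        (\<Sum>i<Suc m. act T R m i \<omega> * (norm (defect T q m i \<omega>))\<^sup>2) \<le> \<theta> / 160"
        and E3: "\<bar>\<Sum>i<Suc m. act T R m i \<omega> * \<psi> q (v (grid T m i) \<omega>) * ((increment T m i \<omega>)\<^sup>2 - (grid T m (Suc i) - grid T m i))\<bar> < 1 / 8"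
        and E4: "\<bar>\<Sum>i<Suc m. 1 * ((increment T m i \<omega>)\<^sup>2 - (grid T m (Suc i) - grid T m i))\<bar> < 1"
      have d: "grid T m (Suc i) - grid T m i = ?\<Delta>" for i by (simp add: grid_Suc)
      have "(\<Sum>i<k. 2 * ?\<kappa> i * (?z i \<bullet> ?e i))\<^sup>2 \<le> (1 / 8)\<^sup>2"
        using E12 oscle unfolding actsum V_def by (simp add: power2_eq_square)
      then have e1: "(\<Sum>i<k. 2 * ?\<kappa> i * (?z i \<bullet> ?e i)) \<le> 1 / 8"
        by (rule power2_le_imp_le) simp
      have e2: "(\<Sum>i<k. (norm (?e i))\<^sup>2) \<le> \<theta> / 160" using E12 oscle unfolding actsum V_def by simp
      have e3: "(\<Sum>i<k. ?\<psi> i * ((?w i)\<^sup>2 - ?\<Delta>)) \<le> 1 / 8"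
        using E3 unfolding mult.assoc actsum d V_def by linarith
      \<comment> \<open>The squared increments exceed the elapsed time \<open>T\<close> by at most
        1, by the bound on their centred sum over the full grid.\<close>
      have "(\<Sum>i<k. (?w i)\<^sup>2) \<le> (\<Sum>i<Suc m. (?w i)\<^sup>2)" using k by (intro sum_mono2) auto
      also have "\<dots> = (\<Sum>i<Suc m. 1 * ((?w i)\<^sup>2 - ?\<Delta>)) + T" by (simp add: sum_subtractf del: sum.lessThan_Suc)
      also have "\<dots> \<le> T + 1" using E4 unfolding d by linarith
      finally have "10 * \<theta> * G\<^sup>2 * (\<Sum>i<k. (?w i)\<^sup>2) \<le> 10 * \<theta> * G\<^sup>2 * (T + 1)"
        using \<theta> by (intro mult_left_mono) auto
      then have e4: "10 * \<theta> * G\<^sup>2 * (\<Sum>i<k. (?w i)\<^sup>2) \<le> 1 / 8" using \<theta>G by simp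
      have kD: "k * ?\<Delta> \<le> T"
      proof -
        have "k * ?\<Delta> \<le> real (Suc m) * ?\<Delta>" using k \<Delta> by (intro mult_right_mono) auto
        then show ?thesis by simp
      qed
      have "20 / \<theta> * ((\<Sum>i<k. (norm (?e i))\<^sup>2) + k * (C * ?\<Delta>)\<^sup>2) \<le> 20 / \<theta> * (\<theta> / 160 + T * C\<^sup>2 * ?\<Delta>)"
      proof (intro mult_left_mono add_mono e2)
        have "k * (C * ?\<Delta>)\<^sup>2 = (k * ?\<Delta>) * (C\<^sup>2 * ?\<Delta>)" by (simp add: power2_eq_square)
        also have "\<dots> \<le> T * (C\<^sup>2 * ?\<Delta>)" by (intro mult_right_mono mult_nonneg_nonneg zero_le_power2 less_imp_le[OF \<Delta>] kD)
        finally show "k * (C * ?\<Delta>)\<^sup>2 \<le> T * C\<^sup>2 * ?\<Delta>" by (simp add: mult.assoc)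
      qed (use \<theta> in auto)
      also have "\<dots> = 1 / 8 + 20 / \<theta> * (T * C\<^sup>2) * ?\<Delta>" using \<theta> by (simp add: distrib_left)
      also have "\<dots> \<le> 1 / 8 + 1 / 8" using elim(2) by simp
      finally have e5: "20 / \<theta> * ((\<Sum>i<k. (norm (?e i))\<^sup>2) + k * (C * ?\<Delta>)\<^sup>2) \<le> 1 / 4" by simp
      have "k * ?\<Delta> * (C0 + \<zeta>) \<le> T * (C0 + \<zeta>)" using kD C0 \<zeta> by (intro mult_right_mono) auto
      also have "\<dots> = C0 * T + 1 / 8" using T by (simp add: \<zeta>_def algebra_simps)
      finally have e6: "k * ?\<Delta> * (C0 + \<zeta>) \<le> C0 * T + 1 / 8" .
      have "ln (R\<^sup>2) \<le> ln (1 + (norm (?z k))\<^sup>2)"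
      proof -
        have "R\<^sup>2 \<le> (norm (V (?t k)))\<^sup>2" using gt R by (intro power_mono) auto
        also have "\<dots> \<le> 1 + (norm (?z k))\<^sup>2" using near[of "?t k"] t0 tD[of k] by (simp add: V_def)
        finally show ?thesis using R by (subst ln_le_cancel_iff) (auto simp: add_pos_nonneg)
      qed
      moreover have "ln (1 + (norm (?z 0))\<^sup>2) \<le> ln (1 + R0\<^sup>2)"
      proof -
        have "norm (?z 0) \<le> R0" using J_le[of q "V 0"] V0 by (simp add: V_def)
        then have "(norm (?z 0))\<^sup>2 \<le> R0\<^sup>2" by (intro power_mono) auto
        then show ?thesis by (subst ln_le_cancel_iff) (auto simp: add_pos_nonneg)
      qed
      ultimately have "ln (R\<^sup>2) - ln (1 + R0\<^sup>2) - C0 * T - 1 \<le> (\<Sum>i<k. ?b i * ?w i - \<eta> * (?b i)\<^sup>2 * ?\<Delta> / 2)"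
        using main e1 e3 e4 e5 e6 by linarith
      then have "\<eta> * (ln (R\<^sup>2) - ln (1 + R0\<^sup>2) - C0 * T - 1) \<le> \<eta> * (\<Sum>i<k. ?b i * ?w i - \<eta> * (?b i)\<^sup>2 * ?\<Delta> / 2)"
        using \<eta> by (intro mult_left_mono) auto
      also have "\<dots> = (\<Sum>i<Suc m. act T R m i \<omega> * (\<eta> * (?b i * ?w i - \<eta> * (?b i)\<^sup>2 * ?\<Delta> / 2)))"
        unfolding actsum sum_distrib_left ..
      also have "\<dots> = (\<Sum>i<Suc m. (act T R m i \<omega> * \<eta> * b q (v (grid T m i) \<omega>)) * increment T m i \<omega>
        - (act T R m i \<omega> * \<eta> * b q (v (grid T m i) \<omega>))\<^sup>2 * (grid T m (Suc i) - grid T m i) / 2)"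
      \<comment> \<open>The switch equals its own square. Hence multiplication by
        \<open>\<eta>\<close> turns the compensated sum into the exponent of an exponential
        martingale with coefficient \<open>\<eta>\<close> times the switched
        \<open>b\<close>.\<close>
      proof (rule sum.cong[OF refl])
        fix i
        show "act T R m i \<omega> * (\<eta> * (?b i * ?w i - \<eta> * (?b i)\<^sup>2 * ?\<Delta> / 2))
          = (act T R m i \<omega> * \<eta> * b q (v (grid T m i) \<omega>)) * increment T m i \<omega>
        - (act T R m i \<omega> * \<eta> * b q (v (grid T m i) \<omega>))\<^sup>2 * (grid T m (Suc i) - grid T m i) / 2"
          unfolding d using act_cases[of T R m i \<omega>]
          by (auto simp: V_def power2_eq_square right_diff_distrib)
      qed
      finally show "\<eta> * (ln (R\<^sup>2) - ln (1 + R0\<^sup>2) - C0 * T - 1) \<le>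
        (\<Sum>i<Suc m. (act T R m i \<omega> * \<eta> * b q (v (grid T m i) \<omega>)) * increment T m i \<omega>
        - (act T R m i \<omega> * \<eta> * b q (v (grid T m i) \<omega>))\<^sup>2 * (grid T m (Suc i) - grid T m i) / 2)" .
    qed
  qed
qed

end

section \<open>From single paths to probabilities\<close>

context multiplicative_evolution
begin

text \<open>Contractions that converge pointwise converge uniformly on compact sets, by a finite
  net. The radius \<open>1 / (6 * B)\<close> puts \<open>x\<close> and \<open>J q x\<close> within
  \<open>1 / (2 * B)\<close> of each other, so their squared norms differ by at most 1.\<close>

lemma eventually_J_near:
  assumes "compact S"
  shows "\<forall>\<^sub>F q in sequentially. \<forall>x\<in>S. (norm x)\<^sup>2 \<le> (norm (J q x))\<^sup>2 + 1"
proof -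
  have "bounded S" using assms by (rule compact_imp_bounded)
  then obtain B where B: "0 < B" "\<forall>x\<in>S. norm x \<le> B" by (auto simp: bounded_pos)
  define \<epsilon> where "\<epsilon> = 1 / (6 * B)"
  have \<epsilon>: "0 < \<epsilon>" using B by (simp add: \<epsilon>_def)
  obtain S' where S': "S' \<subseteq> S" "finite S'" "S \<subseteq> (\<Union>c\<in>S'. ball c \<epsilon>)"
    by (rule compactE_image[OF assms, of S "\<lambda>c. ball c \<epsilon>"]) (use \<epsilon> in auto)
  have "\<forall>\<^sub>F q in sequentially. dist (J q y) y < \<epsilon>" for y
    using tendstoD[OF J_tendsto \<epsilon>] .
  then have "\<forall>\<^sub>F q in sequentially. \<forall>y\<in>S'. dist (J q y) y < \<epsilon>"
    using S'(2) by (intro eventually_ball_finite) auto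
  then show ?thesis
  proof eventually_elim
    case (elim q)
    show ?case
    proof
      fix x assume x: "x \<in> S"
      then obtain y where y: "y \<in> S'" "dist y x < \<epsilon>" using S'(3) by auto
      have "x - J q x = (x - y) + (y - J q y) + J q (y - x)"
        using linear_diff[OF bounded_linear.linear[OF J], of q y x] by simp
      also have "norm \<dots> \<le> norm (x - y) + norm (y - J q y) + norm (J q (y - x))"
        by (intro order_trans[OF norm_triangle_ineq] add_right_mono norm_triangle_ineq)
      also have "\<dots> \<le> \<epsilon> + \<epsilon> + \<epsilon>"
      proof (intro add_mono)
        show "norm (x - y) \<le> \<epsilon>" using y by (simp add: dist_norm norm_minus_commute)
        show "norm (y - J q y) \<le> \<epsilon>" using elim y(1) by (auto simp: dist_norm norm_minus_commute less_imp_le)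
        show "norm (J q (y - x)) \<le> \<epsilon>" using J_le[of q "y - x"] y by (simp add: dist_norm)
      qed
      finally have d: "norm (x - J q x) \<le> 3 * \<epsilon>" by simp
      have xB: "norm x \<le> B" using B x by blast
      have "(norm x)\<^sup>2 - (norm (J q x))\<^sup>2 = (norm x + norm (J q x)) * (norm x - norm (J q x))"
        by (simp add: power2_eq_square algebra_simps)
      also have "\<dots> \<le> (2 * B) * (3 * \<epsilon>)"
        using norm_triangle_ineq2[of x "J q x"] d J_le[of q x] xB by (intro mult_mono) (auto simp: B less_imp_le)
      also have "\<dots> = 1" using B by (simp add: \<epsilon>_def)
      finally show "(norm x)\<^sup>2 \<le> (norm (J q x))\<^sup>2 + 1" by simp
    qed
  qed
qed

text \<open>For a path of \<open>E\<close>, a fine mollifier and then a fine grid leave two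
  possibilities: one of the four error bounds fails, or the exponent is at least \<open>L\<close>.
  In the limit of fine grids the failures have probability at most \<open>e\<close> and the second
  event at most \<open>exp (- L)\<close>, whatever the mollifier.\<close>

theorem exit_probability:
  fixes R R0 T \<eta> C0 :: real and E :: "'w set"
  assumes T: "0 < T" and R: "0 < R" and \<eta>: "0 < \<eta>" and C0: "0 \<le> C0"
    and scalar: "\<And>w n X. 0 \<le> w \<Longrightarrow> 0 \<le> X \<Longrightarrow> 0 \<le> n \<Longrightarrow> w \<le> K * n \<Longrightarrow> n\<^sup>2 \<le> X + 1 \<Longrightarrow>
      \<rho> * w + (c * (1 + w) powr \<delta>)\<^sup>2 * (X / (1 + X))
      - 2 * (1 - \<eta>) * (c * (1 + w) powr \<delta>)\<^sup>2 * (X / (1 + X))\<^sup>2 \<le> C0"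
    and E: "E \<in> events" and E0: "\<And>\<omega>. \<omega> \<in> E \<Longrightarrow> norm (v 0 \<omega>) \<le> R0"
    and exit: "AE \<omega> in M. \<omega> \<in> E \<longrightarrow> (\<exists>D\<in>{0..T}. ennreal D \<le> \<sigma> \<omega> \<and> R < norm (v D \<omega>))"
  shows "prob E \<le> exp (- (\<eta> * (ln (R\<^sup>2) - ln (1 + R0\<^sup>2) - C0 * T - 1)))"
proof (rule field_le_epsilon)
  define L where "L = \<eta> * (ln (R\<^sup>2) - ln (1 + R0\<^sup>2) - C0 * T - 1)"
  fix e :: real assume e: "0 < e"
  define G where "G = \<bar>c\<bar> * (1 + K * R) powr \<delta> * R"
  \<comment> \<open>Chosen so that the noise remainder is at most 1/8; the added ones make it well
    defined and at most 1 even if \<open>G\<close> vanishes.\<close>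
  define \<theta> where "\<theta> = 1 / (80 * (G\<^sup>2 + 1) * (T + 1))"
  have big: "1 \<le> 80 * (G\<^sup>2 + 1) * (T + 1)"
    using T mult_mono[of 1 "80 * (G\<^sup>2 + 1)" 1 "T + 1"] by simp
  have \<theta>: "0 < \<theta>" "\<theta> \<le> 1" using big by (auto simp: \<theta>_def divide_le_eq)
  have \<theta>G: "10 * \<theta> * G\<^sup>2 * (T + 1) \<le> 1 / 8"
  proof -
    have "10 * \<theta> * G\<^sup>2 * (T + 1) \<le> 10 * \<theta> * (G\<^sup>2 + 1) * (T + 1)"
      using \<theta> T by (intro mult_right_mono mult_left_mono) auto
    also have "\<dots> = 1 / 8"
    proof -
      have "10 * (1 / (80 * p * (T + 1))) * p * (T + 1) = 1 / 8" if "0 < p" for p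
      proof -
        have x: "0 < p * (T + 1)" using that T by simp
        have "10 * (1 / (80 * p * (T + 1))) * p * (T + 1) = 10 * (1 / (80 * (p * (T + 1)))) * (p * (T + 1))"
          by (simp only: mult.assoc)
        also have "\<dots> = 1 / 8" using that T x by (simp add: less_imp_neq[symmetric])
        finally show ?thesis .
      qed
      from this[of "G\<^sup>2 + 1"] show ?thesis unfolding \<theta>_def by (simp add: add_nonneg_pos)
    qed
    finally show ?thesis .
  qed
  \<comment> \<open>With the thresholds 1/64 and \<open>\<theta> / 160\<close>, each of the two
    defect events costs at most \<open>e / 2\<close>.\<close>
  define \<beta> where "\<beta> = min (e / 2 * (1 / 64)) (e / 2 * (\<theta> / 160))"
  have \<beta>: "0 < \<beta>" using e \<theta> by (simp add: \<beta>_def)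
  have \<beta>1: "\<beta> / (1 / 64) \<le> e / 2" by (simp add: \<beta>_def)
  have \<beta>2: "\<beta> / (\<theta> / 160) \<le> e / 2"
  proof -
    have "\<beta> \<le> e / 2 * (\<theta> / 160)" by (simp add: \<beta>_def)
    then show ?thesis using \<theta> by (subst pos_divide_le_eq) auto
  qed
  let ?E1 = "\<lambda>q m \<omega>. (\<Sum>i<Suc m. act T R m i \<omega> * (2 * \<kappa> q (v (grid T m i) \<omega>) * (J q (v (grid T m i) \<omega>) \<bullet> defect T q m i \<omega>)))\<^sup>2"
  let ?E2 = "\<lambda>q m \<omega>. (\<Sum>i<Suc m. act T R m i \<omega> * (norm (defect T q m i \<omega>))\<^sup>2)"
  let ?E3 = "\<lambda>q m \<omega>. \<bar>\<Sum>i<Suc m. act T R m i \<omega> * \<psi> q (v (grid T m i) \<omega>) * ((increment T m i \<omega>)\<^sup>2 - (grid T m (Suc i) - grid T m i))\<bar>"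
  let ?E4 = "\<lambda>m \<omega>. \<bar>\<Sum>i<Suc m. 1 * ((increment T m i \<omega>)\<^sup>2 - (grid T m (Suc i) - grid T m i))\<bar>"
  let ?S = "\<lambda>q m \<omega>. (\<Sum>i<Suc m. (act T R m i \<omega> * \<eta> * b q (v (grid T m i) \<omega>)) * increment T m i \<omega>
        - (act T R m i \<omega> * \<eta> * b q (v (grid T m i) \<omega>))\<^sup>2 * (grid T m (Suc i) - grid T m i) / 2)"
  define P1 where "P1 q m Z \<longleftrightarrow> Z \<in> events \<and> prob Z \<le> \<beta> / (1 / 64) \<and>
    (AE \<omega> in M. \<omega> \<notin> Z \<longrightarrow> oscillation_le T R q m \<omega> \<beta> \<longrightarrow> ?E1 q m \<omega> \<le> 1 / 64)" for q m Z
  define P2 where "P2 q m Z \<longleftrightarrow> Z \<in> events \<and> prob Z \<le> \<beta> / (\<theta> / 160) \<and>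
    (AE \<omega> in M. \<omega> \<notin> Z \<longrightarrow> oscillation_le T R q m \<omega> \<beta> \<longrightarrow> ?E2 q m \<omega> \<le> \<theta> / 160)" for q m Z
  \<comment> \<open>The bad sets are only known to exist; one is fixed for every mollifier and grid,
    so that unions and limits of them can be formed.\<close>
  define Z1 where "Z1 q m = (SOME Z. P1 q m Z)" for q m
  define Z2 where "Z2 q m = (SOME Z. P2 q m Z)" for q m
  have P1: "P1 q m (Z1 q m)" for q m
    unfolding Z1_def
  proof (rule someI_ex)
    show "\<exists>Z. P1 q m Z" unfolding P1_def using linear_defect_bad_set[OF T _ \<beta>, of "1 / 64" R q m] by (simp add: Bex_def)
  qed
  have P2: "P2 q m (Z2 q m)" for q m
    unfolding Z2_def
  proof (rule someI_ex)
    show "\<exists>Z. P2 q m Z" unfolding P2_def using square_defect_bad_set[OF T _ \<beta>, of "\<theta> / 160" R q m] \<theta> by (simp add: Bex_def)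
  qed
  define Z3 where "Z3 q m = {\<omega> \<in> space M. 1 / 8 \<le> ?E3 q m \<omega>}" for q m
  define Z4 where "Z4 m = {\<omega> \<in> space M. 1 \<le> ?E4 m \<omega>}" for m
  define Z5 where "Z5 q m = {\<omega> \<in> space M. L \<le> ?S q m \<omega>}" for q m
  have t0: "0 \<le> grid T m i" for m i by (rule grid_nonneg[OF T])
  have actF: "act T R m i \<in> borel_measurable (F (ennreal (grid T m i)))" for m i by (rule act_adapted[OF T])
  have \<psi>F: "(\<lambda>\<omega>. \<psi> q (v (grid T m i) \<omega>)) \<in> borel_measurable (F (ennreal (grid T m i)))" for q m i
    by (rule adapted_continuous[OF continuous_coefficients(4) t0])
  have bF: "(\<lambda>\<omega>. b q (v (grid T m i) \<omega>)) \<in> borel_measurable (F (ennreal (grid T m i)))" for q m i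
    by (rule adapted_continuous[OF continuous_coefficients(3) t0])
  have c3F: "(\<lambda>\<omega>. act T R m i \<omega> * \<psi> q (v (grid T m i) \<omega>)) \<in> borel_measurable (F (ennreal (grid T m i)))" for q m i
    by (intro borel_measurable_times actF \<psi>F)
  have c5F: "(\<lambda>\<omega>. act T R m i \<omega> * \<eta> * b q (v (grid T m i) \<omega>)) \<in> borel_measurable (F (ennreal (grid T m i)))" for q m i
    by (intro borel_measurable_times actF bF borel_measurable_const)
  have [measurable]: "increment T m i \<in> borel_measurable M" for m i
    unfolding increment_def by (intro dW_measurable t0 less_imp_le grid_less T)
  note [measurable] = measurable_F_M[OF c3F] measurable_F_M[OF c5F]
  have Z3: "Z3 q m \<in> events" for q m unfolding Z3_def by measurable
  have Z4: "Z4 m \<in> events" for m unfolding Z4_def by measurable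
  have Z5: "Z5 q m \<in> events" for q m unfolding Z5_def by measurable
  have d: "grid T m (Suc i) - grid T m i = T / real (Suc m)" for m i by (simp add: grid_Suc)
  have p3: "prob (Z3 q m) \<le> 64 * (2 * G\<^sup>2)\<^sup>2 * 2 * T * (T / real (Suc m))" for q m
  proof -
    have "prob (Z3 q m) \<le> (\<Sum>i<Suc m. (2 * G\<^sup>2)\<^sup>2 * (2 * (grid T m (Suc i) - grid T m i)\<^sup>2)) / (1 / 8)\<^sup>2"
      unfolding Z3_def increment_def
    proof (rule prob_squared_increments)
      fix i \<omega>
      show "(\<lambda>\<omega>. act T R m i \<omega> * \<psi> q (v (grid T m i) \<omega>)) \<in> borel_measurable (F (ennreal (grid T m i)))" by (rule c3F)
      show "\<bar>act T R m i \<omega> * \<psi> q (v (grid T m i) \<omega>)\<bar> \<le> 2 * G\<^sup>2"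
        using bounded_coefficients(3)[of "v (grid T m i) \<omega>" R q] by (auto simp: act_def G_def)
    qed (use T in \<open>auto simp: grid_less\<close>)
    also have "\<dots> = 64 * (2 * G\<^sup>2)\<^sup>2 * 2 * T * (T / real (Suc m))"
      unfolding d by (simp add: power2_eq_square del: of_nat_Suc)
    finally show ?thesis .
  qed
  have p4: "prob (Z4 m) \<le> 2 * T * (T / real (Suc m))" for m
  proof -
    have "prob (Z4 m) \<le> (\<Sum>i<Suc m. 1\<^sup>2 * (2 * (grid T m (Suc i) - grid T m i)\<^sup>2)) / 1\<^sup>2"
      unfolding Z4_def increment_def
      by (rule prob_squared_increments) (use T in \<open>auto simp: grid_less\<close>)
    also have "\<dots> = 2 * T * (T / real (Suc m))"
      unfolding d by (simp add: power2_eq_square del: of_nat_Suc)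
    finally show ?thesis .
  qed
  have p5: "prob (Z5 q m) \<le> exp (- L)" for q m
    unfolding Z5_def increment_def
    by (rule prob_exponential_increments) (use T c5F in \<open>auto simp: grid_less\<close>)
  define Z where "Z q m = Z1 q m \<union> (Z2 q m \<union> (Z3 q m \<union> (Z4 m \<union> Z5 q m)))" for q m
  define u where "u m = e / 2 + (e / 2 + (64 * (2 * G\<^sup>2)\<^sup>2 * 2 * T * (T / real (Suc m)) + (2 * T * (T / real (Suc m)) + exp (- L))))" for m
  have Zev: "Z q m \<in> events" for q m
    using P1[of q m] P2[of q m] Z3 Z4 Z5 unfolding Z_def P1_def P2_def by auto
  have pZ: "prob (Z q m) \<le> u m" for q m
  proof -
    have ev: "Z1 q m \<in> events" "Z2 q m \<in> events" using P1[of q m] P2[of q m] by (auto simp: P1_def P2_def)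
    have "prob (Z q m) \<le> prob (Z1 q m) + (prob (Z2 q m) + (prob (Z3 q m) + (prob (Z4 m) + prob (Z5 q m))))"
      unfolding Z_def using ev Z3[of q m] Z4[of m] Z5[of q m]
      by (intro order_trans[OF measure_Un_le] add_left_mono order_refl sets.Un)
    also have "\<dots> \<le> u m"
      unfolding u_def using P1[of q m] P2[of q m] \<beta>1 \<beta>2 p3[of q m] p4[of m] p5[of q m]
      unfolding P1_def P2_def by linarith
    finally show ?thesis .
  qed
  have ulim: "u \<longlonglongrightarrow> e / 2 + (e / 2 + (64 * (2 * G\<^sup>2)\<^sup>2 * 2 * T * 0 + (2 * T * 0 + exp (- L))))"
    unfolding u_def by (intro tendsto_add tendsto_mult tendsto_const LIMSEQ_Suc[OF lim_const_over_n])
  have ueq: "e / 2 + (e / 2 + (64 * (2 * G\<^sup>2)\<^sup>2 * 2 * T * 0 + (2 * T * 0 + exp (- L)))) = exp (- L) + e" by simp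
  \<comment> \<open>Grids are refined first, at a fixed mollifier: the required mesh depends on the
    path and on the mollifier, while the required mollifier depends on the path alone.\<close>
  define D1 where "D1 q = {\<omega> \<in> space M. \<forall>\<^sub>F m in sequentially. \<omega> \<in> Z q m}" for q
  define D2 where "D2 = {\<omega> \<in> space M. \<forall>\<^sub>F q in sequentially. \<omega> \<in> D1 q}"
  have D1: "D1 q \<in> events" "prob (D1 q) \<le> exp (- L) + e" for q
    using prob_eventually_le[of "Z q" u, OF Zev pZ ulim] unfolding ueq D1_def by auto
  have D2: "D2 \<in> events" "prob D2 \<le> exp (- L) + e"
    using prob_eventually_le[of D1 "\<lambda>_. exp (- L) + e", OF D1 tendsto_const] unfolding D2_def by auto
  \<comment> \<open>Mollifiers and grids are countably many, so a single null set serves them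
    all.\<close>
  have "AE \<omega> in M. \<forall>q m. \<omega> \<notin> Z1 q m \<longrightarrow> oscillation_le T R q m \<omega> \<beta> \<longrightarrow> ?E1 q m \<omega> \<le> 1 / 64"
    unfolding AE_all_countable using P1 by (simp add: P1_def)
  moreover have "AE \<omega> in M. \<forall>q m. \<omega> \<notin> Z2 q m \<longrightarrow> oscillation_le T R q m \<omega> \<beta> \<longrightarrow> ?E2 q m \<omega> \<le> \<theta> / 160"
    unfolding AE_all_countable using P2 by (simp add: P2_def)
  moreover have "AE \<omega> in M. \<forall>q. \<forall>t\<ge>0. ennreal t \<le> \<sigma> \<omega> \<longrightarrow>
      (\<lambda>r. A q (v r \<omega>)) integrable_on {0..t} \<and>
      J q (v t \<omega>) + integral {0..t} (\<lambda>r. A q (v r \<omega>)) = J q (v 0 \<omega>) + I q t \<omega>"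
    unfolding AE_all_countable[of "\<lambda>q \<omega>. \<forall>t\<ge>0. ennreal t \<le> \<sigma> \<omega> \<longrightarrow> _ q t \<omega>"] using equation by blast
  ultimately have "AE \<omega> in M. \<omega> \<in> E \<longrightarrow> \<omega> \<in> D2"
    using v_continuous exit AE_space
  proof eventually_elim
    case (elim \<omega>)
    show ?case
    proof
      assume wE: "\<omega> \<in> E"
      then obtain D where D: "0 \<le> D" "D \<le> T" "ennreal D \<le> \<sigma> \<omega>" "R < norm (v D \<omega>)"
        using elim(5) by auto
      have cont: "continuous_on {0..D} (\<lambda>t. v t \<omega>)" using elim(4) D by blast
      have "compact ((\<lambda>t. v t \<omega>) ` {0..D})" using cont by (intro compact_continuous_image) auto
      from eventually_J_near[OF this]
      have "\<forall>\<^sub>F q in sequentially. \<omega> \<in> D1 q"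
      proof eventually_elim
        case nr: (elim q)
        have near: "(norm (v t \<omega>))\<^sup>2 \<le> (norm (J q (v t \<omega>)))\<^sup>2 + 1" if "t \<in> {0..D}" for t
          using nr that by auto
        have "\<forall>\<^sub>F m in sequentially.
          (oscillation_le T R q m \<omega> \<beta> \<longrightarrow> ?E1 q m \<omega> \<le> 1 / 64 \<and> ?E2 q m \<omega> \<le> \<theta> / 160) \<longrightarrow>
          ?E3 q m \<omega> < 1 / 8 \<longrightarrow> ?E4 m \<omega> < 1 \<longrightarrow> L \<le> ?S q m \<omega>"
          unfolding L_def
        proof (rule path_exponent_bound[where \<omega>=\<omega> and q=q and \<theta>=\<theta> and \<beta>=\<beta> and \<eta>=\<eta> and D=D and T=T and R=R and ?R0.0=R0 and ?C0.0=C0])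
          show "10 * \<theta> * (\<bar>c\<bar> * (1 + K * R) powr \<delta> * R)\<^sup>2 * (T + 1) \<le> 1 / 8" using \<theta>G by (simp only: G_def)
          show "\<forall>t\<ge>0. ennreal t \<le> \<sigma> \<omega> \<longrightarrow> (\<lambda>r. A q (v r \<omega>)) integrable_on {0..t} \<and>
            J q (v t \<omega>) + integral {0..t} (\<lambda>r. A q (v r \<omega>)) = J q (v 0 \<omega>) + I q t \<omega>"
            using elim(3) by blast
          show "norm (v 0 \<omega>) \<le> R0" by (rule E0[OF wE])
        qed (fact T R D cont near \<theta> \<beta> \<eta> C0 scalar)+
        then have "\<forall>\<^sub>F m in sequentially. \<omega> \<in> Z q m"
        proof eventually_elim
          case (elim m)
          then show ?case
            using \<open>\<forall>q m. \<omega> \<notin> Z1 q m \<longrightarrow> oscillation_le T R q m \<omega> \<beta> \<longrightarrow> ?E1 q m \<omega> \<le> 1 / 64\<close>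
              \<open>\<forall>q m. \<omega> \<notin> Z2 q m \<longrightarrow> oscillation_le T R q m \<omega> \<beta> \<longrightarrow> ?E2 q m \<omega> \<le> \<theta> / 160\<close> \<open>\<omega> \<in> space M\<close>
            unfolding Z_def Z3_def Z4_def Z5_def by (auto simp del: sum.lessThan_Suc simp: not_le)
        qed
        then show ?case using \<open>\<omega> \<in> space M\<close> by (simp add: D1_def)
      qed
      then show "\<omega> \<in> D2" using \<open>\<omega> \<in> space M\<close> by (simp add: D2_def)
    qed
  qed
  then have "prob E \<le> prob D2" using D2(1) by (intro finite_measure_mono_AE) auto
  then show "prob E \<le> exp (- (\<eta> * (ln (R\<^sup>2) - ln (1 + R0\<^sup>2) - C0 * T - 1))) + e"
    using D2(2) unfolding L_def by linarith
qed

end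

section \<open>Fourier series on the torus\<close>

abbreviation torus_end :: "real ^ 'd::finite" where "torus_end \<equiv> (\<chi> i. 2 * pi)"

lemma space_torus [simp]: "space torus = cbox 0 torus_end"
  by (simp add: torus_def space_restrict_space)

lemma borel_measurable_torus: "f \<in> borel_measurable borel \<Longrightarrow> f \<in> borel_measurable torus"
  unfolding torus_def by (rule measurable_restrict_space1) simp

lemma integral_torus:
  fixes f :: "real ^ 'd::finite \<Rightarrow> 'e::{banach, second_countable_topology}"
  shows "(\<integral>x. f x \<partial>torus) = (\<integral>x. indicator (cbox 0 torus_end) x *\<^sub>R f x \<partial>lborel)"
  unfolding torus_def by (rule integral_restrict_space) simp

lemma Basis_torus_end: "b \<in> Basis \<Longrightarrow> (torus_end :: real ^ 'd::finite) \<bullet> b = 2 * pi"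
  by (auto simp: Basis_vec_def inner_axis)

lemma emeasure_torus: "emeasure torus (space (torus :: (real ^ 'd::finite) measure)) = ennreal ((2 * pi) ^ CARD('d))"
proof -
  have "emeasure torus (space (torus :: (real ^ 'd) measure)) = emeasure lborel (cbox 0 (torus_end :: real ^ 'd))"
    unfolding space_torus unfolding torus_def by (rule emeasure_restrict_space) auto
  also have "\<dots> = ennreal (\<Prod>b\<in>Basis. (torus_end :: real ^ 'd) \<bullet> b)"
    by (subst emeasure_lborel_cbox) (auto simp: Basis_torus_end)
  also have "(\<Prod>b\<in>Basis. (torus_end :: real ^ 'd) \<bullet> b) = (2 * pi) ^ CARD('d)"
    by (simp add: Basis_torus_end)
  finally show ?thesis .
qed

interpretation torus: finite_measure "torus :: (real ^ 'd::finite) measure"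
  by standard (simp only: emeasure_torus, simp)

lemma measure_torus: "measure torus (space (torus :: (real ^ 'd::finite) measure)) = (2 * pi) ^ CARD('d)"
  unfolding measure_def emeasure_torus by simp

text \<open>The faces of the cell are null, and off them \<open>torus_embedding\<close> is
  injective, on which \<open>compact_integral_eq_0\<close> relies.\<close>

lemma AE_torus_interior: "AE x in torus. x \<in> box 0 (torus_end :: real ^ 'd::finite)"
proof -
  have "cbox 0 (torus_end :: real ^ 'd) - box 0 torus_end \<in> null_sets lborel"
  proof (rule null_setsI)
    have "emeasure lborel (cbox 0 (torus_end :: real ^ 'd) - box 0 torus_end)
        = emeasure lborel (cbox 0 (torus_end :: real ^ 'd)) - emeasure lborel (box 0 (torus_end :: real ^ 'd))"
      by (rule emeasure_Diff) (auto simp: box_subset_cbox emeasure_lborel_box_eq)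
    also have "\<dots> = 0" by (simp add: emeasure_lborel_box_eq emeasure_lborel_cbox_eq)
    finally show "emeasure lborel (cbox 0 (torus_end :: real ^ 'd) - box 0 torus_end) = 0" .
  qed auto
  then have "AE x in lborel. x \<in> cbox 0 (torus_end :: real ^ 'd) \<longrightarrow> x \<in> box 0 torus_end"
    by (rule AE_I') auto
  then show ?thesis unfolding torus_def by (subst AE_restrict_space_iff) auto
qed

definition character :: "int ^ 'd::finite \<Rightarrow> real ^ 'd \<Rightarrow> complex" where
  "character k x = cis (freq k \<bullet> x)"

lemma character_0 [simp]: "character 0 x = 1"
  by (simp add: character_def freq_def inner_vec_def)

lemma freq_add: "freq (k + l) = freq k + freq l" and freq_minus: "freq (- k) = - freq k"
  by (simp_all add: freq_def vec_eq_iff)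

lemma character_mult: "character k x * character l x = character (k + l) x"
  by (simp add: character_def cis_mult freq_add inner_add_left)

lemma cnj_character: "cnj (character k x) = character (- k) x"
  by (simp add: character_def freq_minus cis_cnj)

lemma norm_character [simp]: "norm (character k x) = 1"
  by (simp add: character_def)

lemma continuous_character: "continuous_on UNIV (character k)"
  unfolding character_def[abs_def] by (intro continuous_intros)

lemma character_measurable [measurable]: "character k \<in> borel_measurable torus"
  by (intro borel_measurable_torus borel_measurable_continuous_onI continuous_character)

lemma cis_sum: "finite A \<Longrightarrow> cis (sum f A) = (\<Prod>x\<in>A. cis (f x))"
  by (induction A rule: finite_induct) (simp_all add: cis_mult[symmetric])

lemma integral_cis_period:
  assumes "n \<noteq> 0"
  shows "(\<integral>t. indicator {0..2 * pi} t *\<^sub>R cis (real_of_int n * t) \<partial>lborel) = 0"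
proof -
  define G where "G t = cis (real_of_int n * t) / (\<i> * of_int n)" for t :: real
  have "(\<integral>t. indicator {0..2 * pi} t *\<^sub>R cis (real_of_int n * t) \<partial>lborel) = G (2 * pi) - G 0"
  proof (rule integral_FTC_Icc)
    fix t :: real assume "0 \<le> t" "t \<le> 2 * pi"
    have "((\<lambda>t. exp (\<i> * of_int n * complex_of_real t) / (\<i> * of_int n)) has_vector_derivative exp (\<i> * of_int n * complex_of_real t)) (at t within {0..2 * pi})"
    proof -
      have "((\<lambda>z. exp (\<i> * of_int n * z) / (\<i> * of_int n)) has_field_derivative exp (\<i> * of_int n * complex_of_real t)) (at (complex_of_real t))"
        using assms by (auto intro!: derivative_eq_intros)
      from has_vector_derivative_real_field[OF this] show ?thesis by (simp add: comp_def)
    qed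
    then show "(G has_vector_derivative cis (real_of_int n * t)) (at t within {0..2 * pi})"
      by (simp add: G_def[abs_def] cis_conv_exp mult.assoc)
  qed (auto intro!: continuous_intros)
  also have "G (2 * pi) = G 0"
  proof -
    have "cis (real_of_int n * (2 * pi)) = 1"
      by (metis cis_multiple_2pi Ints_of_int mult.commute mult.assoc)
    then show ?thesis by (simp add: G_def)
  qed
  finally show ?thesis by simp
qed

text \<open>Both the character and the indicator of the cell factor over the coordinates, and a
  coordinate with nonzero frequency has a vanishing integral over its period.\<close>

lemma integral_character:
  "(\<integral>x. character (k :: int ^ 'd::finite) x \<partial>torus) = (if k = 0 then (2 * pi) ^ CARD('d) else 0)"
proof (cases "k = 0")
  case True
  then show ?thesis by (simp add: measure_torus[unfolded space_torus] scaleR_conv_of_real)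
next
  case False
  then obtain i where i: "k $ i \<noteq> 0" by (auto simp: vec_eq_iff)
  define h :: "real ^ 'd \<Rightarrow> real \<Rightarrow> complex" where "h b t = indicator {0..2 * pi} t *\<^sub>R cis ((freq k \<bullet> b) * t)" for b t
  interpret P: product_sigma_finite "\<lambda>_ :: real ^ 'd. lborel :: real measure" ..
  have hm [measurable]: "h b \<in> borel_measurable borel" for b
  proof -
    have "continuous_on UNIV (\<lambda>t. cis ((freq k \<bullet> b) * t))" by (intro continuous_intros)
    then have [measurable]: "(\<lambda>t. cis ((freq k \<bullet> b) * t)) \<in> borel_measurable borel" by (rule borel_measurable_continuous_onI)
    show ?thesis unfolding h_def[abs_def] by measurable
  qed
  have hi: "integrable lborel (h b)" for b
    unfolding h_def[abs_def] by (intro borel_integrable_compact) (auto intro!: continuous_intros)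
  have prod: "indicator (cbox 0 torus_end) x *\<^sub>R character k x = (\<Prod>b\<in>Basis. h b (x \<bullet> b))" for x
  proof -
    have "character k x = (\<Prod>b\<in>Basis. cis ((freq k \<bullet> b) * (x \<bullet> b)))"
      unfolding character_def by (subst euclidean_inner) (simp add: cis_sum)
    moreover have "(indicator (cbox 0 torus_end) x :: complex) = (\<Prod>b\<in>Basis. indicator {0..2 * pi} (x \<bullet> b))"
    proof (cases "x \<in> cbox 0 torus_end")
      case True
      then have "\<And>b. b \<in> Basis \<Longrightarrow> x \<bullet> b \<in> {0..2 * pi}" by (auto simp: mem_box Basis_torus_end)
      then show ?thesis using True by (simp add: indicator_def)
    next
      case False
      then obtain b where "b \<in> Basis" "x \<bullet> b \<notin> {0..2 * pi}" by (auto simp: mem_box Basis_torus_end)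
      then have "(\<Prod>b\<in>Basis. indicator {0..2 * pi} (x \<bullet> b)) = (0 :: complex)" by (intro prod_zero) (auto intro!: bexI[of _ b])
      then show ?thesis using False by simp
    qed
    ultimately show ?thesis
      unfolding h_def scaleR_conv_of_real of_real_indicator by (simp add: prod.distrib)
  qed
  have "(\<integral>x. character k x \<partial>torus) = (\<integral>x. (\<Prod>b\<in>Basis. h b (x \<bullet> b)) \<partial>lborel)"
    unfolding integral_torus prod ..
  also have "\<dots> = (\<integral>f. (\<Prod>b\<in>Basis. h b (f b)) \<partial>(\<Pi>\<^sub>M b\<in>Basis. lborel))"
    by (subst lborel_eq, subst integral_distr) (auto intro!: Bochner_Integration.integral_cong prod.cong)
  also have "\<dots> = (\<Prod>b\<in>Basis. \<integral>t. h b t \<partial>lborel)"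
    by (rule P.product_integral_prod) (auto simp: hi)
  also have "\<dots> = 0"
  proof (rule prod_zero)
    have "freq k \<bullet> axis i 1 = real_of_int (k $ i)" by (simp add: inner_axis freq_def)
    then have "(\<integral>t. h (axis i 1) t \<partial>lborel) = 0"
      using integral_cis_period[OF i] by (simp add: h_def)
    then show "\<exists>b\<in>Basis. (\<integral>t. h b t \<partial>lborel) = 0" by (intro bexI[of _ "axis i 1"]) (auto simp: axis_in_Basis_iff)
  qed simp
  finally show ?thesis using False by simp
qed

section \<open>Trigonometric approximation and uniqueness of Fourier coefficients\<close>

inductive trig_poly :: "(real ^ 'd::finite \<Rightarrow> complex) \<Rightarrow> bool" where
  character: "trig_poly (\<lambda>x. c * character k x)"
| add: "trig_poly p \<Longrightarrow> trig_poly q \<Longrightarrow> trig_poly (\<lambda>x. p x + q x)"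

lemma trig_poly_const: "trig_poly (\<lambda>_. c)"
  using trig_poly.character[of c 0] by simp

lemma trig_poly_mult: "trig_poly p \<Longrightarrow> trig_poly q \<Longrightarrow> trig_poly (\<lambda>x. p x * q x)"
proof (induction p rule: trig_poly.induct)
  case (character c k)
  from character(1) show ?case
  proof (induction q rule: trig_poly.induct)
    case (character c' l)
    have "(\<lambda>x. c * character k x * (c' * character l x)) = (\<lambda>x. (c * c') * character (k + l) x)"
      by (simp add: character_mult[symmetric] mult.assoc mult.left_commute)
    then show ?case by (simp only: trig_poly.character)
  next
    case (add p q)
    then show ?case unfolding distrib_left by (intro trig_poly.add)
  qed
next
  case (add p q)
  then show ?case unfolding distrib_right by (intro trig_poly.add) auto
qed

lemma trig_poly_sum: "finite A \<Longrightarrow> (\<And>a. a \<in> A \<Longrightarrow> trig_poly (p a)) \<Longrightarrow> trig_poly (\<lambda>x. \<Sum>a\<in>A. p a x)"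
  by (induction A rule: finite_induct) (auto intro: trig_poly.add trig_poly_const[of 0, simplified])

text \<open>Trigonometric polynomials are the polynomials in the coordinates of this embedding of the torus,
  which makes the Stone-Weierstrass theorem applicable.\<close>

definition torus_embedding :: "real ^ 'd::finite \<Rightarrow> complex ^ 'd" where
  "torus_embedding x = (\<chi> i. cis (x $ i))"

lemma continuous_torus_embedding: "continuous_on A torus_embedding"
  unfolding torus_embedding_def[abs_def] by (intro continuous_intros)

lemma freq_axis: "freq (axis i 1) \<bullet> x = x $ i" and freq_axis': "freq (axis i (-1)) \<bullet> x = - (x $ i)"
proof -
  have "freq (axis i c) = axis i (real_of_int c)" for c by (simp add: freq_def vec_eq_iff axis_def)
  then show "freq (axis i 1) \<bullet> x = x $ i" "freq (axis i (-1)) \<bullet> x = - (x $ i)"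
    by (simp_all add: inner_axis' )
qed

text \<open>Among the cases of the induction only the linear one has content. A coordinate of the
  embedding paired with a unit \<open>u\<close> is the real part of \<open>cnj u * z\<close>, a
  combination of the characters of frequency 1 and -1 in that coordinate.\<close>

lemma trig_poly_real_polynomial:
  assumes "real_polynomial_function p"
  shows "trig_poly (\<lambda>x. complex_of_real (p (torus_embedding x)))"
  using assms
proof (induction p rule: real_polynomial_function.induct)
  case (linear f)
  have rep: "f z = (\<Sum>b\<in>Basis. (z \<bullet> b) * f b)" for z
  proof -
    have "f z = f (\<Sum>b\<in>Basis. (z \<bullet> b) *\<^sub>R b)" by (simp add: euclidean_representation)
    then show ?thesis by (simp add: linear_sum[OF bounded_linear.linear[OF linear]] linear_scale[OF bounded_linear.linear[OF linear]])
  qed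
  have eq: "(\<lambda>x. complex_of_real (f (torus_embedding x)))
      = (\<lambda>x. \<Sum>b\<in>Basis. complex_of_real (f b) * complex_of_real (torus_embedding x \<bullet> b))"
    by (rule ext, subst rep) (simp add: mult.commute)
  have "trig_poly (\<lambda>x. complex_of_real (torus_embedding x \<bullet> b))" if "b \<in> Basis" for b
  proof -
    from that obtain i u where b: "b = axis i u" by (auto simp: Basis_vec_def)
    have "complex_of_real (torus_embedding x \<bullet> b) = (cnj u / 2) * character (axis i 1) x + (u / 2) * character (axis i (-1)) x" for x
    proof -
      have "complex_of_real (z \<bullet> u) = (cnj u / 2) * z + (u / 2) * cnj z" for z
        by (simp add: complex_eq_iff inner_complex_def field_simps)
      then show ?thesis
        by (simp add: b inner_axis torus_embedding_def character_def freq_axis freq_axis' cis_cnj)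
    qed
    then have "(\<lambda>x. complex_of_real (torus_embedding x \<bullet> b)) = (\<lambda>x. (cnj u / 2) * character (axis i 1) x + (u / 2) * character (axis i (-1)) x)"
      by (rule ext)
    then show ?thesis by (simp only: trig_poly.intros)
  qed
  then show ?case unfolding eq
    by (intro trig_poly_sum trig_poly_mult trig_poly_const) auto
next
  case (const c)
  show ?case by (rule trig_poly_const)
next
  case (add f g)
  then show ?case by (simp add: trig_poly.add)
next
  case (mult f g)
  then show ?case by (simp add: trig_poly_mult)
qed

lemma integral_trig_poly_eq_0:
  assumes f: "integrable torus f" and zero: "\<And>k. (\<integral>x. complex_of_real (f x) * character k x \<partial>torus) = 0"
    and p: "trig_poly p"
  shows "integrable torus (\<lambda>x. complex_of_real (f x) * p x) \<and> (\<integral>x. complex_of_real (f x) * p x \<partial>torus) = 0"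
  using p
proof (induction p rule: trig_poly.induct)
  case (character c k)
  have "integrable torus (\<lambda>x. complex_of_real (f x) * character k x)"
    using f by (intro Bochner_Integration.integrable_bound[OF f]) (auto simp: norm_mult)
  then have "integrable torus (\<lambda>x. c * (complex_of_real (f x) * character k x))" by simp
  moreover have "(\<integral>x. c * (complex_of_real (f x) * character k x) \<partial>torus) = 0" using zero[of k] by simp
  ultimately show ?case by (simp add: mult.left_commute)
next
  case (add p q)
  then show ?case by (simp add: distrib_left)
qed

text \<open>Stone-Weierstrass on the compact image of the cell: a polynomial that approximates
  \<open>h\<close> uniformly contributes 0, and the error is weighted by the integral of |f|. The
  \<open>+ 1\<close> in the tolerance excludes division by 0.\<close>

lemma integral_continuous_periodic_eq_0:
  assumes f: "integrable torus f" and zero: "\<And>k. (\<integral>x. complex_of_real (f x) * character k x \<partial>torus) = 0"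
    and h: "continuous_on UNIV h"
  shows "(\<integral>x. f x * h (torus_embedding x) \<partial>torus) = 0"
proof -
  let ?S = "torus_embedding ` cbox 0 torus_end"
  have S: "compact ?S" by (intro compact_continuous_image continuous_torus_embedding compact_cbox)
  have hS: "continuous_on ?S h" using h by (rule continuous_on_subset) simp
  have "bounded (h ` ?S)" by (intro compact_imp_bounded compact_continuous_image hS S)
  then obtain B where B: "\<And>z. z \<in> ?S \<Longrightarrow> \<bar>h z\<bar> \<le> B" by (auto simp: bounded_iff)
  have fm [measurable]: "f \<in> borel_measurable torus" using f by auto
  have hm [measurable]: "(\<lambda>x. g (torus_embedding x)) \<in> borel_measurable torus" if "continuous_on UNIV g" for g :: "complex ^ 'a \<Rightarrow> real"
    by (intro borel_measurable_torus borel_measurable_continuous_onI continuous_on_compose2[OF that continuous_torus_embedding]) auto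
  have hi: "integrable torus (\<lambda>x. f x * h (torus_embedding x))"
  proof (rule Bochner_Integration.integrable_bound)
    show "integrable torus (\<lambda>x. B * f x)" using f by simp
    show "AE x in torus. norm (f x * h (torus_embedding x)) \<le> norm (B * f x)"
    proof (rule AE_I2)
      fix x :: "real ^ 'a" assume "x \<in> space torus"
      then have "\<bar>h (torus_embedding x)\<bar> \<le> \<bar>B\<bar>" using B[of "torus_embedding x"] by auto
      then show "norm (f x * h (torus_embedding x)) \<le> norm (B * f x)"
        using mult_right_mono[of "\<bar>h (torus_embedding x)\<bar>" "\<bar>B\<bar>" "\<bar>f x\<bar>"] by (simp add: abs_mult mult.commute)
    qed
  qed (use hm[OF h] in measurable)
  have small: "\<bar>\<integral>x. f x * h (torus_embedding x) \<partial>torus\<bar> \<le> 0 + e" if e: "0 < e" for e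
  proof -
    let ?N = "\<integral>x. \<bar>f x\<bar> \<partial>torus"
    have N: "0 \<le> ?N" by simp
    obtain p where p: "real_polynomial_function p" "\<And>z. z \<in> ?S \<Longrightarrow> \<bar>h z - p z\<bar> < e / (?N + 1)"
      using Stone_Weierstrass_real_polynomial_function[OF S hS, of "e / (?N + 1)"] e N by auto
    have pc: "continuous_on UNIV p" using p(1) by (simp add: continuous_on_polymonial_function real_polynomial_function_eq)
    have pe: "integrable torus (\<lambda>x. complex_of_real (f x) * complex_of_real (p (torus_embedding x)))"
      "(\<integral>x. complex_of_real (f x) * complex_of_real (p (torus_embedding x)) \<partial>torus) = 0"
      using integral_trig_poly_eq_0[OF f zero trig_poly_real_polynomial[OF p(1)]] by auto
    have pi: "integrable torus (\<lambda>x. f x * p (torus_embedding x))"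
      using pe(1) unfolding of_real_mult[symmetric] by (subst (asm) complex_of_real_integrable_eq)
    have p0: "(\<integral>x. f x * p (torus_embedding x) \<partial>torus) = 0"
      using pe(2) unfolding of_real_mult[symmetric] integral_complex_of_real by simp
    have "(\<integral>x. f x * h (torus_embedding x) \<partial>torus) = (\<integral>x. f x * (h (torus_embedding x) - p (torus_embedding x)) \<partial>torus)"
      using hi pi p0 by (simp add: right_diff_distrib)
    also have "\<bar>\<dots>\<bar> \<le> (\<integral>x. \<bar>f x * (h (torus_embedding x) - p (torus_embedding x))\<bar> \<partial>torus)"
      by (rule integral_abs_bound)
    also have "\<dots> \<le> (\<integral>x. e / (?N + 1) * \<bar>f x\<bar> \<partial>torus)"
    proof (rule integral_mono)
      show "integrable torus (\<lambda>x. \<bar>f x * (h (torus_embedding x) - p (torus_embedding x))\<bar>)"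
        using Bochner_Integration.integrable_diff[OF hi pi] by (simp add: right_diff_distrib)
      show "integrable torus (\<lambda>x. e / (?N + 1) * \<bar>f x\<bar>)" using f by simp
      fix x :: "real ^ 'a" assume "x \<in> space torus"
      then have "\<bar>h (torus_embedding x) - p (torus_embedding x)\<bar> \<le> e / (?N + 1)" using p(2)[of "torus_embedding x"] by auto
      then show "\<bar>f x * (h (torus_embedding x) - p (torus_embedding x))\<bar> \<le> e / (?N + 1) * \<bar>f x\<bar>"
        unfolding abs_mult by (subst mult.commute) (intro mult_right_mono, auto)
    qed
    also have "\<dots> = e * (?N / (?N + 1))" by simp
    also have "\<dots> \<le> e * 1"
    proof (rule mult_left_mono)
      have "0 < ?N + 1" using N by linarith
      then show "?N / (?N + 1) \<le> 1" by (subst pos_divide_le_eq) simp_all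
    qed (use e in simp)
    finally show ?thesis by simp
  qed
  have "\<bar>\<integral>x. f x * h (torus_embedding x) \<partial>torus\<bar> \<le> 0" by (rule field_le_epsilon[OF small])
  then show ?thesis by simp
qed

text \<open>The continuous cutoffs \<open>h n\<close> of the distance to the image of
  \<open>K\<close> decrease to its indicator. As \<open>K\<close> stays off the faces, no interior
  point outside \<open>K\<close> is mapped into that image.\<close>

lemma compact_integral_eq_0:
  fixes f :: "real ^ 'd::finite \<Rightarrow> real"
  assumes f: "integrable torus f" and zero: "\<And>k. (\<integral>x. complex_of_real (f x) * character k x \<partial>torus) = 0"
    and K: "compact K" "K \<subseteq> box 0 torus_end"
  shows "(\<integral>x. f x * indicator K x \<partial>torus) = 0"
proof (cases "K = {}")
  case False
  define C where "C = torus_embedding ` K"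
  define h where "h n z = max 0 (1 - real n * infdist z C)" for n z
  have C: "closed C" "C \<noteq> {}"
    using False K by (auto simp: C_def intro!: compact_imp_closed compact_continuous_image continuous_torus_embedding)
  have hc: "continuous_on UNIV (h n)" for n
    unfolding h_def[abs_def] by (intro continuous_intros)
  have mem: "torus_embedding x \<in> C \<longleftrightarrow> x \<in> K" if x: "x \<in> box 0 torus_end" for x
  proof
    assume "torus_embedding x \<in> C"
    then obtain y where y: "y \<in> K" "torus_embedding x = torus_embedding y" by (auto simp: C_def)
    have "x $ i = y $ i" for i
    proof -
      have "cis (x $ i) = cis (y $ i)" using y(2) by (simp add: torus_embedding_def vec_eq_iff)
      moreover have "x $ i \<in> {0<..<2 * pi}" "y $ i \<in> {0<..<2 * pi}" using x y(1) K(2) by (auto simp: mem_box_cart)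
      \<comment> \<open>Equal images mean a difference that is a multiple of 2 pi, while both
        coordinates lie strictly between 0 and 2 pi.\<close>
      moreover have "cos (x $ i - y $ i) = 1"
        using calculation(1) cis_divide[of "x $ i" "y $ i"] by (metis cis.sel(1) cis_neq_zero divide_self one_complex.sel(1))
      then obtain n :: int where n: "x $ i - y $ i = real_of_int n * 2 * pi" by (auto simp: cos_one_2pi_int)
      ultimately have "\<bar>real_of_int n * (2 * pi)\<bar> < 1 * (2 * pi)" by auto
      then have "\<bar>real_of_int n\<bar> * (2 * pi) < 1 * (2 * pi)" by (simp add: abs_mult)
      then have "\<bar>real_of_int n\<bar> < 1" by (subst (asm) mult_less_cancel_right_pos) auto
      then have "n = 0" by linarith
      then show ?thesis using n by simp
    qed
    then show "x \<in> K" using y(1) by (metis vec_eq_iff)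
  qed (auto simp: C_def)
  have fm [measurable]: "f \<in> borel_measurable torus" using f by auto
  have hm [measurable]: "(\<lambda>x. h n (torus_embedding x)) \<in> borel_measurable torus" for n
    by (intro borel_measurable_torus borel_measurable_continuous_onI continuous_on_compose2[OF hc continuous_torus_embedding]) auto
  have Km [measurable]: "K \<in> sets borel" using K(1) by (intro borel_compact)
  have [measurable]: "(\<lambda>x. indicator K x :: real) \<in> borel_measurable torus" by (intro borel_measurable_torus) measurable
  have "(\<lambda>n. \<integral>x. f x * h n (torus_embedding x) \<partial>torus) \<longlonglongrightarrow> (\<integral>x. f x * indicator K x \<partial>torus)"
  proof (rule integral_dominated_convergence[where w="\<lambda>x. \<bar>f x\<bar>"])
    show "AE x in torus. (\<lambda>n. f x * h n (torus_embedding x)) \<longlonglongrightarrow> f x * indicator K x"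
      using AE_torus_interior
    proof eventually_elim
      case (elim x)
      have "(\<lambda>n. h n (torus_embedding x)) \<longlonglongrightarrow> indicator K x"
      proof (cases "x \<in> K")
        case True
        then have "torus_embedding x \<in> C" using mem elim by simp
        then show ?thesis using True by (simp add: h_def)
      next
        case False
        then have "torus_embedding x \<notin> C" using mem elim by simp
        then have pos: "0 < infdist (torus_embedding x) C"
          using C infdist_nonneg[of "torus_embedding x" C] by (metis in_closed_iff_infdist_zero less_eq_real_def)
        then obtain N where N: "1 < real N * infdist (torus_embedding x) C" using reals_Archimedean3[OF pos] by blast
        have "\<forall>\<^sub>F n in sequentially. h n (torus_embedding x) = 0"
          using eventually_ge_at_top[of N]
        proof eventually_elim
          case (elim n)
          then have "real N * infdist (torus_embedding x) C \<le> real n * infdist (torus_embedding x) C"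
            using pos by (intro mult_right_mono) auto
          then show ?case using N by (simp add: h_def)
        qed
        then show ?thesis using False by (simp add: tendsto_eventually)
      qed
      then show ?case by (intro tendsto_mult tendsto_const)
    qed
    show "AE x in torus. norm (f x * h n (torus_embedding x)) \<le> \<bar>f x\<bar>" for n
    proof (rule AE_I2)
      fix x :: "real ^ 'd"
      have "\<bar>h n (torus_embedding x)\<bar> \<le> 1" by (auto simp: h_def infdist_nonneg)
      then show "norm (f x * h n (torus_embedding x)) \<le> \<bar>f x\<bar>"
        by (simp add: abs_mult mult_left_le)
    qed
    show "(\<lambda>x. f x * indicator K x) \<in> borel_measurable torus" by measurable
    show "(\<lambda>x. f x * h n (torus_embedding x)) \<in> borel_measurable torus" for n by measurable
    show "integrable torus (\<lambda>x. \<bar>f x\<bar>)" using f by simp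
  qed
  then show ?thesis
    using integral_continuous_periodic_eq_0[OF f zero hc] by (simp add: LIMSEQ_const_iff)
qed simp

text \<open>By inner regularity the set where \<open>f\<close> is positive is null once all its
  compact subsets are; over such a subset the integral of \<open>f\<close> vanishes although
  \<open>f\<close> is positive there.\<close>

lemma fourier_zero_imp_nonpos:
  fixes f :: "real ^ 'd::finite \<Rightarrow> real"
  assumes f: "integrable torus f" and zero: "\<And>k. (\<integral>x. complex_of_real (f x) * character k x \<partial>torus) = 0"
  shows "AE x in torus. f x \<le> 0"
proof -
  let ?U = "cbox 0 (torus_end :: real ^ 'd)"
  let ?f = "\<lambda>x. indicator ?U x *\<^sub>R f x"
  have fm: "f \<in> borel_measurable torus" using f by auto
  then have [measurable]: "?f \<in> borel_measurable borel"
    unfolding torus_def by (subst (asm) borel_measurable_restrict_space_iff) auto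
  \<comment> \<open>Restricting Lebesgue measure to the cell makes it finite, as inner regularity
    requires.\<close>
  define N where "N = density lborel (indicator ?U)"
  define B where "B = {x \<in> box 0 torus_end. 0 < ?f x}"
  have sN: "sets N = sets borel" by (simp add: N_def)
  have [measurable]: "B \<in> sets borel" unfolding B_def by measurable
  have eN: "emeasure N A = emeasure lborel (?U \<inter> A)" if "A \<in> sets borel" for A
    using that by (simp add: N_def emeasure_restricted)
  have fin: "emeasure N (space N) \<noteq> \<infinity>"
    using eN[of UNIV] sets_eq_imp_space_eq[OF sN] emeasure_lborel_cbox_finite[of 0 torus_end] by (simp add: less_top)
  have "emeasure N K = 0" if K: "K \<subseteq> B" "compact K" for K
  proof -
    have KU: "K \<subseteq> box 0 torus_end" "K \<subseteq> ?U" using K(1) by (auto simp: B_def box_subset_cbox[THEN subsetD])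
    have Km [measurable]: "K \<in> sets borel" using K(2) by (rule borel_compact)
    have [measurable]: "(\<lambda>x. indicator K x :: real) \<in> borel_measurable torus" by (intro borel_measurable_torus) measurable
    have int: "integrable torus (\<lambda>x. f x * indicator K x)"
    proof (rule Bochner_Integration.integrable_bound[OF f])
      show "(\<lambda>x. f x * indicator K x) \<in> borel_measurable torus" using fm by measurable
    qed (auto simp: indicator_def)
    have pos: "0 < f x" if "x \<in> K" for x using subsetD[OF K(1) that] subsetD[OF KU(2) that] by (simp add: B_def)
    have "AE x in torus. f x * indicator K x = 0"
      using compact_integral_eq_0[OF f zero K(2) KU(1)] int pos
      by (subst integral_nonneg_eq_0_iff_AE[symmetric]) (auto simp: indicator_def less_imp_le)
    then have "AE x in torus. x \<notin> K"
    proof eventually_elim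
      case (elim x)
      then show ?case using pos[of x] by (auto simp: indicator_def)
    qed
    then have "AE x in lborel. x \<in> ?U \<longrightarrow> x \<notin> K" unfolding torus_def by (subst (asm) AE_restrict_space_iff) auto
    then have "AE x in lborel. x \<notin> K" using KU(2) by (auto elim: AE_mp)
    then have "emeasure lborel K = 0"
      using AE_iff_measurable[of K lborel "\<lambda>x. x \<notin> K"] by simp
    then show ?thesis using eN[OF Km] KU(2) by (simp add: Int_absorb1)
  qed
  then have "emeasure N B = 0"
    using inner_regular[OF sN fin, of B] by (auto simp: SUP_eq_const image_def intro!: antisym Sup_least)
  moreover have "?U \<inter> B = B" using box_subset_cbox by (auto simp: B_def)
  ultimately have "emeasure lborel B = 0" using eN[OF \<open>B \<in> sets borel\<close>] by simp
  then have "AE x in lborel. x \<notin> B" by (intro AE_not_in) (simp add: null_setsI)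
  then have "AE x in lborel. x \<in> ?U \<longrightarrow> x \<notin> B" by (auto elim: AE_mp)
  then have "AE x in torus. x \<notin> B" unfolding torus_def by (subst AE_restrict_space_iff) auto
  then show ?thesis
    using AE_torus_interior AE_space
  proof eventually_elim
    case (elim x)
    then show ?case by (auto simp: B_def)
  qed
qed

lemma fourier_zero_imp_AE_zero:
  fixes f :: "real ^ 'd::finite \<Rightarrow> real"
  assumes f: "integrable torus f" and zero: "\<And>k. (\<integral>x. complex_of_real (f x) * character k x \<partial>torus) = 0"
  shows "AE x in torus. f x = 0"
proof -
  have "AE x in torus. - f x \<le> 0"
    using f zero by (intro fourier_zero_imp_nonpos) auto
  with fourier_zero_imp_nonpos[OF f zero] show ?thesis by eventually_elim simp
qed

section \<open>Square-integrable classes, their representatives and coefficients\<close>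

lemma sq_integrable_rep: "sq_integrable (rep_L2 f)"
  using Quotient3_rep_reflp[OF Quotient3_L2, of f] by simp

lemma rep_abs_L2:
  assumes "sq_integrable f"
  shows "AE x in torus. rep_L2 (abs_L2 f) x = f x"
  using Quotient3_rep_abs[OF Quotient3_L2, of f] assms by simp

lemma abs_rep_L2: "abs_L2 (rep_L2 f) = f"
  by (rule Quotient3_abs_rep[OF Quotient3_L2])

lemma L2_eqI:
  assumes "AE x in torus. rep_L2 f x = rep_L2 g x"
  shows "f = g"
proof -
  have "abs_L2 (rep_L2 f) = abs_L2 (rep_L2 g)"
    using Quotient3_rel[OF Quotient3_L2, of "rep_L2 f" "rep_L2 g"] assms sq_integrable_rep[of f] sq_integrable_rep[of g] by auto
  then show ?thesis by (simp add: abs_rep_L2)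
qed

lemma rep_add: "AE x in torus. rep_L2 (f + g) x = rep_L2 f x + rep_L2 g x"
proof -
  have "f + g = abs_L2 (\<lambda>x. rep_L2 f x + rep_L2 g x)"
    using plus_L2.abs_eq[of "rep_L2 f" "rep_L2 g"] by (simp add: abs_rep_L2 eq_onp_def sq_integrable_rep)
  then show ?thesis using rep_abs_L2[OF sq_integrable_add[OF sq_integrable_rep sq_integrable_rep]] by simp
qed

lemma rep_scaleR: "AE x in torus. rep_L2 (r *\<^sub>R f) x = r * rep_L2 f x"
proof -
  have "r *\<^sub>R f = abs_L2 (\<lambda>x. r * rep_L2 f x)"
    using scaleR_L2.abs_eq[of "rep_L2 f" r] by (simp add: abs_rep_L2 eq_onp_def sq_integrable_rep)
  then show ?thesis using rep_abs_L2[OF sq_integrable_scale[OF sq_integrable_rep]] by simp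
qed

lemma rep_zero: "AE x in torus. rep_L2 (0 :: 'd::finite L2) x = 0"
proof -
  have "AE x in torus. rep_L2 (0 *\<^sub>R (0 :: 'd L2)) x = 0 * rep_L2 (0 :: 'd L2) x" by (rule rep_scaleR)
  then show ?thesis by simp
qed

lemma rep_diff: "AE x in torus. rep_L2 (f - g) x = rep_L2 f x - rep_L2 g x"
proof -
  have "f - g = f + (-1) *\<^sub>R g" by simp
  then have "AE x in torus. rep_L2 (f - g) x = rep_L2 f x + rep_L2 ((-1) *\<^sub>R g) x" using rep_add[of f "(-1) *\<^sub>R g"] by simp
  with rep_scaleR[of "-1" g] show ?thesis by eventually_elim simp
qed

lemma rep_measurable [measurable]: "rep_L2 f \<in> borel_measurable torus"
  and rep_sq_integrable: "integrable torus (\<lambda>x. (rep_L2 f x)\<^sup>2)"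
  using sq_integrable_rep[of f] by (auto simp: sq_integrable_def)

lemma rep_integrable: "integrable torus (rep_L2 f)"
  by (rule torus.square_integrable_imp_integrable[OF rep_measurable rep_sq_integrable])

lemma inner_L2_eq: "inner f g = (\<integral>x. rep_L2 f x * rep_L2 g x \<partial>torus)"
  using inner_L2.abs_eq[of "rep_L2 f" "rep_L2 g"] by (simp add: abs_rep_L2 eq_onp_def sq_integrable_rep)

lemma norm_L2_sq: "(norm f)\<^sup>2 = (\<integral>x. (rep_L2 f x)\<^sup>2 \<partial>torus)"
  unfolding power2_norm_eq_inner inner_L2_eq by (simp add: power2_eq_square)

lemma norm_abs_L2_sq:
  assumes "sq_integrable f"
  shows "(norm (abs_L2 f))\<^sup>2 = (\<integral>x. (f x)\<^sup>2 \<partial>torus)"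
  unfolding norm_L2_sq
  using rep_abs_L2[OF assms] assms by (intro integral_cong_AE) (auto simp: sq_integrable_def)

lemma fourier_coeff_eq:
  "fourier_coeff f k = (\<integral>x. complex_of_real (rep_L2 f x) * character (- k) x \<partial>torus) / (2 * pi) ^ CARD('d)"
  for f :: "'d::finite L2"
  by (simp add: fourier_coeff_def character_def freq_minus)

lemma integrable_times_character:
  assumes "integrable torus f"
  shows "integrable torus (\<lambda>x. complex_of_real (f x) * character k x)"
  using assms by (intro Bochner_Integration.integrable_bound[OF assms]) (auto simp: norm_mult)

lemma fourier_coeff_abs:
  fixes f :: "real ^ 'd::finite \<Rightarrow> real"
  assumes "sq_integrable f"
  shows "fourier_coeff (abs_L2 f) k = (\<integral>x. complex_of_real (f x) * character (- k) x \<partial>torus) / (2 * pi) ^ CARD('d)"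
proof -
  have [measurable]: "f \<in> borel_measurable torus" using assms by (simp add: sq_integrable_def)
  have "(\<integral>x. complex_of_real (rep_L2 (abs_L2 f) x) * character (- k) x \<partial>torus) = (\<integral>x. complex_of_real (f x) * character (- k) x \<partial>torus)"
    using rep_abs_L2[OF assms] by (intro integral_cong_AE) auto
  then show ?thesis unfolding fourier_coeff_eq by simp
qed

lemma fourier_coeff_add: "fourier_coeff (f + g) k = fourier_coeff f k + fourier_coeff g k"
  for f :: "'d::finite L2"
proof -
  have "(\<integral>x. complex_of_real (rep_L2 (f + g) x) * character (- k) x \<partial>torus)
      = (\<integral>x. complex_of_real (rep_L2 f x) * character (- k) x + complex_of_real (rep_L2 g x) * character (- k) x \<partial>torus)"
    using rep_add[of f g] by (intro integral_cong_AE) (auto simp: distrib_right elim!: AE_mp)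
  also have "\<dots> = (\<integral>x. complex_of_real (rep_L2 f x) * character (- k) x \<partial>torus) + (\<integral>x. complex_of_real (rep_L2 g x) * character (- k) x \<partial>torus)"
    by (intro Bochner_Integration.integral_add integrable_times_character rep_integrable)
  finally show ?thesis by (simp add: fourier_coeff_eq add_divide_distrib)
qed

lemma fourier_coeff_scaleR: "fourier_coeff (r *\<^sub>R f) k = r *\<^sub>R fourier_coeff f k"
  for f :: "'d::finite L2"
proof -
  have "(\<integral>x. complex_of_real (rep_L2 (r *\<^sub>R f) x) * character (- k) x \<partial>torus)
      = (\<integral>x. complex_of_real r * (complex_of_real (rep_L2 f x) * character (- k) x) \<partial>torus)"
    using rep_scaleR[of r f] by (intro integral_cong_AE) (auto elim!: AE_mp)
  also have "\<dots> = complex_of_real r * (\<integral>x. complex_of_real (rep_L2 f x) * character (- k) x \<partial>torus)"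
    by (intro integral_mult_right_zero)
  finally show ?thesis by (simp add: fourier_coeff_eq scaleR_conv_of_real)
qed

lemma fourier_coeff_minus: "fourier_coeff f (- k) = cnj (fourier_coeff f k)"
  for f :: "'d::finite L2"
proof -
  have "cnj (\<integral>x. complex_of_real (rep_L2 f x) * character (- k) x \<partial>torus) = (\<integral>x. cnj (complex_of_real (rep_L2 f x) * character (- k) x) \<partial>torus)"
    by (simp only: Bochner_Integration.integral_cnj)
  then show ?thesis by (simp add: fourier_coeff_eq cnj_character)
qed

lemma L2_eq_fourierI:
  fixes f g :: "'d::finite L2"
  assumes "\<And>k. fourier_coeff f k = fourier_coeff g k"
  shows "f = g"
proof -
  have "fourier_coeff (f - g) k = 0" for k
    using fourier_coeff_add[of f "(-1) *\<^sub>R g" k] fourier_coeff_scaleR[of "-1" g k] assms[of k] by simp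
  then have "(\<integral>x. complex_of_real (rep_L2 (f - g) x) * character k x \<partial>torus) = 0" for k
    using fourier_coeff_eq[of "f - g" "- k"] by simp
  then have "AE x in torus. rep_L2 (f - g) x = 0"
    by (intro fourier_zero_imp_AE_zero rep_integrable)
  with rep_diff[of f g] have "AE x in torus. rep_L2 f x = rep_L2 g x" by eventually_elim simp
  then show ?thesis by (rule L2_eqI)
qed

section \<open>Bessel's inequality and real trigonometric sums\<close>

lemma integrable_bounded_torus:
  fixes f :: "real ^ 'd::finite \<Rightarrow> 'e::{banach, second_countable_topology}"
  assumes "f \<in> borel_measurable torus" "\<And>x. norm (f x) \<le> B"
  shows "integrable torus f"
  by (rule torus.integrable_const_bound[where B=B]) (use assms in auto)

lemma norm_trig_sum_le: "norm (\<Sum>k\<in>S. c k * character k x) \<le> (\<Sum>k\<in>S. norm (c k))"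
  by (rule order_trans[OF norm_sum]) (simp add: norm_mult)

lemma integral_trig_sum_sq:
  fixes c :: "int ^ 'd::finite \<Rightarrow> complex"
  assumes "finite S"
  shows "(\<integral>x. (norm (\<Sum>k\<in>S. c k * character k x))\<^sup>2 \<partial>torus) = (2 * pi) ^ CARD('d) * (\<Sum>k\<in>S. (norm (c k))\<^sup>2)"
proof -
  have eq: "complex_of_real ((norm (\<Sum>k\<in>S. c k * character k x))\<^sup>2) = (\<Sum>k\<in>S. \<Sum>l\<in>S. (c k * cnj (c l)) * character (k - l) x)" for x
  proof -
    have "complex_of_real ((norm (\<Sum>k\<in>S. c k * character k x))\<^sup>2) = (\<Sum>k\<in>S. c k * character k x) * cnj (\<Sum>l\<in>S. c l * character l x)"
      by (rule complex_norm_square)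
    also have "\<dots> = (\<Sum>k\<in>S. \<Sum>l\<in>S. (c k * character k x) * (cnj (c l) * character (- l) x))"
      by (simp add: sum_product cnj_character)
    also have "\<dots> = (\<Sum>k\<in>S. \<Sum>l\<in>S. (c k * cnj (c l)) * (character k x * character (- l) x))"
      by (intro sum.cong refl) (simp add: mult.assoc mult.left_commute)
    finally show ?thesis by (simp add: character_mult)
  qed
  have int: "integrable torus (character k)" for k :: "int ^ 'd"
    by (rule integrable_bounded_torus[where B=1]) auto
  have "complex_of_real (\<integral>x. (norm (\<Sum>k\<in>S. c k * character k x))\<^sup>2 \<partial>torus)
      = (\<integral>x. (\<Sum>k\<in>S. \<Sum>l\<in>S. (c k * cnj (c l)) * character (k - l) x) \<partial>torus)"
    unfolding integral_complex_of_real[symmetric] eq ..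
  also have "\<dots> = (\<Sum>k\<in>S. \<Sum>l\<in>S. (c k * cnj (c l)) * (\<integral>x. character (k - l) x \<partial>torus))"
    using int by (simp add: Bochner_Integration.integral_sum)
  also have "\<dots> = (\<Sum>k\<in>S. \<Sum>l\<in>S. if l = k then (c k * cnj (c k)) * (2 * pi) ^ CARD('d) else 0)"
    by (intro sum.cong refl) (auto simp: integral_character)
  also have "\<dots> = (\<Sum>k\<in>S. complex_of_real ((norm (c k))\<^sup>2) * (2 * pi) ^ CARD('d))"
    using assms by (simp only: sum.delta if_True complex_norm_square) simp
  also have "\<dots> = complex_of_real ((2 * pi) ^ CARD('d) * (\<Sum>k\<in>S. (norm (c k))\<^sup>2))"
    by (simp add: sum_distrib_right[symmetric] mult.commute)
  finally show ?thesis by (simp only: of_real_eq_iff)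
qed

lemma cnj_measurable [measurable]: "cnj \<in> borel_measurable borel"
  by (intro borel_measurable_continuous_onI continuous_on_cnj continuous_on_id)

text \<open>The integral of |f - T|^2, with \<open>T\<close> the partial Fourier sum, is
  nonnegative; expanded, its cross term removes the sum of squares twice and the square of
  \<open>T\<close> restores it once.\<close>

lemma bessel:
  fixes f :: "'d::finite L2"
  assumes "finite S"
  shows "(2 * pi) ^ CARD('d) * (\<Sum>k\<in>S. (norm (fourier_coeff f k))\<^sup>2) \<le> (norm f)\<^sup>2"
proof -
  let ?N = "(2 * pi) ^ CARD('d)"
  let ?c = "fourier_coeff f"
  let ?T = "\<lambda>x. \<Sum>k\<in>S. ?c k * character k x"
  let ?f = "\<lambda>x. complex_of_real (rep_L2 f x)"
  have intfT: "integrable torus (\<lambda>x. ?f x * cnj (?T x))"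
  proof (rule Bochner_Integration.integrable_bound)
    show "integrable torus (\<lambda>x. (\<Sum>k\<in>S. norm (?c k)) * rep_L2 f x)" using rep_integrable[of f] by simp
    show "AE x in torus. norm (?f x * cnj (?T x)) \<le> norm ((\<Sum>k\<in>S. norm (?c k)) * rep_L2 f x)"
    proof (rule AE_I2)
      fix x
      have "norm (?T x) \<le> \<bar>\<Sum>k\<in>S. norm (?c k)\<bar>" using norm_trig_sum_le[where c="?c"] by (simp add: sum_nonneg)
      then show "norm (?f x * cnj (?T x)) \<le> norm ((\<Sum>k\<in>S. norm (?c k)) * rep_L2 f x)"
        using mult_right_mono[of "norm (?T x)" "\<bar>\<Sum>k\<in>S. norm (?c k)\<bar>" "\<bar>rep_L2 f x\<bar>"]
        by (simp add: norm_mult abs_mult mult.commute del: cnj_sum)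
    qed
  qed measurable
  have fT: "(\<integral>x. ?f x * cnj (?T x) \<partial>torus) = complex_of_real (?N * (\<Sum>k\<in>S. (norm (?c k))\<^sup>2))"
  proof -
    have "(\<integral>x. ?f x * cnj (?T x) \<partial>torus) = (\<integral>x. (\<Sum>k\<in>S. cnj (?c k) * (?f x * character (- k) x)) \<partial>torus)"
      by (intro Bochner_Integration.integral_cong refl) (simp add: sum_distrib_left cnj_character mult.left_commute)
    also have "\<dots> = (\<Sum>k\<in>S. cnj (?c k) * (\<integral>x. ?f x * character (- k) x \<partial>torus))"
      by (subst Bochner_Integration.integral_sum)
        (auto intro!: integrable_mult_right integrable_times_character rep_integrable)
    also have "\<dots> = (\<Sum>k\<in>S. cnj (?c k) * (?N * ?c k))" by (simp add: fourier_coeff_eq)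
    also have "\<dots> = (\<Sum>k\<in>S. ?N * complex_of_real ((norm (?c k))\<^sup>2))"
      by (intro sum.cong refl) (simp only: complex_norm_square, simp add: mult.commute mult.left_commute)
    finally show ?thesis by (simp add: sum_distrib_left)
  qed
  have T2: "integrable torus (\<lambda>x. (norm (?T x))\<^sup>2)"
    by (rule integrable_bounded_torus[where B="(\<Sum>k\<in>S. norm (?c k))\<^sup>2"])
      (auto intro!: power_mono norm_trig_sum_le)
  have RefT: "integrable torus (\<lambda>x. Re (?f x * cnj (?T x)))" using intfT by (rule integrable_Re)
  have "0 \<le> (\<integral>x. (norm (?f x - ?T x))\<^sup>2 \<partial>torus)" by simp
  also have "\<dots> = (\<integral>x. (rep_L2 f x)\<^sup>2 - 2 * Re (?f x * cnj (?T x)) + (norm (?T x))\<^sup>2 \<partial>torus)"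
  proof (intro Bochner_Integration.integral_cong refl)
    have "(norm (complex_of_real a - w))\<^sup>2 = a\<^sup>2 - 2 * Re (complex_of_real a * cnj w) + (norm w)\<^sup>2" for a w
      unfolding cmod_power2 by (simp add: power2_eq_square algebra_simps)
    then show "(norm (?f x - ?T x))\<^sup>2 = (rep_L2 f x)\<^sup>2 - 2 * Re (?f x * cnj (?T x)) + (norm (?T x))\<^sup>2" for x .
  qed
  also have "\<dots> = (\<integral>x. (rep_L2 f x)\<^sup>2 \<partial>torus) - 2 * (\<integral>x. Re (?f x * cnj (?T x)) \<partial>torus) + (\<integral>x. (norm (?T x))\<^sup>2 \<partial>torus)"
    using T2 RefT rep_sq_integrable[of f] by simp
  also have "(\<integral>x. Re (?f x * cnj (?T x)) \<partial>torus) = ?N * (\<Sum>k\<in>S. (norm (?c k))\<^sup>2)"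
    using integral_Re[OF intfT] fT by (simp only: Re_complex_of_real)
  also have "(\<integral>x. (norm (?T x))\<^sup>2 \<partial>torus) = ?N * (\<Sum>k\<in>S. (norm (?c k))\<^sup>2)"
    by (rule integral_trig_sum_sq[OF assms])
  finally show ?thesis unfolding norm_L2_sq by linarith
qed

text \<open>The classes consist of real functions, so the building block is the real part of a
  character. It contributes half of \<open>z\<close> at \<open>k\<close> and half of its conjugate
  at \<open>- k\<close>.\<close>

definition wave :: "complex \<Rightarrow> int ^ 'd::finite \<Rightarrow> 'd L2" where
  "wave z k = abs_L2 (\<lambda>x. Re (z * character k x))"

lemma sq_integrable_bounded:
  assumes "f \<in> borel_measurable torus" "\<And>x. \<bar>f x\<bar> \<le> B"
  shows "sq_integrable f"
  unfolding sq_integrable_def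
proof
  show "integrable torus (\<lambda>x. (f x)\<^sup>2)"
  proof (rule integrable_bounded_torus[where B="B\<^sup>2"])
    fix x show "norm ((f x)\<^sup>2) \<le> B\<^sup>2" using power_mono[OF assms(2)[of x], of 2] by simp
  qed (use assms in measurable)
qed fact

lemma sq_integrable_Re_trig: "sq_integrable (\<lambda>x. Re (\<Sum>k\<in>S. c k * character k x))"
proof (rule sq_integrable_bounded)
  show "(\<lambda>x. Re (\<Sum>k\<in>S. c k * character k x)) \<in> borel_measurable torus" by measurable
  show "\<bar>Re (\<Sum>k\<in>S. c k * character k x)\<bar> \<le> (\<Sum>k\<in>S. norm (c k))" for x
    using abs_Re_le_cmod norm_trig_sum_le order_trans by blast
qed

lemma sum_wave:
  assumes "finite S"
  shows "AE x in torus. rep_L2 (\<Sum>k\<in>S. wave (c k) k) x = Re (\<Sum>k\<in>S. c k * character k x)"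
  using assms
proof (induction S rule: finite_induct)
  case empty
  then show ?case using rep_zero by simp
next
  case (insert k S)
  have "AE x in torus. rep_L2 (wave (c k) k) x = Re (c k * character k x)"
    unfolding wave_def using rep_abs_L2[OF sq_integrable_Re_trig[of c "{k}"]] by simp
  with insert.IH rep_add[of "wave (c k) k" "\<Sum>k\<in>S. wave (c k) k"] show ?case
    by eventually_elim (use insert.hyps in simp)
qed

lemma norm_sum_wave_le:
  fixes c :: "int ^ 'd::finite \<Rightarrow> complex"
  assumes "finite S"
  shows "(norm (\<Sum>k\<in>S. wave (c k) k))\<^sup>2 \<le> (2 * pi) ^ CARD('d) * (\<Sum>k\<in>S. (norm (c k))\<^sup>2)"
proof -
  have "(norm (\<Sum>k\<in>S. wave (c k) k))\<^sup>2 = (\<integral>x. (Re (\<Sum>k\<in>S. c k * character k x))\<^sup>2 \<partial>torus)"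
    unfolding norm_L2_sq using sum_wave[OF assms, of c] by (intro integral_cong_AE) auto
  also have "\<dots> \<le> (\<integral>x. (norm (\<Sum>k\<in>S. c k * character k x))\<^sup>2 \<partial>torus)"
  proof (rule integral_mono)
    show "integrable torus (\<lambda>x. (Re (\<Sum>k\<in>S. c k * character k x))\<^sup>2)"
      using sq_integrable_Re_trig[of c S] by (simp only: sq_integrable_def)
    show "integrable torus (\<lambda>x. (norm (\<Sum>k\<in>S. c k * character k x))\<^sup>2)"
      by (rule integrable_bounded_torus[where B="(\<Sum>k\<in>S. norm (c k))\<^sup>2"]) (auto intro!: power_mono norm_trig_sum_le)
    show "(Re (\<Sum>k\<in>S. c k * character k x))\<^sup>2 \<le> (norm (\<Sum>k\<in>S. c k * character k x))\<^sup>2" for x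
      using power_mono[OF abs_Re_le_cmod abs_ge_zero, of "\<Sum>k\<in>S. c k * character k x" 2] by (simp only: power2_abs)
  qed
  also have "\<dots> = (2 * pi) ^ CARD('d) * (\<Sum>k\<in>S. (norm (c k))\<^sup>2)" by (rule integral_trig_sum_sq[OF assms])
  finally show ?thesis .
qed

lemma fourier_coeff_wave:
  "fourier_coeff (wave z k) l = (if k = l then z / 2 else 0) + (if k = - l then cnj z / 2 else 0)"
  for k l :: "int ^ 'd::finite"
proof -
  have int: "integrable torus (character k)" for k :: "int ^ 'd"
    by (rule integrable_bounded_torus[where B=1]) auto
  have sq: "sq_integrable (\<lambda>x. Re (z * character k x))" using sq_integrable_Re_trig[of "\<lambda>_. z" "{k}"] by simp
  have "complex_of_real (Re (z * character k x)) * character (- l) x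
     = (z / 2) * character (k + - l) x + (cnj z / 2) * character (- k + - l) x" for x
  proof -
    have "complex_of_real (Re w) = (w + cnj w) / 2" for w by (simp add: complex_add_cnj)
    then have "complex_of_real (Re (z * character k x)) = (z * character k x + cnj (z * character k x)) / 2" .
    also have "\<dots> = (z / 2) * character k x + (cnj z / 2) * character (- k) x"
      by (simp add: cnj_character add_divide_distrib)
    finally show ?thesis by (simp only: distrib_right mult.assoc character_mult)
  qed
  then have "fourier_coeff (wave z k) l = (\<integral>x. (z / 2) * character (k + - l) x + (cnj z / 2) * character (- k + - l) x \<partial>torus) / (2 * pi) ^ CARD('d)"
    unfolding wave_def fourier_coeff_abs[OF sq] by simp
  also have "(\<integral>x. (z / 2) * character (k + - l) x + (cnj z / 2) * character (- k + - l) x \<partial>torus)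
    = (z / 2) * (\<integral>x. character (k + - l) x \<partial>torus) + (cnj z / 2) * (\<integral>x. character (- k + - l) x \<partial>torus)"
    using int by simp
  also have "\<dots> / (2 * pi) ^ CARD('d) = (if k = l then z / 2 else 0) + (if k = - l then cnj z / 2 else 0)"
  proof -
    have "k + - l = 0 \<longleftrightarrow> k = l" "- k + - l = 0 \<longleftrightarrow> k = - l" by (auto simp: neg_eq_iff_add_eq_0 add_eq_0_iff)
    then show ?thesis unfolding integral_character by (simp add: add_divide_distrib)
  qed
  finally show ?thesis .
qed

lemma fourier_coeff_sum: "fourier_coeff (\<Sum>i\<in>A. f i) k = (\<Sum>i\<in>A. fourier_coeff (f i) k)"
proof -
  have 0: "fourier_coeff 0 k = 0" using fourier_coeff_scaleR[of 0 0 k] by simp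
  show ?thesis by (induction A rule: infinite_finite_induct) (simp_all add: 0 fourier_coeff_add)
qed

definition hermitian :: "(int ^ 'd::finite \<Rightarrow> complex) \<Rightarrow> bool" where
  "hermitian c \<longleftrightarrow> (\<forall>k. c (- k) = cnj (c k))"

text \<open>For Hermitian coefficients on a symmetric set, the halves coming from \<open>l\<close>
  and from \<open>- l\<close> add up to \<open>c l\<close>.\<close>

lemma fourier_coeff_sum_wave:
  assumes "finite S" "hermitian c" "\<And>k. k \<in> S \<longleftrightarrow> - k \<in> S"
  shows "fourier_coeff (\<Sum>k\<in>S. wave (c k) k) l = (if l \<in> S then c l else 0)"
proof -
  have e: "k = - l \<longleftrightarrow> - l = k" for k by auto
  have "(\<Sum>k\<in>S. (if k = l then c k / 2 else 0) + (if k = - l then cnj (c k) / 2 else 0))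
    = (if l \<in> S then c l / 2 else 0) + (if - l \<in> S then cnj (c (- l)) / 2 else 0)"
    using assms(1) by (simp add: sum.distrib)
  then show ?thesis
    using assms(2) assms(3)[of l] by (simp add: fourier_coeff_sum fourier_coeff_wave hermitian_def)
qed

section \<open>Completeness and Fourier multipliers\<close>

text \<open>Cauchy-Schwarz against the constant 1. Through it a Cauchy sequence in L2 is Cauchy in
  L1 and has an almost everywhere convergent subsequence.\<close>

lemma integral_abs_rep_le:
  fixes f :: "'d::finite L2"
  shows "(\<integral>x. \<bar>rep_L2 f x\<bar> \<partial>torus) \<le> norm f * sqrt ((2 * pi) ^ CARD('d))"
proof -
  have sq1: "sq_integrable (\<lambda>x. \<bar>rep_L2 f x\<bar>)" and sq2: "sq_integrable (\<lambda>x :: real ^ 'd. 1)"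
    using sq_integrable_rep[of f] by (auto simp: sq_integrable_def)
  have "(\<integral>x. \<bar>rep_L2 f x\<bar> \<partial>torus) = inner (abs_L2 (\<lambda>x. \<bar>rep_L2 f x\<bar>)) (abs_L2 (\<lambda>x. 1))"
    unfolding inner_L2_eq using rep_abs_L2[OF sq1] rep_abs_L2[OF sq2] by (intro integral_cong_AE) (auto elim!: AE_mp)
  also have "\<dots> \<le> norm (abs_L2 (\<lambda>x. \<bar>rep_L2 f x\<bar>)) * norm (abs_L2 (\<lambda>x :: real ^ 'd. 1))" by (rule norm_cauchy_schwarz)
  also have "norm (abs_L2 (\<lambda>x. \<bar>rep_L2 f x\<bar>)) = norm f"
    by (rule power2_eq_imp_eq) (use norm_abs_L2_sq[OF sq1] norm_L2_sq[of f] in auto)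
  also have "norm (abs_L2 (\<lambda>x :: real ^ 'd. 1)) = sqrt ((2 * pi) ^ CARD('d))"
    using norm_abs_L2_sq[OF sq2] by (intro real_sqrt_unique[symmetric]) (auto simp: measure_torus[unfolded space_torus])
  finally show ?thesis .
qed

lemma nn_integral_rep_sq: "(\<integral>\<^sup>+x. ennreal ((rep_L2 f x)\<^sup>2) \<partial>torus) = ennreal ((norm f)\<^sup>2)"
  unfolding norm_L2_sq by (rule nn_integral_eq_integral[OF rep_sq_integrable]) simp

text \<open>A subsequence converges almost everywhere; Fatou's lemma along it bounds the distance
  from the limit to every late \<open>s j\<close>, so that the whole sequence converges.\<close>

lemma L2_Cauchy_convergent:
  fixes s :: "nat \<Rightarrow> 'd::finite L2"
  assumes "Cauchy s"
  shows "convergent s"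
proof -
  let ?N = "sqrt ((2 * pi) ^ CARD('d))"
  have N: "0 < ?N" by simp
  have L1: "\<exists>n0. \<forall>i\<ge>n0. \<forall>j\<ge>n0. (\<integral>x. norm (rep_L2 (s i) x - rep_L2 (s j) x) \<partial>torus) < e" if e: "0 < e" for e
  proof -
    obtain n0 where n0: "\<And>i j. n0 \<le> i \<Longrightarrow> n0 \<le> j \<Longrightarrow> norm (s i - s j) < e / ?N"
      using CauchyD[OF assms, of "e / ?N"] e N by auto
    have "(\<integral>x. norm (rep_L2 (s i) x - rep_L2 (s j) x) \<partial>torus) < e" if "n0 \<le> i" "n0 \<le> j" for i j
    proof -
      have "(\<integral>x. norm (rep_L2 (s i) x - rep_L2 (s j) x) \<partial>torus) = (\<integral>x. \<bar>rep_L2 (s i - s j) x\<bar> \<partial>torus)"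
        using rep_diff[of "s i" "s j"] by (intro integral_cong_AE) auto
      also have "\<dots> \<le> norm (s i - s j) * ?N" by (rule integral_abs_rep_le)
      also have "\<dots> < e" using n0[OF that] N by (simp add: pos_less_divide_eq)
      finally show ?thesis .
    qed
    then show ?thesis by blast
  qed
  obtain r where r: "strict_mono r" and ae: "AE x in torus. Cauchy (\<lambda>i. rep_L2 (s (r i)) x)"
    using cauchy_L1_AE_cauchy_subseq[OF rep_integrable L1] by blast
  define f where "f x = lim (\<lambda>i. rep_L2 (s (r i)) x)" for x
  have [measurable]: "f \<in> borel_measurable torus"
    unfolding f_def[abs_def] by (rule borel_measurable_lim_metric) measurable
  have lim: "AE x in torus. (\<lambda>i. rep_L2 (s (r i)) x) \<longlonglongrightarrow> f x"
    using ae unfolding f_def by eventually_elim (simp add: Cauchy_convergent_iff convergent_LIMSEQ_iff)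
  have fatou: "(\<integral>\<^sup>+x. ennreal ((f x - rep_L2 (s j) x)\<^sup>2) \<partial>torus) \<le> ennreal (e\<^sup>2)"
    if e: "\<And>i. n0 \<le> i \<Longrightarrow> norm (s i - s j) \<le> e" for j n0 e
  proof -
    have "(\<integral>\<^sup>+x. ennreal ((f x - rep_L2 (s j) x)\<^sup>2) \<partial>torus)
        = (\<integral>\<^sup>+x. liminf (\<lambda>i. ennreal ((rep_L2 (s (r i) - s j) x)\<^sup>2)) \<partial>torus)"
    proof (rule nn_integral_cong_AE)
      have "AE x in torus. \<forall>i. rep_L2 (s (r i) - s j) x = rep_L2 (s (r i)) x - rep_L2 (s j) x"
        unfolding AE_all_countable using rep_diff by blast
      with lim show "AE x in torus. ennreal ((f x - rep_L2 (s j) x)\<^sup>2) = liminf (\<lambda>i. ennreal ((rep_L2 (s (r i) - s j) x)\<^sup>2))"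
      proof eventually_elim
        case (elim x)
        have "(\<lambda>i. ennreal ((rep_L2 (s (r i) - s j) x)\<^sup>2)) \<longlonglongrightarrow> ennreal ((f x - rep_L2 (s j) x)\<^sup>2)"
          unfolding elim(2)[rule_format] by (intro tendsto_ennrealI tendsto_power tendsto_diff elim(1) tendsto_const)
        then show ?case by (intro lim_imp_Liminf[symmetric] trivial_limit_sequentially)
      qed
    qed
    also have "\<dots> \<le> liminf (\<lambda>i. \<integral>\<^sup>+x. ennreal ((rep_L2 (s (r i) - s j) x)\<^sup>2) \<partial>torus)"
      by (rule nn_integral_liminf) measurable
    also have "\<dots> \<le> ennreal (e\<^sup>2)"
    proof (rule Liminf_le)
      show "\<forall>\<^sub>F i in sequentially. (\<integral>\<^sup>+x. ennreal ((rep_L2 (s (r i) - s j) x)\<^sup>2) \<partial>torus) \<le> ennreal (e\<^sup>2)"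
        using eventually_ge_at_top[of n0]
      proof eventually_elim
        case (elim i)
        then have "n0 \<le> r i" using seq_suble[OF r, of i] by simp
        then show ?case unfolding nn_integral_rep_sq by (intro ennreal_leI power_mono e) auto
      qed
    qed simp
    finally show ?thesis .
  qed
  have sqd: "sq_integrable (\<lambda>x. f x - rep_L2 (s j) x)" if "\<And>i. n0 \<le> i \<Longrightarrow> norm (s i - s j) \<le> e" for j n0 e
    unfolding sq_integrable_def
  proof
    have "(\<integral>\<^sup>+x. ennreal ((f x - rep_L2 (s j) x)\<^sup>2) \<partial>torus) < \<infinity>"
      using fatou[OF that] using ennreal_less_top[of "e\<^sup>2"] unfolding infinity_ennreal_def by (rule le_less_trans)
    then show "integrable torus (\<lambda>x. (f x - rep_L2 (s j) x)\<^sup>2)" by (intro integrableI_nonneg) auto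
  qed measurable
  obtain n1 where n1: "\<And>i j. n1 \<le> i \<Longrightarrow> n1 \<le> j \<Longrightarrow> norm (s i - s j) < 1"
    using CauchyD[OF assms, of 1] by auto
  have "sq_integrable (\<lambda>x. (f x - rep_L2 (s n1) x) + rep_L2 (s n1) x)"
    by (rule sq_integrable_add[OF sqd sq_integrable_rep]) (use n1 in \<open>auto intro: less_imp_le\<close>)
  then have sqf: "sq_integrable f" by simp
  have "s \<longlonglongrightarrow> abs_L2 f"
  proof (rule LIMSEQ_I)
    fix e :: real assume e: "0 < e"
    obtain n0 where n0: "\<And>i j. n0 \<le> i \<Longrightarrow> n0 \<le> j \<Longrightarrow> norm (s i - s j) < e / 2"
      using CauchyD[OF assms, of "e / 2"] e by auto
    have "norm (s j - abs_L2 f) < e" if j: "n0 \<le> j" for j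
    proof -
      have le: "norm (s i - s j) \<le> e / 2" if "n0 \<le> i" for i using n0[OF that j] by simp
      have "ennreal ((norm (abs_L2 f - s j))\<^sup>2) = (\<integral>\<^sup>+x. ennreal ((f x - rep_L2 (s j) x)\<^sup>2) \<partial>torus)"
        unfolding nn_integral_rep_sq[symmetric]
        using rep_diff[of "abs_L2 f" "s j"] rep_abs_L2[OF sqf] by (intro nn_integral_cong_AE) (auto elim!: AE_mp)
      also have "\<dots> \<le> ennreal ((e / 2)\<^sup>2)" by (rule fatou[OF le])
      finally have "(norm (abs_L2 f - s j))\<^sup>2 \<le> (e / 2)\<^sup>2" by (subst (asm) ennreal_le_iff) (rule zero_le_power2)
      then have "norm (abs_L2 f - s j) \<le> e / 2" by (rule power2_le_imp_le) (use e in simp)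
      then show ?thesis using e by (simp add: norm_minus_commute)
    qed
    then show "\<exists>n0. \<forall>n\<ge>n0. norm (s n - abs_L2 f) < e" by blast
  qed
  then show ?thesis by (auto simp: convergent_def)
qed

section \<open>Riesz-Fischer, Parseval and Fourier multipliers\<close>

definition freq_box :: "nat \<Rightarrow> (int ^ 'd::finite) set" where
  "freq_box n = {k. \<forall>i. \<bar>k $ i\<bar> \<le> int n}"

lemma vectors_over_eq_image:
  "{x :: 'a ^ 'b::finite. \<forall>i. x $ i \<in> D} = vec_lambda ` (PiE UNIV (\<lambda>_. D))"
proof (intro equalityI subsetI)
  fix x :: "'a ^ 'b" assume "x \<in> {x. \<forall>i. x $ i \<in> D}"
  then show "x \<in> vec_lambda ` (PiE UNIV (\<lambda>_. D))"
    by (intro image_eqI[of _ _ "vec_nth x"]) (auto simp: vec_nth_inverse)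
qed auto

lemma finite_freq_box [simp]: "finite (freq_box n :: (int ^ 'd::finite) set)"
proof -
  have "freq_box n = {k :: int ^ 'd. \<forall>i. k $ i \<in> {- int n..int n}}"
    by (auto simp: freq_box_def abs_le_iff) (metis minus_le_iff)+
  then show ?thesis unfolding vectors_over_eq_image by (simp add: finite_PiE)
qed

lemma freq_box_minus: "- k \<in> freq_box n \<longleftrightarrow> k \<in> freq_box n"
  by (simp add: freq_box_def)

lemma freq_box_mono: "m \<le> n \<Longrightarrow> freq_box m \<subseteq> freq_box n"
  by (auto simp: freq_box_def intro: order_trans)

lemma ex_freq_box: "\<exists>n. (k :: int ^ 'd::finite) \<in> freq_box n"
proof
  show "k \<in> freq_box (nat (\<Sum>i\<in>UNIV. \<bar>k $ i\<bar>))"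
    unfolding freq_box_def
  proof (intro CollectI allI)
    fix i
    have "\<bar>k $ i\<bar> \<le> (\<Sum>i\<in>UNIV. \<bar>k $ i\<bar>)" by (rule member_le_sum) auto
    then show "\<bar>k $ i\<bar> \<le> int (nat (\<Sum>i\<in>UNIV. \<bar>k $ i\<bar>))" by simp
  qed
qed

lemma eventually_freq_box: "\<forall>\<^sub>F n in sequentially. (k :: int ^ 'd::finite) \<in> freq_box n"
proof -
  obtain n0 where "k \<in> freq_box n0" using ex_freq_box by blast
  then show ?thesis using freq_box_mono by (intro eventually_sequentiallyI[of n0]) blast
qed

abbreviation torus_vol :: "'d::finite itself \<Rightarrow> real" where
  "torus_vol TYPE('d) \<equiv> (2 * pi) ^ CARD('d)"

lemma bounded_linear_fourier_coeff: "bounded_linear (\<lambda>f. fourier_coeff f k)"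
  for k :: "int ^ 'd::finite"
proof (rule bounded_linear_intro)
  fix f :: "'d L2"
  have "(2 * pi) ^ CARD('d) * (norm (fourier_coeff f k))\<^sup>2 \<le> (norm f)\<^sup>2" using bessel[of "{k}" f] by simp
  moreover have "1 * (norm (fourier_coeff f k))\<^sup>2 \<le> (2 * pi) ^ CARD('d) * (norm (fourier_coeff f k))\<^sup>2"
    using pi_gt3 by (intro mult_right_mono one_le_power) auto
  ultimately have "(norm (fourier_coeff f k))\<^sup>2 \<le> (norm f)\<^sup>2" by linarith
  then have "norm (fourier_coeff f k) \<le> norm f" by (rule power2_le_imp_le) simp
  then show "norm (fourier_coeff f k) \<le> norm f * 1" by simp
qed (auto simp: fourier_coeff_add fourier_coeff_scaleR)

text \<open>Sums over growing cubes are Cauchy, since their differences are bounded by tails of a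
  convergent series. A Fourier coefficient is a continuous functional and is constant along these
  sums from some cube on.\<close>

lemma riesz_fischer:
  fixes c :: "int ^ 'd::finite \<Rightarrow> complex"
  assumes herm: "hermitian c" and sum: "(\<lambda>k. (norm (c k))\<^sup>2) summable_on UNIV"
  obtains f where "\<And>k. fourier_coeff f k = c k"
    "(norm f)\<^sup>2 \<le> torus_vol TYPE('d) * (\<Sum>\<^sub>\<infinity>k. (norm (c k))\<^sup>2)"
    "(\<lambda>n. \<Sum>k\<in>freq_box n. wave (c k) k) \<longlonglongrightarrow> f"
proof -
  let ?N = "torus_vol TYPE('d)"
  define s where "s n = (\<Sum>k\<in>freq_box n. wave (c k) k)" for n
  define a where "a n = (\<Sum>k\<in>freq_box n. (norm (c k))\<^sup>2)" for n
  have N: "0 < ?N" by simp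
  have amono: "incseq a" unfolding a_def by (intro incseq_SucI sum_mono2 freq_box_mono) auto
  have abd: "a n \<le> (\<Sum>\<^sub>\<infinity>k. (norm (c k))\<^sup>2)" for n
    unfolding a_def by (rule finite_sum_le_infsum[OF sum]) auto
  have "convergent a" using abd amono by (intro Bseq_monoseq_convergent BseqI'[of _ "\<Sum>\<^sub>\<infinity>k. (norm (c k))\<^sup>2"])
    (auto simp: a_def sum_nonneg monoseq_iff)
  then have Ca: "Cauchy a" by (simp add: Cauchy_convergent_iff)
  have diff: "(norm (s n - s m))\<^sup>2 \<le> ?N * \<bar>a n - a m\<bar>" if mn: "m \<le> n" for m n
  proof -
    have sub: "freq_box m \<subseteq> (freq_box n :: (int ^ 'd) set)" by (rule freq_box_mono[OF mn])
    have "s n - s m = (\<Sum>k\<in>freq_box n - freq_box m. wave (c k) k)"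
      unfolding s_def using sum_diff[OF finite_freq_box sub, of "\<lambda>k. wave (c k) k"] by simp
    then have "(norm (s n - s m))\<^sup>2 \<le> ?N * (\<Sum>k\<in>freq_box n - freq_box m. (norm (c k))\<^sup>2)"
      by (simp only:) (rule norm_sum_wave_le, simp)
    also have "(\<Sum>k\<in>freq_box n - freq_box m. (norm (c k))\<^sup>2) = a n - a m"
      unfolding a_def using sum_diff[OF finite_freq_box sub, of "\<lambda>k. (norm (c k))\<^sup>2"] by simp
    also have "\<dots> \<le> \<bar>a n - a m\<bar>" by simp
    finally show ?thesis using N by simp
  qed
  have "Cauchy s"
  proof (rule CauchyI)
    fix e :: real assume e: "0 < e"
    obtain n0 where n0: "\<And>m n. n0 \<le> m \<Longrightarrow> n0 \<le> n \<Longrightarrow> \<bar>a n - a m\<bar> < e\<^sup>2 / ?N"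
      using CauchyD[OF Ca, of "e\<^sup>2 / ?N"] e N by (auto simp: real_norm_def)
    have le: "norm (s n - s m) < e" if "n0 \<le> m" "m \<le> n" for m n
    proof -
      have "(norm (s n - s m))\<^sup>2 \<le> ?N * \<bar>a n - a m\<bar>" by (rule diff[OF that(2)])
      also have "\<dots> < ?N * (e\<^sup>2 / ?N)" using n0[of m n] that N by (intro mult_strict_left_mono) auto
      finally have "(norm (s n - s m))\<^sup>2 < e\<^sup>2" using N by simp
      then show ?thesis by (rule power2_less_imp_less) (use e in simp)
    qed
    have "norm (s m - s n) < e" if "n0 \<le> m" "n0 \<le> n" for m n
      using le[of m n] le[of n m] that by (cases "m \<le> n") (auto simp: norm_minus_commute)
    then show "\<exists>M. \<forall>m\<ge>M. \<forall>n\<ge>M. norm (s m - s n) < e" by blast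
  qed
  then obtain f where f: "s \<longlonglongrightarrow> f" using L2_Cauchy_convergent by (auto simp: convergent_def)
  have "fourier_coeff f l = c l" for l
  proof -
    have 1: "(\<lambda>n. fourier_coeff (s n) l) \<longlonglongrightarrow> fourier_coeff f l"
      by (rule bounded_linear.tendsto[OF bounded_linear_fourier_coeff f])
    have "\<forall>\<^sub>F n in sequentially. fourier_coeff (s n) l = c l"
      using eventually_freq_box[of l]
      by eventually_elim (simp add: s_def fourier_coeff_sum_wave[OF finite_freq_box herm] freq_box_minus)
    then have "(\<lambda>n. fourier_coeff (s n) l) \<longlonglongrightarrow> c l" by (rule tendsto_eventually)
    with 1 show ?thesis by (rule LIMSEQ_unique)
  qed
  moreover have "(norm f)\<^sup>2 \<le> ?N * (\<Sum>\<^sub>\<infinity>k. (norm (c k))\<^sup>2)"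
  proof (rule LIMSEQ_le_const2)
    show "(\<lambda>n. (norm (s n))\<^sup>2) \<longlonglongrightarrow> (norm f)\<^sup>2" by (intro tendsto_power tendsto_norm f)
    have "(norm (s n))\<^sup>2 \<le> ?N * (\<Sum>\<^sub>\<infinity>k. (norm (c k))\<^sup>2)" for n
    proof -
      have "(norm (s n))\<^sup>2 \<le> ?N * a n" unfolding s_def a_def by (rule norm_sum_wave_le) simp
      also have "\<dots> \<le> ?N * (\<Sum>\<^sub>\<infinity>k. (norm (c k))\<^sup>2)" using abd N by (intro mult_left_mono) auto
      finally show ?thesis .
    qed
    then show "\<exists>n0. \<forall>n\<ge>n0. (norm (s n))\<^sup>2 \<le> ?N * (\<Sum>\<^sub>\<infinity>k. (norm (c k))\<^sup>2)" by blast
  qed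
  ultimately show ?thesis using that f unfolding s_def by blast
qed

lemma hermitian_fourier_coeff: "hermitian (fourier_coeff f)"
  by (simp add: hermitian_def fourier_coeff_minus)

lemma hermitian_mult: "hermitian c \<Longrightarrow> hermitian m \<Longrightarrow> hermitian (\<lambda>k. c k * m k)"
  by (simp add: hermitian_def)

lemma summable_fourier_coeff: "(\<lambda>k. (norm (fourier_coeff f k))\<^sup>2) summable_on UNIV"
  for f :: "'d::finite L2"
proof (rule nonneg_bdd_above_summable_on)
  have N: "0 < torus_vol TYPE('d)" by simp
  have "(\<Sum>k\<in>S. (norm (fourier_coeff f k))\<^sup>2) \<le> (norm f)\<^sup>2 / torus_vol TYPE('d)" if "finite S" for S
    using bessel[OF that, of f] N by (subst pos_le_divide_eq) (auto simp: mult.commute)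
  then show "bdd_above (sum (\<lambda>k. (norm (fourier_coeff f k))\<^sup>2) ` {F. F \<subseteq> UNIV \<and> finite F})"
    by (intro bdd_aboveI[of _ "(norm f)\<^sup>2 / torus_vol TYPE('d)"]) auto
qed simp

text \<open>One inequality is Bessel's. The other is the norm bound of Riesz-Fischer, as the
  function rebuilt from the coefficients is \<open>f\<close> by uniqueness.\<close>

lemma parseval:
  fixes f :: "'d::finite L2"
  shows "(norm f)\<^sup>2 = torus_vol TYPE('d) * (\<Sum>\<^sub>\<infinity>k. (norm (fourier_coeff f k))\<^sup>2)"
proof (rule antisym)
  let ?N = "torus_vol TYPE('d)"
  have N: "0 < ?N" by simp
  obtain g where g: "\<And>k. fourier_coeff g k = fourier_coeff f k" "(norm g)\<^sup>2 \<le> ?N * (\<Sum>\<^sub>\<infinity>k. (norm (fourier_coeff f k))\<^sup>2)"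
    using riesz_fischer[OF hermitian_fourier_coeff summable_fourier_coeff, of f] by blast
  have "g = f" by (rule L2_eq_fourierI) (rule g(1))
  then show "(norm f)\<^sup>2 \<le> ?N * (\<Sum>\<^sub>\<infinity>k. (norm (fourier_coeff f k))\<^sup>2)" using g(2) by simp
  have "(\<Sum>\<^sub>\<infinity>k. (norm (fourier_coeff f k))\<^sup>2) \<le> (norm f)\<^sup>2 / ?N"
  proof (rule infsum_le_finite_sums[OF summable_fourier_coeff])
    fix S :: "(int ^ 'd) set" assume "finite S"
    then show "(\<Sum>k\<in>S. (norm (fourier_coeff f k))\<^sup>2) \<le> (norm f)\<^sup>2 / ?N"
      using bessel[of S f] N by (subst pos_le_divide_eq) (auto simp: mult.commute)
  qed
  then show "?N * (\<Sum>\<^sub>\<infinity>k. (norm (fourier_coeff f k))\<^sup>2) \<le> (norm f)\<^sup>2"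
    using N by (simp add: pos_le_divide_eq mult.commute)
qed

lemma partial_sums_tendsto: "(\<lambda>n. \<Sum>k\<in>freq_box n. wave (fourier_coeff f k) k) \<longlonglongrightarrow> f"
  for f :: "'d::finite L2"
proof -
  obtain g where g: "\<And>k. fourier_coeff g k = fourier_coeff f k" "(\<lambda>n. \<Sum>k\<in>freq_box n. wave (fourier_coeff f k) k) \<longlonglongrightarrow> g"
    using riesz_fischer[OF hermitian_fourier_coeff summable_fourier_coeff, of f] by blast
  have "g = f" by (rule L2_eq_fourierI) (rule g(1))
  then show ?thesis using g(2) by simp
qed

text \<open>Riesz-Fischer supplies existence and \<open>L2_eq_fourierI\<close> uniqueness, so the
  description in \<open>fourier_mult\<close> denotes the expected function.\<close>

lemma fourier_coeff_mult:
  fixes f :: "'d::finite L2"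
  assumes "hermitian m" "(\<lambda>k. (norm (m k * fourier_coeff f k))\<^sup>2) summable_on UNIV"
  shows "fourier_coeff (fourier_mult m f) k = m k * fourier_coeff f k"
proof -
  obtain g where g: "\<And>k. fourier_coeff g k = m k * fourier_coeff f k"
    using riesz_fischer[OF hermitian_mult[OF assms(1) hermitian_fourier_coeff] assms(2)] by blast
  have "\<exists>!g. \<forall>k. fourier_coeff g k = m k * fourier_coeff f k"
    using g by (intro ex1I[of _ g]) (auto intro: L2_eq_fourierI)
  from theI'[OF this] show ?thesis unfolding fourier_mult_def by blast
qed

lemma fourier_mult_eqI:
  assumes "\<And>k. fourier_coeff g k = m k * fourier_coeff f k"
  shows "fourier_mult m f = g"
  unfolding fourier_mult_def using assms by (intro the_equality) (auto intro: L2_eq_fourierI)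

text \<open>The Hermitian symbols are those that send real functions to real functions.\<close>

definition bounded_symbol :: "real \<Rightarrow> (int ^ 'd::finite \<Rightarrow> complex) \<Rightarrow> bool" where
  "bounded_symbol B m \<longleftrightarrow> hermitian m \<and> (\<forall>k. norm (m k) \<le> B)"

lemma fourier_coeff_bounded_mult:
  fixes f :: "'d::finite L2"
  assumes "bounded_symbol B m"
  shows "fourier_coeff (fourier_mult m f) k = m k * fourier_coeff f k"
proof (rule fourier_coeff_mult)
  show "hermitian m" using assms by (simp add: bounded_symbol_def)
  have "(\<lambda>k. B\<^sup>2 * (norm (fourier_coeff f k))\<^sup>2) summable_on UNIV"
    by (intro summable_on_cmult_right summable_fourier_coeff)
  then show "(\<lambda>k. (norm (m k * fourier_coeff f k))\<^sup>2) summable_on UNIV"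
  proof (rule summable_on_comparison_test)
    fix k show "(norm (m k * fourier_coeff f k))\<^sup>2 \<le> B\<^sup>2 * (norm (fourier_coeff f k))\<^sup>2"
      using assms by (auto simp: bounded_symbol_def norm_mult power_mult_distrib intro!: mult_right_mono power_mono)
  qed simp
qed

lemma norm_fourier_mult_le:
  fixes f :: "'d::finite L2"
  assumes m: "bounded_symbol B m"
  shows "norm (fourier_mult m f) \<le> B * norm f"
proof -
  have "norm (m 0) \<le> B" using m by (simp add: bounded_symbol_def)
  with norm_ge_zero have B: "0 \<le> B" by (rule order_trans)
  have "(norm (fourier_mult m f))\<^sup>2 = torus_vol TYPE('d) * (\<Sum>\<^sub>\<infinity>k. (norm (m k * fourier_coeff f k))\<^sup>2)"
    unfolding parseval fourier_coeff_bounded_mult[OF m] ..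
  also have "(\<Sum>\<^sub>\<infinity>k. (norm (m k * fourier_coeff f k))\<^sup>2) \<le> (\<Sum>\<^sub>\<infinity>k. B\<^sup>2 * (norm (fourier_coeff f k))\<^sup>2)"
  proof (rule infsum_mono)
    show "(\<lambda>k. (norm (m k * fourier_coeff f k))\<^sup>2) summable_on UNIV"
      using summable_fourier_coeff[of "fourier_mult m f"] unfolding fourier_coeff_bounded_mult[OF m] .
    show "(\<lambda>k. B\<^sup>2 * (norm (fourier_coeff f k))\<^sup>2) summable_on UNIV"
      by (intro summable_on_cmult_right summable_fourier_coeff)
    show "(norm (m k * fourier_coeff f k))\<^sup>2 \<le> B\<^sup>2 * (norm (fourier_coeff f k))\<^sup>2" for k
      using m by (auto simp: bounded_symbol_def norm_mult power_mult_distrib intro!: mult_right_mono power_mono)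
  qed
  also have "(\<Sum>\<^sub>\<infinity>k. B\<^sup>2 * (norm (fourier_coeff f k))\<^sup>2) = B\<^sup>2 * (\<Sum>\<^sub>\<infinity>k. (norm (fourier_coeff f k))\<^sup>2)"
    by (rule infsum_cmult_right) (simp add: summable_fourier_coeff)
  also have "torus_vol TYPE('d) * (B\<^sup>2 * (\<Sum>\<^sub>\<infinity>k. (norm (fourier_coeff f k))\<^sup>2)) = (B * norm f)\<^sup>2"
    unfolding power_mult_distrib parseval[of f] by simp
  finally have "(norm (fourier_mult m f))\<^sup>2 \<le> (B * norm f)\<^sup>2" by simp
  then show ?thesis by (rule power2_le_imp_le) (use B in simp)
qed

lemma bounded_linear_fourier_mult:
  assumes m: "bounded_symbol B m"
  shows "bounded_linear (fourier_mult m :: 'd::finite L2 \<Rightarrow> 'd L2)"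
proof (rule bounded_linear_intro)
  fix f g :: "'d L2" and r :: real
  show "fourier_mult m (f + g) = fourier_mult m f + fourier_mult m g"
    by (rule fourier_mult_eqI) (simp add: fourier_coeff_add fourier_coeff_bounded_mult[OF m] distrib_left)
  show "fourier_mult m (r *\<^sub>R f) = r *\<^sub>R fourier_mult m f"
    by (rule fourier_mult_eqI) (simp add: fourier_coeff_scaleR fourier_coeff_bounded_mult[OF m])
  show "norm (fourier_mult m f) \<le> norm f * B"
    using norm_fourier_mult_le[OF m, of f] by (simp add: mult.commute)
qed

section \<open>Separability of the state space\<close>

lemma wave_add: "wave (z + w) k = wave z k + wave w k"
proof (rule L2_eqI)
  have r: "AE x in torus. rep_L2 (wave z k) x = Re (z * character k x)" for z
    unfolding wave_def using rep_abs_L2[OF sq_integrable_Re_trig[of "\<lambda>_. z" "{k}"]] by simp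
  from r[of "z + w"] r[of z] r[of w] rep_add[of "wave z k" "wave w k"]
  show "AE x in torus. rep_L2 (wave (z + w) k) x = rep_L2 (wave z k + wave w k) x"
    by eventually_elim (simp add: distrib_right)
qed

lemma norm_wave_le: "(norm (wave z k))\<^sup>2 \<le> torus_vol TYPE('d) * (norm z)\<^sup>2"
  for k :: "int ^ 'd::finite"
  using norm_sum_wave_le[of "{k}" "\<lambda>_. z"] by simp

lemma norm_wave_diff_le: "norm (wave z k - wave w k) \<le> sqrt (torus_vol TYPE('d)) * norm (z - w)"
  for k :: "int ^ 'd::finite"
proof -
  have "wave z k - wave w k = wave (z - w) k" using wave_add[of "z - w" w k] by simp
  then have "(norm (wave z k - wave w k))\<^sup>2 \<le> (sqrt (torus_vol TYPE('d)) * norm (z - w))\<^sup>2"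
    using norm_wave_le[of "z - w" k] by (simp add: power_mult_distrib)
  then show ?thesis by (rule power2_le_imp_le) simp
qed

text \<open>Partial Fourier sums with their coefficients rounded to complex rationals are dense;
  coding such sums by finite lists makes their countability immediate.\<close>

lemma L2_countable_dense:
  obtains D :: "'d::finite L2 set" where "countable D" "\<And>f e. 0 < e \<Longrightarrow> \<exists>g\<in>D. dist g f < e"
proof -
  define Q :: "complex set" where "Q = {Complex (real_of_rat p) (real_of_rat q) | p q. True}"
  have "Q = (\<lambda>(p, q). Complex (real_of_rat p) (real_of_rat q)) ` UNIV" by (auto simp: Q_def)
  then have cQ: "countable Q" by simp
  define D :: "'d L2 set" where
    "D = (\<lambda>l. sum_list (map (\<lambda>(z, k). wave z k) l)) ` lists (Q \<times> UNIV)"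
  have "countable D" unfolding D_def using cQ by (intro countable_image countable_lists countable_SIGMA) auto
  moreover have "\<exists>g\<in>D. dist g f < e" if e: "0 < e" for f :: "'d L2" and e
  proof -
    have "\<forall>\<^sub>F n in sequentially. dist (\<Sum>k\<in>freq_box n. wave (fourier_coeff f k) k) f < e / 2"
      using tendstoD[OF partial_sums_tendsto, of "e / 2" f] e by simp
    then obtain n where n: "dist (\<Sum>k\<in>freq_box n. wave (fourier_coeff f k) k) f < e / 2"
      by (auto simp: eventually_sequentially)
    let ?B = "freq_box n :: (int ^ 'd) set"
    define \<eta> where "\<eta> = e / (2 * (sqrt (torus_vol TYPE('d)) * (real (card ?B) + 1)))"
    have sN: "0 < sqrt (torus_vol TYPE('d))" by simp
    have den: "0 < 2 * (sqrt (torus_vol TYPE('d)) * (real (card ?B) + 1))"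
      using sN by (intro mult_pos_pos) auto
    have \<eta>: "0 < \<eta>" unfolding \<eta>_def using e den by (rule divide_pos_pos)
    have "\<exists>q\<in>Q. norm (q - z) < \<eta>" for z
    proof -
      obtain p where p: "Re z - \<eta> / 2 < of_rat p" "of_rat p < Re z" using of_rat_dense[of "Re z - \<eta> / 2" "Re z"] \<eta> by auto
      obtain q where q: "Im z - \<eta> / 2 < of_rat q" "of_rat q < Im z" using of_rat_dense[of "Im z - \<eta> / 2" "Im z"] \<eta> by auto
      have "norm (Complex (of_rat p) (of_rat q) - z) \<le> \<bar>of_rat p - Re z\<bar> + \<bar>of_rat q - Im z\<bar>"
        using cmod_le[of "Complex (of_rat p) (of_rat q) - z"] by simp
      also have "\<dots> < \<eta>" using p q by (simp add: abs_if)
      finally show ?thesis by (intro bexI[of _ "Complex (of_rat p) (of_rat q)"]) (auto simp: Q_def)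
    qed
    then obtain q where q: "\<And>z. q z \<in> Q" "\<And>z. norm (q z - z) < \<eta>" by metis
    define g where "g = (\<Sum>k\<in>?B. wave (q (fourier_coeff f k)) k)"
    obtain l where l: "set l = ?B" "distinct l" using finite_distinct_list[OF finite_freq_box] by blast
    have "g = sum_list (map (\<lambda>(z, k). wave z k) (map (\<lambda>k. (q (fourier_coeff f k), k)) l))"
      unfolding g_def l(1)[symmetric] by (simp add: sum.distinct_set_conv_list[OF l(2)] comp_def)
    then have "g \<in> D" unfolding D_def
      by (rule image_eqI) (use q(1) in auto)
    moreover have "dist g (\<Sum>k\<in>?B. wave (fourier_coeff f k) k) < e / 2"
    proof -
      have "norm (g - (\<Sum>k\<in>?B. wave (fourier_coeff f k) k))
          = norm (\<Sum>k\<in>?B. wave (q (fourier_coeff f k)) k - wave (fourier_coeff f k) k)"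
        by (simp add: g_def sum_subtractf)
      also have "\<dots> \<le> (\<Sum>k\<in>?B. sqrt (torus_vol TYPE('d)) * \<eta>)"
      proof (rule sum_norm_le)
        fix k
        have "norm (wave (q (fourier_coeff f k)) k - wave (fourier_coeff f k) k) \<le> sqrt (torus_vol TYPE('d)) * norm (q (fourier_coeff f k) - fourier_coeff f k)"
          by (rule norm_wave_diff_le)
        also have "\<dots> \<le> sqrt (torus_vol TYPE('d)) * \<eta>" using q(2) by (intro mult_left_mono less_imp_le) auto
        finally show "norm (wave (q (fourier_coeff f k)) k - wave (fourier_coeff f k) k) \<le> sqrt (torus_vol TYPE('d)) * \<eta>" .
      qed
      also have "\<dots> = real (card ?B) * (sqrt (torus_vol TYPE('d)) * \<eta>)" by simp
      also have "\<dots> < (real (card ?B) + 1) * (sqrt (torus_vol TYPE('d)) * \<eta>)"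
        using mult_pos_pos[OF sN \<eta>] by (intro mult_strict_right_mono) auto
      also have "\<dots> = e / 2"
      proof -
        have "x * (y * (e / (2 * (y * x)))) = e / 2" if "x \<noteq> 0" "y \<noteq> 0" for x y :: real using that by simp
        from this[of "real (card ?B) + 1" "sqrt (torus_vol TYPE('d))"] show ?thesis unfolding \<eta>_def using sN by simp
      qed
      finally show ?thesis by (simp add: dist_norm)
    qed
    then have "dist g f < e" using n dist_triangle[of g f "\<Sum>k\<in>?B. wave (fourier_coeff f k) k"] by linarith
    ultimately show ?thesis by blast
  qed
  ultimately show ?thesis using that by blast
qed

lemma second_countable_from_dense:
  fixes D :: "'a::metric_space set"
  assumes D: "countable D" and dense: "\<And>f e. 0 < e \<Longrightarrow> \<exists>g\<in>D. dist g f < e"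
  shows "\<exists>B :: 'a set set. countable B \<and> open = generate_topology B"
proof -
  define B where "B = (\<lambda>(g, n). ball g (1 / real (Suc n))) ` (D \<times> UNIV)"
  have "topological_basis B"
  proof (rule topological_basisI)
    fix U :: "'a set" and f assume U: "open U" "f \<in> U"
    obtain e where e: "0 < e" "ball f e \<subseteq> U" using U open_contains_ball by blast
    obtain n where n: "1 / real (Suc n) < e / 2" using reals_Archimedean[of "e / 2"] e by (auto simp: inverse_eq_divide)
    obtain g where g: "g \<in> D" "dist g f < 1 / real (Suc n)" using dense[of "1 / real (Suc n)" f] by auto
    show "\<exists>V\<in>B. f \<in> V \<and> V \<subseteq> U"
    proof (rule bexI, intro conjI)
      show "ball g (1 / real (Suc n)) \<in> B" using g(1) by (auto simp: B_def)
      show "f \<in> ball g (1 / real (Suc n))" using g(2) by simp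
      show "ball g (1 / real (Suc n)) \<subseteq> U"
      proof
        fix h assume "h \<in> ball g (1 / real (Suc n))"
        then have "dist f h < e" using g(2) n dist_triangle[of f h g] by (simp add: dist_commute)
        then show "h \<in> U" using e(2) by auto
      qed
    qed
  qed (auto simp: B_def)
  moreover have "countable B" unfolding B_def using D by (intro countable_image countable_SIGMA) auto
  ultimately show ?thesis by (intro exI[of _ B] conjI topological_basis_imp_subbasis)
qed

text \<open>Borel measurability of sums and inner products of random elements rests on second
  countability, which the probabilistic lemmas assume of the state space.\<close>

instance L2 :: (finite) second_countable_topology
proof
  obtain D :: "'a L2 set" where D: "countable D" "\<And>f e. 0 < e \<Longrightarrow> \<exists>g\<in>D. dist g f < e"
    by (rule L2_countable_dense) (rule that)
  then show "\<exists>B :: 'a L2 set set. countable B \<and> open = generate_topology B"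
    by (rule second_countable_from_dense)
qed

instance vec :: ("{metric_space, second_countable_topology}", finite) second_countable_topology
proof
  obtain D :: "'a set" where D: "countable D" "\<And>X. open X \<Longrightarrow> X \<noteq> {} \<Longrightarrow> \<exists>d\<in>D. d \<in> X"
    using countable_dense_setE by blast
  define E :: "('a ^ 'b) set" where "E = {x. \<forall>i. x $ i \<in> D}"
  have "countable E"
  proof -
    have "countable (PiE UNIV (\<lambda>_ :: 'b. D))" by (rule countable_PiE) (use D in auto)
    then show ?thesis unfolding E_def vectors_over_eq_image by (rule countable_image)
  qed
  moreover have "\<exists>g\<in>E. dist g f < e" if e: "0 < e" for f :: "'a ^ 'b" and e
  proof -
    define \<eta> where "\<eta> = e / (real CARD('b) + 1)"
    have \<eta>: "0 < \<eta>" using e by (simp add: \<eta>_def add_nonneg_pos)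
    have "\<exists>d\<in>D. d \<in> ball (f $ i) \<eta>" for i using \<eta> by (intro D(2)) auto
    then obtain d where d: "\<And>i. d i \<in> D" "\<And>i. dist (f $ i) (d i) < \<eta>" by (metis mem_ball)
    have "dist (vec_lambda d) f \<le> (\<Sum>i\<in>UNIV. dist (vec_lambda d $ i) (f $ i))"
      unfolding dist_vec_def by (rule L2_set_le_sum) simp
    also have "\<dots> \<le> (\<Sum>i\<in>(UNIV :: 'b set). \<eta>)" using d(2) by (intro sum_mono) (simp add: dist_commute less_imp_le)
    also have "\<dots> = real CARD('b) * \<eta>" by simp
    also have "\<dots> < (real CARD('b) + 1) * \<eta>" using \<eta> by (intro mult_strict_right_mono) auto
    also have "\<dots> = e" by (simp add: \<eta>_def add_nonneg_pos less_imp_neq[symmetric])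
    finally show ?thesis using d(1) by (intro bexI[of _ "vec_lambda d"]) (auto simp: E_def)
  qed
  ultimately show "\<exists>B :: ('a ^ 'b) set set. countable B \<and> open = generate_topology B"
    by (rule second_countable_from_dense)
qed

section \<open>Sobolev embedding\<close>

definition weight :: "int ^ 'd::finite \<Rightarrow> real" where
  "weight k = 1 + (norm (freq k))\<^sup>2"

lemma weight_ge_1: "1 \<le> weight k" and weight_pos: "0 < weight k"
  by (simp_all add: weight_def add_pos_nonneg)

lemma weight_minus [simp]: "weight (- k) = weight k"
  by (simp add: weight_def freq_minus)

lemma component_le_weight: "1 + (real_of_int (k $ i))\<^sup>2 \<le> weight k"
proof -
  have "\<bar>freq k $ i\<bar> \<le> norm (freq k)" by (rule component_le_norm_cart)
  then have "\<bar>freq k $ i\<bar>\<^sup>2 \<le> (norm (freq k))\<^sup>2" by (intro power_mono) auto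
  then show ?thesis by (simp add: weight_def freq_def)
qed

lemma sum_int_powr_le:
  assumes "1 / 2 < a"
  obtains C where "0 \<le> C" "\<And>n. (\<Sum>j\<in>{- int n..int n}. (1 + (real_of_int j)\<^sup>2) powr (- a)) \<le> C"
proof -
  let ?g = "\<lambda>j :: nat. real j powr (- 2 * a)"
  have sg: "summable ?g" using assms by (subst summable_real_powr_iff) simp
  have bd: "(1 + (real_of_int j)\<^sup>2) powr (- a) \<le> ?g (nat \<bar>j\<bar>)" if "j \<noteq> 0" for j
  proof -
    have p: "0 < \<bar>real_of_int j\<bar>" using that by simp
    have "(1 + (real_of_int j)\<^sup>2) powr (- a) \<le> (\<bar>real_of_int j\<bar> powr 2) powr (- a)"
      using assms p by (intro powr_mono2') auto
    then show ?thesis unfolding powr_powr by simp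
  qed
  have "(\<Sum>j\<in>{- int n..int n}. (1 + (real_of_int j)\<^sup>2) powr (- a)) \<le> 1 + 2 * suminf ?g" for n
  proof -
    have split: "{- int n..int n} = insert 0 ((\<lambda>i. int i) ` {1..n} \<union> (\<lambda>i. - int i) ` {1..n})"
    proof (intro equalityI subsetI)
      fix j assume j: "j \<in> {- int n..int n}"
      then have "nat \<bar>j\<bar> \<in> {1..n} \<or> j = 0" "j = int (nat \<bar>j\<bar>) \<or> j = - int (nat \<bar>j\<bar>)" by auto
      then show "j \<in> insert 0 ((\<lambda>i. int i) ` {1..n} \<union> (\<lambda>i. - int i) ` {1..n})" by blast
    qed auto
    have "(\<Sum>j\<in>{- int n..int n}. (1 + (real_of_int j)\<^sup>2) powr (- a))
       = 1 + (\<Sum>j\<in>(\<lambda>i. int i) ` {1..n} \<union> (\<lambda>i. - int i) ` {1..n}. (1 + (real_of_int j)\<^sup>2) powr (- a))"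
      unfolding split by (subst sum.insert) auto
    also have "(\<Sum>j\<in>(\<lambda>i. int i) ` {1..n} \<union> (\<lambda>i. - int i) ` {1..n}. (1 + (real_of_int j)\<^sup>2) powr (- a))
      = (\<Sum>j\<in>(\<lambda>i. int i) ` {1..n}. (1 + (real_of_int j)\<^sup>2) powr (- a)) + (\<Sum>j\<in>(\<lambda>i. - int i) ` {1..n}. (1 + (real_of_int j)\<^sup>2) powr (- a))"
      by (rule sum.union_disjoint) auto
    also have "\<dots> = (\<Sum>i\<in>{1..n}. (1 + (real i)\<^sup>2) powr (- a)) + (\<Sum>i\<in>{1..n}. (1 + (real i)\<^sup>2) powr (- a))"
      by (simp add: sum.reindex inj_on_def)
    also have "(\<Sum>i\<in>{1..n}. (1 + (real i)\<^sup>2) powr (- a)) \<le> (\<Sum>i\<in>{1..n}. ?g i)"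
      using bd[of "int _"] by (intro sum_mono) auto
    also have "\<dots> \<le> suminf ?g" by (rule sum_le_suminf[OF sg]) auto
    finally show ?thesis by simp
  qed
  moreover have "0 \<le> 1 + 2 * suminf ?g" using suminf_nonneg[OF sg] by simp
  ultimately show ?thesis using that by blast
qed

text \<open>In every coordinate one plus the squared frequency is at most the weight. So
  \<open>weight k powr (- a)\<close> is at most a product of one-dimensional terms with exponent
  \<open>a\<close> divided by the dimension, and the sum over a cube factors. The hypothesis says
  that this exponent exceeds 1/2.\<close>

lemma summable_weight_powr:
  assumes "real CARD('d) / 2 < a"
  shows "(\<lambda>k :: int ^ 'd::finite. weight k powr (- a)) summable_on UNIV"
proof (rule nonneg_bdd_above_summable_on)
  define a' where "a' = a / real CARD('d)"
  have d: "0 < real CARD('d)" by simp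
  have a': "1 / 2 < a'" using assms d by (simp add: a'_def field_simps)
  obtain C where C: "0 \<le> C" "\<And>n. (\<Sum>j\<in>{- int n..int n}. (1 + (real_of_int j)\<^sup>2) powr (- a')) \<le> C"
    using sum_int_powr_le[OF a'] by blast
  have term_le: "weight k powr (- a) \<le> (\<Prod>i\<in>UNIV. (1 + (real_of_int (k $ i))\<^sup>2) powr (- a'))" for k :: "int ^ 'd"
  proof -
    have "weight k powr (- a) = (\<Prod>i\<in>(UNIV :: 'd set). weight k powr (- a'))"
      using weight_pos[of k] d by (simp add: powr_realpow[symmetric] powr_powr a'_def)
    also have "\<dots> \<le> (\<Prod>i\<in>UNIV. (1 + (real_of_int (k $ i))\<^sup>2) powr (- a'))"
      using a' component_le_weight by (intro prod_mono conjI powr_mono2') (auto simp: add_pos_nonneg)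
    finally show ?thesis .
  qed
  have box: "(\<Sum>k\<in>(freq_box n :: (int ^ 'd) set). weight k powr (- a)) \<le> C ^ CARD('d)" for n
  proof -
    have eq: "freq_box n = vec_lambda ` (PiE UNIV (\<lambda>_ :: 'd. {- int n..int n}))"
      unfolding vectors_over_eq_image[symmetric] by (auto simp: freq_box_def abs_le_iff) (metis minus_le_iff)+
    have "(\<Sum>k\<in>(freq_box n :: (int ^ 'd) set). weight k powr (- a)) \<le> (\<Sum>k\<in>(freq_box n :: (int ^ 'd) set). \<Prod>i\<in>UNIV. (1 + (real_of_int (k $ i))\<^sup>2) powr (- a'))"
      by (intro sum_mono term_le)
    also have "\<dots> = (\<Sum>g\<in>PiE UNIV (\<lambda>_ :: 'd. {- int n..int n}). \<Prod>i\<in>UNIV. (1 + (real_of_int (g i))\<^sup>2) powr (- a'))"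
      unfolding eq by (subst sum.reindex) (auto simp: inj_on_def vec_lambda_inject)
    also have "\<dots> = (\<Prod>i\<in>(UNIV :: 'd set). \<Sum>j\<in>{- int n..int n}. (1 + (real_of_int j)\<^sup>2) powr (- a'))"
      by (rule prod_sum_PiE[symmetric]) auto
    also have "\<dots> \<le> (\<Prod>i\<in>(UNIV :: 'd set). C)"
      using C(2) by (intro prod_mono) (auto intro!: sum_nonneg)
    finally show ?thesis by simp
  qed
  have "(\<Sum>k\<in>S. weight k powr (- a)) \<le> C ^ CARD('d)" if S: "finite S" for S :: "(int ^ 'd) set"
  proof -
    have "\<forall>\<^sub>F n in sequentially. \<forall>k\<in>S. k \<in> freq_box n"
      using S by (intro eventually_ball_finite) (auto simp: eventually_freq_box)
    then obtain n where "S \<subseteq> freq_box n" by (auto simp: eventually_sequentially)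
    then have "(\<Sum>k\<in>S. weight k powr (- a)) \<le> (\<Sum>k\<in>(freq_box n :: (int ^ 'd) set). weight k powr (- a))"
      by (intro sum_mono2) auto
    then show ?thesis using box[of n] by simp
  qed
  then show "bdd_above (sum (\<lambda>k :: int ^ 'd. weight k powr (- a)) ` {F. F \<subseteq> UNIV \<and> finite F})"
    by (intro bdd_aboveI[of _ "C ^ CARD('d)"]) auto
qed simp

text \<open>The partial sums are bounded by \<open>B\<close> but converge only in mean square. The
  excess of |f| over \<open>B\<close> is dominated by |f - s n|, so its square integrates to
  0.\<close>

lemma AE_bounded_of_partial_sums:
  fixes f :: "'d::finite L2"
  assumes B: "\<And>n. (\<Sum>k\<in>freq_box n. norm (fourier_coeff f k)) \<le> B"
  shows "AE x in torus. \<bar>rep_L2 f x\<bar> \<le> B"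
proof -
  define s where "s n = (\<Sum>k\<in>freq_box n. wave (fourier_coeff f k) k)" for n
  have [measurable]: "rep_L2 f \<in> borel_measurable torus" by (rule rep_measurable)
  let ?p = "\<lambda>x. (max 0 (\<bar>rep_L2 f x\<bar> - B))\<^sup>2"
  have B0: "0 \<le> B" using B[of 0] sum_nonneg[of "freq_box 0" "\<lambda>k. norm (fourier_coeff f k)"] by (meson norm_ge_zero order_trans)
  have pi: "integrable torus ?p"
  proof (rule Bochner_Integration.integrable_bound[OF rep_sq_integrable[of f]])
    show "AE x in torus. norm (?p x) \<le> norm ((rep_L2 f x)\<^sup>2)"
    proof (rule AE_I2)
      fix x have "(max 0 (\<bar>rep_L2 f x\<bar> - B))\<^sup>2 \<le> \<bar>rep_L2 f x\<bar>\<^sup>2" using B0 by (intro power_mono) auto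
      then show "norm (?p x) \<le> norm ((rep_L2 f x)\<^sup>2)" by simp
    qed
  qed measurable
  have le: "(\<integral>x. ?p x \<partial>torus) \<le> (norm (f - s n))\<^sup>2" for n
    unfolding norm_L2_sq
  proof (rule integral_mono_AE[OF pi rep_sq_integrable])
    have "AE x in torus. rep_L2 (s n) x = Re (\<Sum>k\<in>freq_box n. fourier_coeff f k * character k x)"
      unfolding s_def by (rule sum_wave) simp
    with rep_diff[of f "s n"] show "AE x in torus. ?p x \<le> (rep_L2 (f - s n) x)\<^sup>2"
    proof eventually_elim
      case (elim x)
      have "\<bar>rep_L2 (s n) x\<bar> \<le> B"
        unfolding elim(2) using abs_Re_le_cmod norm_trig_sum_le B order_trans by metis
      then have "max 0 (\<bar>rep_L2 f x\<bar> - B) \<le> \<bar>rep_L2 (f - s n) x\<bar>" unfolding elim(1) by auto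
      then have "(max 0 (\<bar>rep_L2 f x\<bar> - B))\<^sup>2 \<le> \<bar>rep_L2 (f - s n) x\<bar>\<^sup>2" by (intro power_mono) auto
      then show ?case by simp
    qed
  qed
  have lim: "(\<lambda>n. (norm (f - s n))\<^sup>2) \<longlonglongrightarrow> (norm (f - f))\<^sup>2"
    unfolding s_def by (intro tendsto_power tendsto_norm tendsto_diff tendsto_const partial_sums_tendsto)
  have "(\<integral>x. ?p x \<partial>torus) \<le> (norm (f - f))\<^sup>2" by (rule LIMSEQ_le_const[OF lim]) (use le in blast)
  then have "(\<integral>x. ?p x \<partial>torus) \<le> 0" by simp
  moreover have "0 \<le> (\<integral>x. ?p x \<partial>torus)" by simp
  ultimately have "(\<integral>x. ?p x \<partial>torus) = 0" by simp
  then have "AE x in torus. ?p x = 0" by (subst (asm) integral_nonneg_eq_0_iff_AE[OF pi]) auto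
  then show ?thesis by eventually_elim (simp add: max_def split: if_splits)
qed

lemma AE_bounded_fourier_mult:
  fixes f :: "'d::finite L2"
  assumes m: "bounded_symbol B m" and sum: "(\<lambda>k. (norm (m k))\<^sup>2) summable_on UNIV"
  shows "AE x in torus. \<bar>rep_L2 (fourier_mult m f) x\<bar> \<le> sqrt (\<Sum>\<^sub>\<infinity>k. (norm (m k))\<^sup>2) * norm f"
proof (rule AE_bounded_of_partial_sums)
  fix n
  have "(\<Sum>k\<in>freq_box n. norm (fourier_coeff (fourier_mult m f) k)) = (\<Sum>k\<in>freq_box n. norm (m k) * norm (fourier_coeff f k))"
    unfolding fourier_coeff_bounded_mult[OF m] norm_mult ..
  also have "\<dots> \<le> sqrt (\<Sum>k\<in>freq_box n. (norm (m k))\<^sup>2) * sqrt (\<Sum>k\<in>freq_box n. (norm (fourier_coeff f k))\<^sup>2)"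
    using L2_set_mult_ineq[of "\<lambda>k. norm (m k)" "\<lambda>k. norm (fourier_coeff f k)" "freq_box n"] by (simp add: L2_set_def)
  also have "\<dots> \<le> sqrt (\<Sum>\<^sub>\<infinity>k. (norm (m k))\<^sup>2) * norm f"
  proof (intro mult_mono)
    show "sqrt (\<Sum>k\<in>freq_box n. (norm (m k))\<^sup>2) \<le> sqrt (\<Sum>\<^sub>\<infinity>k. (norm (m k))\<^sup>2)"
      by (intro real_sqrt_le_mono finite_sum_le_infsum[OF sum]) auto
    have "1 * (\<Sum>k\<in>freq_box n. (norm (fourier_coeff f k))\<^sup>2) \<le> (2 * pi) ^ CARD('d) * (\<Sum>k\<in>freq_box n. (norm (fourier_coeff f k))\<^sup>2)"
      using pi_gt3 by (intro mult_right_mono one_le_power sum_nonneg) auto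
    also have "\<dots> \<le> (norm f)\<^sup>2" by (rule bessel) simp
    finally show "sqrt (\<Sum>k\<in>freq_box n. (norm (fourier_coeff f k))\<^sup>2) \<le> norm f"
      by (intro real_le_lsqrt) (auto simp: sum_nonneg)
  qed (auto simp: sum_nonneg infsum_nonneg)
  finally show "(\<Sum>k\<in>freq_box n. norm (fourier_coeff (fourier_mult m f) k)) \<le> sqrt (\<Sum>\<^sub>\<infinity>k. (norm (m k))\<^sup>2) * norm f" .
qed

section \<open>Essential suprema\<close>

definition ess_bounded :: "(real ^ 'd::finite \<Rightarrow> 'e::euclidean_space) \<Rightarrow> real \<Rightarrow> bool" where
  "ess_bounded f B \<longleftrightarrow> f \<in> borel_measurable torus \<and> (AE x in torus. norm (f x) \<le> B)"

text \<open>\<open>real_of_ereal\<close> sends infinity to 0, so \<open>sup_norm\<close> carries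
  information only under an essential bound. Nonnegativity of the essential supremum uses that the
  torus is not a null set.\<close>

lemma sup_norm_properties:
  assumes "ess_bounded f B"
  shows "AE x in torus. norm (f x) \<le> sup_norm f" "0 \<le> sup_norm f" "sup_norm f \<le> B"
proof -
  let ?E = "esssup torus (\<lambda>x. ereal (norm (f x)))"
  have [measurable]: "f \<in> borel_measurable torus" using assms by (simp add: ess_bounded_def)
  have m: "(\<lambda>x. ereal (norm (f x))) \<in> borel_measurable torus" by measurable
  have up: "?E \<le> ereal B" using assms by (intro esssup_I[OF m]) (simp add: ess_bounded_def)
  have ae: "AE x in torus. ereal (norm (f x)) \<le> ?E" by (rule esssup_AE)
  have lo: "0 \<le> ?E"
  proof (rule ccontr)
    assume neg: "\<not> 0 \<le> ?E"
    have "AE x in (torus :: (real ^ 'a) measure). False" using ae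
    proof eventually_elim
      case (elim x)
      have "0 \<le> ereal (norm (f x))" by simp
      then show ?case using elim neg by (meson order_trans)
    qed
    then have "emeasure torus (space (torus :: (real ^ 'a) measure)) = 0" unfolding eventually_False ae_filter_eq_bot_iff .
    then show False unfolding emeasure_torus by simp
  qed
  have fin: "\<bar>?E\<bar> \<noteq> \<infinity>" using up lo by auto
  then have eq: "?E = ereal (sup_norm f)" by (simp add: sup_norm_def ereal_real)
  show "AE x in torus. norm (f x) \<le> sup_norm f" using ae unfolding eq by simp
  show "0 \<le> sup_norm f" "sup_norm f \<le> B" using lo up unfolding eq by simp_all
qed

lemma sup_norm_triangle:
  assumes f: "ess_bounded f B" and f': "ess_bounded f' B'" and f'': "ess_bounded f'' B''"
    and eq: "AE x in torus. f x = f' x + f'' x"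
  shows "sup_norm f \<le> sup_norm f' + sup_norm f''"
proof (rule sup_norm_properties(3))
  have "AE x in torus. norm (f x) \<le> sup_norm f' + sup_norm f''"
    using eq sup_norm_properties(1)[OF f'] sup_norm_properties(1)[OF f'']
  proof eventually_elim
    case (elim x)
    then show ?case using norm_triangle_ineq[of "f' x" "f'' x"] by simp
  qed
  then show "ess_bounded f (sup_norm f' + sup_norm f'')" using f by (simp add: ess_bounded_def)
qed

lemma borel_measurable_vec_lambda:
  fixes g :: "'i::finite \<Rightarrow> 'a \<Rightarrow> 'e::euclidean_space"
  assumes "\<And>i. g i \<in> borel_measurable M"
  shows "(\<lambda>x. \<chi> i. g i x) \<in> borel_measurable M"
proof (subst borel_measurable_euclidean_space, intro ballI)
  fix b :: "'e ^ 'i" assume "b \<in> Basis"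
  then obtain i u where "b = axis i u" by (auto simp: Basis_vec_def)
  then show "(\<lambda>x. (\<chi> i. g i x) \<bullet> b) \<in> borel_measurable M"
    using assms[of i] by (simp add: inner_axis)
qed

lemma ess_bounded_vec:
  fixes g :: "'i::finite \<Rightarrow> real ^ 'd::finite \<Rightarrow> 'e::euclidean_space"
  assumes "\<And>i. ess_bounded (g i) B"
  shows "ess_bounded (\<lambda>x. \<chi> i. g i x) (real CARD('i) * B)"
  unfolding ess_bounded_def
proof
  show "(\<lambda>x. \<chi> i. g i x) \<in> borel_measurable torus"
    using assms by (intro borel_measurable_vec_lambda) (simp add: ess_bounded_def)
  have "AE x in torus. \<forall>i\<in>UNIV. norm (g i x) \<le> B"
    using assms by (intro AE_finite_allI) (auto simp: ess_bounded_def)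
  then show "AE x in torus. norm (\<chi> i. g i x) \<le> real CARD('i) * B"
  proof eventually_elim
    case (elim x)
    have "norm (\<chi> i. g i x) \<le> (\<Sum>i\<in>UNIV. norm ((\<chi> i. g i x) $ i))"
      unfolding norm_vec_def by (rule L2_set_le_sum) simp
    also have "\<dots> \<le> (\<Sum>i\<in>(UNIV :: 'i set). B)" using elim by (intro sum_mono) auto
    finally show ?case by simp
  qed
qed

section \<open>Bessel potentials and derivatives as multipliers\<close>

lemma bessel_symbol_eq: "bessel_symbol r k = complex_of_real (weight k powr (r / 2))"
  by (simp add: bessel_symbol_def weight_def)

lemma norm_bessel_symbol: "norm (bessel_symbol r k) = weight k powr (r / 2)"
  by (simp add: bessel_symbol_eq)

lemma bessel_symbol_inverse: "bessel_symbol r k * bessel_symbol (- r) k = 1"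
  using weight_pos[of k] by (simp add: bessel_symbol_eq powr_add[symmetric] of_real_mult[symmetric] del: of_real_mult)

lemma hermitian_bessel: "hermitian (bessel_symbol r)"
  by (simp add: hermitian_def bessel_symbol_eq)

lemma hermitian_deriv: "hermitian (deriv_symbol j)"
  by (simp add: hermitian_def deriv_symbol_def)

lemma norm_deriv_symbol_le: "norm (deriv_symbol j k) \<le> weight k powr (1 / 2)"
proof -
  have "(real_of_int (k $ j))\<^sup>2 \<le> weight k" using component_le_weight[of k j] by linarith
  then have "\<bar>real_of_int (k $ j)\<bar> \<le> sqrt (weight k)" using real_le_rsqrt by fastforce
  then show ?thesis using weight_pos[of k] by (simp add: deriv_symbol_def norm_mult powr_half_sqrt)
qed

lemma bounded_bessel: "0 \<le> r \<Longrightarrow> bounded_symbol 1 (bessel_symbol (- r) :: int ^ 'd::finite \<Rightarrow> complex)"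
  for r :: real
  unfolding bounded_symbol_def norm_bessel_symbol
proof (intro conjI allI hermitian_bessel)
  fix k :: "int ^ 'd" assume r: "0 \<le> r"
  have "weight k powr (- r / 2) \<le> weight k powr 0" using weight_ge_1[of k] r by (intro powr_mono) auto
  also have "\<dots> = 1" using weight_pos[of k] by simp
  finally show "weight k powr (- r / 2) \<le> 1" .
qed

lemma norm_deriv_bessel_le: "norm (deriv_symbol j k * bessel_symbol (- r) k) \<le> weight k powr ((1 - r) / 2)"
proof -
  have "norm (deriv_symbol j k * bessel_symbol (- r) k) \<le> weight k powr (1 / 2) * weight k powr (- r / 2)"
    unfolding norm_mult norm_bessel_symbol by (intro mult_right_mono norm_deriv_symbol_le) simp
  also have "\<dots> = weight k powr ((1 - r) / 2)" by (simp add: powr_add[symmetric] diff_divide_distrib)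
  finally show ?thesis .
qed

lemma bounded_deriv_bessel: "1 \<le> r \<Longrightarrow> bounded_symbol 1 (\<lambda>k. deriv_symbol j k * bessel_symbol (- r) k)"
  for j :: "'d::finite"
  unfolding bounded_symbol_def
proof (intro conjI allI)
  fix k :: "int ^ 'd" assume r: "1 \<le> r"
  have "weight k powr ((1 - r) / 2) \<le> weight k powr 0" using weight_ge_1[of k] r by (intro powr_mono) auto
  also have "\<dots> = 1" using weight_pos[of k] by simp
  finally show "norm (deriv_symbol j k * bessel_symbol (- r) k) \<le> 1"
    using norm_deriv_bessel_le[of j k r] by linarith
qed (intro hermitian_mult hermitian_deriv hermitian_bessel)

lemma bounded_bessel_deriv2: "bounded_symbol 1 (\<lambda>k. bessel_symbol (- 2) k * deriv_symbol j k)"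
  using bounded_deriv_bessel[of 2 j] by (simp add: mult.commute)

lemma \<Lambda>\<^sub>0_lower:
  fixes f :: "'d::finite L2"
  assumes r: "0 \<le> r"
  shows "fourier_coeff (\<Lambda>\<^sub>0 (- r) f) k = bessel_symbol (- r) k * fourier_coeff f k"
    and "\<Lambda>\<^sub>0 (- r) f \<in> sobolev_scalar r" and "\<Lambda>\<^sub>0 r (\<Lambda>\<^sub>0 (- r) f) = f"
proof -
  show co: "fourier_coeff (\<Lambda>\<^sub>0 (- r) f) k = bessel_symbol (- r) k * fourier_coeff f k" for k
    unfolding \<Lambda>\<^sub>0_def by (rule fourier_coeff_bounded_mult[OF bounded_bessel[OF r]])
  have "(1 + (norm (freq k))\<^sup>2) powr r * (norm (fourier_coeff (\<Lambda>\<^sub>0 (- r) f) k))\<^sup>2 = (norm (fourier_coeff f k))\<^sup>2" for k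
  proof -
    have "weight k powr r * (weight k powr (- r / 2))\<^sup>2 = 1"
      using weight_pos[of k] by (simp add: power2_eq_square powr_add[symmetric])
    then show ?thesis unfolding co norm_mult norm_bessel_symbol weight_def[symmetric] power_mult_distrib
      by (simp add: mult.assoc[symmetric])
  qed
  then show "\<Lambda>\<^sub>0 (- r) f \<in> sobolev_scalar r" by (simp add: sobolev_scalar_def summable_fourier_coeff)
  show "\<Lambda>\<^sub>0 r (\<Lambda>\<^sub>0 (- r) f) = f"
    unfolding \<Lambda>\<^sub>0_def[of r] by (intro fourier_mult_eqI) (simp add: co mult.assoc[symmetric] bessel_symbol_inverse)
qed

lemma \<Lambda>\<^sub>0_raise:
  fixes f :: "'d::finite L2"
  assumes f: "f \<in> sobolev_scalar r" and r: "0 \<le> r"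
  shows "fourier_coeff (\<Lambda>\<^sub>0 r f) k = bessel_symbol r k * fourier_coeff f k" and "\<Lambda>\<^sub>0 (- r) (\<Lambda>\<^sub>0 r f) = f"
proof -
  have "(norm (bessel_symbol r k * fourier_coeff f k))\<^sup>2 = (1 + (norm (freq k))\<^sup>2) powr r * (norm (fourier_coeff f k))\<^sup>2" for k
  proof -
    have "(weight k powr (r / 2))\<^sup>2 = weight k powr r" by (simp add: power2_eq_square powr_add[symmetric])
    then show ?thesis by (simp add: norm_mult norm_bessel_symbol power_mult_distrib weight_def)
  qed
  then have "(\<lambda>k. (norm (bessel_symbol r k * fourier_coeff f k))\<^sup>2) summable_on UNIV"
    using f by (simp add: sobolev_scalar_def)
  then show co: "fourier_coeff (\<Lambda>\<^sub>0 r f) k = bessel_symbol r k * fourier_coeff f k" for k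
    unfolding \<Lambda>\<^sub>0_def by (rule fourier_coeff_mult[OF hermitian_bessel])
  have "bessel_symbol (- r) k * bessel_symbol r k = 1" for k :: "int ^ 'd"
    using bessel_symbol_inverse[of "- r" k] by simp
  then show "\<Lambda>\<^sub>0 (- r) (\<Lambda>\<^sub>0 r f) = f"
    unfolding \<Lambda>\<^sub>0_def[of "- r"] by (intro fourier_mult_eqI) (simp add: co mult.assoc[symmetric])
qed

text \<open>The composition is a single bounded multiplier, whereas \<open>dx j\<close> alone is
  unbounded.\<close>

lemma dx_\<Lambda>\<^sub>0:
  fixes f :: "'d::finite L2"
  assumes r: "1 \<le> r"
  shows "dx j (\<Lambda>\<^sub>0 (- r) f) = fourier_mult (\<lambda>k. deriv_symbol j k * bessel_symbol (- r) k) f"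
  unfolding dx_def
  by (rule fourier_mult_eqI)
    (use r in \<open>simp add: fourier_coeff_bounded_mult[OF bounded_deriv_bessel[OF r]] \<Lambda>\<^sub>0_lower(1) mult.assoc\<close>)

lemma \<Lambda>_components: "fst (\<Lambda> r y) $ i = \<Lambda>\<^sub>0 r (fst y $ i)" "snd (\<Lambda> r y) = \<Lambda>\<^sub>0 r (snd y)"
  by (simp_all add: \<Lambda>_def state_mult_def \<Lambda>\<^sub>0_def)

lemma state_eqI: "(\<And>i. fst y $ i = fst z $ i) \<Longrightarrow> snd y = snd z \<Longrightarrow> y = z"
  by (simp add: prod_eq_iff vec_eq_iff)

text \<open>Together with \<open>\<Lambda>_raise\<close> this makes \<open>\<Lambda> (- r)\<close> a
  bijection from all of L2 onto \<open>Hs r\<close>, so functionals on \<open>Hs r\<close> become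
  functions of an arbitrary element of L2.\<close>

lemma \<Lambda>_lower:
  fixes v :: "'d::finite state"
  assumes "0 \<le> r"
  shows "\<Lambda> (- r) v \<in> Hs r" "\<Lambda> r (\<Lambda> (- r) v) = v"
  by (simp add: Hs_def \<Lambda>_components \<Lambda>\<^sub>0_lower(2)[OF assms],
    rule state_eqI, simp_all add: \<Lambda>_components \<Lambda>\<^sub>0_lower(3)[OF assms])

lemma \<Lambda>_raise:
  fixes y :: "'d::finite state"
  assumes "y \<in> Hs r" "0 \<le> r"
  shows "\<Lambda> (- r) (\<Lambda> r y) = y"
  using assms by (intro state_eqI) (simp_all add: Hs_def \<Lambda>_components \<Lambda>\<^sub>0_raise(2))

lemma norm_component_le: "norm (fst (v :: 'd::finite state) $ i) \<le> norm v" "norm (snd v) \<le> norm v"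
proof -
  have "norm (fst v $ i) \<le> norm (fst v)" by (rule Finite_Cartesian_Product.norm_nth_le)
  also have "\<dots> \<le> norm v" using norm_fst_le[of "fst v" "snd v"] by simp
  finally show "norm (fst v $ i) \<le> norm v" .
qed (use norm_snd_le[of "snd v" "fst v"] in simp)

lemma norm_state_le: "norm (v :: 'd::finite state) \<le> (\<Sum>i\<in>UNIV. norm (fst v $ i)) + norm (snd v)"
proof -
  have "norm v \<le> norm (fst v) + norm (snd v)" using norm_Pair_le[of "fst v" "snd v"] by simp
  also have "norm (fst v) \<le> (\<Sum>i\<in>UNIV. norm (fst v $ i))" unfolding norm_vec_def by (rule L2_set_le_sum) simp
  finally show ?thesis by simp
qed

lemma norm_state_sq: "(norm (v :: 'd::finite state))\<^sup>2 = (\<Sum>i\<in>UNIV. (norm (fst v $ i))\<^sup>2) + (norm (snd v))\<^sup>2"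
  by (simp add: norm_prod_def norm_vec_def L2_set_def sum_nonneg)

lemma norm_state_mult_le:
  fixes y :: "'d::finite state"
  assumes m: "bounded_symbol B m"
  shows "norm (state_mult m y) \<le> B * norm y"
proof (rule power2_le_imp_le)
  have "norm (m 0) \<le> B" using m by (simp add: bounded_symbol_def)
  with norm_ge_zero have B: "0 \<le> B" by (rule order_trans)
  then show "0 \<le> B * norm y" by simp
  have *: "(norm (fourier_mult m f))\<^sup>2 \<le> B\<^sup>2 * (norm f)\<^sup>2" for f :: "'d L2"
    using power_mono[OF norm_fourier_mult_le[OF m, of f], of 2] by (simp add: power_mult_distrib)
  have "(norm (state_mult m y))\<^sup>2 = (\<Sum>i\<in>UNIV. (norm (fourier_mult m (fst y $ i)))\<^sup>2) + (norm (fourier_mult m (snd y)))\<^sup>2"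
    by (simp add: norm_state_sq state_mult_def)
  also have "\<dots> \<le> (\<Sum>i\<in>UNIV. B\<^sup>2 * (norm (fst y $ i))\<^sup>2) + B\<^sup>2 * (norm (snd y))\<^sup>2"
    by (intro add_mono sum_mono *)
  also have "\<dots> = (B * norm y)\<^sup>2" by (simp add: norm_state_sq power_mult_distrib sum_distrib_left distrib_left)
  finally show "(norm (state_mult m y))\<^sup>2 \<le> (B * norm y)\<^sup>2" .
qed

lemma bounded_linear_state_mult:
  assumes m: "bounded_symbol B m"
  shows "bounded_linear (state_mult m :: 'd::finite state \<Rightarrow> 'd state)"
proof (rule bounded_linear_intro)
  interpret L: bounded_linear "fourier_mult m :: 'd L2 \<Rightarrow> 'd L2" by (rule bounded_linear_fourier_mult[OF m])
  fix y z :: "'d state" and r :: real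
  show "state_mult m (y + z) = state_mult m y + state_mult m z"
    by (rule state_eqI) (simp_all add: state_mult_def L.add)
  show "state_mult m (r *\<^sub>R y) = r *\<^sub>R state_mult m y"
    by (rule state_eqI) (simp_all add: state_mult_def L.scaleR)
  show "norm (state_mult m y) \<le> norm y * B" using norm_state_mult_le[OF m, of y] by (simp add: mult.commute)
qed

text \<open>Both symbols are bounded by \<open>weight k powr ((1 - s) / 2)\<close>, which is square
  summable because \<open>s - 1\<close> exceeds half the dimension; Cauchy-Schwarz then bounds the
  absolute sum of the Fourier coefficients.\<close>

lemma sobolev_embedding:
  assumes s: "1 + real CARD('d) / 2 < s"
  obtains M where "0 \<le> M"
    "\<And>f :: 'd::finite L2. ess_bounded (rep_L2 (\<Lambda>\<^sub>0 (- s) f)) (M * norm f)"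
    "\<And>(f :: 'd::finite L2) j. ess_bounded (rep_L2 (dx j (\<Lambda>\<^sub>0 (- s) f))) (M * norm f)"
proof -
  have s1: "1 \<le> s" "0 \<le> s" using s by (auto intro: order_trans[OF _ less_imp_le[OF s]])
  have sum: "(\<lambda>k :: int ^ 'd. weight k powr (- (s - 1))) summable_on UNIV" by (rule summable_weight_powr) (use s in simp)
  define M where "M = sqrt (\<Sum>\<^sub>\<infinity>k :: int ^ 'd. weight k powr (- (s - 1)))"
  have bd: "ess_bounded (rep_L2 (fourier_mult m f)) (M * norm f)"
    if m: "bounded_symbol 1 m" "\<And>k. norm (m k) \<le> weight k powr ((1 - s) / 2)" for m and f :: "'d L2"
  proof -
    have sq: "(norm (m k))\<^sup>2 \<le> weight k powr (- (s - 1))" for k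
    proof -
      have "(norm (m k))\<^sup>2 \<le> (weight k powr ((1 - s) / 2))\<^sup>2" by (intro power_mono m(2)) simp
      also have "\<dots> = weight k powr (- (s - 1))"
        by (simp add: power2_eq_square powr_add[symmetric])
      finally show ?thesis .
    qed
    have ms: "(\<lambda>k. (norm (m k))\<^sup>2) summable_on UNIV" by (rule summable_on_comparison_test[OF sum]) (use sq in auto)
    have "sqrt (\<Sum>\<^sub>\<infinity>k. (norm (m k))\<^sup>2) \<le> M" unfolding M_def by (intro real_sqrt_le_mono infsum_mono ms sum sq)
    then have "sqrt (\<Sum>\<^sub>\<infinity>k. (norm (m k))\<^sup>2) * norm f \<le> M * norm f" by (intro mult_right_mono) auto
    then show ?thesis
      unfolding ess_bounded_def using AE_bounded_fourier_mult[OF m(1) ms, of f] by (auto elim!: AE_mp)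
  qed
  show ?thesis
  proof (rule that)
    show "0 \<le> M" unfolding M_def by (simp add: infsum_nonneg)
    show "ess_bounded (rep_L2 (\<Lambda>\<^sub>0 (- s) f)) (M * norm f)" for f :: "'d L2"
      unfolding \<Lambda>\<^sub>0_def
    proof (rule bd)
      show "norm (bessel_symbol (- s) k) \<le> weight k powr ((1 - s) / 2)" for k :: "int ^ 'd"
        unfolding norm_bessel_symbol using weight_ge_1[of k] by (intro powr_mono) auto
    qed (rule bounded_bessel[OF s1(2)])
    show "ess_bounded (rep_L2 (dx j (\<Lambda>\<^sub>0 (- s) f))) (M * norm f)" for f :: "'d L2" and j
      unfolding dx_\<Lambda>\<^sub>0[OF s1(1)] by (rule bd[OF bounded_deriv_bessel[OF s1(1)] norm_deriv_bessel_le])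
  qed
qed

lemma ess_bounded_mono: "ess_bounded f B \<Longrightarrow> B \<le> B' \<Longrightarrow> ess_bounded f B'"
  by (auto simp: ess_bounded_def elim!: AE_mp)

text \<open>The last two bounds make the \<open>W1inf_norm\<close> a Lipschitz function of v in L2.
  The norm is built from four essential suprema, of the values and gradients of both components;
  each satisfies a triangle inequality, and the Euclidean norm of the plane combines them.\<close>

lemma W1inf_lower_bounds:
  assumes s: "1 + real CARD('d) / 2 < s"
  defines "w \<equiv> (\<lambda>v :: 'd::finite state. W1inf_norm (\<Lambda> (- s) v))"
  obtains K where "0 \<le> K" "\<And>v. 0 \<le> w v" "\<And>v. w v \<le> K * norm v" "\<And>v v'. w v \<le> w v' + w (v - v')"
proof -
  have s1: "1 \<le> s" "0 \<le> s" using s by (auto intro: order_trans[OF _ less_imp_le[OF s]])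
  obtain M where M: "0 \<le> M" "\<And>f :: 'd L2. ess_bounded (rep_L2 (\<Lambda>\<^sub>0 (- s) f)) (M * norm f)"
    "\<And>(f :: 'd L2) j. ess_bounded (rep_L2 (dx j (\<Lambda>\<^sub>0 (- s) f))) (M * norm f)"
    using sobolev_embedding[OF s] by blast
  define d where "d = real CARD('d)"
  have d: "1 \<le> d" unfolding d_def by (simp add: Suc_le_eq)
  define a1 :: "'d state \<Rightarrow> real ^ 'd \<Rightarrow> real ^ 'd" where "a1 v x = (\<chi> i. rep_L2 (fst (\<Lambda> (- s) v) $ i) x)" for v x
  define a2 :: "'d state \<Rightarrow> real ^ 'd \<Rightarrow> real ^ 'd ^ 'd" where "a2 v x = (\<chi> i j. rep_L2 (dx j (fst (\<Lambda> (- s) v) $ i)) x)" for v x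
  define a3 :: "'d state \<Rightarrow> real ^ 'd \<Rightarrow> real" where "a3 v x = rep_L2 (snd (\<Lambda> (- s) v)) x" for v x
  define a4 :: "'d state \<Rightarrow> real ^ 'd \<Rightarrow> real ^ 'd" where "a4 v x = (\<chi> j. rep_L2 (dx j (snd (\<Lambda> (- s) v))) x)" for v x
  have weq: "w v = sqrt ((sup_norm (a1 v) + sup_norm (a2 v))\<^sup>2 + (sup_norm (a3 v) + sup_norm (a4 v))\<^sup>2)" for v
    by (simp add: w_def W1inf_norm_def W1inf_vector_def W1inf_scalar_def a1_def[abs_def] a2_def[abs_def] a3_def[abs_def] a4_def[abs_def])
  have c: "M * norm (fst v $ i) \<le> M * norm v" "M * norm (snd v) \<le> M * norm v" for v :: "'d state" and i
    by (intro mult_left_mono M(1) norm_component_le)+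
  have b1: "ess_bounded (a1 v) (d * (M * norm v))" for v
    unfolding a1_def[abs_def] \<Lambda>_components d_def by (intro ess_bounded_vec ess_bounded_mono[OF M(2) c(1)])
  have b2: "ess_bounded (a2 v) (d * (d * (M * norm v)))" for v
    unfolding a2_def[abs_def] \<Lambda>_components d_def by (intro ess_bounded_vec ess_bounded_mono[OF M(3) c(1)])
  have b3: "ess_bounded (a3 v) (M * norm v)" for v
    unfolding a3_def[abs_def] \<Lambda>_components by (intro ess_bounded_mono[OF M(2) c(2)])
  have b4: "ess_bounded (a4 v) (d * (M * norm v))" for v
    unfolding a4_def[abs_def] \<Lambda>_components d_def by (intro ess_bounded_vec ess_bounded_mono[OF M(3) c(2)])
  have r0: "AE x in torus. rep_L2 (\<Lambda>\<^sub>0 (- s) f) x = rep_L2 (\<Lambda>\<^sub>0 (- s) f') x + rep_L2 (\<Lambda>\<^sub>0 (- s) (f - f')) x" for f f' :: "'d L2"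
  proof -
    interpret L: bounded_linear "\<Lambda>\<^sub>0 (- s) :: 'd L2 \<Rightarrow> 'd L2"
      unfolding \<Lambda>\<^sub>0_def by (rule bounded_linear_fourier_mult[OF bounded_bessel[OF s1(2)]])
    have "\<Lambda>\<^sub>0 (- s) f = \<Lambda>\<^sub>0 (- s) f' + \<Lambda>\<^sub>0 (- s) (f - f')" by (simp add: L.diff)
    then show ?thesis using rep_add[of "\<Lambda>\<^sub>0 (- s) f'" "\<Lambda>\<^sub>0 (- s) (f - f')"] by simp
  qed
  have r1: "AE x in torus. rep_L2 (dx j (\<Lambda>\<^sub>0 (- s) f)) x = rep_L2 (dx j (\<Lambda>\<^sub>0 (- s) f')) x + rep_L2 (dx j (\<Lambda>\<^sub>0 (- s) (f - f'))) x"
    for f f' :: "'d L2" and j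
  proof -
    interpret L: bounded_linear "\<lambda>f :: 'd L2. dx j (\<Lambda>\<^sub>0 (- s) f)"
      unfolding dx_\<Lambda>\<^sub>0[OF s1(1)] by (rule bounded_linear_fourier_mult[OF bounded_deriv_bessel[OF s1(1)]])
    have "dx j (\<Lambda>\<^sub>0 (- s) f) = dx j (\<Lambda>\<^sub>0 (- s) f') + dx j (\<Lambda>\<^sub>0 (- s) (f - f'))" by (simp add: L.diff)
    then show ?thesis using rep_add[of "dx j (\<Lambda>\<^sub>0 (- s) f')" "dx j (\<Lambda>\<^sub>0 (- s) (f - f'))"] by simp
  qed
  have t1: "sup_norm (a1 v) \<le> sup_norm (a1 v') + sup_norm (a1 (v - v'))" for v v'
  proof (rule sup_norm_triangle[OF b1 b1 b1])
    have "AE x in torus. \<forall>i\<in>UNIV. rep_L2 (\<Lambda>\<^sub>0 (- s) (fst v $ i)) x = rep_L2 (\<Lambda>\<^sub>0 (- s) (fst v' $ i)) x + rep_L2 (\<Lambda>\<^sub>0 (- s) (fst v $ i - fst v' $ i)) x"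
      by (intro AE_finite_allI r0) simp
    then show "AE x in torus. a1 v x = a1 v' x + a1 (v - v') x"
      by eventually_elim (simp add: a1_def \<Lambda>_components vec_eq_iff)
  qed
  have t2: "sup_norm (a2 v) \<le> sup_norm (a2 v') + sup_norm (a2 (v - v'))" for v v'
  proof (rule sup_norm_triangle[OF b2 b2 b2])
    have "AE x in torus. \<forall>i\<in>UNIV. \<forall>j\<in>UNIV. rep_L2 (dx j (\<Lambda>\<^sub>0 (- s) (fst v $ i))) x = rep_L2 (dx j (\<Lambda>\<^sub>0 (- s) (fst v' $ i))) x + rep_L2 (dx j (\<Lambda>\<^sub>0 (- s) (fst v $ i - fst v' $ i))) x"
      by (intro AE_finite_allI r1) auto
    then show "AE x in torus. a2 v x = a2 v' x + a2 (v - v') x"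
      by eventually_elim (simp add: a2_def \<Lambda>_components vec_eq_iff)
  qed
  have t3: "sup_norm (a3 v) \<le> sup_norm (a3 v') + sup_norm (a3 (v - v'))" for v v'
    by (rule sup_norm_triangle[OF b3 b3 b3]) (use r0[of "snd v" "snd v'"] in \<open>simp add: a3_def \<Lambda>_components\<close>)
  have t4: "sup_norm (a4 v) \<le> sup_norm (a4 v') + sup_norm (a4 (v - v'))" for v v'
  proof (rule sup_norm_triangle[OF b4 b4 b4])
    have "AE x in torus. \<forall>j\<in>UNIV. rep_L2 (dx j (\<Lambda>\<^sub>0 (- s) (snd v))) x = rep_L2 (dx j (\<Lambda>\<^sub>0 (- s) (snd v'))) x + rep_L2 (dx j (\<Lambda>\<^sub>0 (- s) (snd v - snd v'))) x"
      by (intro AE_finite_allI r1) simp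
    then show "AE x in torus. a4 v x = a4 v' x + a4 (v - v') x"
      by eventually_elim (simp add: a4_def \<Lambda>_components vec_eq_iff)
  qed
  define b where "b v = sup_norm (a1 v) + sup_norm (a2 v)" for v
  define b' where "b' v = sup_norm (a3 v) + sup_norm (a4 v)" for v
  have b0: "0 \<le> b v" "0 \<le> b' v" for v
    using sup_norm_properties(2)[OF b1] sup_norm_properties(2)[OF b2] sup_norm_properties(2)[OF b3] sup_norm_properties(2)[OF b4]
    by (simp_all add: b_def b'_def)
  have btri: "b v \<le> b v' + b (v - v')" "b' v \<le> b' v' + b' (v - v')" for v v'
    using t1[of v v'] t2[of v v'] t3[of v v'] t4[of v v'] by (simp_all add: b_def b'_def)
  have weq': "w v = sqrt ((b v)\<^sup>2 + (b' v)\<^sup>2)" for v by (simp add: weq b_def b'_def)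
  define K where "K = (d * M + d * (d * M)) + (M + d * M)"
  show ?thesis
  proof (rule that)
    show "0 \<le> K" using M(1) d by (simp add: K_def)
    show "0 \<le> w v" for v by (simp add: weq')
    show "w v \<le> K * norm v" for v
    proof -
      have "w v \<le> b v + b' v" unfolding weq' using b0[of v] by (rule sqrt_sum_squares_le_sum)
      also have "\<dots> \<le> (d * (M * norm v) + d * (d * (M * norm v))) + (M * norm v + d * (M * norm v))"
        unfolding b_def b'_def
        by (intro add_mono sup_norm_properties(3) b1 b2 b3 b4)
      also have "\<dots> = K * norm v" by (simp add: K_def algebra_simps)
      finally show ?thesis .
    qed
    show "w v \<le> w v' + w (v - v')" for v v'
    proof -
      have "w v \<le> sqrt ((b v' + b (v - v'))\<^sup>2 + (b' v' + b' (v - v'))\<^sup>2)"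
        unfolding weq' using b0 btri by (intro real_sqrt_le_mono add_mono power_mono) auto
      also have "\<dots> \<le> w v' + w (v - v')" unfolding weq' by (rule real_sqrt_sum_squares_triangle_ineq)
      finally show ?thesis .
    qed
  qed
qed

section \<open>Nonlinearity and mollifier\<close>

definition bounded_on_balls :: "('d::finite state \<Rightarrow> 'e::real_normed_vector) \<Rightarrow> bool" where
  "bounded_on_balls f \<longleftrightarrow> (\<forall>R. \<exists>C. \<forall>v. norm v \<le> R \<longrightarrow> norm (f v) \<le> C)"

text \<open>Sup bounds are carried along as long as products are to be formed, since a product of
  two elements of L2 may leave L2; after the last product a bound in norm is enough.\<close>

definition sup_bounded_on_balls :: "('d::finite state \<Rightarrow> 'd L2) \<Rightarrow> bool" where
  "sup_bounded_on_balls f \<longleftrightarrow> (\<forall>R. \<exists>C. \<forall>v. norm v \<le> R \<longrightarrow> ess_bounded (rep_L2 (f v)) C)"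

lemma ess_boundedD: "ess_bounded (rep_L2 f) B \<Longrightarrow> AE x in torus. \<bar>rep_L2 f x\<bar> \<le> B"
  by (simp add: ess_bounded_def)

lemma ess_boundedI: "AE x in torus. \<bar>rep_L2 f x\<bar> \<le> B \<Longrightarrow> ess_bounded (rep_L2 f) B"
  by (simp add: ess_bounded_def)

text \<open>Bounded factors have a square-integrable product, and only then does
  \<open>\<odot>\<close> return the class of that product.\<close>

lemma ess_bounded_mult:
  assumes f: "ess_bounded (rep_L2 f) B" and g: "ess_bounded (rep_L2 g) C"
  shows "ess_bounded (rep_L2 (f \<odot> g)) (B * C)"
proof -
  let ?h = "\<lambda>x. rep_L2 f x * rep_L2 g x"
  have b: "AE x in torus. \<bar>?h x\<bar> \<le> B * C"
    using ess_boundedD[OF f] ess_boundedD[OF g]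
  proof eventually_elim
    case (elim x)
    from order_trans[OF abs_ge_zero elim(1)] elim show ?case by (simp add: abs_mult mult_mono)
  qed
  have "integrable torus (\<lambda>x. (?h x)\<^sup>2)"
  proof (rule Bochner_Integration.integrable_bound[where f = "\<lambda>_. (B * C)\<^sup>2"])
    show "AE x in torus. norm ((?h x)\<^sup>2) \<le> norm ((B * C)\<^sup>2)"
      using b
    proof eventually_elim
      case (elim x)
      then have "\<bar>?h x\<bar>\<^sup>2 \<le> (B * C)\<^sup>2" by (intro power_mono) auto
      then show ?case by simp
    qed
  qed simp_all
  then have "sq_integrable ?h" by (simp add: sq_integrable_def)
  from rep_abs_L2[OF this] b show ?thesis
    unfolding ess_bounded_def L2_mult_def by (auto elim!: AE_mp)
qed

lemma norm_le_of_ess_bounded: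
  fixes f :: "'d::finite L2"
  assumes "ess_bounded (rep_L2 f) B"
  shows "norm f \<le> sqrt ((2 * pi) ^ CARD('d)) * \<bar>B\<bar>"
proof -
  have "(norm f)\<^sup>2 \<le> (\<integral>x. B\<^sup>2 \<partial>(torus :: (real ^ 'd) measure))"
    unfolding norm_L2_sq
  proof (rule integral_mono_AE)
    show "AE x in torus. (rep_L2 f x)\<^sup>2 \<le> B\<^sup>2"
      using ess_boundedD[OF assms] by eventually_elim (simp add: abs_le_square_iff[symmetric])
  qed (simp_all add: rep_sq_integrable)
  also have "\<dots> = (sqrt ((2 * pi) ^ CARD('d)) * \<bar>B\<bar>)\<^sup>2" by (simp add: measure_torus[simplified] power_mult_distrib)
  finally show ?thesis by (rule power2_le_imp_le) simp
qed

lemma sup_bounded_imp_bounded: "sup_bounded_on_balls f \<Longrightarrow> bounded_on_balls f"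
  unfolding sup_bounded_on_balls_def bounded_on_balls_def using norm_le_of_ess_bounded by meson

lemma sup_bounded_binop:
  assumes f: "sup_bounded_on_balls f" and g: "sup_bounded_on_balls g"
    and op: "\<And>p q B C. ess_bounded (rep_L2 p) B \<Longrightarrow> ess_bounded (rep_L2 q) C \<Longrightarrow> ess_bounded (rep_L2 (h p q)) (k B C)"
  shows "sup_bounded_on_balls (\<lambda>v. h (f v) (g v))"
  unfolding sup_bounded_on_balls_def
proof
  fix R
  obtain B C where "\<And>v. norm v \<le> R \<Longrightarrow> ess_bounded (rep_L2 (f v)) B" "\<And>v. norm v \<le> R \<Longrightarrow> ess_bounded (rep_L2 (g v)) C"
    using f g unfolding sup_bounded_on_balls_def by meson
  then show "\<exists>C. \<forall>v. norm v \<le> R \<longrightarrow> ess_bounded (rep_L2 (h (f v) (g v))) C" using op by blast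
qed

lemma sup_bounded_mult: "sup_bounded_on_balls f \<Longrightarrow> sup_bounded_on_balls g \<Longrightarrow> sup_bounded_on_balls (\<lambda>v. f v \<odot> g v)"
  by (rule sup_bounded_binop[OF _ _ ess_bounded_mult])

lemma ess_bounded_add: "ess_bounded (rep_L2 p) B \<Longrightarrow> ess_bounded (rep_L2 q) C \<Longrightarrow> ess_bounded (rep_L2 (p + q)) (B + C)"
proof (rule ess_boundedI)
  assume "ess_bounded (rep_L2 p) B" "ess_bounded (rep_L2 q) C"
  from this[THEN ess_boundedD] rep_add[of p q] show "AE x in torus. \<bar>rep_L2 (p + q) x\<bar> \<le> B + C"
    by eventually_elim linarith
qed

lemma ess_bounded_diff: "ess_bounded (rep_L2 p) B \<Longrightarrow> ess_bounded (rep_L2 q) C \<Longrightarrow> ess_bounded (rep_L2 (p - q)) (B + C)"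
proof (rule ess_boundedI)
  assume "ess_bounded (rep_L2 p) B" "ess_bounded (rep_L2 q) C"
  from this[THEN ess_boundedD] rep_diff[of p q] show "AE x in torus. \<bar>rep_L2 (p - q) x\<bar> \<le> B + C"
    by eventually_elim linarith
qed

lemma ess_bounded_scaleR: "ess_bounded (rep_L2 p) B \<Longrightarrow> ess_bounded (rep_L2 (r *\<^sub>R p)) (\<bar>r\<bar> * B)"
proof (rule ess_boundedI)
  assume "ess_bounded (rep_L2 p) B"
  from this[THEN ess_boundedD] rep_scaleR[of r p] show "AE x in torus. \<bar>rep_L2 (r *\<^sub>R p) x\<bar> \<le> \<bar>r\<bar> * B"
    by eventually_elim (simp add: abs_mult mult_left_mono)
qed

lemma sup_bounded_add: "sup_bounded_on_balls f \<Longrightarrow> sup_bounded_on_balls g \<Longrightarrow> sup_bounded_on_balls (\<lambda>v. f v + g v)"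
  by (rule sup_bounded_binop[OF _ _ ess_bounded_add])

lemma sup_bounded_diff: "sup_bounded_on_balls f \<Longrightarrow> sup_bounded_on_balls g \<Longrightarrow> sup_bounded_on_balls (\<lambda>v. f v - g v)"
  by (rule sup_bounded_binop[OF _ _ ess_bounded_diff])

lemma sup_bounded_scaleR: "sup_bounded_on_balls f \<Longrightarrow> sup_bounded_on_balls (\<lambda>v. r *\<^sub>R f v)"
  by (rule sup_bounded_binop[where h = "\<lambda>p q. r *\<^sub>R p" and g = f]) (auto intro: ess_bounded_scaleR)

lemma sup_bounded_zero: "sup_bounded_on_balls (\<lambda>v. 0)"
  unfolding sup_bounded_on_balls_def ess_bounded_def using rep_zero
  by (auto intro!: exI[of _ 0] elim!: AE_mp)

lemma sup_bounded_sum: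
  assumes "\<And>i. i \<in> S \<Longrightarrow> sup_bounded_on_balls (f i)"
  shows "sup_bounded_on_balls (\<lambda>v. \<Sum>i\<in>S. f i v)"
proof (cases "finite S")
  case True
  then show ?thesis using assms
    by (induction S) (auto intro: sup_bounded_zero sup_bounded_add)
qed (simp add: sup_bounded_zero)

lemma bounded_add: "bounded_on_balls f \<Longrightarrow> bounded_on_balls g \<Longrightarrow> bounded_on_balls (\<lambda>v. f v + g v)"
  unfolding bounded_on_balls_def by (meson norm_triangle_mono)

lemma bounded_sum:
  assumes "\<And>i. i \<in> S \<Longrightarrow> bounded_on_balls (f i)"
  shows "bounded_on_balls (\<lambda>v. \<Sum>i\<in>S. f i v)"
proof (cases "finite S")
  case True
  then show ?thesis using assms
  proof (induction S)
    case empty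
    then show ?case by (auto simp: bounded_on_balls_def)
  next
    case (insert x S)
    then have "bounded_on_balls (\<lambda>v. f x v + (\<Sum>i\<in>S. f i v))" by (intro bounded_add) auto
    then show ?case using insert by simp
  qed
qed (auto simp add: bounded_on_balls_def)

lemma bounded_contraction:
  assumes "bounded_on_balls f" "\<And>p. norm (g p) \<le> norm p"
  shows "bounded_on_balls (\<lambda>v. g (f v))"
  using assms unfolding bounded_on_balls_def by (meson order_trans)

lemma bounded_state:
  assumes "\<And>i. bounded_on_balls (\<lambda>v. fst (f v) $ i)" "bounded_on_balls (\<lambda>v. snd (f v))"
  shows "bounded_on_balls (f :: 'd state \<Rightarrow> 'd::finite state)"
proof -
  have n: "bounded_on_balls (\<lambda>v. norm (g v))" if "bounded_on_balls g" for g :: "'d state \<Rightarrow> 'd L2"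
    using that by (simp add: bounded_on_balls_def)
  have "bounded_on_balls (\<lambda>v. (\<Sum>i\<in>UNIV. norm (fst (f v) $ i)) + norm (snd (f v)))"
    by (intro bounded_add bounded_sum n[OF assms(1)] n[OF assms(2)])
  then have "\<exists>C. \<forall>v. norm v \<le> R \<longrightarrow> (\<Sum>i\<in>UNIV. norm (fst (f v) $ i)) + norm (snd (f v)) \<le> C" for R
    unfolding bounded_on_balls_def real_norm_def by (meson abs_ge_self order_trans)
  then show ?thesis unfolding bounded_on_balls_def using norm_state_le[where 'd = 'd] by (meson order_trans)
qed

lemma norm_\<Lambda>m2_dx_le: "norm (\<Lambda>m2_dx j f) \<le> norm f"
  unfolding \<Lambda>m2_dx_def using norm_fourier_mult_le[OF bounded_bessel_deriv2, of j f] by simp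

lemma norm_\<Lambda>\<^sub>0_m2_le: "norm (\<Lambda>\<^sub>0 (- 2) f) \<le> norm f"
  unfolding \<Lambda>\<^sub>0_def using norm_fourier_mult_le[OF bounded_bessel[of 2], of f] by simp

text \<open>Sobolev embedding bounds the fields and their first derivatives, products preserve such
  bounds, and the operators of negative order applied last are contractions. The resulting bound is
  in L2 rather than in \<open>Hs s\<close>, so lifting it by \<open>\<Lambda> s\<close> calls for
  smoothing.\<close>

lemma nonlinearity_bounded:
  assumes s: "1 + real CARD('d) / 2 < s"
  shows "bounded_on_balls (\<lambda>v :: 'd::finite state.
    nonlin_B (\<Lambda> (- s) v) (\<Lambda> (- s) v) + nonlin_F (\<Lambda> (- s) v))"
proof -
  obtain M where M: "0 \<le> M" "\<And>f :: 'd L2. ess_bounded (rep_L2 (\<Lambda>\<^sub>0 (- s) f)) (M * norm f)"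
    "\<And>(f :: 'd L2) j. ess_bounded (rep_L2 (dx j (\<Lambda>\<^sub>0 (- s) f))) (M * norm f)"
    using sobolev_embedding[OF s] by blast
  let ?u = "\<lambda>i (v :: 'd state). fst (\<Lambda> (- s) v) $ i" and ?g = "\<lambda>v :: 'd state. snd (\<Lambda> (- s) v)"
  have M': "M * norm (fst v $ i) \<le> M * R" "M * norm (snd v) \<le> M * R" if "norm v \<le> R" for v :: "'d state" and R i
    by (intro mult_left_mono M(1) order_trans[OF norm_component_le(1) that] order_trans[OF norm_component_le(2) that])+
  have u: "sup_bounded_on_balls (?u i)" for i
    unfolding sup_bounded_on_balls_def \<Lambda>_components using ess_bounded_mono[OF M(2) M'(1)] by blast
  have du: "sup_bounded_on_balls (\<lambda>v. dx j (?u i v))" for i j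
    unfolding sup_bounded_on_balls_def \<Lambda>_components by (intro allI exI impI ess_bounded_mono[OF M(3)]) (rule M'(1))
  have g: "sup_bounded_on_balls ?g"
    unfolding sup_bounded_on_balls_def \<Lambda>_components using ess_bounded_mono[OF M(2) M'(2)] by blast
  have dg: "sup_bounded_on_balls (\<lambda>v. dx j (?g v))" for j
    unfolding sup_bounded_on_balls_def \<Lambda>_components by (intro allI exI impI ess_bounded_mono[OF M(3)]) (rule M'(2))
  have gr: "sup_bounded_on_balls (\<lambda>v :: 'd state. grad (fst (\<Lambda> (- s) v)) i j)" for i j
    unfolding grad_def by (rule du)
  have dv: "sup_bounded_on_balls (\<lambda>v :: 'd state. divergence (fst (\<Lambda> (- s) v)))"
    unfolding divergence_def by (intro sup_bounded_sum du)
  note sup_intros = sup_bounded_add sup_bounded_diff sup_bounded_mult sup_bounded_sum sup_bounded_scaleR u du g dg gr dv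
  have cond: "sup_bounded_on_balls (\<lambda>v. if P then f v else 0)" if "sup_bounded_on_balls f" for P and f :: "'d state \<Rightarrow> 'd L2"
    using that sup_bounded_zero by (cases P) auto
  have div: "bounded_on_balls (\<lambda>v. \<Lambda>m2_div (f v))" if "\<And>j. sup_bounded_on_balls (\<lambda>v. f v j)" for f :: "'d state \<Rightarrow> 'd \<Rightarrow> 'd L2"
    unfolding \<Lambda>m2_div_def by (intro bounded_sum bounded_contraction[OF _ norm_\<Lambda>m2_dx_le] sup_bounded_imp_bounded that)
  have L1: "bounded_on_balls (\<lambda>v :: 'd state. \<L>\<^sub>1 (fst (\<Lambda> (- s) v)) $ i)" for i
    unfolding \<L>\<^sub>1_def vec_lambda_beta
    by (intro bounded_add div bounded_contraction[OF _ norm_\<Lambda>\<^sub>0_m2_le] sup_bounded_imp_bounded cond sup_intros)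
  have L2: "bounded_on_balls (\<lambda>v :: 'd state. \<L>\<^sub>2 (snd (\<Lambda> (- s) v)) $ i)" for i
    unfolding \<L>\<^sub>2_def vec_lambda_beta by (intro div cond sup_intros)
  have L3: "bounded_on_balls (\<lambda>v :: 'd state. \<L>\<^sub>3 (fst (\<Lambda> (- s) v)) (snd (\<Lambda> (- s) v)))"
    unfolding \<L>\<^sub>3_def
    by (intro bounded_add div bounded_contraction[OF _ norm_\<Lambda>\<^sub>0_m2_le] sup_bounded_imp_bounded sup_intros)
  show ?thesis
  proof (rule bounded_state)
    show "bounded_on_balls (\<lambda>v :: 'd state. fst (nonlin_B (\<Lambda> (- s) v) (\<Lambda> (- s) v) + nonlin_F (\<Lambda> (- s) v)) $ i)" for i
      unfolding nonlin_B_def nonlin_F_def fst_add vector_add_component fst_conv vec_lambda_beta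
      by (intro bounded_add L1 L2 sup_bounded_imp_bounded sup_intros)
    show "bounded_on_balls (\<lambda>v :: 'd state. snd (nonlin_B (\<Lambda> (- s) v) (\<Lambda> (- s) v) + nonlin_F (\<Lambda> (- s) v)))"
      unfolding nonlin_B_def nonlin_F_def snd_add snd_conv
      by (intro bounded_add L3 sup_bounded_imp_bounded sup_intros)
  qed
qed

section \<open>The mollifier as a bounded multiplier\<close>

lemma bounded_mollifier_symbol:
  assumes "friedrichs_symbol jhat"
  shows "bounded_symbol 1 (\<lambda>k :: int ^ 'd::finite. complex_of_real (jhat (\<epsilon> *\<^sub>R freq k)))"
  using assms by (simp add: bounded_symbol_def hermitian_def friedrichs_symbol_def freq_minus)

text \<open>\<open>\<Lambda> s\<close> after the mollifier, as one multiplier: in contrast to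
  \<open>\<Lambda> s\<close> it is bounded on L2 and can be applied to the nonlinearity.\<close>

definition smoothed_lift :: "real \<Rightarrow> (real ^ 'd::finite \<Rightarrow> real) \<Rightarrow> real \<Rightarrow> 'd state \<Rightarrow> 'd state" where
  "smoothed_lift s jhat \<epsilon> = state_mult (\<lambda>k. bessel_symbol s k * complex_of_real (jhat (\<epsilon> *\<^sub>R freq k)))"

text \<open>Decay of order \<open>n \<ge> s\<close> of the Schwartz function beats the growth of the
  Bessel symbol. Rescaling by \<open>\<epsilon>\<close> costs a factor
  \<open>1 / \<epsilon> ^ n\<close>, harmless for fixed \<open>\<epsilon>\<close>.\<close>

lemma bounded_smoothed_lift_symbol:
  fixes jhat :: "real ^ 'd::finite \<Rightarrow> real"
  assumes j: "friedrichs_symbol jhat" and \<epsilon>: "0 < \<epsilon>" "\<epsilon> < 1"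
  obtains B where "bounded_symbol B (\<lambda>k. bessel_symbol s k * complex_of_real (jhat (\<epsilon> *\<^sub>R freq k)))"
proof -
  obtain n :: nat where n: "s \<le> real n" using real_arch_simple by blast
  obtain C where C: "\<And>x. (1 + norm x) ^ n * \<bar>jhat x\<bar> \<le> C"
    using j unfolding friedrichs_symbol_def schwartz_def by metis
  have "norm (bessel_symbol s k * complex_of_real (jhat (\<epsilon> *\<^sub>R freq k))) \<le> C / \<epsilon> ^ n" for k :: "int ^ 'd"
  proof -
    let ?x = "norm (freq k)"
    have "weight k powr (s / 2) \<le> weight k powr (real n / 2)"
      using n weight_ge_1[of k] by (intro powr_mono) auto
    also have "\<dots> \<le> ((1 + ?x)\<^sup>2) powr (real n / 2)"
      using weight_pos[of k] by (intro powr_mono2) (auto simp: weight_def power2_sum)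
    also have "\<dots> = (1 + ?x) ^ n"
    proof -
      have p: "0 < 1 + ?x" by (simp add: add_pos_nonneg)
      have "((1 + ?x)\<^sup>2) powr (real n / 2) = ((1 + ?x) powr 2) powr (real n / 2)" by (simp add: powr_numeral[OF less_imp_le[OF p]])
      also have "\<dots> = (1 + ?x) powr real n" by (simp only: powr_powr) simp
      also have "\<dots> = (1 + ?x) ^ n" by (rule powr_realpow[OF p])
      finally show ?thesis .
    qed
    finally have w: "weight k powr (s / 2) \<le> (1 + ?x) ^ n" .
    have "\<epsilon> * (1 + ?x) \<le> 1 + norm (\<epsilon> *\<^sub>R freq k)" using \<epsilon> by (simp add: distrib_left)
    then have "(\<epsilon> * (1 + ?x)) ^ n \<le> (1 + norm (\<epsilon> *\<^sub>R freq k)) ^ n" using \<epsilon> by (intro power_mono) auto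
    then have "\<epsilon> ^ n * (1 + ?x) ^ n * \<bar>jhat (\<epsilon> *\<^sub>R freq k)\<bar> \<le> C"
      using C[of "\<epsilon> *\<^sub>R freq k"] by (intro order_trans[OF mult_right_mono C]) (auto simp: power_mult_distrib)
    moreover have "\<epsilon> ^ n * (weight k powr (s / 2) * \<bar>jhat (\<epsilon> *\<^sub>R freq k)\<bar>) \<le> \<epsilon> ^ n * ((1 + ?x) ^ n * \<bar>jhat (\<epsilon> *\<^sub>R freq k)\<bar>)"
      using \<epsilon> w by (intro mult_left_mono mult_right_mono) auto
    ultimately have "\<epsilon> ^ n * (weight k powr (s / 2) * \<bar>jhat (\<epsilon> *\<^sub>R freq k)\<bar>) \<le> C" by (simp add: mult.assoc)
    then show ?thesis using \<epsilon> by (simp add: norm_mult norm_bessel_symbol field_simps)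
  qed
  moreover have "hermitian (\<lambda>k. bessel_symbol s k * complex_of_real (jhat (\<epsilon> *\<^sub>R freq k)))"
    using bounded_mollifier_symbol[OF j, of \<epsilon>] by (intro hermitian_mult hermitian_bessel) (simp add: bounded_symbol_def)
  ultimately show ?thesis using that unfolding bounded_symbol_def by blast
qed

lemma bounded_linear_smoothed_lift:
  assumes "friedrichs_symbol jhat" "0 < \<epsilon>" "\<epsilon> < 1"
  shows "bounded_linear (smoothed_lift s jhat \<epsilon>)"
  unfolding smoothed_lift_def using bounded_smoothed_lift_symbol[OF assms] bounded_linear_state_mult by metis

lemma state_mult_compose:
  assumes n: "\<And>f k. fourier_coeff (fourier_mult n f) k = n k * fourier_coeff f k"
    and mn: "\<And>f k. fourier_coeff (fourier_mult (\<lambda>k. m k * n k) f) k = m k * n k * fourier_coeff f k"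
  shows "state_mult m (state_mult n y) = state_mult (\<lambda>k. m k * n k) y"
proof -
  have "fourier_mult m (fourier_mult n f) = fourier_mult (\<lambda>k. m k * n k) f" for f
    by (rule fourier_mult_eqI) (simp add: n mn mult.assoc)
  then show ?thesis by (simp add: state_mult_def)
qed

lemma \<Lambda>_mollifier:
  assumes j: "friedrichs_symbol jhat" and \<epsilon>: "0 < \<epsilon>" "\<epsilon> < 1"
  shows "\<Lambda> s (mollifier jhat \<epsilon> y) = smoothed_lift s jhat \<epsilon> y"
proof -
  obtain B where B: "bounded_symbol B (\<lambda>k. bessel_symbol s k * complex_of_real (jhat (\<epsilon> *\<^sub>R freq k)))"
    using bounded_smoothed_lift_symbol[OF assms] by blast
  show ?thesis unfolding \<Lambda>_def mollifier_def smoothed_lift_def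
    by (rule state_mult_compose[OF fourier_coeff_bounded_mult[OF bounded_mollifier_symbol[OF j]] fourier_coeff_bounded_mult[OF B]])
qed

lemma smoothed_lift_\<Lambda>:
  fixes v :: "'d::finite state"
  assumes j: "friedrichs_symbol jhat" and s: "0 \<le> s"
  shows "smoothed_lift s jhat \<epsilon> (\<Lambda> (- s) v) = mollifier jhat \<epsilon> v"
proof -
  have eq: "(\<lambda>k. bessel_symbol s k * complex_of_real (jhat (\<epsilon> *\<^sub>R freq k)) * bessel_symbol (- s) k)
      = (\<lambda>k :: int ^ 'd. complex_of_real (jhat (\<epsilon> *\<^sub>R freq k)))"
  proof
    fix k :: "int ^ 'd"
    have "bessel_symbol s k * complex_of_real (jhat (\<epsilon> *\<^sub>R freq k)) * bessel_symbol (- s) k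
      = (bessel_symbol s k * bessel_symbol (- s) k) * complex_of_real (jhat (\<epsilon> *\<^sub>R freq k))" by (simp only: mult_ac)
    then show "bessel_symbol s k * complex_of_real (jhat (\<epsilon> *\<^sub>R freq k)) * bessel_symbol (- s) k
      = complex_of_real (jhat (\<epsilon> *\<^sub>R freq k))" by (simp add: bessel_symbol_inverse)
  qed
  show ?thesis unfolding \<Lambda>_def mollifier_def smoothed_lift_def
    by (subst state_mult_compose[OF fourier_coeff_bounded_mult[OF bounded_bessel[OF s]]])
      (simp_all only: eq eq[THEN fun_cong] fourier_coeff_bounded_mult[OF bounded_mollifier_symbol[OF j]])
qed

lemma norm_mollifier_le: "friedrichs_symbol jhat \<Longrightarrow> norm (mollifier jhat \<epsilon> v) \<le> norm v"
  unfolding mollifier_def using norm_state_mult_le[OF bounded_mollifier_symbol, of jhat \<epsilon> v] by simp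

lemma bounded_linear_mollifier: "friedrichs_symbol jhat \<Longrightarrow> bounded_linear (mollifier jhat \<epsilon>)"
  unfolding mollifier_def by (rule bounded_linear_state_mult[OF bounded_mollifier_symbol])

text \<open>A fixed partial Fourier sum is left unchanged once \<open>\<epsilon> q\<close> is small,
  because \<open>jhat\<close> is 1 on the unit ball; on the remainder the mollifier acts as a
  contraction.\<close>

lemma fourier_mult_mollifier_tendsto:
  fixes f :: "'d::finite L2"
  assumes j: "friedrichs_symbol jhat" and \<epsilon>: "\<epsilon> \<longlonglongrightarrow> 0"
  shows "(\<lambda>q. fourier_mult (\<lambda>k. complex_of_real (jhat (\<epsilon> q *\<^sub>R freq k))) f) \<longlonglongrightarrow> f"
proof (rule metric_LIMSEQ_I)
  let ?J = "\<lambda>q. fourier_mult (\<lambda>k. complex_of_real (jhat (\<epsilon> q *\<^sub>R freq k))) :: 'd L2 \<Rightarrow> 'd L2"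
  fix r :: real assume r: "0 < r"
  let ?S = "\<lambda>n. \<Sum>k\<in>freq_box n. wave (fourier_coeff f k) k"
  obtain n where n: "dist (?S n) f < r / 2"
    using partial_sums_tendsto[of f, THEN metric_LIMSEQ_D, of "r / 2"] r by auto
  have "\<forall>\<^sub>F q in sequentially. norm (\<epsilon> q *\<^sub>R freq k) \<le> 1" for k :: "int ^ 'd"
  proof -
    have "(\<lambda>q. norm (\<epsilon> q *\<^sub>R freq k)) \<longlonglongrightarrow> norm (0 *\<^sub>R freq k)" by (intro tendsto_intros \<epsilon>)
    then have "\<forall>\<^sub>F q in sequentially. norm (\<epsilon> q *\<^sub>R freq k) < 1" by (intro order_tendstoD) auto
    then show ?thesis by eventually_elim simp
  qed
  then have "\<forall>\<^sub>F q in sequentially. \<forall>k\<in>(freq_box n :: (int ^ 'd) set). norm (\<epsilon> q *\<^sub>R freq k) \<le> 1"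
    by (intro eventually_ball_finite) auto
  then obtain q0 where q0: "\<And>q k. q0 \<le> q \<Longrightarrow> k \<in> (freq_box n :: (int ^ 'd) set) \<Longrightarrow> norm (\<epsilon> q *\<^sub>R freq k) \<le> 1"
    unfolding eventually_sequentially by blast
  show "\<exists>q0. \<forall>q\<ge>q0. dist (?J q f) f < r"
  proof (intro exI allI impI)
    fix q assume q: "q0 \<le> q"
    interpret L: bounded_linear "?J q" by (rule bounded_linear_fourier_mult[OF bounded_mollifier_symbol[OF j]])
    have co: "fourier_coeff (?S n) l = (if l \<in> freq_box n then fourier_coeff f l else 0)" for l
      by (rule fourier_coeff_sum_wave) (auto simp: hermitian_fourier_coeff freq_box_minus)
    have "?J q (?S n) = ?S n"
      by (rule fourier_mult_eqI) (use q0[OF q] j in \<open>auto simp: co friedrichs_symbol_def\<close>)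
    then have "?J q f - f = ?J q (f - ?S n) + (?S n - f)" by (simp add: L.diff)
    then have "norm (?J q f - f) \<le> norm (?J q (f - ?S n)) + norm (?S n - f)" by (simp only: norm_triangle_ineq)
    also have "norm (?J q (f - ?S n)) \<le> norm (f - ?S n)"
      using norm_fourier_mult_le[OF bounded_mollifier_symbol[OF j], of "\<epsilon> q" "f - ?S n"] by simp
    finally show "dist (?J q f) f < r" using n by (simp add: dist_norm norm_minus_commute)
  qed
qed

lemma mollifier_tendsto:
  fixes v :: "'d::finite state"
  assumes "friedrichs_symbol jhat" "\<epsilon> \<longlonglongrightarrow> 0"
  shows "(\<lambda>q. mollifier jhat (\<epsilon> q) v) \<longlonglongrightarrow> v"
proof -
  have "(\<lambda>q. mollifier jhat (\<epsilon> q) v) \<longlonglongrightarrow> ((\<chi> i. fst v $ i), snd v)"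
    unfolding mollifier_def state_mult_def
    by (intro tendsto_Pair tendsto_vec_lambda fourier_mult_mollifier_tendsto assms)
  then show ?thesis by simp
qed

section \<open>Global existence\<close>

lemma elementary_integral_0:
  assumes "elementary F n p X"
  shows "elementary_integral W n p X 0 \<omega> = 0"
proof -
  have p: "0 \<le> p i" if "i \<le> n" for i
    using that
  proof (induction i)
    case 0
    then show ?case using assms by (simp add: elementary_def)
  next
    case (Suc i)
    then have "0 \<le> p i" "p i \<le> p (Suc i)" using assms by (simp_all add: elementary_def)
    then show ?case by linarith
  qed
  show ?thesis unfolding elementary_integral_def
    by (rule sum.neutral) (simp add: p min_absorb1 Suc_leI)
qed

text \<open>Read at time 0, the integrated system then identifies \<open>y 0 \<omega>\<close> with
  \<open>y0 \<omega>\<close>.\<close>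

lemma ito_integral_0:
  assumes "ito_integral M F W H I"
  shows "AE \<omega> in M. I 0 \<omega> = 0"
proof -
  from assms obtain n p X where el: "\<And>m. elementary F (n m) (p m) (X m)"
    and lim: "AE \<omega> in M. \<forall>T\<ge>0.
        (\<lambda>m. \<integral>\<^sup>+t\<in>{0..T}. ennreal ((norm (elementary_process (n m) (p m) (X m) t \<omega> - H t \<omega>))\<^sup>2) \<partial>lborel) \<longlonglongrightarrow> 0 \<and>
        uniform_limit {0..T} (\<lambda>m t. elementary_integral W (n m) (p m) (X m) t \<omega>) (\<lambda>t. I t \<omega>) sequentially"
    unfolding ito_integral_def by blast
  from lim show ?thesis
  proof eventually_elim
    case (elim \<omega>)
    then have "uniform_limit {0..0} (\<lambda>m t. elementary_integral W (n m) (p m) (X m) t \<omega>) (\<lambda>t. I t \<omega>) sequentially" by blast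
    from tendsto_uniform_limitI[OF this, of 0]
    have "(\<lambda>m. 0) \<longlonglongrightarrow> I 0 \<omega>" by (simp add: elementary_integral_0[OF el])
    then show ?case using LIMSEQ_unique tendsto_const by metis
  qed
qed

lemma (in brownian_basis) space_predictable_sigma: "space (predictable_sigma F) = {0..} \<times> space M"
proof -
  have "{{0} \<times> A |A. A \<in> sets (F 0)} \<union> {{a<..b} \<times> A |a b A. 0 \<le> a \<and> a \<le> b \<and> A \<in> sets (F (ennreal a))}
    \<subseteq> Pow ({0..} \<times> space (F 0))"
    using sets.sets_into_space by fastforce
  then show ?thesis by (simp add: predictable_sigma_def space_measure_of)
qed

text \<open>Applying \<open>T\<close> to the elementary approximations preserves both kinds of
  convergence, at the price of its operator bound. Agreement of \<open>H'\<close> with the image of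
  \<open>H\<close> is asked only at nonnegative times on \<open>space M\<close>, where the solution
  is known to lie in \<open>Hs s\<close>.\<close>

lemma (in brownian_basis) ito_integral_bounded_linear:
  fixes T :: "'a::{real_inner, second_countable_topology} \<Rightarrow> 'b::{real_inner, second_countable_topology}"
  assumes T: "bounded_linear T" and ito: "ito_integral M F W H I"
    and H': "\<And>t \<omega>. 0 \<le> t \<Longrightarrow> \<omega> \<in> space M \<Longrightarrow> H' t \<omega> = T (H t \<omega>)"
  shows "ito_integral M F W H' (\<lambda>t \<omega>. T (I t \<omega>))"
proof -
  interpret T: bounded_linear T by (rule T)
  obtain C where C: "0 < C" "\<And>x. norm (T x) \<le> norm x * C" using T.pos_bounded by blast
  from ito obtain n p X where el: "\<And>m. elementary F (n m) (p m) (X m)"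
    and lim: "AE \<omega> in M. \<forall>T\<ge>0.
        (\<lambda>m. \<integral>\<^sup>+t\<in>{0..T}. ennreal ((norm (elementary_process (n m) (p m) (X m) t \<omega> - H t \<omega>))\<^sup>2) \<partial>lborel) \<longlonglongrightarrow> 0 \<and>
        uniform_limit {0..T} (\<lambda>m t. elementary_integral W (n m) (p m) (X m) t \<omega>) (\<lambda>t. I t \<omega>) sequentially"
    and H: "(\<lambda>(t, \<omega>). H t \<omega>) \<in> borel_measurable (predictable_sigma F)"
    unfolding ito_integral_def by blast
  let ?X = "\<lambda>m i. T \<circ> X m i"
  have ep: "elementary_process (n m) (p m) (?X m) t \<omega> = T (elementary_process (n m) (p m) (X m) t \<omega>)" for m t \<omega>
    by (simp add: elementary_process_def T.sum T.scaleR)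
  have ei: "elementary_integral W (n m) (p m) (?X m) t \<omega> = T (elementary_integral W (n m) (p m) (X m) t \<omega>)" for m t \<omega>
    by (simp add: elementary_integral_def T.sum T.scaleR)
  show ?thesis
    unfolding ito_integral_def
  proof (intro conjI exI)
    have "(\<lambda>x. T ((\<lambda>(t, \<omega>). H t \<omega>) x)) \<in> borel_measurable (predictable_sigma F)"
      using borel_measurable_continuous_onI[OF T.continuous_on[OF continuous_on_id]] H by (rule measurable_compose[rotated])
    then show "(\<lambda>(t, \<omega>). H' t \<omega>) \<in> borel_measurable (predictable_sigma F)"
      by (rule measurable_cong[THEN iffD1, rotated]) (auto simp: space_predictable_sigma H')
    show "\<forall>m. elementary F (n m) (p m) (?X m)"
      using el by (auto simp: elementary_def intro: simple_function_compose)
    show "AE \<omega> in M. \<forall>T'\<ge>0.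
        (\<lambda>m. \<integral>\<^sup>+t\<in>{0..T'}. ennreal ((norm (elementary_process (n m) (p m) (?X m) t \<omega> - H' t \<omega>))\<^sup>2) \<partial>lborel) \<longlonglongrightarrow> 0 \<and>
        uniform_limit {0..T'} (\<lambda>m t. elementary_integral W (n m) (p m) (?X m) t \<omega>) (\<lambda>t. T (I t \<omega>)) sequentially"
      using lim AE_space
    proof eventually_elim
      case (elim \<omega>)
      show ?case
      proof (intro allI impI conjI)
        fix T' :: real assume T': "0 \<le> T'"
        let ?f = "\<lambda>m t. ennreal ((norm (elementary_process (n m) (p m) (X m) t \<omega> - H t \<omega>))\<^sup>2) * indicator {0..T'} t"
        have Hm: "(\<lambda>t. H t \<omega>) \<in> borel_measurable (restrict_space borel {0..})"
          by (rule predictable_path_measurable[OF H elim(2)])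
        have "(\<lambda>t. ennreal ((norm (elementary_process (n m) (p m) (X m) t \<omega> - H t \<omega>))\<^sup>2)) \<in> borel_measurable (restrict_space borel {0..})" for m
          using Hm measurable_restrict_space1[OF elementary_process_path_measurable[of "n m" "p m" "X m" \<omega>], of "{0..}"] by measurable
        then have "(\<lambda>t. ennreal ((norm (elementary_process (n m) (p m) (X m) t \<omega> - H t \<omega>))\<^sup>2) * indicator {0..} t) \<in> borel_measurable borel" for m
          by (subst (asm) borel_measurable_restrict_space_iff_ennreal) auto
        then have "(\<lambda>t. ennreal ((norm (elementary_process (n m) (p m) (X m) t \<omega> - H t \<omega>))\<^sup>2) * indicator {0..} t * indicator {0..T'} t) \<in> borel_measurable borel" for m
          by measurable
        then have fm: "?f m \<in> borel_measurable borel" for m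
          by (rule measurable_cong[THEN iffD1, rotated]) (auto simp: indicator_def)
        have "(\<integral>\<^sup>+t\<in>{0..T'}. ennreal ((norm (elementary_process (n m) (p m) (?X m) t \<omega> - H' t \<omega>))\<^sup>2) \<partial>lborel)
            \<le> ennreal (C\<^sup>2) * (\<integral>\<^sup>+t. ?f m t \<partial>lborel)" (is "?l m \<le> _") for m
        proof -
          have "ennreal ((norm (elementary_process (n m) (p m) (?X m) t \<omega> - H' t \<omega>))\<^sup>2) * indicator {0..T'} t \<le> ennreal (C\<^sup>2) * ?f m t" for t
          proof (cases "t \<in> {0..T'}")
            case True
            have "(norm (T (elementary_process (n m) (p m) (X m) t \<omega> - H t \<omega>)))\<^sup>2 \<le> (norm (elementary_process (n m) (p m) (X m) t \<omega> - H t \<omega>) * C)\<^sup>2"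
              by (intro power_mono C) simp
            also have "\<dots> = C\<^sup>2 * (norm (elementary_process (n m) (p m) (X m) t \<omega> - H t \<omega>))\<^sup>2" by (simp add: power_mult_distrib)
            finally show ?thesis using True by (simp add: ep H' elim(2) T.diff ennreal_mult[symmetric] ennreal_leI)
          qed simp
          then have "(\<integral>\<^sup>+t\<in>{0..T'}. ennreal ((norm (elementary_process (n m) (p m) (?X m) t \<omega> - H' t \<omega>))\<^sup>2) \<partial>lborel)
            \<le> (\<integral>\<^sup>+t. ennreal (C\<^sup>2) * ?f m t \<partial>lborel)" by (intro nn_integral_mono) simp
          also have "\<dots> = ennreal (C\<^sup>2) * (\<integral>\<^sup>+t. ?f m t \<partial>lborel)" by (rule nn_integral_cmult) (use fm in simp)
          finally show ?thesis .
        qed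
        then have "\<forall>\<^sub>F m in sequentially. ?l m \<le> ennreal (C\<^sup>2) * (\<integral>\<^sup>+t. ?f m t \<partial>lborel)"
          by (intro always_eventually allI)
        moreover have "(\<lambda>m. ennreal (C\<^sup>2) * (\<integral>\<^sup>+t. ?f m t \<partial>lborel)) \<longlonglongrightarrow> ennreal (C\<^sup>2) * 0"
          by (rule ennreal_tendsto_cmult) (use elim(1) T' in simp_all)
        then have "(\<lambda>m. ennreal (C\<^sup>2) * (\<integral>\<^sup>+t. ?f m t \<partial>lborel)) \<longlonglongrightarrow> 0" by (simp only: mult_zero_right)
        ultimately show "(\<lambda>m. \<integral>\<^sup>+t\<in>{0..T'}. ennreal ((norm (elementary_process (n m) (p m) (?X m) t \<omega> - H' t \<omega>))\<^sup>2) \<partial>lborel) \<longlonglongrightarrow> 0"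
          by (elim tendsto_sandwich[OF _ _ tendsto_const, rotated]) simp_all
        show "uniform_limit {0..T'} (\<lambda>m t. elementary_integral W (n m) (p m) (?X m) t \<omega>) (\<lambda>t. T (I t \<omega>)) sequentially"
          unfolding ei by (rule T.uniform_limit) (use elim(1) T' in blast)
      qed
    qed
  qed
qed

lemma stopped_eq: "0 \<le> t \<Longrightarrow> ennreal t \<le> \<sigma> \<omega> \<Longrightarrow> stopped \<sigma> t \<omega> = t"
  by (simp add: stopped_def min_absorb1)

text \<open>The smoothed lift of \<open>y\<close> is the mollification of
  \<open>\<Lambda> s y\<close>, so applying it to the system gives an equation in L2 for the
  mollified v. It passes through the noise coefficient, which is a scalar multiple of the state, and
  through the time integral, since it is bounded and linear.\<close>

lemma local_solution_evolution:
  fixes M :: "'w measure" and y :: "real \<Rightarrow> 'w \<Rightarrow> 'd::finite state" and jhat :: "real ^ 'd \<Rightarrow> real"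
  assumes bb: "brownian_basis M F W"
    and s: "1 + real CARD('d) / 2 < s"
    and j: "friedrichs_symbol jhat" and en: "energy_constant s jhat \<rho>"
    and \<delta>: "0 \<le> \<delta>"
    and K: "0 \<le> K" "\<And>v :: 'd state. 0 \<le> W1inf_norm (\<Lambda> (- s) v)" "\<And>v :: 'd state. W1inf_norm (\<Lambda> (- s) v) \<le> K * norm v"
      "\<And>v v' :: 'd state. W1inf_norm (\<Lambda> (- s) v) \<le> W1inf_norm (\<Lambda> (- s) v') + W1inf_norm (\<Lambda> (- s) (v - v'))"
    and sol: "local_strong_solution M F W s c \<delta> y0 y \<sigma>"
  obtains J A I where "multiplicative_evolution M F W (\<lambda>t \<omega>. \<Lambda> s (y t \<omega>)) \<sigma> (\<lambda>v. W1inf_norm (\<Lambda> (- s) v)) J A I \<rho> c \<delta> K"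
proof -
  interpret brownian_basis M F W by (rule bb)
  have s0: "0 \<le> s" using s by (auto intro: order_trans[OF _ less_imp_le[OF s]])
  \<comment> \<open>A null sequence; the shift by 2 keeps all its terms in the open unit interval
    that \<open>energy_constant\<close> covers.\<close>
  define \<epsilon> where "\<epsilon> q = 1 / (real q + 2)" for q
  have \<epsilon>: "0 < \<epsilon> q" "\<epsilon> q < 1" for q by (auto simp: \<epsilon>_def)
  have \<epsilon>0: "\<epsilon> \<longlonglongrightarrow> 0" unfolding \<epsilon>_def[abs_def] by real_asymp
  let ?T = "\<lambda>q. smoothed_lift s jhat (\<epsilon> q) :: 'd state \<Rightarrow> 'd state"
  let ?N = "\<lambda>y :: 'd state. nonlin_B y y + nonlin_F y"
  let ?v = "\<lambda>t \<omega>. \<Lambda> s (y t \<omega>)"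
  have T: "bounded_linear (?T q)" for q by (rule bounded_linear_smoothed_lift[OF j \<epsilon>])
  from sol have st: "stopping_time F \<sigma>"
    and meas: "Hs_measurable s (predictable_sigma F) (\<lambda>(t, \<omega>). y t \<omega>)"
    and cont: "AE \<omega> in M. Hs_continuous_on s {0..} (\<lambda>t. y (stopped \<sigma> t \<omega>) \<omega>)"
    and sys: "satisfies_system M F W c \<delta> y0 y \<sigma>"
    by (simp_all add: local_strong_solution_def)
  have Hs: "y t \<omega> \<in> Hs s" if "0 \<le> t" "\<omega> \<in> space M" for t \<omega>
    using meas that by (auto simp: Hs_measurable_def space_predictable_sigma)
  have yv: "\<Lambda> (- s) (\<Lambda> s (y t \<omega>)) = y t \<omega>" if "0 \<le> t" "\<omega> \<in> space M" for t \<omega>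
    by (rule \<Lambda>_raise[OF Hs[OF that] s0])
  from sys obtain I where ito: "ito_integral M F W (\<lambda>t \<omega>. if ennreal t \<le> \<sigma> \<omega> then noise_coeff c \<delta> (y t \<omega>) else 0) I"
    and eq: "AE \<omega> in M. \<forall>t\<ge>0. let t' = stopped \<sigma> t \<omega> in
        (\<lambda>r. ?N (y r \<omega>)) integrable_on {0..t'} \<and>
        y t' \<omega> + integral {0..t'} (\<lambda>r. ?N (y r \<omega>)) = y0 \<omega> + I t \<omega>"
    unfolding satisfies_system_def by blast
  have "multiplicative_evolution M F W ?v \<sigma> (\<lambda>v. W1inf_norm (\<Lambda> (- s) v)) (\<lambda>q. mollifier jhat (\<epsilon> q))
    (\<lambda>q v. ?T q (?N (\<Lambda> (- s) v))) (\<lambda>q t \<omega>. ?T q (I t \<omega>)) \<rho> c \<delta> K"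
  proof (rule multiplicative_evolution.intro[OF bb], rule multiplicative_evolution_axioms.intro)
    show "stopping_time F \<sigma>" by (rule st)
    show "?v t \<in> borel_measurable (F (ennreal t))" if "0 \<le> t" for t
      by (rule predictable_adapted[OF _ that]) (use meas in \<open>simp add: Hs_measurable_def case_prod_unfold\<close>)
    show "AE \<omega> in M. \<forall>D\<ge>0. ennreal D \<le> \<sigma> \<omega> \<longrightarrow> continuous_on {0..D} (\<lambda>t. ?v t \<omega>)"
      using cont
    proof eventually_elim
      case (elim \<omega>)
      show ?case
      proof (intro allI impI)
        fix D :: real assume D: "0 \<le> D" "ennreal D \<le> \<sigma> \<omega>"
        have "stopped \<sigma> t \<omega> = t" if "t \<in> {0..D}" for t
          using that D by (intro stopped_eq) (auto intro: order_trans[OF ennreal_leI])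
        moreover have "continuous_on {0..D} (\<lambda>t. \<Lambda> s (y (stopped \<sigma> t \<omega>) \<omega>))"
          using elim by (auto simp: Hs_continuous_on_def intro: continuous_on_subset)
        ultimately show "continuous_on {0..D} (\<lambda>t. ?v t \<omega>)" by (elim continuous_on_eq) simp
      qed
    qed
    \<comment> \<open>Lipschitz continuity with constant \<open>K\<close>, from the triangle
      inequality in both directions and the linear bound.\<close>
    have "dist (W1inf_norm (\<Lambda> (- s) v)) (W1inf_norm (\<Lambda> (- s) v')) \<le> K * dist v v'" for v v' :: "'d state"
      using K(4)[of v v'] K(4)[of v' v] K(3)[of "v - v'"] K(3)[of "v' - v"]
      by (simp add: dist_norm norm_minus_commute abs_le_iff)
    then show "continuous_on UNIV (\<lambda>v :: 'd state. W1inf_norm (\<Lambda> (- s) v))"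
      using K(1) by (intro lipschitz_on_continuous_on[of K]) (simp add: lipschitz_on_def)
    show "0 \<le> W1inf_norm (\<Lambda> (- s) x)" "W1inf_norm (\<Lambda> (- s) x) \<le> K * norm x" for x :: "'d state" by (rule K)+
    show "bounded_linear (mollifier jhat (\<epsilon> q))" for q by (rule bounded_linear_mollifier[OF j])
    show "norm (mollifier jhat (\<epsilon> q) x) \<le> norm x" for q and x :: "'d state" by (rule norm_mollifier_le[OF j])
    show "(\<lambda>q. mollifier jhat (\<epsilon> q) x) \<longlonglongrightarrow> x" for x :: "'d state" by (rule mollifier_tendsto[OF j \<epsilon>0])
    show "\<exists>C. \<forall>x. norm x \<le> B \<longrightarrow> norm (?T q (?N (\<Lambda> (- s) x))) \<le> C" for q B
    proof -
      obtain C where C: "\<And>x :: 'd state. norm x \<le> B \<Longrightarrow> norm (?N (\<Lambda> (- s) x)) \<le> C"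
        using nonlinearity_bounded[OF s] unfolding bounded_on_balls_def by blast
      obtain C' where C': "0 < C'" "\<And>x. norm (?T q x) \<le> norm x * C'" using bounded_linear.pos_bounded[OF T] by blast
      have "norm (?T q (?N (\<Lambda> (- s) x))) \<le> C * C'" if "norm x \<le> B" for x
        using C'(1) by (intro order_trans[OF C'(2)] mult_right_mono C that) auto
      then show ?thesis by blast
    qed
    \<comment> \<open>The energy constant is applied to \<open>\<Lambda> (- s) x\<close>, which
      turns both factors of the inner product into expressions in \<open>x\<close>.\<close>
    show "- (2 * (mollifier jhat (\<epsilon> q) x \<bullet> ?T q (?N (\<Lambda> (- s) x)))) \<le> \<rho> * W1inf_norm (\<Lambda> (- s) x) * (norm x)\<^sup>2" for q x
    proof -
      interpret m: bounded_linear "mollifier jhat (\<epsilon> q)" by (rule bounded_linear_mollifier[OF j])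
      let ?y = "\<Lambda> (- s) x"
      have 1: "\<Lambda> s (mollifier jhat (\<epsilon> q) ?y) = mollifier jhat (\<epsilon> q) x"
        by (simp only: \<Lambda>_mollifier[OF j \<epsilon>] smoothed_lift_\<Lambda>[OF j s0])
      have 2: "\<Lambda> s (mollifier jhat (\<epsilon> q) (nonlin_B ?y ?y) + mollifier jhat (\<epsilon> q) (nonlin_F ?y)) = ?T q (?N ?y)"
        by (simp only: m.add[symmetric] \<Lambda>_mollifier[OF j \<epsilon>])
      have 3: "Hs_norm s ?y = norm x" by (simp add: Hs_norm_def \<Lambda>_lower(2)[OF s0])
      have "\<bar>2 * (mollifier jhat (\<epsilon> q) x \<bullet> ?T q (?N ?y))\<bar> \<le> \<rho> * W1inf_norm ?y * (norm x)\<^sup>2"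
        using en[unfolded energy_constant_def, THEN conjunct2, rule_format, of "\<epsilon> q" ?y] \<epsilon>[of q] \<Lambda>_lower(1)[OF s0, of x]
        unfolding 1 2 3 by simp
      then show ?thesis by linarith
    qed
    show "ito_integral M F W (\<lambda>t \<omega>. if ennreal t \<le> \<sigma> \<omega> then
        (c * (1 + W1inf_norm (\<Lambda> (- s) (?v t \<omega>))) powr \<delta>) *\<^sub>R mollifier jhat (\<epsilon> q) (?v t \<omega>) else 0) (\<lambda>t \<omega>. ?T q (I t \<omega>))" for q
    proof (rule ito_integral_bounded_linear[OF T ito])
      fix t :: real and \<omega> assume "0 \<le> t" "\<omega> \<in> space M"
      note yv = yv[OF this]
      have "mollifier jhat (\<epsilon> q) (?v t \<omega>) = ?T q (y t \<omega>)"
        using smoothed_lift_\<Lambda>[OF j s0, of "\<epsilon> q" "?v t \<omega>"] by (simp only: yv)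
      then show "(if ennreal t \<le> \<sigma> \<omega> then
          (c * (1 + W1inf_norm (\<Lambda> (- s) (?v t \<omega>))) powr \<delta>) *\<^sub>R mollifier jhat (\<epsilon> q) (?v t \<omega>) else 0)
        = ?T q (if ennreal t \<le> \<sigma> \<omega> then noise_coeff c \<delta> (y t \<omega>) else 0)"
        by (simp add: yv noise_coeff_def linear_0[OF bounded_linear.linear[OF T]] linear_scale[OF bounded_linear.linear[OF T]])
    qed
    show "AE \<omega> in M. \<forall>t\<ge>0. ennreal t \<le> \<sigma> \<omega> \<longrightarrow>
      (\<lambda>r. ?T q (?N (\<Lambda> (- s) (?v r \<omega>)))) integrable_on {0..t} \<and>
      mollifier jhat (\<epsilon> q) (?v t \<omega>) + integral {0..t} (\<lambda>r. ?T q (?N (\<Lambda> (- s) (?v r \<omega>))))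
        = mollifier jhat (\<epsilon> q) (?v 0 \<omega>) + ?T q (I t \<omega>)" for q
      using eq ito_integral_0[OF ito] AE_space
    proof eventually_elim
      case (elim \<omega>)
      interpret T: bounded_linear "?T q" by (rule T)
      have J: "mollifier jhat (\<epsilon> q) (?v t \<omega>) = ?T q (y t \<omega>)" if "0 \<le> t" for t
        using smoothed_lift_\<Lambda>[OF j s0, of "\<epsilon> q" "?v t \<omega>"] by (simp only: yv[OF that elim(3)])
      have e: "(\<lambda>r. ?N (y r \<omega>)) integrable_on {0..t}" "y t \<omega> + integral {0..t} (\<lambda>r. ?N (y r \<omega>)) = y0 \<omega> + I t \<omega>"
        if "0 \<le> t" "ennreal t \<le> \<sigma> \<omega>" for t
        using elim(1)[rule_format, OF that(1)] by (simp_all add: stopped_eq[of t \<sigma> \<omega>, OF that] Let_def)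
      have y0: "y 0 \<omega> = y0 \<omega>" using e(2)[of 0] elim(2) by simp
      show ?case
      proof (intro allI impI)
        fix t :: real assume t: "0 \<le> t" "ennreal t \<le> \<sigma> \<omega>"
        have N: "?T q (?N (\<Lambda> (- s) (?v r \<omega>))) = (?T q \<circ> (\<lambda>r. ?N (y r \<omega>))) r" if "r \<in> {0..t}" for r
          using that yv[OF _ elim(3), of r] by simp
        have "(\<lambda>r. ?T q (?N (\<Lambda> (- s) (?v r \<omega>)))) integrable_on {0..t}"
          by (rule integrable_eq[OF integrable_linear[OF e(1)[OF t] T[of q]] N[symmetric]])
        moreover have "integral {0..t} (\<lambda>r. ?T q (?N (\<Lambda> (- s) (?v r \<omega>)))) = ?T q (integral {0..t} (\<lambda>r. ?N (y r \<omega>)))"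
          by (rule trans[OF integral_cong[OF N] integral_linear[OF e(1)[OF t] T[of q]]])
        moreover have "?T q (y t \<omega>) + ?T q (integral {0..t} (\<lambda>r. ?N (y r \<omega>))) = ?T q (y 0 \<omega>) + ?T q (I t \<omega>)"
          using e(2)[OF t] unfolding T.add[symmetric] y0 by (simp only:)
        ultimately show "(\<lambda>r. ?T q (?N (\<Lambda> (- s) (?v r \<omega>)))) integrable_on {0..t} \<and>
          mollifier jhat (\<epsilon> q) (?v t \<omega>) + integral {0..t} (\<lambda>r. ?T q (?N (\<Lambda> (- s) (?v r \<omega>))))
            = mollifier jhat (\<epsilon> q) (?v 0 \<omega>) + ?T q (I t \<omega>)"
          by (simp only: J t order_refl)
      qed
    qed
    show "0 < \<rho>" using en by (simp add: energy_constant_def)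
  qed (use K \<delta> in auto)
  then show ?thesis by (rule that)
qed

theorem theorem1p6:
  fixes M :: "'w measure" and F :: "ennreal \<Rightarrow> 'w measure" and W :: "real \<Rightarrow> 'w \<Rightarrow> real"
    and s \<delta> c \<rho> :: real
    and jhat :: "real ^ 'd::finite \<Rightarrow> real"
    and y0 :: "'w \<Rightarrow> 'd state"
    and y :: "real \<Rightarrow> 'w \<Rightarrow> 'd state"
    and \<tau> :: "'w \<Rightarrow> ennreal"
  assumes "brownian_basis M F W"
    and "s > 1 + real CARD('d) / 2"
    and "Hs_measurable s (F 0) y0"
    and "integrable M (\<lambda>\<omega>. (Hs_norm s (y0 \<omega>))\<^sup>2)"
    and "friedrichs_symbol jhat"
    and "energy_constant s jhat \<rho>"
    and "(\<delta> > 1 / 2 \<and> c \<noteq> 0) \<or> (\<delta> = 1 / 2 \<and> \<bar>c\<bar> > sqrt \<rho>)"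
    and "maximal_strong_solution M F W s c \<delta> y0 y \<tau>"
  shows "\<P>(\<omega> in M. \<tau> \<omega> = \<infinity>) = 1"
proof -
  interpret brownian_basis M F W by (rule assms(1))
  note s = assms(2) and j = assms(5) and en = assms(6)
  obtain K where K: "0 \<le> K" "\<And>v :: 'd state. 0 \<le> W1inf_norm (\<Lambda> (- s) v)" "\<And>v :: 'd state. W1inf_norm (\<Lambda> (- s) v) \<le> K * norm v"
      "\<And>v v' :: 'd state. W1inf_norm (\<Lambda> (- s) v) \<le> W1inf_norm (\<Lambda> (- s) v') + W1inf_norm (\<Lambda> (- s) (v - v'))"
    using W1inf_lower_bounds[OF s] by blast
  have "0 < \<rho>" using en by (simp add: energy_constant_def)
  then obtain \<eta> C where \<eta>: "0 < \<eta>" and C: "0 \<le> C"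
    and scalar: "\<And>w n X. 0 \<le> w \<Longrightarrow> 0 \<le> X \<Longrightarrow> 0 \<le> n \<Longrightarrow> w \<le> K * n \<Longrightarrow> n\<^sup>2 \<le> X + 1 \<Longrightarrow>
      \<rho> * w + (c * (1 + w) powr \<delta>)\<^sup>2 * (X / (1 + X))
      - 2 * (1 - \<eta>) * (c * (1 + w) powr \<delta>)\<^sup>2 * (X / (1 + X))\<^sup>2 \<le> C"
    using lyapunov_scalar_bound[OF _ assms(7) K(1)] by blast
  have \<delta>: "0 \<le> \<delta>" using assms(7) by auto
  from assms(8) obtain \<tau>n where st: "stopping_time F \<tau>"
    and sol: "\<And>n. local_strong_solution M F W s c \<delta> y0 y (\<tau>n n)"
    and lim: "AE \<omega> in M. incseq (\<lambda>n. \<tau>n n \<omega>) \<and> (\<lambda>n. \<tau>n n \<omega>) \<longlonglongrightarrow> \<tau> \<omega>"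
    and blow: "\<And>n. AE \<omega> in M. \<tau> \<omega> < \<infinity> \<longrightarrow>
        (\<Squnion>t\<in>{t. 0 \<le> t \<and> ennreal t \<le> \<tau>n n \<omega>}. ennreal (W1inf_norm (y t \<omega>))) > of_nat n"
    unfolding maximal_strong_solution_def by blast
  have meas: "Hs_measurable s (predictable_sigma F) (\<lambda>(t, \<omega>). y t \<omega>)"
    using sol[of 0] by (simp add: local_strong_solution_def)
  have s0: "0 \<le> s" using s by (auto intro: order_trans[OF _ less_imp_le[OF s]])
  have yv: "\<Lambda> (- s) (\<Lambda> s (y t \<omega>)) = y t \<omega>" if "0 \<le> t" "\<omega> \<in> space M" for t \<omega>
    using meas that by (intro \<Lambda>_raise s0) (auto simp: Hs_measurable_def space_predictable_sigma)
  have v0[measurable]: "(\<lambda>\<omega>. \<Lambda> s (y 0 \<omega>)) \<in> borel_measurable M"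
    by (rule measurable_F_M, rule predictable_adapted[of "\<lambda>t \<omega>. \<Lambda> s (y t \<omega>)" _ 0])
      (use meas in \<open>simp_all add: Hs_measurable_def case_prod_unfold\<close>)
  have \<tau>m[measurable]: "\<tau> \<in> borel_measurable M"
    by (rule measurable_stopping_time[OF st sets_F_subset space_F_eq])
  \<comment> \<open>The exit bound depends on the size of the initial value, so bounded initial data
    and a fixed horizon come first; countably many choices of \<open>T\<close> and \<open>R0\<close>
    then exhaust the space.\<close>
  have null: "AE \<omega> in M. \<not> (\<tau> \<omega> < ennreal T \<and> norm (\<Lambda> s (y 0 \<omega>)) \<le> R0)" if T: "0 < T" for T R0
  proof -
    let ?E = "{\<omega>\<in>space M. \<tau> \<omega> < ennreal T \<and> norm (\<Lambda> s (y 0 \<omega>)) \<le> R0}"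
    have E: "?E \<in> events" by measurable
    \<comment> \<open>The level is \<open>n / (K + 1)\<close>, because \<open>W1inf_norm\<close>
      above \<open>n\<close> forces |v| above it; the added 1 excludes division by 0.\<close>
    define b where "b n = exp (- (\<eta> * (ln ((real n / (K + 1))\<^sup>2) - ln (1 + R0\<^sup>2) - C * T - 1)))" for n
    have K1: "0 < K + 1" using K by simp
    have bound: "prob ?E \<le> b n" if n: "0 < n" for n
    proof -
      \<comment> \<open>These operators and integrals depend on \<open>n\<close>, but the bound
        \<open>b n\<close> does not involve them.\<close>
      obtain J A I where ev: "multiplicative_evolution M F W (\<lambda>t \<omega>. \<Lambda> s (y t \<omega>)) (\<tau>n n) (\<lambda>v. W1inf_norm (\<Lambda> (- s) v)) J A I \<rho> c \<delta> K"
        using local_solution_evolution[OF assms(1) s j en \<delta> K sol[of n]] by blast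
      interpret ev: multiplicative_evolution M F W "\<lambda>t \<omega>. \<Lambda> s (y t \<omega>)" "\<tau>n n" "\<lambda>v. W1inf_norm (\<Lambda> (- s) v)" J A I \<rho> c \<delta> K
        by (rule ev)
      show ?thesis unfolding b_def
      proof (rule ev.exit_probability[OF T _ \<eta> C scalar E])
        show "0 < real n / (K + 1)" using n K1 by simp
        show "AE \<omega> in M. \<omega> \<in> ?E \<longrightarrow> (\<exists>D\<in>{0..T}. ennreal D \<le> \<tau>n n \<omega> \<and> real n / (K + 1) < norm (\<Lambda> s (y D \<omega>)))"
          using lim blow[of n] AE_space
        proof eventually_elim
          case (elim \<omega>)
          show ?case
          proof
            assume w: "\<omega> \<in> ?E"
            then have "\<tau> \<omega> < \<infinity>" using order.strict_trans by fastforce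
            \<comment> \<open>A supremum above \<open>n\<close> is witnessed by a time at which the
              norm already exceeds \<open>n\<close>; that time is not after
              \<open>\<tau> \<omega>\<close>, hence before \<open>T\<close>.\<close>
            with elim(2) obtain t where t: "0 \<le> t" "ennreal t \<le> \<tau>n n \<omega>" "of_nat n < ennreal (W1inf_norm (y t \<omega>))"
              by (auto simp: less_SUP_iff)
            have "\<tau>n n \<omega> \<le> \<tau> \<omega>" using elim(1) by (intro incseq_le) auto
            with t w have "ennreal t < ennreal T" by (auto intro: le_less_trans order_trans)
            then have tT: "t \<in> {0..T}" using t by (simp add: ennreal_less_iff)
            have "ennreal (real n) < ennreal (W1inf_norm (y t \<omega>))" using t(3) by (simp add: ennreal_of_nat_eq_real_of_nat)
            then have "real n < W1inf_norm (\<Lambda> (- s) (\<Lambda> s (y t \<omega>)))" by (simp add: ennreal_less_iff yv[OF t(1) elim(3)])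
            also have "\<dots> \<le> K * norm (\<Lambda> s (y t \<omega>))" by (rule K(3))
            also have "\<dots> \<le> (K + 1) * norm (\<Lambda> s (y t \<omega>))" by (intro mult_right_mono) auto
            finally have "real n / (K + 1) < norm (\<Lambda> s (y t \<omega>))" using K1 by (simp add: divide_less_eq mult.commute)
            with t tT show "\<exists>D\<in>{0..T}. ennreal D \<le> \<tau>n n \<omega> \<and> real n / (K + 1) < norm (\<Lambda> s (y D \<omega>))" by blast
          qed
        qed
      qed auto
    qed
    have "b \<longlonglongrightarrow> 0" unfolding b_def using \<eta> K1 by real_asymp
    then have "prob ?E \<le> 0"
      by (rule LIMSEQ_le_const) (use bound in \<open>auto intro!: exI[of _ 1]\<close>)
    then have "prob ?E = 0" using measure_nonneg[of M ?E] by linarith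
    then show ?thesis using prob_eq_0[OF E] by (auto elim!: AE_mp)
  qed
  \<comment> \<open>The successor keeps the horizon positive, as \<open>null\<close>
    requires.\<close>
  have "AE \<omega> in M. \<forall>T R0 :: nat. \<not> (\<tau> \<omega> < ennreal (real (Suc T)) \<and> norm (\<Lambda> s (y 0 \<omega>)) \<le> real R0)"
    unfolding AE_all_countable by (intro allI null) simp
  then have "AE \<omega> in M. \<tau> \<omega> = \<infinity>"
  proof eventually_elim
    case (elim \<omega>)
    obtain R0 where R0: "norm (\<Lambda> s (y 0 \<omega>)) \<le> real R0" using real_arch_simple by blast
    show ?case
    proof (rule ccontr)
      assume "\<tau> \<omega> \<noteq> \<infinity>"
      then obtain r where r: "\<tau> \<omega> = ennreal r" "0 \<le> r" by (cases "\<tau> \<omega>") auto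
      obtain n where "r < real n" using reals_Archimedean2 by blast
      then have "\<tau> \<omega> < ennreal (real (Suc n))" using r by (simp add: ennreal_less_iff del: of_nat_Suc)
      with elim R0 show False by blast
    qed
  qed
  then show ?thesis by (subst prob_Collect_eq_1) auto
qed

end
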